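(* Let $m\ge 0$ and consider the initial value problem $$i\partial_t u=\sqrt{-\Delta+m^2}\,u-(|x|^{-1}\ast|u|^2)u \quad\text{on }\mathbb{R}^3,\qquad u(0,\cdot)=\phi .$$ (1) Let $s<\frac14$ and $T>0$. If the flow map $\phi\mapsto u$ exists (in a small neighbourhood of the origin) as a map from $H^s(\mathbb{R}^3)$ to $C([0,T],H^s(\mathbb{R}^3))$, then it fails to be $C^3$ at the origin. (2) Let $s<0$ and $T>0$. If the flow map $\phi\mapsto u$ exists (in a small neighbourhood of the origin) as a map from $H^s_{rad}(\mathbb{R}^3)$ to $C([0,T],H^s_{rad}(\mathbb{R}^3))$, then it fails to be $C^3$ at the origin.
   Context: $\sqrt{-\Delta+m^2}$ is the Fourier multiplier with symbol $\sqrt{|\xi|^2+m^2}$, and $\ast$ is convolution in $x\in\mathbb{R}^3$. $H^s(\mathbb{R}^3)$ is the $L^2$-based Sobolev space of complex-valued functions (distributions) and $H^s_{rad}(\mathbb{R}^3)$ its closed subspace of radial elements. A flow map in a neighbourhood $V$ of the origin is a map $\Phi$ from $V$ to $C([0,T],H^s)$ (resp. $C([0,T],H^s_{rad})$) assigning to each $\phi\in V$ the solution $u$ with initial datum $\phi$; in particular, whenever $\phi\in V\cap H^1(\mathbb{R}^3)$ and the (unique) solution $u\in C([0,T],H^1(\mathbb{R}^3))$ of the equation with datum $\phi$ exists on $[0,T]$, $\Phi(\phi)$ is equal to that solution. $C^3$ refers to Fréchet differentiability over the real scalars. *)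

theory Defs
  imports "HOL-Analysis.Analysis" "HOL-Library.Function_Algebras"
begin

section \<open>Frechet calculus between normed spaces given by a carrier and a norm\<close>

text \<open>
  The Sobolev index and the length of the time interval are real parameters, so the spaces
  involved cannot be types of class \<open>real_normed_vector\<close>.  They are pairs of a linear subspace of
  an ambient real vector space and a norm on this subspace.  All ambient spaces are function spaces
  with the pointwise operations; \<open>HOL-Library.Function_Algebras\<close> provides the additive structure.
\<close>

instantiation "fun" :: (type, real_vector) real_vector
begin

definition scaleR_fun :: "real \<Rightarrow> ('a \<Rightarrow> 'b) \<Rightarrow> 'a \<Rightarrow> 'b"
  where "scaleR_fun c f = (\<lambda>x. c *\<^sub>R f x)"

instance
  by standard (auto simp: scaleR_fun_def plus_fun_def fun_eq_iff scaleR_add_right scaleR_add_left)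

end

type_synonym 'a nspace = "'a set \<times> ('a \<Rightarrow> real)"

abbreviation ncarrier :: "'a nspace \<Rightarrow> 'a set" where "ncarrier \<equiv> fst"
abbreviation nnorm :: "'a nspace \<Rightarrow> 'a \<Rightarrow> real" where "nnorm \<equiv> snd"

definition nball :: "'a::real_vector nspace \<Rightarrow> 'a \<Rightarrow> real \<Rightarrow> 'a set"
  where "nball X p r = {x \<in> ncarrier X. nnorm X (x - p) < r}"

text \<open>
  Bounded real-linear operators with the operator norm.  Operators are extended by zero outside
  the carrier, so that equality of operators is equality of functions.
\<close>

definition bounded_ops :: "'a::real_vector nspace \<Rightarrow> 'b::real_vector nspace \<Rightarrow> ('a \<Rightarrow> 'b) nspace"
  where "bounded_ops X Y =
    ({A. (\<forall>v\<in>ncarrier X. A v \<in> ncarrier Y) \<and>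
         (\<forall>v. v \<notin> ncarrier X \<longrightarrow> A v = 0) \<and>
         (\<forall>v\<in>ncarrier X. \<forall>w\<in>ncarrier X. A (v + w) = A v + A w) \<and>
         (\<forall>c. \<forall>v\<in>ncarrier X. A (c *\<^sub>R v) = c *\<^sub>R A v) \<and>
         (\<exists>C. \<forall>v\<in>ncarrier X. nnorm Y (A v) \<le> C * nnorm X v)},
     \<lambda>A. SUP v\<in>{v \<in> ncarrier X. nnorm X v \<le> 1}. nnorm Y (A v))"

text \<open>\<open>F\<close> maps \<open>U\<close> into \<open>Y\<close> and has the Frechet derivative \<open>DF x\<close> at every \<open>x\<close> in \<open>U\<close>
  (used for open \<open>U\<close>).\<close>

definition frechet_on ::
    "'a::real_vector nspace \<Rightarrow> 'b::real_vector nspace \<Rightarrow> 'a set \<Rightarrow> ('a \<Rightarrow> 'b) \<Rightarrow> ('a \<Rightarrow> 'a \<Rightarrow> 'b) \<Rightarrow> bool"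
  where "frechet_on X Y U F DF \<longleftrightarrow>
    (\<forall>x\<in>U. F x \<in> ncarrier Y \<and> DF x \<in> ncarrier (bounded_ops X Y) \<and>
      (\<forall>e>0. \<exists>d>0. \<forall>h\<in>ncarrier X. nnorm X h < d \<and> x + h \<in> U \<longrightarrow>
         nnorm Y (F (x + h) - F x - DF x h) \<le> e * nnorm X h))"

definition ncontinuous_on ::
    "'a::real_vector nspace \<Rightarrow> 'b::real_vector nspace \<Rightarrow> 'a set \<Rightarrow> ('a \<Rightarrow> 'b) \<Rightarrow> bool"
  where "ncontinuous_on X Y U F \<longleftrightarrow>
    (\<forall>x\<in>U. F x \<in> ncarrier Y \<and>
      (\<forall>e>0. \<exists>d>0. \<forall>y\<in>U. nnorm X (y - x) < d \<longrightarrow> nnorm Y (F y - F x) < e))"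

text \<open>\<open>F\<close>, defined on \<open>V\<close>, is three times continuously Frechet differentiable on an open ball
  around \<open>p\<close>.\<close>

definition C3_at ::
    "'a::real_vector nspace \<Rightarrow> 'b::real_vector nspace \<Rightarrow> 'a set \<Rightarrow> ('a \<Rightarrow> 'b) \<Rightarrow> 'a \<Rightarrow> bool"
  where "C3_at X Y V F p \<longleftrightarrow>
    (\<exists>r>0. \<exists>D1 D2 D3. nball X p r \<subseteq> V \<and>
       frechet_on X Y (nball X p r) F D1 \<and>
       frechet_on X (bounded_ops X Y) (nball X p r) D1 D2 \<and>
       frechet_on X (bounded_ops X (bounded_ops X Y)) (nball X p r) D2 D3 \<and>
       ncontinuous_on X (bounded_ops X (bounded_ops X (bounded_ops X Y))) (nball X p r) D3)"

text \<open>\<open>C([0,T],X)\<close> with the supremum norm; curves are extended by zero outside \<open>[0,T]\<close>.\<close>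

definition curves :: "real \<Rightarrow> 'a::real_vector nspace \<Rightarrow> (real \<Rightarrow> 'a) nspace"
  where "curves T X =
    ({u. (\<forall>t\<in>{0..T}. u t \<in> ncarrier X) \<and> (\<forall>t. t \<notin> {0..T} \<longrightarrow> u t = 0) \<and>
         (\<forall>t\<in>{0..T}. ((\<lambda>r. nnorm X (u r - u t)) \<longlongrightarrow> 0) (at t within {0..T}))},
     \<lambda>u. SUP t\<in>{0..T}. nnorm X (u t))"


section \<open>Tempered distributions on three-dimensional space\<close>

type_synonym R3 = "real ^ 3"

definition partial_deriv :: "3 \<Rightarrow> (R3 \<Rightarrow> complex) \<Rightarrow> R3 \<Rightarrow> complex"
  where "partial_deriv i f x = frechet_derivative f (at x) (axis i 1)"

text \<open>The list \<open>\<alpha>\<close> enumerates the coordinates in which derivatives are taken, with repetition.\<close>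

definition partial_derivs :: "3 list \<Rightarrow> (R3 \<Rightarrow> complex) \<Rightarrow> R3 \<Rightarrow> complex"
  where "partial_derivs \<alpha> f = foldr partial_deriv \<alpha> f"

definition schwartz :: "(R3 \<Rightarrow> complex) set"
  where "schwartz = {\<psi>. \<forall>\<alpha>. (\<forall>x. partial_derivs \<alpha> \<psi> differentiable (at x)) \<and>
    (\<forall>N. \<exists>C. \<forall>x. (1 + norm x) ^ N * cmod (partial_derivs \<alpha> \<psi> x) \<le> C)}"

definition schwartz_seminorm :: "nat \<Rightarrow> (R3 \<Rightarrow> complex) \<Rightarrow> real"
  where "schwartz_seminorm N \<psi> =
    (SUP (\<alpha>, x) \<in> {\<alpha>. length \<alpha> \<le> N} \<times> UNIV. (1 + norm x) ^ N * cmod (partial_derivs \<alpha> \<psi> x))"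

text \<open>Functionals are extended by zero outside the Schwartz space.\<close>

type_synonym dist3 = "(R3 \<Rightarrow> complex) \<Rightarrow> complex"

definition tempered :: "dist3 set"
  where "tempered = {u.
    (\<forall>\<psi>. \<psi> \<notin> schwartz \<longrightarrow> u \<psi> = 0) \<and>
    (\<forall>\<psi>\<in>schwartz. \<forall>\<eta>\<in>schwartz. u (\<lambda>x. \<psi> x + \<eta> x) = u \<psi> + u \<eta>) \<and>
    (\<forall>c. \<forall>\<psi>\<in>schwartz. u (\<lambda>x. c * \<psi> x) = c * u \<psi>) \<and>
    (\<exists>N C. \<forall>\<psi>\<in>schwartz. cmod (u \<psi>) \<le> C * schwartz_seminorm N \<psi>)}"

definition dist_of :: "(R3 \<Rightarrow> complex) \<Rightarrow> dist3"
  where "dist_of f = (\<lambda>\<psi>. if \<psi> \<in> schwartz then (LINT x|lborel. f x * \<psi> x) else 0)"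

definition represented_by :: "dist3 \<Rightarrow> (R3 \<Rightarrow> complex) \<Rightarrow> bool"
  where "represented_by u f \<longleftrightarrow> f \<in> borel_measurable borel \<and>
    (\<forall>\<psi>\<in>schwartz. integrable lborel (\<lambda>x. f x * \<psi> x)) \<and> u = dist_of f"

text \<open>The function (unique almost everywhere) representing a distribution; meaningful only if one
  exists.\<close>

definition fun_of :: "dist3 \<Rightarrow> R3 \<Rightarrow> complex"
  where "fun_of u = (SOME f. represented_by u f)"

definition fourier :: "(R3 \<Rightarrow> complex) \<Rightarrow> R3 \<Rightarrow> complex"
  where "fourier \<psi> \<xi> =
    of_real ((2 * pi) powr (- 3 / 2)) * (LINT x|lborel. exp (- (\<i> * of_real (x \<bullet> \<xi>))) * \<psi> x)"

definition fourier_dist :: "dist3 \<Rightarrow> dist3"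
  where "fourier_dist u = (\<lambda>\<psi>. if \<psi> \<in> schwartz then u (fourier \<psi>) else 0)"

text \<open>\<open>\<sigma>(D) u\<close>: the tempered distribution whose Fourier transform is the function \<open>\<sigma>\<close> times
  the Fourier transform of \<open>u\<close>.  This is used only for \<open>u\<close> whose Fourier transform is a function;
  the symbol need not be smooth.\<close>

definition fourier_multiplier :: "(R3 \<Rightarrow> complex) \<Rightarrow> dist3 \<Rightarrow> dist3"
  where "fourier_multiplier \<sigma> u =
    (THE v. v \<in> tempered \<and> represented_by (fourier_dist v) (\<lambda>\<xi>. \<sigma> \<xi> * fun_of (fourier_dist u) \<xi>))"


section \<open>Sobolev spaces\<close>

definition Hs :: "real \<Rightarrow> dist3 nspace"
  where "Hs s =
    ({u \<in> tempered. \<exists>g. represented_by (fourier_dist u) g \<and>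
        integrable lborel (\<lambda>\<xi>. (1 + (norm \<xi>)\<^sup>2) powr s * (cmod (g \<xi>))\<^sup>2)},
     \<lambda>u. sqrt (LINT \<xi>|lborel. (1 + (norm \<xi>)\<^sup>2) powr s * (cmod (fun_of (fourier_dist u) \<xi>))\<^sup>2))"

definition radial :: "dist3 \<Rightarrow> bool"
  where "radial u \<longleftrightarrow>
    (\<forall>R. orthogonal_transformation R \<longrightarrow> (\<forall>\<psi>\<in>schwartz. u (\<lambda>x. \<psi> (R x)) = u \<psi>))"

definition Hs_rad :: "real \<Rightarrow> dist3 nspace"
  where "Hs_rad s = ({u \<in> ncarrier (Hs s). radial u}, nnorm (Hs s))"


section \<open>The semirelativistic Hartree equation\<close>

definition half_wave :: "real \<Rightarrow> dist3 \<Rightarrow> dist3"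
  where "half_wave m = fourier_multiplier (\<lambda>\<xi>. of_real (sqrt ((norm \<xi>)\<^sup>2 + m\<^sup>2)))"

definition convolution3 :: "(R3 \<Rightarrow> real) \<Rightarrow> (R3 \<Rightarrow> real) \<Rightarrow> R3 \<Rightarrow> real"
  where "convolution3 f g x = (LINT y|lborel. f (x - y) * g y)"

text \<open>\<open>(|x|\<^sup>-\<^sup>1 \<^bold>* |u|\<^sup>2) u\<close>, used for \<open>u\<close> in \<open>H\<^sup>1\<close>, where the convolution
  integral converges at every point and defines a bounded function.\<close>

definition hartree :: "dist3 \<Rightarrow> dist3"
  where "hartree u = dist_of (\<lambda>x.
    of_real (convolution3 (\<lambda>y. 1 / norm y) (\<lambda>y. (cmod (fun_of u y))\<^sup>2) x) * fun_of u x)"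

text \<open>\<open>u \<in> C([0,T],H\<^sup>1)\<close> solves \<open>\<i> u' = half_wave m u - hartree u\<close> with \<open>u(0) = \<phi>\<close>.
  The time derivative (one-sided at the end points) is taken in the space of tempered
  distributions, i.e. after pairing with each Schwartz function.\<close>

definition H1_solution :: "real \<Rightarrow> real \<Rightarrow> dist3 \<Rightarrow> (real \<Rightarrow> dist3) \<Rightarrow> bool"
  where "H1_solution m T \<phi> u \<longleftrightarrow>
    u \<in> ncarrier (curves T (Hs 1)) \<and> u 0 = \<phi> \<and>
    (\<forall>t\<in>{0..T}. \<forall>\<psi>\<in>schwartz.
      ((\<lambda>r. u r \<psi>) has_vector_derivative (- \<i> * (half_wave m (u t) \<psi> - hartree (u t) \<psi>)))
        (at t within {0..T}))"

text \<open>
  \<open>\<Phi>\<close> is a flow map on the neighbourhood \<open>V\<close> of the origin in the phase space \<open>X\<close>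
  (\<open>Hs s\<close> or \<open>Hs_rad s\<close>), with values in \<open>C([0,T],X)\<close>.  For rough data the nonlinearity need not be
  defined; what is required of \<open>\<Phi>\<close> is that it attains the initial datum and agrees with the
  \<open>H\<^sup>1\<close> solution whenever the datum lies in \<open>H\<^sup>1\<close> and that solution exists on \<open>[0,T]\<close>.
\<close>

definition flow_map ::
    "real \<Rightarrow> real \<Rightarrow> dist3 nspace \<Rightarrow> dist3 set \<Rightarrow> (dist3 \<Rightarrow> real \<Rightarrow> dist3) \<Rightarrow> bool"
  where "flow_map m T X V \<Phi> \<longleftrightarrow>
    V \<subseteq> ncarrier X \<and> (\<exists>r>0. nball X 0 r \<subseteq> V) \<and>
    (\<forall>\<phi>\<in>V. \<Phi> \<phi> \<in> ncarrier (curves T X) \<and> \<Phi> \<phi> 0 = \<phi>) \<and>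
    (\<forall>\<phi>\<in>V \<inter> ncarrier (Hs 1). \<forall>u. H1_solution m T \<phi> u \<longrightarrow> \<Phi> \<phi> = u)"

end

theory Submission
  imports Defs "HOL-Probability.Probability" "HOL-Real_Asymp.Real_Asymp"
begin

text \<open>
  Take as datum \<open>h v\<close>, where the Fourier transform of \<open>v\<close> is the indicator function of a
  bounded set \<open>A\<close>.  On the Fourier side the Duhamel equation is a fixed point problem for functions
  dominated by \<open>(1 + |\<xi>|\<^sup>2)\<^sup>-\<^sup>4\<close>, a weight that the Hartree nonlinearity preserves; for small \<open>h\<close>
  this gives the \<open>H\<^sup>1\<close> solution together with its expansion
  \<open>h\<close> (linear flow) \<open>+ h\<^sup>3\<close> (cubic term) \<open>+ O(h\<^sup>5)\<close>.  A flow map that is \<open>C\<^sup>3\<close> at the origin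
  therefore bounds the pairing of the cubic term with any functional on \<open>H\<^sup>s\<close> by a multiple of the
  cube of the \<open>H\<^sup>s\<close> norm of \<open>v\<close>.

  The cubic term is the time integral of \<open>1 / |\<eta>|\<^sup>2\<close> times an oscillating factor with the phase
  \<open>\<tau> (\<omega>(\<xi>) - \<omega>(\<zeta>) + \<omega>(\<zeta> - \<eta>) - \<omega>(\<xi> - \<eta>))\<close>, \<open>\<omega>(\<xi>) = sqrt (|\<xi>|\<^sup>2 + m\<^sup>2)\<close>.  There is no
  cancellation as long as this phase is at most 1.  For (1), \<open>A\<close> is a slab of length \<open>K\<^sup>2\<close> and
  width \<open>K\<close> at distance \<open>K\<^sup>2\<close> from the origin, on which \<open>\<omega>(\<xi>) = \<xi>\<^sub>1 + O(1)\<close>; the phase is then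
  bounded for times of order 1.  For (2), \<open>A\<close> is the shell \<open>N \<le> |\<xi>| \<le> 4 N\<close> and the time is of
  order \<open>1 / N\<close>.  Letting \<open>K\<close> and \<open>N\<close> tend to infinity contradicts the bound.
\<close>

section \<open>Taylor coefficients of C3 maps\<close>

text \<open>A flow map is tied to the equation only on \<open>H^1\<close> data, so smoothness in
  \<open>H^s\<close> must be refuted with nice data. This works because only one constant has to be
  uniform, the bound on the third derivative near the origin. The range of \<open>h\<close> and the
  constant in \<open>O(h^5)\<close> may depend on the set \<open>A\<close>, so no solution theory at
  low regularity enters.

  The thresholds come from counting. Let \<open>a\<close> be the measure of \<open>A\<close> and
  \<open>n\<close> the size of \<open>1 + |xi|^2\<close> on it. The datum has norm about
  \<open>sqrt (a n^s)\<close>. The functional also lives on \<open>A\<close> and has norm about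
  \<open>sqrt (a n^(-s))\<close>, so the upper bound is a multiple of \<open>a^2 n^s\<close>. The
  pairing is at least a multiple of time times \<open>a^2\<close> times (measure of the transferred
  frequencies \<open>eta\<close>) / (their size)^2. In the slab \<open>n\<close> is about
  \<open>K^4\<close> and \<open>eta\<close> fills a cube of side about \<open>K\<close>, whence
  \<open>K <= const K^(4 s)\<close>. In the shell \<open>n\<close> is about \<open>N^2\<close> and
  \<open>eta\<close> fills a cube of side about \<open>N\<close>, but the time is only
  \<open>1 / N\<close>, whence \<open>1 <= const N^(2 s)\<close>.\<close>

definition seminormed :: "'a::real_vector nspace \<Rightarrow> bool"
  where "seminormed X \<longleftrightarrow> 0 \<in> ncarrier X \<and>
    (\<forall>x\<in>ncarrier X. \<forall>y\<in>ncarrier X. x + y \<in> ncarrier X \<and> nnorm X (x + y) \<le> nnorm X x + nnorm X y) \<and>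
    (\<forall>c. \<forall>x\<in>ncarrier X. c *\<^sub>R x \<in> ncarrier X \<and> nnorm X (c *\<^sub>R x) = \<bar>c\<bar> * nnorm X x) \<and>
    (\<forall>x\<in>ncarrier X. 0 \<le> nnorm X x)"

lemma seminormedD:
  assumes "seminormed X"
  shows "0 \<in> ncarrier X"
    and "x \<in> ncarrier X \<Longrightarrow> y \<in> ncarrier X \<Longrightarrow> x + y \<in> ncarrier X"
    and "x \<in> ncarrier X \<Longrightarrow> y \<in> ncarrier X \<Longrightarrow> x - y \<in> ncarrier X"
    and "x \<in> ncarrier X \<Longrightarrow> c *\<^sub>R x \<in> ncarrier X"
    and "x \<in> ncarrier X \<Longrightarrow> y \<in> ncarrier X \<Longrightarrow> nnorm X (x + y) \<le> nnorm X x + nnorm X y"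
    and "x \<in> ncarrier X \<Longrightarrow> nnorm X (c *\<^sub>R x) = \<bar>c\<bar> * nnorm X x"
    and "x \<in> ncarrier X \<Longrightarrow> 0 \<le> nnorm X x"
    and "nnorm X 0 = 0"
proof -
  show *: "0 \<in> ncarrier X"
    and "x \<in> ncarrier X \<Longrightarrow> y \<in> ncarrier X \<Longrightarrow> x + y \<in> ncarrier X"
    and "x \<in> ncarrier X \<Longrightarrow> c *\<^sub>R x \<in> ncarrier X"
    and "x \<in> ncarrier X \<Longrightarrow> y \<in> ncarrier X \<Longrightarrow> nnorm X (x + y) \<le> nnorm X x + nnorm X y"
    and "x \<in> ncarrier X \<Longrightarrow> nnorm X (c *\<^sub>R x) = \<bar>c\<bar> * nnorm X x"
    and "x \<in> ncarrier X \<Longrightarrow> 0 \<le> nnorm X x"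
    using assms unfolding seminormed_def by blast+
  show "x - y \<in> ncarrier X" if "x \<in> ncarrier X" "y \<in> ncarrier X"
  proof -
    have "x + (-1) *\<^sub>R y \<in> ncarrier X"
      using assms that unfolding seminormed_def by blast
    then show ?thesis by simp
  qed
  have "nnorm X (0 *\<^sub>R 0) = \<bar>0\<bar> * nnorm X 0"
    using assms * unfolding seminormed_def by blast
  then show "nnorm X 0 = 0" by simp
qed

lemma seminormed_diff_triangle:
  assumes "seminormed X" "x \<in> ncarrier X" "y \<in> ncarrier X"
  shows "nnorm X x \<le> nnorm X y + nnorm X (x - y)"
  using seminormedD(5)[OF assms(1,3) seminormedD(3)[OF assms]] by simp

section \<open>Spaces of operators and of curves\<close>

lemma bounded_ops_carrierD:
  assumes "A \<in> ncarrier (bounded_ops X Y)"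
  shows "v \<in> ncarrier X \<Longrightarrow> A v \<in> ncarrier Y"
    and "v \<notin> ncarrier X \<Longrightarrow> A v = 0"
    and "v \<in> ncarrier X \<Longrightarrow> w \<in> ncarrier X \<Longrightarrow> A (v + w) = A v + A w"
    and "v \<in> ncarrier X \<Longrightarrow> A (c *\<^sub>R v) = c *\<^sub>R A v"
    and "\<exists>C\<ge>0. \<forall>v\<in>ncarrier X. nnorm Y (A v) \<le> C * \<bar>nnorm X v\<bar>"
proof -
  show "v \<in> ncarrier X \<Longrightarrow> A v \<in> ncarrier Y"
    and "v \<notin> ncarrier X \<Longrightarrow> A v = 0"
    and "v \<in> ncarrier X \<Longrightarrow> w \<in> ncarrier X \<Longrightarrow> A (v + w) = A v + A w"
    and "v \<in> ncarrier X \<Longrightarrow> A (c *\<^sub>R v) = c *\<^sub>R A v"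
    using assms unfolding bounded_ops_def by auto
  obtain C where C: "\<And>v. v \<in> ncarrier X \<Longrightarrow> nnorm Y (A v) \<le> C * nnorm X v"
    using assms unfolding bounded_ops_def by fastforce
  \<comment> \<open>Absolute values on both factors give a nonnegative constant without any
    information on the sign of \<open>nnorm X v\<close>.\<close>
  have "nnorm Y (A v) \<le> \<bar>C\<bar> * \<bar>nnorm X v\<bar>" if "v \<in> ncarrier X" for v
    using C[OF that] by (metis abs_ge_self abs_mult order_trans)
  then show "\<exists>C\<ge>0. \<forall>v\<in>ncarrier X. nnorm Y (A v) \<le> C * \<bar>nnorm X v\<bar>"
    by (intro exI[of _ "\<bar>C\<bar>"]) auto
qed

lemma bounded_ops_bdd:
  assumes X: "seminormed X" and A: "A \<in> ncarrier (bounded_ops X Y)"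
  shows "bdd_above ((\<lambda>v. nnorm Y (A v)) ` {v \<in> ncarrier X. nnorm X v \<le> 1})"
proof -
  obtain C where C: "C \<ge> 0" "\<And>v. v \<in> ncarrier X \<Longrightarrow> nnorm Y (A v) \<le> C * \<bar>nnorm X v\<bar>"
    using bounded_ops_carrierD(5)[OF A] by blast
  show ?thesis
  proof (rule bdd_aboveI2[of _ _ C])
    fix v assume v: "v \<in> {v \<in> ncarrier X. nnorm X v \<le> 1}"
    then have "nnorm Y (A v) \<le> C * \<bar>nnorm X v\<bar>" using C by blast
    also have "\<dots> \<le> C * 1" using v C(1) seminormedD(7)[OF X] by (intro mult_left_mono) auto
    finally show "nnorm Y (A v) \<le> C" by simp
  qed
qed

lemma nnorm_bounded_ops: "nnorm (bounded_ops X Y) A = (SUP v\<in>{v \<in> ncarrier X. nnorm X v \<le> 1}. nnorm Y (A v))"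
  by (simp add: bounded_ops_def)

lemma bounded_ops_unit:
  assumes "seminormed X" "A \<in> ncarrier (bounded_ops X Y)" "v \<in> ncarrier X" "nnorm X v \<le> 1"
  shows "nnorm Y (A v) \<le> nnorm (bounded_ops X Y) A"
  unfolding nnorm_bounded_ops
  by (rule cSUP_upper[OF _ bounded_ops_bdd[OF assms(1,2)]]) (use assms in auto)

lemma bounded_ops_apply:
  assumes X: "seminormed X" and Y: "seminormed Y" and A: "A \<in> ncarrier (bounded_ops X Y)"
    and v: "v \<in> ncarrier X"
  shows "nnorm Y (A v) \<le> nnorm (bounded_ops X Y) A * nnorm X v"
proof (cases "nnorm X v = 0")
  case True
  \<comment> \<open>A vector of seminorm zero cannot be rescaled to the unit sphere; boundedness of
    \<open>A\<close> shows directly that its image has seminorm at most 0.\<close>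
  obtain C where C: "\<And>v. v \<in> ncarrier X \<Longrightarrow> nnorm Y (A v) \<le> C * \<bar>nnorm X v\<bar>"
    using bounded_ops_carrierD(5)[OF A] by blast
  show ?thesis using C[OF v] True by simp
next
  case False
  then have pos: "nnorm X v > 0" using seminormedD(7)[OF X v] by simp
  let ?w = "(1 / nnorm X v) *\<^sub>R v"
  have w: "?w \<in> ncarrier X" by (rule seminormedD(4)[OF X v])
  have "nnorm X ?w \<le> 1" using seminormedD(6)[OF X v] pos by simp
  then have "nnorm Y (A ?w) \<le> nnorm (bounded_ops X Y) A"
    by (rule bounded_ops_unit[OF X A w])
  moreover have "A ?w = (1 / nnorm X v) *\<^sub>R A v" by (rule bounded_ops_carrierD(4)[OF A v])
  moreover have "nnorm Y ((1 / nnorm X v) *\<^sub>R A v) = nnorm Y (A v) / nnorm X v"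
    using seminormedD(6)[OF Y bounded_ops_carrierD(1)[OF A v]] pos by simp
  ultimately show ?thesis using pos by (simp add: field_simps)
qed

text \<open>Iterating this closure property covers the spaces of bilinear and trilinear maps in
  which the second and third derivatives live. This is why \<open>seminormed\<close> speaks about
  carriers and not about types.\<close>

lemma seminormed_bounded_ops:
  assumes X: "seminormed X" and Y: "seminormed Y"
  shows "seminormed (bounded_ops X Y)"
  unfolding seminormed_def
proof (intro conjI ballI allI)
  let ?Z = "bounded_ops X Y"
  have ne: "{v \<in> ncarrier X. nnorm X v \<le> 1} \<noteq> {}"
    using seminormedD(1,8)[OF X] by (metis (mono_tags, lifting) empty_iff mem_Collect_eq zero_le_one)
  show zero: "0 \<in> ncarrier ?Z"
    using seminormedD(1,8)[OF Y] by (auto simp: bounded_ops_def scaleR_fun_def intro!: exI[of _ 0])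
  fix A assume A: "A \<in> ncarrier ?Z"
  show "0 \<le> nnorm ?Z A"
  proof -
    have "nnorm Y (A 0) \<le> nnorm ?Z A"
      by (rule bounded_ops_unit[OF X A]) (use seminormedD(1,8)[OF X] in auto)
    then show ?thesis
      using seminormedD(7)[OF Y bounded_ops_carrierD(1)[OF A seminormedD(1)[OF X]]] by simp
  qed
  {
    fix B assume B: "B \<in> ncarrier ?Z"
    obtain C where C: "\<And>v. v \<in> ncarrier X \<Longrightarrow> nnorm Y (A v) \<le> C * \<bar>nnorm X v\<bar>"
      using bounded_ops_carrierD(5)[OF A] by blast
    obtain D where D: "\<And>v. v \<in> ncarrier X \<Longrightarrow> nnorm Y (B v) \<le> D * \<bar>nnorm X v\<bar>"
      using bounded_ops_carrierD(5)[OF B] by blast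
    have bd: "nnorm Y (A v + B v) \<le> (C + D) * nnorm X v" if v: "v \<in> ncarrier X" for v
      using C[OF v] D[OF v] seminormedD(7)[OF X v]
        seminormedD(5)[OF Y bounded_ops_carrierD(1)[OF A v] bounded_ops_carrierD(1)[OF B v]]
      by (simp add: algebra_simps)
    show "A + B \<in> ncarrier ?Z"
      using bounded_ops_carrierD[OF A] bounded_ops_carrierD[OF B] seminormedD(2)[OF Y] bd
      by (simp add: bounded_ops_def scaleR_add_right) blast
    show "nnorm ?Z (A + B) \<le> nnorm ?Z A + nnorm ?Z B"
      unfolding nnorm_bounded_ops[of X Y "A + B"]
    proof (rule cSUP_least[OF ne])
      fix v assume "v \<in> {v \<in> ncarrier X. nnorm X v \<le> 1}"
      then have v: "v \<in> ncarrier X" "nnorm X v \<le> 1" by auto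
      show "nnorm Y ((A + B) v) \<le> nnorm ?Z A + nnorm ?Z B"
        using bounded_ops_unit[OF X A v] bounded_ops_unit[OF X B v]
         seminormedD(5)[OF Y bounded_ops_carrierD(1)[OF A v(1)] bounded_ops_carrierD(1)[OF B v(1)]]
        by simp
    qed
  }
  {
    fix c :: real
    obtain C where C: "\<And>v. v \<in> ncarrier X \<Longrightarrow> nnorm Y (A v) \<le> C * \<bar>nnorm X v\<bar>"
      using bounded_ops_carrierD(5)[OF A] by blast
    have bd: "nnorm Y (c *\<^sub>R A v) \<le> (\<bar>c\<bar> * C) * nnorm X v" if v: "v \<in> ncarrier X" for v
      using mult_left_mono[OF C[OF v], of "\<bar>c\<bar>"] seminormedD(6)[OF Y bounded_ops_carrierD(1)[OF A v]]
       seminormedD(7)[OF X v] by simp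
    show cA: "c *\<^sub>R A \<in> ncarrier ?Z"
      using bounded_ops_carrierD[OF A] seminormedD(4)[OF Y] bd
      by (simp add: bounded_ops_def scaleR_fun_def scaleR_add_right) blast
    have le: "nnorm ?Z (d *\<^sub>R B) \<le> \<bar>d\<bar> * nnorm ?Z B" if B: "B \<in> ncarrier ?Z" for d B
      unfolding nnorm_bounded_ops[of X Y "d *\<^sub>R B"]
    proof (rule cSUP_least[OF ne])
      fix v assume "v \<in> {v \<in> ncarrier X. nnorm X v \<le> 1}"
      then have v: "v \<in> ncarrier X" "nnorm X v \<le> 1" by auto
      show "nnorm Y ((d *\<^sub>R B) v) \<le> \<bar>d\<bar> * nnorm ?Z B"
        using mult_left_mono[OF bounded_ops_unit[OF X B v], of "\<bar>d\<bar>"]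
          seminormedD(6)[OF Y bounded_ops_carrierD(1)[OF B v(1)]]
        by (simp add: scaleR_fun_def)
    qed
    show "nnorm ?Z (c *\<^sub>R A) = \<bar>c\<bar> * nnorm ?Z A"
    proof (cases "c = 0")
      case True
      have "(\<lambda>v. 0::'b) = 0" by (simp add: fun_eq_iff)
      then have "nnorm ?Z 0 = 0"
        unfolding nnorm_bounded_ops using ne seminormedD(8)[OF Y] by simp
      then show ?thesis using True by simp
    next
      case False
      \<comment> \<open>The reverse inequality is \<open>le\<close> for the inverse scalar.\<close>
      have "nnorm ?Z ((1/c) *\<^sub>R (c *\<^sub>R A)) \<le> \<bar>1/c\<bar> * nnorm ?Z (c *\<^sub>R A)" by (rule le[OF cA])
      then have "\<bar>c\<bar> * nnorm ?Z A \<le> nnorm ?Z (c *\<^sub>R A)" using False by (simp add: field_simps)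
      then show ?thesis using le[OF A, of c] by simp
    qed
  }
qed

text \<open>By the reverse triangle inequality the seminorm along a curve is a continuous function
  on a compact interval. Hence the supremum defining the norm of \<open>curves\<close> is over a
  bounded set and dominates every value.\<close>

lemma curves_bdd:
  assumes X: "seminormed X" and u: "u \<in> ncarrier (curves T X)"
  shows "bdd_above ((\<lambda>t. nnorm X (u t)) ` {0..T})"
proof -
  have "continuous_on {0..T} (\<lambda>t. nnorm X (u t))"
    unfolding continuous_on_def
  proof
    fix t assume t: "t \<in> {0..T}"
    have lim: "((\<lambda>r. nnorm X (u r - u t)) \<longlongrightarrow> 0) (at t within {0..T})"
      using u t by (auto simp: curves_def)
    have c: "u r \<in> ncarrier X" if "r \<in> {0..T}" for r using u that by (auto simp: curves_def)
    have "((\<lambda>r. nnorm X (u r) - nnorm X (u t)) \<longlongrightarrow> 0) (at t within {0..T})"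
    proof (rule Lim_null_comparison[OF _ lim])
      have "norm (nnorm X (u r) - nnorm X (u t)) \<le> nnorm X (u r - u t)" if "r \<in> {0..T}" for r
      proof -
        have "nnorm X ((-1) *\<^sub>R (u r - u t)) = nnorm X (u r - u t)"
          using seminormedD(6)[OF X seminormedD(3)[OF X c[OF that] c[OF t]], of "-1"]
          by (simp only: abs_minus_cancel abs_one mult_1)
        then show ?thesis
          using seminormed_diff_triangle[OF X c[OF that] c[OF t]]
            seminormed_diff_triangle[OF X c[OF t] c[OF that]] by simp
      qed
      then show "\<forall>\<^sub>F r in at t within {0..T}. norm (nnorm X (u r) - nnorm X (u t)) \<le> nnorm X (u r - u t)"
        by (auto simp: eventually_at_filter)
    qed
    then show "((\<lambda>t. nnorm X (u t)) \<longlongrightarrow> nnorm X (u t)) (at t within {0..T})"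
      by (simp add: LIM_zero_iff)
  qed
  then show ?thesis
    by (intro bounded_imp_bdd_above compact_imp_bounded compact_continuous_image) auto
qed

lemma nnorm_curves: "nnorm (curves T X) u = (SUP t\<in>{0..T}. nnorm X (u t))"
  by (simp add: curves_def)

lemma curves_at:
  assumes "seminormed X" "u \<in> ncarrier (curves T X)" "t \<in> {0..T}"
  shows "nnorm X (u t) \<le> nnorm (curves T X) u"
  unfolding nnorm_curves by (rule cSUP_upper[OF assms(3) curves_bdd[OF assms(1,2)]])

lemma curves_carrierD:
  assumes "u \<in> ncarrier (curves T X)"
  shows "t \<in> {0..T} \<Longrightarrow> u t \<in> ncarrier X" "t \<notin> {0..T} \<Longrightarrow> u t = 0"
    "t \<in> {0..T} \<Longrightarrow> ((\<lambda>r. nnorm X (u r - u t)) \<longlongrightarrow> 0) (at t within {0..T})"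
  using assms by (auto simp: curves_def)

lemma seminormed_curves:
  assumes X: "seminormed X" and T: "T > 0"
  shows "seminormed (curves T X)"
  unfolding seminormed_def
proof (intro conjI ballI allI)
  let ?Z = "curves T X"
  have ne: "{0..T} \<noteq> {}" and T0: "0 \<in> {0..T}" using T by auto
  show zero: "0 \<in> ncarrier ?Z"
    using seminormedD(1,8)[OF X] by (auto simp: curves_def)
  fix u assume u: "u \<in> ncarrier ?Z"
  note uc = curves_carrierD[OF u]
  show "0 \<le> nnorm ?Z u"
    using curves_at[OF X u T0] seminormedD(7)[OF X uc(1)[OF T0]] by simp
  {
    fix w assume w: "w \<in> ncarrier ?Z"
    note wc = curves_carrierD[OF w]
    have "((\<lambda>r. nnorm X ((u + w) r - (u + w) t)) \<longlongrightarrow> 0) (at t within {0..T})" if t: "t \<in> {0..T}" for t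
    proof (rule Lim_null_comparison)
      show "((\<lambda>r. nnorm X (u r - u t) + nnorm X (w r - w t)) \<longlongrightarrow> 0) (at t within {0..T})"
        using tendsto_add[OF uc(3)[OF t] wc(3)[OF t]] by simp
      have "norm (nnorm X ((u + w) r - (u + w) t)) \<le> nnorm X (u r - u t) + nnorm X (w r - w t)"
        if r: "r \<in> {0..T}" for r
      proof -
        have 1: "u r - u t \<in> ncarrier X" "w r - w t \<in> ncarrier X"
          using seminormedD(3)[OF X] uc wc r t by auto
        show ?thesis
          using seminormedD(5)[OF X 1] seminormedD(7)[OF X seminormedD(2)[OF X 1]]
          by (simp add: algebra_simps)
      qed
      then show "\<forall>\<^sub>F r in at t within {0..T}.
          norm (nnorm X ((u + w) r - (u + w) t)) \<le> nnorm X (u r - u t) + nnorm X (w r - w t)"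
        by (auto simp: eventually_at_filter)
    qed
    then show "u + w \<in> ncarrier ?Z"
      using uc wc seminormedD(2)[OF X] by (auto simp: curves_def)
    show "nnorm ?Z (u + w) \<le> nnorm ?Z u + nnorm ?Z w"
      unfolding nnorm_curves[of T X "u + w"]
    proof (rule cSUP_least[OF ne])
      fix t assume t: "t \<in> {0..T}"
      show "nnorm X ((u + w) t) \<le> nnorm ?Z u + nnorm ?Z w"
        using curves_at[OF X u t] curves_at[OF X w t] seminormedD(5)[OF X uc(1)[OF t] wc(1)[OF t]]
        by simp
    qed
  }
  {
    fix c :: real
    have "((\<lambda>r. nnorm X ((c *\<^sub>R u) r - (c *\<^sub>R u) t)) \<longlongrightarrow> 0) (at t within {0..T})" if t: "t \<in> {0..T}" for t
    proof (rule Lim_null_comparison)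
      show "((\<lambda>r. \<bar>c\<bar> * nnorm X (u r - u t)) \<longlongrightarrow> 0) (at t within {0..T})"
        using tendsto_mult[OF tendsto_const uc(3)[OF t]] by simp
      have "norm (nnorm X ((c *\<^sub>R u) r - (c *\<^sub>R u) t)) \<le> \<bar>c\<bar> * nnorm X (u r - u t)"
        if r: "r \<in> {0..T}" for r
      proof -
        have 1: "u r - u t \<in> ncarrier X"
          using seminormedD(3)[OF X] uc r t by auto
        have 2: "(c *\<^sub>R u) r - (c *\<^sub>R u) t = c *\<^sub>R (u r - u t)"
          by (simp add: scaleR_fun_def scaleR_diff_right)
        show ?thesis
          unfolding 2 using seminormedD(6)[OF X 1, of c] seminormedD(7)[OF X 1] by simp
      qed
      then show "\<forall>\<^sub>F r in at t within {0..T}.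
          norm (nnorm X ((c *\<^sub>R u) r - (c *\<^sub>R u) t)) \<le> \<bar>c\<bar> * nnorm X (u r - u t)"
        by (auto simp: eventually_at_filter)
    qed
    then show cu: "c *\<^sub>R u \<in> ncarrier ?Z"
      using uc seminormedD(4)[OF X] by (auto simp: curves_def scaleR_fun_def)
    have le: "nnorm ?Z (d *\<^sub>R w) \<le> \<bar>d\<bar> * nnorm ?Z w" if w: "w \<in> ncarrier ?Z" for d w
      unfolding nnorm_curves[of T X "d *\<^sub>R w"]
    proof (rule cSUP_least[OF ne])
      fix t assume t: "t \<in> {0..T}"
      show "nnorm X ((d *\<^sub>R w) t) \<le> \<bar>d\<bar> * nnorm ?Z w"
        using mult_left_mono[OF curves_at[OF X w t], of "\<bar>d\<bar>"]
          seminormedD(6)[OF X curves_carrierD(1)[OF w t]]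
        by (simp add: scaleR_fun_def)
    qed
    show "nnorm ?Z (c *\<^sub>R u) = \<bar>c\<bar> * nnorm ?Z u"
    proof (cases "c = 0")
      case True
      have "nnorm ?Z 0 = 0"
        unfolding nnorm_curves using ne seminormedD(8)[OF X] by simp
      then show ?thesis using True by simp
    next
      case False
      have "nnorm ?Z ((1/c) *\<^sub>R (c *\<^sub>R u)) \<le> \<bar>1/c\<bar> * nnorm ?Z (c *\<^sub>R u)" by (rule le[OF cu])
      then have "\<bar>c\<bar> * nnorm ?Z u \<le> nnorm ?Z (c *\<^sub>R u)" using False by (simp add: field_simps)
      then show ?thesis using le[OF u, of c] by simp
    qed
  }
qed

text \<open>Testing with such functionals replaces Taylor expansion in \<open>Y\<close> by that of
  real functions of one variable. The bound \<open>C\<close> is carried along explicitly because its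
  size, a dual Sobolev norm in the application, enters the final inequality.\<close>

definition bounded_functional :: "'a::real_vector nspace \<Rightarrow> ('a \<Rightarrow> real) \<Rightarrow> real \<Rightarrow> bool"
  where "bounded_functional Z L C \<longleftrightarrow>
    (\<forall>x\<in>ncarrier Z. \<forall>y\<in>ncarrier Z. L (x + y) = L x + L y) \<and>
    (\<forall>c. \<forall>x\<in>ncarrier Z. L (c *\<^sub>R x) = c * L x) \<and>
    (\<forall>x\<in>ncarrier Z. \<bar>L x\<bar> \<le> C * nnorm Z x) \<and> C \<ge> 0"

lemma bounded_functionalD:
  assumes "bounded_functional Z L C"
  shows "x \<in> ncarrier Z \<Longrightarrow> y \<in> ncarrier Z \<Longrightarrow> L (x + y) = L x + L y"
    "x \<in> ncarrier Z \<Longrightarrow> L (c *\<^sub>R x) = c * L x"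
    "x \<in> ncarrier Z \<Longrightarrow> \<bar>L x\<bar> \<le> C * nnorm Z x" "C \<ge> 0"
  using assms unfolding bounded_functional_def by blast+

lemma bounded_functional_diff:
  assumes "seminormed Z" "bounded_functional Z L C" "x \<in> ncarrier Z" "y \<in> ncarrier Z"
  shows "L (x - y) = L x - L y"
proof -
  have "L (x + (-1) *\<^sub>R y) = L x + L ((-1) *\<^sub>R y)"
    by (rule bounded_functionalD(1)[OF assms(2,3) seminormedD(4)[OF assms(1,4)]])
  also have "L ((-1) *\<^sub>R y) = - L y" using bounded_functionalD(2)[OF assms(2,4), of "-1"] by simp
  finally show ?thesis by simp
qed

text \<open>Evaluating at \<open>v\<close> costs one factor \<open>nnorm X v\<close>. Three
  evaluations turn a functional on \<open>Y\<close> into one on trilinear maps and produce the cube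
  of the norm of the datum.\<close>

lemma bounded_functional_eval:
  assumes X: "seminormed X" and Z: "seminormed Z" and L: "bounded_functional Z L C"
    and v: "v \<in> ncarrier X"
  shows "bounded_functional (bounded_ops X Z) (\<lambda>A. L (A v)) (C * nnorm X v)"
  unfolding bounded_functional_def
proof (intro conjI ballI allI)
  show "0 \<le> C * nnorm X v" using bounded_functionalD(4)[OF L] seminormedD(7)[OF X v] by simp
  fix A assume A: "A \<in> ncarrier (bounded_ops X Z)"
  note Av = bounded_ops_carrierD(1)[OF A v]
  show "L ((c *\<^sub>R A) v) = c * L (A v)" for c
    using bounded_functionalD(2)[OF L Av] by (simp add: scaleR_fun_def)
  have "\<bar>L (A v)\<bar> \<le> C * nnorm Z (A v)" by (rule bounded_functionalD(3)[OF L Av])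
  also have "\<dots> \<le> C * (nnorm (bounded_ops X Z) A * nnorm X v)"
    by (rule mult_left_mono[OF bounded_ops_apply[OF X Z A v] bounded_functionalD(4)[OF L]])
  finally show "\<bar>L (A v)\<bar> \<le> C * nnorm X v * nnorm (bounded_ops X Z) A" by (simp add: mult_ac)
  fix B assume B: "B \<in> ncarrier (bounded_ops X Z)"
  show "L ((A + B) v) = L (A v) + L (B v)"
    using bounded_functionalD(1)[OF L Av bounded_ops_carrierD(1)[OF B v]] by simp
qed

text \<open>Chain rule along the line through \<open>v\<close>. As \<open>L\<close> is bounded, the
  Frechet remainder at \<open>h *\<^sub>R v\<close> becomes \<open>o(h)\<close> after testing; here
  \<open>F\<close> may itself be a derivative with values in an operator space.\<close>

lemma frechet_on_ray_derivative:
  assumes X: "seminormed X" and Z: "seminormed Z" and L: "bounded_functional Z L C"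
    and v: "v \<in> ncarrier X" and F: "frechet_on X Z (nball X 0 r) F DF"
    and t: "\<bar>t\<bar> * nnorm X v < r"
  shows "((\<lambda>t. L (F (t *\<^sub>R v))) has_real_derivative L (DF (t *\<^sub>R v) v)) (at t)"
proof -
  let ?n = "nnorm X v"
  have ball: "s *\<^sub>R v \<in> nball X 0 r \<longleftrightarrow> \<bar>s\<bar> * ?n < r" for s
    using seminormedD(4)[OF X v, of s] seminormedD(6)[OF X v, of s] by (simp add: nball_def)
  have Fb: "F x \<in> ncarrier Z" "DF x \<in> ncarrier (bounded_ops X Z)" if "x \<in> nball X 0 r" for x
    using F that unfolding frechet_on_def by auto
  note tb = t[folded ball]
  have ev0: "\<forall>\<^sub>F h in at 0. \<bar>t + h\<bar> * ?n < r"
  proof -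
    have "((\<lambda>h. \<bar>t + h\<bar> * ?n) \<longlongrightarrow> \<bar>t + 0\<bar> * ?n) (at 0)" by (intro tendsto_intros)
    then show ?thesis using t by (auto dest!: order_tendstoD(2))
  qed
  have "((\<lambda>h. (L (F ((t + h) *\<^sub>R v)) - L (F (t *\<^sub>R v))) / h - L (DF (t *\<^sub>R v) v)) \<longlongrightarrow> 0) (at 0)"
  proof (rule tendstoI)
    fix e :: real assume e: "e > 0"
    \<comment> \<open>The summand 1 keeps the denominator positive when \<open>C * ?n\<close>
      vanishes, so no case distinction is needed.\<close>
    define e' where "e' = e / (2 * (C * ?n + 1))"
    have Cn: "C * ?n \<ge> 0" using bounded_functionalD(4)[OF L] seminormedD(7)[OF X v] by simp
    have e': "e' > 0" using e Cn by (simp add: e'_def)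
    have "\<forall>e>0. \<exists>d>0. \<forall>h\<in>ncarrier X. nnorm X h < d \<and> t *\<^sub>R v + h \<in> nball X 0 r \<longrightarrow>
         nnorm Z (F (t *\<^sub>R v + h) - F (t *\<^sub>R v) - DF (t *\<^sub>R v) h) \<le> e * nnorm X h"
      using F tb unfolding frechet_on_def by blast
    then obtain d where d: "d > 0" "\<And>h. h \<in> ncarrier X \<Longrightarrow> nnorm X h < d \<Longrightarrow> t *\<^sub>R v + h \<in> nball X 0 r \<Longrightarrow>
         nnorm Z (F (t *\<^sub>R v + h) - F (t *\<^sub>R v) - DF (t *\<^sub>R v) h) \<le> e' * nnorm X h"
      using e' by meson
    have ev1: "\<forall>\<^sub>F h in at 0. \<bar>h\<bar> * ?n < d"
    proof -
      have "((\<lambda>h. \<bar>h\<bar> * ?n) \<longlongrightarrow> \<bar>0\<bar> * ?n) (at 0)" by (intro tendsto_intros)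
      then show ?thesis using d by (auto dest!: order_tendstoD(2))
    qed
    have ev2: "\<forall>\<^sub>F h in at (0::real). h \<noteq> 0" by (simp add: eventually_at_filter)
    show "\<forall>\<^sub>F h in at 0. dist ((L (F ((t + h) *\<^sub>R v)) - L (F (t *\<^sub>R v))) / h - L (DF (t *\<^sub>R v) v)) 0 < e"
      using ev0 ev1 ev2
    proof eventually_elim
      case (elim h)
      have hv: "h *\<^sub>R v \<in> ncarrier X" by (rule seminormedD(4)[OF X v])
      have nh: "nnorm X (h *\<^sub>R v) = \<bar>h\<bar> * ?n" by (rule seminormedD(6)[OF X v])
      have sum: "t *\<^sub>R v + h *\<^sub>R v = (t + h) *\<^sub>R v" by (simp add: scaleR_left_distrib)
      have thb: "(t + h) *\<^sub>R v \<in> nball X 0 r" using elim(1) ball by simp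
      let ?R = "F ((t + h) *\<^sub>R v) - F (t *\<^sub>R v) - DF (t *\<^sub>R v) (h *\<^sub>R v)"
      have "nnorm Z ?R \<le> e' * (\<bar>h\<bar> * ?n)"
        using d(2)[OF hv] elim nh sum thb by simp
      note c1 = Fb(1)[OF thb] and c2 = Fb(1)[OF tb] and c3 = bounded_ops_carrierD(1)[OF Fb(2)[OF tb] hv]
      have "L ?R = L (F ((t + h) *\<^sub>R v)) - L (F (t *\<^sub>R v)) - L (DF (t *\<^sub>R v) (h *\<^sub>R v))"
        using bounded_functional_diff[OF Z L] c1 c2 c3 seminormedD(3)[OF Z] by simp
      also have "L (DF (t *\<^sub>R v) (h *\<^sub>R v)) = h * L (DF (t *\<^sub>R v) v)"
        using bounded_ops_carrierD(4)[OF Fb(2)[OF tb] v, of h] bounded_functionalD(2)[OF L bounded_ops_carrierD(1)[OF Fb(2)[OF tb] v], of h]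
        by simp
      finally have LR: "L ?R = L (F ((t + h) *\<^sub>R v)) - L (F (t *\<^sub>R v)) - h * L (DF (t *\<^sub>R v) v)" .
      have "\<bar>L ?R\<bar> \<le> C * nnorm Z ?R"
        by (rule bounded_functionalD(3)[OF L]) (use c1 c2 c3 seminormedD(3)[OF Z] in auto)
      also have "\<dots> \<le> C * (e' * (\<bar>h\<bar> * ?n))"
        by (rule mult_left_mono) (use \<open>nnorm Z ?R \<le> _\<close> bounded_functionalD(4)[OF L] in auto)
      also have "\<dots> = \<bar>h\<bar> * (e' * (C * ?n))" by simp
      finally have "\<bar>L ?R\<bar> / \<bar>h\<bar> \<le> e' * (C * ?n)" using elim(3) by (simp add: field_simps)
      also have "\<dots> < e"
      proof -
        have "e' * (C * ?n) = e * (C * ?n / (2 * (C * ?n + 1)))" by (simp add: e'_def)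
        also have "\<dots> < e * 1" by (rule mult_strict_left_mono) (use e Cn in \<open>auto simp: field_simps\<close>)
        finally show ?thesis by simp
      qed
      finally have "\<bar>L ?R / h\<bar> < e" by simp
      moreover have "L ?R / h = (L (F ((t + h) *\<^sub>R v)) - L (F (t *\<^sub>R v))) / h - L (DF (t *\<^sub>R v) v)"
        unfolding LR using elim(3) by (simp add: field_simps)
      ultimately show ?case by (simp add: dist_real_def)
    qed
  qed
  then have "((\<lambda>h. (L (F ((t + h) *\<^sub>R v)) - L (F (t *\<^sub>R v))) / h) \<longlongrightarrow> L (DF (t *\<^sub>R v) v)) (at 0)"
    by (simp add: LIM_zero_iff)
  then show ?thesis unfolding DERIV_def .
qed

text \<open>The third finite difference with nodes \<open>h, 2h, 3h, 4h\<close> annihilates quadratic polynomials.\<close>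

lemma cubic_coefficient_bound:
  fixes G :: "real \<Rightarrow> real"
  assumes d: "d > 0"
    and taylor: "\<And>h. 0 < h \<Longrightarrow> h < d \<Longrightarrow> \<bar>G h - (p + q * h + r * h^2)\<bar> \<le> M * h^3"
    and expansion: "\<And>h. 0 < h \<Longrightarrow> h < d \<Longrightarrow> \<bar>G h - (a * h + b * h^3)\<bar> \<le> K * h^4"
  shows "\<bar>b\<bar> \<le> 100 * M"
proof -
  \<comment> \<open>Sum of the weights 1, 3, 3, 1 of the third difference times the fourth powers of
    the nodes 4, 3, 2, 1. With cubes in place of fourth powers the sum is 170.\<close>
  define K' where "K' = K * (256 + 3 * 81 + 3 * 16 + 1)"
  have bd: "6 * \<bar>b\<bar> \<le> (64 + 3 * 27 + 3 * 8 + 1) * M + K' * h" if h: "0 < h" "h < d / 4" for h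
  proof -
    define g where "g x = G x - (p + q * x + r * x^2)" for x
    define k where "k x = G x - (a * x + b * x^3)" for x
    have g: "\<bar>g (c * h)\<bar> \<le> (c^3 * M) * h^3" if "0 < c" "c \<le> 4" for c
    proof -
      have "c * h \<le> 4 * h" using that h by (intro mult_right_mono) auto
      then have "c * h < d" using h by linarith
      then show ?thesis using taylor[of "c * h"] that h by (simp add: g_def power_mult_distrib mult_ac)
    qed
    have k: "\<bar>k (c * h)\<bar> \<le> (c^4 * K) * h^4" if "0 < c" "c \<le> 4" for c
    proof -
      have "c * h \<le> 4 * h" using that h by (intro mult_right_mono) auto
      then have "c * h < d" using h by linarith
      then show ?thesis using expansion[of "c * h"] that h by (simp add: k_def power_mult_distrib mult_ac)
    qed
    define A B where "A = M * h^3" and "B = K * h^4"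
    \<comment> \<open>The quadratic in \<open>g\<close> and the linear term in \<open>k\<close> are
      both annihilated by the difference, so \<open>p\<close>, \<open>q\<close>, \<open>r\<close>
      need not be compared with \<open>a\<close>. On cubes it gives
      \<open>64 - 3 * 27 + 3 * 8 - 1 = 6\<close>.\<close>
    have "6 * b * h^3 = (g (4*h) - 3 * g (3*h) + 3 * g (2*h) - g (1*h)) - (k (4*h) - 3 * k (3*h) + 3 * k (2*h) - k (1*h))"
      unfolding g_def k_def by (simp add: power_mult_distrib)
    moreover have "\<bar>g (1*h)\<bar> \<le> A" "\<bar>g (2*h)\<bar> \<le> 8 * A" "\<bar>g (3*h)\<bar> \<le> 27 * A" "\<bar>g (4*h)\<bar> \<le> 64 * A"
      "\<bar>k (1*h)\<bar> \<le> B" "\<bar>k (2*h)\<bar> \<le> 16 * B" "\<bar>k (3*h)\<bar> \<le> 81 * B" "\<bar>k (4*h)\<bar> \<le> 256 * B"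
      using g[of 1] g[of 2] g[of 3] g[of 4] k[of 1] k[of 2] k[of 3] k[of 4] by (simp_all add: A_def B_def)
    moreover have "\<bar>x\<bar> \<le> 170 * A + 548 * B"
      if "x = (g4 - 3 * g3 + 3 * g2 - g1) - (k4 - 3 * k3 + 3 * k2 - k1)"
        "\<bar>g1\<bar> \<le> A" "\<bar>g2\<bar> \<le> 8 * A" "\<bar>g3\<bar> \<le> 27 * A" "\<bar>g4\<bar> \<le> 64 * A"
        "\<bar>k1\<bar> \<le> B" "\<bar>k2\<bar> \<le> 16 * B" "\<bar>k3\<bar> \<le> 81 * B" "\<bar>k4\<bar> \<le> 256 * B"
      for x g1 g2 g3 g4 k1 k2 k3 k4 :: real
      using that unfolding abs_le_iff by linarith
    ultimately have "\<bar>6 * b * h^3\<bar> \<le> 170 * A + 548 * B" by blast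
    also have "\<dots> = h^3 * ((64 + 3 * 27 + 3 * 8 + 1) * M + K' * h)"
    proof -
      have "B = h^3 * (K * h)" by (simp add: B_def power4_eq_xxxx power3_eq_cube)
      then show ?thesis by (simp add: A_def K'_def distrib_left)
    qed
    finally have "h^3 * (6 * \<bar>b\<bar>) \<le> h^3 * ((64 + 3 * 27 + 3 * 8 + 1) * M + K' * h)"
      using h by (simp add: abs_mult)
    then show ?thesis using h by (simp add: mult_le_cancel_left)
  qed
  have "((\<lambda>h. (64 + 3 * 27 + 3 * 8 + 1) * M + K' * h) \<longlongrightarrow> (64 + 3 * 27 + 3 * 8 + 1) * M + K' * 0) (at_right 0)"
    by (intro tendsto_intros)
  then have "6 * \<bar>b\<bar> \<le> (64 + 3 * 27 + 3 * 8 + 1) * M + K' * 0"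
  proof (rule tendsto_lowerbound)
    show "\<forall>\<^sub>F h in at_right 0. 6 * \<bar>b\<bar> \<le> (64 + 3 * 27 + 3 * 8 + 1) * M + K' * h"
      unfolding eventually_at_right_field
      using bd d by (intro exI[of _ "d/4"]) auto
  qed simp
  \<comment> \<open>The limit gives the factor \<open>170 / 6\<close>; rounding it up to 100
    requires the sign of \<open>M\<close>.\<close>
  moreover have "M \<ge> 0"
  proof -
    have "0 \<le> M * (d/2)^3" by (rule order_trans[OF abs_ge_zero taylor[of "d/2"]]) (use d in auto)
    moreover have "(d/2)^3 > 0" using d by simp
    ultimately show ?thesis by (simp add: zero_le_mult_iff)
  qed
  ultimately show ?thesis by simp
qed

text \<open>\<open>M\<close> depends on \<open>F\<close> alone: up to a factor it bounds the norm of
  the third derivative near the origin. The range \<open>d\<close> and the error constant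
  \<open>K\<close> of the expansion may depend on \<open>v\<close> and \<open>L\<close>, since they
  disappear in the limit of small \<open>h\<close>. This permits smallness conditions that depend on
  the datum.\<close>

lemma C3_at_cubic_coefficient:
  assumes X: "seminormed X" and Y: "seminormed Y" and C3: "C3_at X Y V F 0"
  obtains M where "M \<ge> 0"
    "\<And>v L C d a b K. v \<in> ncarrier X \<Longrightarrow> bounded_functional Y L C \<Longrightarrow> d > 0 \<Longrightarrow>
      (\<And>h. 0 < h \<Longrightarrow> h < d \<Longrightarrow> \<bar>L (F (h *\<^sub>R v)) - (a * h + b * h^3)\<bar> \<le> K * h^4) \<Longrightarrow>
      \<bar>b\<bar> \<le> M * C * nnorm X v ^ 3"
proof -
  let ?O1 = "bounded_ops X Y" and ?O2 = "bounded_ops X (bounded_ops X Y)"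
    and ?O3 = "bounded_ops X (bounded_ops X (bounded_ops X Y))"
  note O1 = seminormed_bounded_ops[OF X Y]
  note O2 = seminormed_bounded_ops[OF X O1]
  note O3 = seminormed_bounded_ops[OF X O2]
  obtain r D1 D2 D3 where r: "r > 0" and f1: "frechet_on X Y (nball X 0 r) F D1"
    and f2: "frechet_on X ?O1 (nball X 0 r) D1 D2"
    and f3: "frechet_on X ?O2 (nball X 0 r) D2 D3"
    and ct: "ncontinuous_on X ?O3 (nball X 0 r) D3"
    using C3 unfolding C3_at_def by blast
  have z: "0 \<in> nball X 0 r" using seminormedD(1,8)[OF X] r by (simp add: nball_def)
  \<comment> \<open>Continuity of \<open>D3\<close> is used at the origin only, with tolerance 1; it
    makes the third derivative bounded by \<open>nnorm ?O3 (D3 0) + 1\<close> on a small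
    ball.\<close>
  obtain d0 where d0: "d0 > 0" "\<And>y. y \<in> nball X 0 r \<Longrightarrow> nnorm X (y - 0) < d0 \<Longrightarrow> nnorm ?O3 (D3 y - D3 0) < 1"
    using ct z unfolding ncontinuous_on_def by (meson zero_less_one)
  have D3c: "D3 y \<in> ncarrier ?O3" if "y \<in> nball X 0 r" for y
    using ct that unfolding ncontinuous_on_def by blast
  define M0 where "M0 = nnorm ?O3 (D3 0) + 1"
  have M0: "M0 \<ge> 0" using seminormedD(7)[OF O3 D3c[OF z]] by (simp add: M0_def)
  show ?thesis
  proof (rule that[of "100 * M0"])
    show "100 * M0 \<ge> 0" using M0 by simp
    fix v L C d a b K
    assume v: "v \<in> ncarrier X" and L: "bounded_functional Y L C" and d: "d > 0"
      and ex: "\<And>h. 0 < h \<Longrightarrow> h < d \<Longrightarrow> \<bar>L (F (h *\<^sub>R v)) - (a * h + b * h^3)\<bar> \<le> K * h^4"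
    let ?n = "nnorm X v"
    have n0: "?n \<ge> 0" by (rule seminormedD(7)[OF X v])
    \<comment> \<open>For \<open>|t| < d1\<close> the point \<open>t *\<^sub>R v\<close> lies in the
      ball of differentiability and in the ball where \<open>D3\<close> is bounded; the summand 1
      handles \<open>?n = 0\<close>.\<close>
    define d1 where "d1 = min d (min r d0 / (?n + 1))"
    have d1: "d1 > 0" "d1 \<le> d" using d r d0(1) n0 by (auto simp: d1_def)
    have small: "\<bar>t\<bar> * ?n < min r d0" if "\<bar>t\<bar> < d1" for t
    proof -
      have "\<bar>t\<bar> < min r d0 / (?n + 1)" using that by (simp add: d1_def)
      then have "\<bar>t\<bar> * (?n + 1) < min r d0" using n0 by (simp add: pos_less_divide_eq)
      moreover have "\<bar>t\<bar> * ?n \<le> \<bar>t\<bar> * (?n + 1)" by (rule mult_left_mono) auto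
      ultimately show ?thesis by linarith
    qed
    note L1 = bounded_functional_eval[OF X Y L v]
    note L2 = bounded_functional_eval[OF X O1 L1 v]
    note L3 = bounded_functional_eval[OF X O2 L2 v]
    \<comment> \<open>\<open>G m\<close> is the \<open>m\<close>-th derivative of
      \<open>G 0\<close>, the tested restriction of \<open>F\<close> to the line through
      \<open>v\<close>.\<close>
    define G where "G m t = (if m = 0 then L (F (t *\<^sub>R v)) else if m = 1 then L (D1 (t *\<^sub>R v) v)
      else if m = 2 then L (D2 (t *\<^sub>R v) v v) else L (D3 (t *\<^sub>R v) v v v))" for m :: nat and t
    have deriv: "DERIV (G m) t :> G (Suc m) t" if "m < 3" "\<bar>t\<bar> < d1" for m t
    proof -
      have t: "\<bar>t\<bar> * ?n < r" using small[OF that(2)] by simp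
      consider "m = 0" | "m = 1" | "m = 2" using \<open>m < 3\<close> by linarith
      then show ?thesis
      proof cases
        case 1
        then show ?thesis using frechet_on_ray_derivative[OF X Y L v f1 t] by (simp add: G_def[abs_def])
      next
        case 2
        then show ?thesis using frechet_on_ray_derivative[OF X O1 L1 v f2 t] by (simp add: G_def[abs_def])
      next
        case 3
        then show ?thesis using frechet_on_ray_derivative[OF X O2 L2 v f3 t] by (simp add: G_def[abs_def])
      qed
    qed
    define M where "M = C * ?n * ?n * ?n * M0"
    have G3: "\<bar>G 3 t\<bar> \<le> M" if "\<bar>t\<bar> < d1" for t
    proof -
      have tb: "t *\<^sub>R v \<in> nball X 0 r" "nnorm X (t *\<^sub>R v - 0) < d0"
        using small[OF that] seminormedD(4)[OF X v, of t] seminormedD(6)[OF X v, of t] by (auto simp: nball_def)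
      have "nnorm ?O3 (D3 (t *\<^sub>R v)) \<le> M0"
        using seminormed_diff_triangle[OF O3 D3c[OF tb(1)] D3c[OF z]] d0(2)[OF tb] by (simp add: M0_def)
      then have "C * ?n * ?n * ?n * nnorm ?O3 (D3 (t *\<^sub>R v)) \<le> M"
        unfolding M_def using bounded_functionalD(4)[OF L3] by (intro mult_left_mono) auto
      moreover have "\<bar>L (D3 (t *\<^sub>R v) v v v)\<bar> \<le> C * ?n * ?n * ?n * nnorm ?O3 (D3 (t *\<^sub>R v))"
        by (rule bounded_functionalD(3)[OF L3 D3c[OF tb(1)]])
      ultimately show ?thesis by (simp add: G_def)
    qed
    have "\<bar>b\<bar> \<le> 100 * M"
    proof (rule cubic_coefficient_bound[OF d1(1), where a = a and K = K and G = "G 0" and p = "G 0 0" and q = "G 1 0" and r = "G 2 0 / 2"])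
      fix h :: real assume h: "0 < h" "h < d1"
      show "\<bar>G 0 h - (a * h + b * h^3)\<bar> \<le> K * h^4"
        using ex[of h] h d1(2) by (simp add: G_def)
      \<comment> \<open>Taylor's formula with Lagrange remainder. The factor \<open>1 / 6\<close> in
        the remainder is simply estimated by 1 below.\<close>
      have "\<exists>t>0. t < h \<and> G 0 h = (\<Sum>m<3. G m 0 / fact m * h ^ m) + G 3 t / fact 3 * h ^ 3"
        by (rule Maclaurin[OF h(1)]) (use deriv h in auto)
      then obtain t where t: "t > 0" "t < h"
        and eq: "G 0 h = (\<Sum>m<3. G m 0 / fact m * h ^ m) + G 3 t / fact 3 * h ^ 3" by blast
      have "G 0 h - (G 0 0 + G 1 0 * h + G 2 0 / 2 * h^2) = G 3 t / 6 * h^3"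
        unfolding eq by (simp add: eval_nat_numeral)
      moreover have "\<bar>G 3 t / 6 * h^3\<bar> \<le> M * h^3"
      proof -
        have "\<bar>G 3 t / 6\<bar> \<le> M" using G3[of t] t h by simp
        then have "\<bar>G 3 t / 6\<bar> * h^3 \<le> M * h^3" using h by (intro mult_right_mono) auto
        then show ?thesis using h by (simp add: abs_mult)
      qed
      ultimately show "\<bar>G 0 h - (G 0 0 + G 1 0 * h + G 2 0 / 2 * h^2)\<bar> \<le> M * h^3" by simp
    qed
    then show "\<bar>b\<bar> \<le> 100 * M0 * C * ?n ^ 3" by (simp add: M_def power3_eq_cube mult_ac)
  qed
qed

section \<open>Integrals and Gaussians\<close>

text \<open>\<open>lborel\<close> is the image of a product of one-dimensional Lebesgue measures
  under the coordinate map, so integrals of products over the coordinates factor.\<close>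

lemma lborel_integral_prod_Basis:
  fixes f :: "'a::euclidean_space \<Rightarrow> real \<Rightarrow> 'b::{real_normed_field,banach,second_countable_topology}"
  assumes f: "\<And>b. b \<in> Basis \<Longrightarrow> integrable lborel (f b)"
  shows "integrable lborel (\<lambda>x::'a. \<Prod>b\<in>Basis. f b (x \<bullet> b))"
    and "(LINT x|lborel. (\<Prod>b\<in>Basis. f b (x \<bullet> b))) = (\<Prod>b\<in>Basis. (LINT x|lborel. f b x))"
proof -
  interpret product_sigma_finite "\<lambda>_::'a. lborel :: real measure" by standard
  let ?P = "\<Pi>\<^sub>M b\<in>(Basis::'a set). (lborel :: real measure)"
  let ?T = "\<lambda>g. \<Sum>b\<in>(Basis::'a set). g b *\<^sub>R b"
  have T: "?T \<in> measurable ?P borel" by measurable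
  have [measurable]: "f b \<in> borel_measurable borel" if "b \<in> Basis" for b
    using borel_measurable_integrable[OF f[OF that]] by simp
  have F: "(\<lambda>x::'a. \<Prod>b\<in>Basis. f b (x \<bullet> b)) \<in> borel_measurable borel" by measurable
  have eq: "(\<Prod>b\<in>Basis. f b (?T g \<bullet> b)) = (\<Prod>b\<in>Basis. f b (g b))" for g
    by (intro prod.cong refl) simp
  show "integrable lborel (\<lambda>x::'a. \<Prod>b\<in>Basis. f b (x \<bullet> b))"
    by (subst lborel_eq, subst integrable_distr_eq[OF T F], unfold eq)
       (intro product_integrable_prod f finite_Basis)
  show "(LINT x|lborel. (\<Prod>b\<in>Basis. f b (x \<bullet> b))) = (\<Prod>b\<in>Basis. (LINT x|lborel. f b x))"
    by (subst lborel_eq, subst integral_distr[OF T F], unfold eq)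
       (intro product_integral_prod f finite_Basis)
qed

lemma integrable_inverse_1_plus_square: "integrable lborel (\<lambda>x::real. 1 / (1 + x\<^sup>2))"
proof -
  have "set_integrable lborel (einterval (-\<infinity>) \<infinity>) (\<lambda>x::real. 1 / (1 + x\<^sup>2))"
  proof (rule interval_integral_FTC_nonneg(1)[where F = arctan and A = "-pi/2" and B = "pi/2"])
    show "((arctan \<circ> real_of_ereal) \<longlongrightarrow> - pi / 2) (at_right (-\<infinity>))"
      using tendsto_arctan_at_bot by (simp add: ereal_tendsto_simps1)
    show "((arctan \<circ> real_of_ereal) \<longlongrightarrow> pi / 2) (at_left \<infinity>)"
      using tendsto_arctan_at_top by (simp add: ereal_tendsto_simps1)
    fix x :: real
    show "DERIV arctan x :> 1 / (1 + x\<^sup>2)" by (auto intro!: derivative_eq_intros simp: field_simps)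
    show "isCont (\<lambda>x. 1 / (1 + x\<^sup>2)) x"
      by (intro continuous_intros) (metis add_pos_nonneg less_numeral_extra(3) zero_le_power2 zero_less_one)
  qed auto
  then show ?thesis by (simp add: set_integrable_def)
qed

text \<open>The exponent leaves room for one extra factor \<open>1 + |x|^2\<close>, which dominates
  the dispersion relation: the remaining power 3 is still integrable on three-dimensional
  space.\<close>

definition decay :: "R3 \<Rightarrow> real"
  where "decay x = 1 / (1 + (norm x)\<^sup>2) ^ 4"

text \<open>\<open>(1 + |x|^2)^3\<close> dominates the product of \<open>1 + x_b^2\<close> over the
  three coordinates, whose reciprocal is integrable factor by factor.\<close>

lemma integrable_decay_power:
  assumes "k \<ge> 3"
  shows "integrable lborel (\<lambda>x::R3. 1 / (1 + (norm x)\<^sup>2) ^ k)"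
proof (rule Bochner_Integration.integrable_bound)
  show "integrable lborel (\<lambda>x::R3. \<Prod>b\<in>Basis. 1 / (1 + (x \<bullet> b)\<^sup>2))"
    by (intro lborel_integral_prod_Basis integrable_inverse_1_plus_square)
  show "AE x in lborel. norm (1 / (1 + (norm (x::R3))\<^sup>2) ^ k) \<le> norm (\<Prod>b\<in>Basis. 1 / (1 + (x \<bullet> b)\<^sup>2))"
  proof (rule AE_I2)
    fix x :: R3
    have "(\<Prod>b\<in>(Basis::R3 set). 1 + (x \<bullet> b)\<^sup>2) \<le> (\<Prod>b\<in>(Basis::R3 set). 1 + (norm x)\<^sup>2)"
    proof (intro prod_mono conjI)
      fix b :: R3 assume "b \<in> Basis"
      then have "\<bar>x \<bullet> b\<bar>\<^sup>2 \<le> (norm x)\<^sup>2" by (intro power_mono Basis_le_norm) auto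
      then show "1 + (x \<bullet> b)\<^sup>2 \<le> 1 + (norm x)\<^sup>2" by simp
    qed auto
    also have "\<dots> = (1 + (norm x)\<^sup>2) ^ 3" by simp
    also have "\<dots> \<le> (1 + (norm x)\<^sup>2) ^ k" by (rule power_increasing[OF assms]) simp
    finally have le: "(\<Prod>b\<in>(Basis::R3 set). 1 + (x \<bullet> b)\<^sup>2) \<le> (1 + (norm x)\<^sup>2) ^ k" .
    have pos: "0 < (\<Prod>b\<in>(Basis::R3 set). 1 + (x \<bullet> b)\<^sup>2)"
      by (rule prod_pos) (metis add_pos_nonneg zero_le_power2 zero_less_one)
    have "norm (\<Prod>b\<in>(Basis::R3 set). 1 / (1 + (x \<bullet> b)\<^sup>2)) = 1 / (\<Prod>b\<in>(Basis::R3 set). 1 + (x \<bullet> b)\<^sup>2)"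
      using pos by (simp add: prod_dividef abs_prod abs_divide)
    then show "norm (1 / (1 + (norm x)\<^sup>2) ^ k) \<le> norm (\<Prod>b\<in>Basis. 1 / (1 + (x \<bullet> b)\<^sup>2))"
      using frac_le[OF _ _ pos le, of 1 1] pos by simp
  qed
qed simp

lemma integrable_decay [simp, intro]: "integrable lborel decay"
  unfolding decay_def[abs_def] by (rule integrable_decay_power) simp

lemma decay_pos [simp]: "decay x > 0"
  unfolding decay_def by (metis add_pos_nonneg zero_le_power2 zero_less_divide_1_iff zero_less_one zero_less_power)

lemma decay_nonneg [simp]: "decay x \<ge> 0"
  by (rule less_imp_le) simp

lemma decay_measurable [measurable]: "decay \<in> borel_measurable borel"
  unfolding decay_def[abs_def] by measurable

lemma decay_minus [simp]: "decay (- x) = decay x"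
  by (simp add: decay_def)

lemma decay_le_1: "decay x \<le> 1"
proof -
  have "1 \<le> (1 + (norm x)\<^sup>2) ^ 4" by (rule one_le_power) simp
  then show ?thesis using frac_le[of 1 1 1 "(1 + (norm x)\<^sup>2) ^ 4"] by (simp add: decay_def)
qed

text \<open>From \<open>|x| <= |x + h| + 1\<close> follows
  \<open>1 + |x|^2 <= 3 (1 + |x + h|^2)\<close>, and \<open>81 = 3^4\<close>. All translates by at
  most 1 thus have a common integrable majorant.\<close>

lemma decay_shift:
  assumes "norm h \<le> 1"
  shows "decay (x + h) \<le> 81 * decay x"
proof -
  have "norm x \<le> norm (x + h) + 1" using assms norm_triangle_ineq4[of "x + h" h] by simp
  then have "(norm x)\<^sup>2 \<le> (norm (x + h) + 1)\<^sup>2" by (intro power_mono) auto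
  also have "\<dots> \<le> 2 * (norm (x + h))\<^sup>2 + 2"
    using zero_le_power2[of "norm (x + h) - 1"] by (simp add: power2_eq_square algebra_simps)
  finally have "1 + (norm x)\<^sup>2 \<le> 3 * (1 + (norm (x + h))\<^sup>2)"
    using zero_le_power2[of "norm (x + h)"] unfolding distrib_left by linarith
  then have "(1 + (norm x)\<^sup>2) ^ 4 \<le> (3 * (1 + (norm (x + h))\<^sup>2)) ^ 4" by (intro power_mono) auto
  then have "(1 + (norm x)\<^sup>2) ^ 4 \<le> 81 * (1 + (norm (x + h))\<^sup>2) ^ 4" by (simp only: power_mult_distrib) simp
  moreover have "0 < (1 + (norm y)\<^sup>2) ^ 4" for y :: R3
    by (metis add_pos_nonneg zero_le_power2 zero_less_one zero_less_power)
  ultimately show ?thesis by (simp add: decay_def field_simps)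
qed

text \<open>Dominated convergence for difference quotients along sequences; \<open>bound\<close>
  says that \<open>g\<close> dominates them. Working within a set \<open>S\<close> includes
  one-sided derivatives at the end points of a time interval.\<close>

lemma has_vector_derivative_integral_dominated:
  fixes f :: "real \<Rightarrow> 'a \<Rightarrow> 'b::{banach,second_countable_topology}"
  assumes t: "t \<in> S" and f: "\<And>r. r \<in> S \<Longrightarrow> integrable M (f r)"
    and f'[measurable]: "f' \<in> borel_measurable M"
    and deriv: "\<And>x. x \<in> space M \<Longrightarrow> ((\<lambda>r. f r x) has_vector_derivative f' x) (at t within S)"
    and g: "integrable M g"
    and bound: "\<And>r x. r \<in> S \<Longrightarrow> x \<in> space M \<Longrightarrow> norm (f r x - f t x) \<le> \<bar>r - t\<bar> * g x"
  shows "((\<lambda>r. LINT x|M. f r x) has_vector_derivative (LINT x|M. f' x)) (at t within S)"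
proof -
  have iff: "(h has_vector_derivative h') (at t within S) \<longleftrightarrow>
      ((\<lambda>r. (1 / (r - t)) *\<^sub>R (h r - h t)) \<longlongrightarrow> h') (at t within S)" for h :: "real \<Rightarrow> 'b" and h'
  proof -
    have "(h has_vector_derivative h') (at t within S) \<longleftrightarrow>
      ((\<lambda>r. (1 / norm (r - t)) *\<^sub>R (h r - (h t + (r - t) *\<^sub>R h'))) \<longlongrightarrow> 0) (at t within S)"
      by (simp add: has_vector_derivative_def has_derivative_within bounded_linear_scaleR_left)
    also have "\<dots> \<longleftrightarrow> ((\<lambda>r. norm ((1 / norm (r - t)) *\<^sub>R (h r - (h t + (r - t) *\<^sub>R h')))) \<longlongrightarrow> 0) (at t within S)"
      by (rule tendsto_norm_zero_iff[symmetric])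
    also have "\<dots> \<longleftrightarrow> ((\<lambda>r. norm ((1 / (r - t)) *\<^sub>R (h r - h t) - h')) \<longlongrightarrow> 0) (at t within S)"
    proof (rule filterlim_cong[OF refl refl])
      have "norm ((1 / norm (r - t)) *\<^sub>R (h r - (h t + (r - t) *\<^sub>R h'))) = norm ((1 / (r - t)) *\<^sub>R (h r - h t) - h')"
        if "r \<noteq> t" for r
      proof -
        have "(1 / (r - t)) *\<^sub>R (h r - h t) - h' = (1 / (r - t)) *\<^sub>R (h r - (h t + (r - t) *\<^sub>R h'))"
          using that by (simp add: scaleR_diff_right scaleR_add_right)
        then show ?thesis by simp
      qed
      then show "\<forall>\<^sub>F r in at t within S. norm ((1 / norm (r - t)) *\<^sub>R (h r - (h t + (r - t) *\<^sub>R h'))) =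
          norm ((1 / (r - t)) *\<^sub>R (h r - h t) - h')"
        by (auto simp: eventually_at_filter)
    qed
    also have "\<dots> \<longleftrightarrow> ((\<lambda>r. (1 / (r - t)) *\<^sub>R (h r - h t) - h') \<longlongrightarrow> 0) (at t within S)"
      by (rule tendsto_norm_zero_iff)
    finally show ?thesis by (simp add: LIM_zero_iff)
  qed
  show ?thesis
    unfolding iff tendsto_at_iff_sequentially
  proof (intro allI impI)
    fix X :: "nat \<Rightarrow> real" assume X: "\<forall>i. X i \<in> S - {t}" "X \<longlonglongrightarrow> t"
    have "(\<lambda>i. LINT x|M. (1 / (X i - t)) *\<^sub>R (f (X i) x - f t x)) \<longlonglongrightarrow> (LINT x|M. f' x)"
    proof (rule integral_dominated_convergence[where w = g])
      show "(\<lambda>x. (1 / (X i - t)) *\<^sub>R (f (X i) x - f t x)) \<in> borel_measurable M" for i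
        using f[of "X i"] f[OF t] X(1) by (intro borel_measurable_integrable) auto
      show "AE x in M. (\<lambda>i. (1 / (X i - t)) *\<^sub>R (f (X i) x - f t x)) \<longlonglongrightarrow> f' x"
      proof (rule AE_I2)
        fix x assume "x \<in> space M"
        from deriv[OF this, unfolded iff tendsto_at_iff_sequentially] X
        show "(\<lambda>i. (1 / (X i - t)) *\<^sub>R (f (X i) x - f t x)) \<longlonglongrightarrow> f' x" by (auto simp: comp_def)
      qed
      show "AE x in M. norm ((1 / (X i - t)) *\<^sub>R (f (X i) x - f t x)) \<le> g x" for i
      proof (rule AE_I2)
        fix x assume x: "x \<in> space M"
        have "X i \<in> S" "X i \<noteq> t" using X(1) by auto
        then show "norm ((1 / (X i - t)) *\<^sub>R (f (X i) x - f t x)) \<le> g x"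
          using bound[of "X i" x] x unfolding norm_scaleR by (simp add: pos_divide_le_eq mult.commute)
      qed
    qed (use g in auto)
    moreover have "(LINT x|M. (1 / (X i - t)) *\<^sub>R (f (X i) x - f t x)) =
        (1 / (X i - t)) *\<^sub>R ((LINT x|M. f (X i) x) - (LINT x|M. f t x))" for i
      using f[of "X i"] f[OF t] X(1) by simp
    ultimately show "((\<lambda>r. (1 / (r - t)) *\<^sub>R ((LINT x|M. f r x) - (LINT x|M. f t x))) \<circ> X) \<longlonglongrightarrow> (LINT x|M. f' x)"
      by (simp only: comp_def)
  qed
qed

text \<open>A rescaling, by \<open>c = sqrt (2 a)\<close>, of the characteristic function of the
  standard normal distribution.\<close>

lemma gaussian_fourier_real:
  fixes a t :: real
  assumes a: "a > 0"
  shows "integrable lborel (\<lambda>x. exp (- (\<i> * of_real (x * t))) * complex_of_real (exp (- a * x\<^sup>2)))"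
    and "(LINT x|lborel. exp (- (\<i> * of_real (x * t))) * complex_of_real (exp (- a * x\<^sup>2)))
      = of_real (sqrt (pi / a) * exp (- t\<^sup>2 / (4 * a)))"
proof -
  define c where "c = sqrt (2 * a)"
  have c: "c > 0" "c\<^sup>2 = 2 * a" using a by (auto simp: c_def)
  define f where "f x = std_normal_density x *\<^sub>R iexp ((- t / c) * x)" for x
  have f_int: "integrable lborel f"
  proof (rule Bochner_Integration.integrable_bound[of _ std_normal_density])
    show "f \<in> borel_measurable lborel" unfolding f_def[abs_def] by measurable
  qed (auto simp: f_def)
  have eq: "f (0 + c * x) = of_real (1 / sqrt (2 * pi)) * (exp (- (\<i> * of_real (x * t))) * complex_of_real (exp (- a * x\<^sup>2)))" for x
    using c by (simp add: f_def std_normal_density_def scaleR_conv_of_real power_mult_distrib mult_ac)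
  have "integrable lborel (\<lambda>x. f (0 + c * x))"
    by (rule lborel_integrable_real_affine[OF f_int]) (use c in auto)
  then have "integrable lborel (\<lambda>x. of_real (1 / sqrt (2 * pi)) * (exp (- (\<i> * of_real (x * t))) * complex_of_real (exp (- a * x\<^sup>2))))"
    unfolding eq .
  then show i: "integrable lborel (\<lambda>x. exp (- (\<i> * of_real (x * t))) * complex_of_real (exp (- a * x\<^sup>2)))"
    using integrable_mult_right[of "of_real (sqrt (2 * pi))" lborel "\<lambda>x. of_real (1 / sqrt (2 * pi)) * (exp (- (\<i> * of_real (x * t))) * complex_of_real (exp (- a * x\<^sup>2)))"]
    by (simp add: mult.assoc[symmetric] of_real_mult[symmetric] del: of_real_mult of_real_exp)
  have "complex_of_real (exp (- (- t / c)\<^sup>2 / 2)) = char std_normal_distribution (- t / c)"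
    by (simp add: char_std_normal_distribution)
  also have "\<dots> = integral\<^sup>L lborel f"
    unfolding char_def f_def[abs_def] by (subst integral_density) auto
  also have "\<dots> = \<bar>c\<bar> *\<^sub>R (LINT x|lborel. f (0 + c * x))"
    by (rule lborel_integral_real_affine) (use c in auto)
  also have "\<dots> = of_real (c / sqrt (2 * pi)) * (LINT x|lborel. exp (- (\<i> * of_real (x * t))) * complex_of_real (exp (- a * x\<^sup>2)))"
    unfolding eq using c(1) i by (simp add: scaleR_conv_of_real)
  finally have "(LINT x|lborel. exp (- (\<i> * of_real (x * t))) * complex_of_real (exp (- a * x\<^sup>2)))
      = of_real (sqrt (2 * pi) / c) * of_real (exp (- (- t / c)\<^sup>2 / 2))"
    using c(1) by (simp add: field_simps)
  also have "(- t / c)\<^sup>2 / 2 = t\<^sup>2 / (4 * a)" using c by (simp add: power_divide)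
  then have "- (- t / c)\<^sup>2 / 2 = - t\<^sup>2 / (4 * a)" by simp
  also have "sqrt (2 * pi) / c = sqrt (pi / a)"
    using a by (simp add: c_def real_sqrt_divide[symmetric])
  finally show "(LINT x|lborel. exp (- (\<i> * of_real (x * t))) * complex_of_real (exp (- a * x\<^sup>2)))
      = of_real (sqrt (pi / a) * exp (- t\<^sup>2 / (4 * a)))"
    by simp
qed

lemma gaussian_fourier:
  fixes \<xi> :: "'a::euclidean_space"
  assumes a: "a > 0"
  shows "integrable lborel (\<lambda>x. exp (- (\<i> * of_real (x \<bullet> \<xi>))) * complex_of_real (exp (- a * (norm x)\<^sup>2)))"
    and "(LINT x|lborel. exp (- (\<i> * of_real (x \<bullet> \<xi>))) * complex_of_real (exp (- a * (norm x)\<^sup>2)))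
      = of_real (sqrt (pi / a) ^ DIM('a) * exp (- (norm \<xi>)\<^sup>2 / (4 * a)))"
proof -
  have nrm: "(norm y)\<^sup>2 = (\<Sum>b\<in>Basis. (y \<bullet> b)\<^sup>2)" for y :: 'a
    unfolding power2_norm_eq_inner by (subst euclidean_inner) (simp add: power2_eq_square)
  have eq: "exp (- (\<i> * of_real (x \<bullet> \<xi>))) * complex_of_real (exp (- a * (norm x)\<^sup>2))
     = (\<Prod>b\<in>Basis. exp (- (\<i> * of_real ((x \<bullet> b) * (\<xi> \<bullet> b)))) * complex_of_real (exp (- a * (x \<bullet> b)\<^sup>2)))" for x
    by (subst euclidean_inner)
       (simp add: nrm prod.distrib exp_sum[symmetric] sum_distrib_left sum_negf[symmetric] of_real_prod[symmetric] del: of_real_prod)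
  note i = gaussian_fourier_real[OF a, of "\<xi> \<bullet> b" for b]
  show "integrable lborel (\<lambda>x. exp (- (\<i> * of_real (x \<bullet> \<xi>))) * complex_of_real (exp (- a * (norm x)\<^sup>2)))"
    unfolding eq by (rule lborel_integral_prod_Basis(1)) (rule i)
  have "(LINT x|lborel. exp (- (\<i> * of_real (x \<bullet> \<xi>))) * complex_of_real (exp (- a * (norm x)\<^sup>2)))
     = (\<Prod>b\<in>(Basis::'a set). of_real (sqrt (pi / a) * exp (- (\<xi> \<bullet> b)\<^sup>2 / (4 * a))))"
    unfolding eq lborel_integral_prod_Basis(2)[OF i(1)] i(2) ..
  also have "\<dots> = of_real (sqrt (pi / a) ^ DIM('a) * (\<Prod>b\<in>(Basis::'a set). exp (- (\<xi> \<bullet> b)\<^sup>2 / (4 * a))))"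
    by (simp add: prod.distrib)
  also have "(\<Prod>b\<in>(Basis::'a set). exp (- (\<xi> \<bullet> b)\<^sup>2 / (4 * a))) = exp (- (norm \<xi>)\<^sup>2 / (4 * a))"
    by (simp add: exp_sum[symmetric] nrm sum_negf sum_divide_distrib)
  finally show "(LINT x|lborel. exp (- (\<i> * of_real (x \<bullet> \<xi>))) * complex_of_real (exp (- a * (norm x)\<^sup>2)))
      = of_real (sqrt (pi / a) ^ DIM('a) * exp (- (norm \<xi>)\<^sup>2 / (4 * a)))" .
qed

lemma gaussian_integral:
  assumes a: "a > 0"
  shows "integrable lborel (\<lambda>x::'a::euclidean_space. exp (- a * (norm x)\<^sup>2))"
    and "(LINT x|lborel. exp (- a * (norm (x::'a::euclidean_space))\<^sup>2)) = sqrt (pi / a) ^ DIM('a)"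
proof -
  show "integrable lborel (\<lambda>x::'a::euclidean_space. exp (- a * (norm x)\<^sup>2))"
    using gaussian_fourier(1)[OF a, of "0::'a"] by (simp add: complex_of_real_integrable_eq)
  have "complex_of_real (LINT x|lborel. exp (- a * (norm (x::'a))\<^sup>2)) = of_real (sqrt (pi / a) ^ DIM('a))"
    using gaussian_fourier(2)[OF a, of "0::'a"] by simp
  then show "(LINT x|lborel. exp (- a * (norm (x::'a::euclidean_space))\<^sup>2)) = sqrt (pi / a) ^ DIM('a)"
    by (simp only: of_real_eq_iff)
qed

lemma integrable_pair_mult:
  fixes f :: "'a \<Rightarrow> 'c::{real_normed_field,banach,second_countable_topology}" and g :: "'b \<Rightarrow> 'c"
  assumes "sigma_finite_measure M" "sigma_finite_measure N"
    and f: "integrable M f" and g: "integrable N g"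
  shows "integrable (M \<Otimes>\<^sub>M N) (\<lambda>(x, y). f x * g y)"
proof -
  interpret pair_sigma_finite M N using assms by (simp add: pair_sigma_finite_def)
  have [measurable]: "f \<in> borel_measurable M" "g \<in> borel_measurable N" using f g by auto
  show ?thesis
  proof (rule Fubini_integrable)
    show "integrable M (\<lambda>x. \<integral>y. norm (case (x, y) of (x, y) \<Rightarrow> f x * g y) \<partial>N)"
      using f by (simp add: norm_mult)
  qed (use g in auto)
qed

lemma lborel_integral_shift:
  fixes f :: "'a::euclidean_space \<Rightarrow> 'b::{banach,second_countable_topology}"
  assumes [measurable]: "f \<in> borel_measurable borel"
  shows "(LINT x|lborel. f (x + h)) = (LINT x|lborel. f x)"
    and "integrable lborel (\<lambda>x. f (x + h)) \<longleftrightarrow> integrable lborel f"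
    and "(LINT x|lborel. f (h - x)) = (LINT x|lborel. f x)"
    and "integrable lborel (\<lambda>x. f (h - x)) \<longleftrightarrow> integrable lborel f"
proof -
  have d: "distr lborel borel (\<lambda>x::'a. h + x) = lborel" by (simp add: lborel_distr_plus)
  have n: "distr lborel borel (\<lambda>x::'a. h - x) = lborel"
    using lborel_affine[of "-1" h] by (simp add: density_1)
  show "(LINT x|lborel. f (x + h)) = (LINT x|lborel. f x)"
    by (subst (2) d[symmetric], subst integral_distr) (simp_all add: add.commute)
  show "integrable lborel (\<lambda>x. f (x + h)) \<longleftrightarrow> integrable lborel f"
    by (subst (2) d[symmetric], subst integrable_distr_eq) (simp_all add: add.commute)
  show "(LINT x|lborel. f (h - x)) = (LINT x|lborel. f x)"
    by (subst (2) n[symmetric], subst integral_distr) simp_all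
  show "integrable lborel (\<lambda>x. f (h - x)) \<longleftrightarrow> integrable lborel f"
    by (subst (2) n[symmetric], subst integrable_distr_eq) simp_all
qed

lemma lborel_integral_scaleR:
  fixes f :: "'a::euclidean_space \<Rightarrow> 'b::{banach,second_countable_topology}"
  assumes [measurable]: "f \<in> borel_measurable borel" and c: "c > 0"
  shows "(LINT x|lborel. f x) = c ^ DIM('a) *\<^sub>R (LINT x|lborel. f (t + c *\<^sub>R x))"
  by (subst lborel_affine[of c t]) (use c in \<open>simp_all add: integral_density integral_distr\<close>)

text \<open>Dominated convergence with a Gaussian majorant. The Gaussian is not normalised, which
  leaves its total mass \<open>sqrt pi ^ DIM('a)\<close> in the limit.\<close>

lemma gaussian_approximate_identity:
  fixes f :: "'a::euclidean_space \<Rightarrow> complex"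
  assumes [measurable]: "f \<in> borel_measurable borel" and B: "\<And>x. norm (f x) \<le> B"
    and x: "isCont f x" and c: "c \<longlonglongrightarrow> 0"
  shows "(\<lambda>n. LINT z|lborel. f (x + c n *\<^sub>R z) * of_real (exp (- (norm z)\<^sup>2))) \<longlonglongrightarrow> f x * of_real (sqrt pi ^ DIM('a))"
proof -
  have "(\<lambda>n. LINT z|lborel. f (x + c n *\<^sub>R z) * of_real (exp (- (norm z)\<^sup>2))) \<longlonglongrightarrow> (LINT z|lborel. f x * of_real (exp (- (norm (z::'a))\<^sup>2)))"
  proof (rule integral_dominated_convergence[where w = "\<lambda>z::'a. B * exp (- 1 * (norm z)\<^sup>2)"])
    show "integrable lborel (\<lambda>z::'a. B * exp (- 1 * (norm z)\<^sup>2))"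
      by (intro integrable_mult_right gaussian_integral) auto
    show "AE z in lborel. (\<lambda>n. f (x + c n *\<^sub>R z) * of_real (exp (- (norm z)\<^sup>2))) \<longlonglongrightarrow> f x * of_real (exp (- (norm z)\<^sup>2))"
    proof (rule AE_I2)
      fix z :: 'a
      have "(\<lambda>n. x + c n *\<^sub>R z) \<longlonglongrightarrow> x + 0 *\<^sub>R z" by (intro tendsto_intros c)
      then have "(\<lambda>n. f (x + c n *\<^sub>R z)) \<longlonglongrightarrow> f x" using isCont_tendsto_compose[OF x] by simp
      then show "(\<lambda>n. f (x + c n *\<^sub>R z) * of_real (exp (- (norm z)\<^sup>2))) \<longlonglongrightarrow> f x * of_real (exp (- (norm z)\<^sup>2))"
        by (intro tendsto_intros)
    qed
    show "AE z in lborel. norm (f (x + c n *\<^sub>R z) * of_real (exp (- (norm z)\<^sup>2))) \<le> B * exp (- 1 * (norm z)\<^sup>2)" for n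
      using B by (auto simp: norm_mult intro!: AE_I2 mult_right_mono)
  qed measurable
  also have "(LINT z|lborel. f x * of_real (exp (- (norm (z::'a))\<^sup>2))) = f x * of_real (sqrt pi ^ DIM('a))"
    using gaussian_integral(2)[of 1, where 'a = 'a] by (simp del: of_real_power of_real_exp)
  finally show ?thesis .
qed

section \<open>Schwartz functions\<close>

lemma partial_deriv_eq:
  "(f has_derivative D) (at x) \<Longrightarrow> partial_deriv i f x = D (axis i 1)"
  unfolding partial_deriv_def by (metis frechet_derivative_at)

text \<open>A coinduction principle: it suffices to exhibit a class of differentiable, rapidly
  decreasing functions that is stable under first partial derivatives. This replaces Leibniz
  formulas for iterated derivatives throughout.\<close>

lemma schwartz_coinduct:
  assumes "f \<in> S"
    and diff: "\<And>f x. f \<in> S \<Longrightarrow> f differentiable (at x)"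
    and bound: "\<And>f N. f \<in> S \<Longrightarrow> \<exists>C. \<forall>x. (1 + norm x) ^ N * cmod (f x) \<le> C"
    and step: "\<And>f i. f \<in> S \<Longrightarrow> partial_deriv i f \<in> S"
  shows "f \<in> schwartz"
proof -
  have "partial_derivs \<alpha> f \<in> S" for \<alpha>
    by (induction \<alpha>) (use assms in \<open>auto simp: partial_derivs_def\<close>)
  then show ?thesis unfolding schwartz_def using diff bound by blast
qed

lemma schwartzD:
  assumes "f \<in> schwartz"
  shows schwartz_differentiable: "f differentiable (at x)"
    and schwartz_bound: "\<exists>C. \<forall>x. (1 + norm x) ^ N * cmod (f x) \<le> C"
    and schwartz_partial_deriv: "partial_deriv i f \<in> schwartz"
    and schwartz_partial_derivs_bound: "\<exists>C. \<forall>x. (1 + norm x) ^ N * cmod (partial_derivs \<alpha> f x) \<le> C"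
proof -
  have a: "\<And>\<alpha> x. partial_derivs \<alpha> f differentiable (at x)"
    and b: "\<And>\<alpha> N. \<exists>C. \<forall>x. (1 + norm x) ^ N * cmod (partial_derivs \<alpha> f x) \<le> C"
    using assms unfolding schwartz_def by blast+
  show "f differentiable (at x)" using a[of "[]"] by (simp add: partial_derivs_def)
  show "\<exists>C. \<forall>x. (1 + norm x) ^ N * cmod (f x) \<le> C" using b[where \<alpha> = "[]"] by (simp add: partial_derivs_def)
  show "\<exists>C. \<forall>x. (1 + norm x) ^ N * cmod (partial_derivs \<alpha> f x) \<le> C" by (rule b)
  have "partial_derivs \<alpha> (partial_deriv i f) = partial_derivs (\<alpha> @ [i]) f" for \<alpha>
    by (simp add: partial_derivs_def)
  then show "partial_deriv i f \<in> schwartz" unfolding schwartz_def using a b by simp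
qed

lemma schwartz_has_derivative:
  assumes "f \<in> schwartz"
  shows "(f has_derivative (\<lambda>h. \<Sum>i\<in>UNIV. of_real (h $ i) * partial_deriv i f x)) (at x)"
proof -
  let ?D = "frechet_derivative f (at x)"
  have D: "(f has_derivative ?D) (at x)" using schwartz_differentiable[OF assms] by (simp add: frechet_derivative_works)
  have "?D h = (\<Sum>i\<in>UNIV. of_real (h $ i) * partial_deriv i f x)" for h
  proof -
    have lin: "linear ?D" using D by (rule has_derivative_linear)
    have "?D h = ?D (\<Sum>i\<in>UNIV. h $ i *\<^sub>R axis i 1)" 
      using basis_expansion[of h] by (simp add: scalar_mult_eq_scaleR)
    also have "\<dots> = (\<Sum>i\<in>UNIV. h $ i *\<^sub>R ?D (axis i 1))"
      using lin by (simp add: linear_sum linear_cmul)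
    finally show ?thesis by (simp add: partial_deriv_def scaleR_conv_of_real)
  qed
  then show ?thesis using D by (metis (no_types, lifting) ext)
qed

lemma axis_sum: "(\<Sum>j\<in>UNIV. of_real ((axis i (1::real) :: R3) $ j) * g j) = (g i :: complex)"
proof -
  have "of_real ((axis i (1::real) :: R3) $ j) * g j = (if j = i then g j else 0)" for j
    by (simp add: axis_def)
  then show ?thesis by simp
qed

lemma schwartz_add:
  assumes "f \<in> schwartz" "g \<in> schwartz"
  shows "(\<lambda>x. f x + g x) \<in> schwartz"
proof (rule schwartz_coinduct[of _ "{\<lambda>x. f x + g x | f g. f \<in> schwartz \<and> g \<in> schwartz}"])
  show "(\<lambda>x. f x + g x) \<in> {\<lambda>x. f x + g x | f g. f \<in> schwartz \<and> g \<in> schwartz}" using assms by blast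
  fix h assume "h \<in> {\<lambda>x. f x + g x | f g. f \<in> schwartz \<and> g \<in> schwartz}"
  then obtain f g where h: "h = (\<lambda>x. f x + g x)" and f: "f \<in> schwartz" and g: "g \<in> schwartz" by blast
  have D: "(h has_derivative (\<lambda>v. (\<Sum>i\<in>UNIV. of_real (v $ i) * partial_deriv i f x) + (\<Sum>i\<in>UNIV. of_real (v $ i) * partial_deriv i g x))) (at x)" for x
    unfolding h by (intro has_derivative_add schwartz_has_derivative f g)
  then show "h differentiable (at x)" for x unfolding differentiable_def by blast
  have "partial_deriv i h = (\<lambda>x. partial_deriv i f x + partial_deriv i g x)" for i
    using partial_deriv_eq[OF D] by (auto simp: axis_sum)
  then show "partial_deriv i h \<in> {\<lambda>x. f x + g x | f g. f \<in> schwartz \<and> g \<in> schwartz}" for i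
    using schwartz_partial_deriv[OF f, of i] schwartz_partial_deriv[OF g, of i]
    by (intro CollectI exI[of _ "partial_deriv i f"] exI[of _ "partial_deriv i g"]) auto
  fix N
  obtain C D where "\<And>x. (1 + norm x) ^ N * cmod (f x) \<le> C" "\<And>x. (1 + norm x) ^ N * cmod (g x) \<le> D"
    using schwartz_bound[OF f] schwartz_bound[OF g] by meson
  then have "(1 + norm x) ^ N * cmod (f x) + (1 + norm x) ^ N * cmod (g x) \<le> C + D" for x by (intro add_mono)
  moreover have "(1 + norm x) ^ N * cmod (h x) \<le> (1 + norm x) ^ N * cmod (f x) + (1 + norm x) ^ N * cmod (g x)" for x
    unfolding h distrib_left[symmetric] by (intro mult_left_mono norm_triangle_ineq) auto
  ultimately show "\<exists>C. \<forall>x. (1 + norm x) ^ N * cmod (h x) \<le> C" by (meson order_trans)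
qed

lemma schwartz_cmult:
  assumes "f \<in> schwartz"
  shows "(\<lambda>x. c * f x) \<in> schwartz"
proof (rule schwartz_coinduct[of _ "{\<lambda>x. c * f x | f. f \<in> schwartz}"])
  show "(\<lambda>x. c * f x) \<in> {\<lambda>x. c * f x | f. f \<in> schwartz}" using assms by blast
  fix h assume "h \<in> {\<lambda>x. c * f x | f. f \<in> schwartz}"
  then obtain f where h: "h = (\<lambda>x. c * f x)" and f: "f \<in> schwartz" by blast
  have D: "(h has_derivative (\<lambda>v. c * (\<Sum>i\<in>UNIV. of_real (v $ i) * partial_deriv i f x))) (at x)" for x
    unfolding h by (intro has_derivative_mult_right schwartz_has_derivative f)
  then show "h differentiable (at x)" for x unfolding differentiable_def by blast
  have "partial_deriv i h = (\<lambda>x. c * partial_deriv i f x)" for i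
    using partial_deriv_eq[OF D] by (auto simp: axis_sum)
  then show "partial_deriv i h \<in> {\<lambda>x. c * f x | f. f \<in> schwartz}" for i
    using schwartz_partial_deriv[OF f, of i]
    by (intro CollectI exI[of _ "partial_deriv i f"]) auto
  fix N
  obtain C where C: "\<And>x. (1 + norm x) ^ N * cmod (f x) \<le> C"
    using schwartz_bound[OF f] by meson
  have "(1 + norm x) ^ N * cmod (h x) \<le> cmod c * C" for x
    using mult_left_mono[OF C, of "cmod c" x] by (simp add: h norm_mult mult_ac)
  then show "\<exists>C. \<forall>x. (1 + norm x) ^ N * cmod (h x) \<le> C" by blast
qed

lemma schwartz_coordinate_mult:
  assumes "f \<in> schwartz"
  shows "(\<lambda>x. of_real (x $ k) * f x) \<in> schwartz"
\<comment> \<open>The summand \<open>g\<close> absorbs the term without the factor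
  \<open>x $ k\<close> that differentiation of the product creates.\<close>
proof (rule schwartz_coinduct[of _ "{\<lambda>x. of_real (x $ k) * f x + g x | f g. f \<in> schwartz \<and> g \<in> schwartz}"])
  have "(\<lambda>x. 0) \<in> schwartz" using schwartz_cmult[OF assms, of 0] by simp
  then show "(\<lambda>x. of_real (x $ k) * f x) \<in> {\<lambda>x. of_real (x $ k) * f x + g x | f g. f \<in> schwartz \<and> g \<in> schwartz}"
    using assms by (intro CollectI exI[of _ f] exI[of _ "\<lambda>x. 0"]) auto
  fix h assume "h \<in> {\<lambda>x. of_real (x $ k) * f x + g x | f g. f \<in> schwartz \<and> g \<in> schwartz}"
  then obtain f g where h: "h = (\<lambda>x. of_real (x $ k) * f x + g x)" and f: "f \<in> schwartz" and g: "g \<in> schwartz" by blast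
  have D: "(h has_derivative (\<lambda>v. of_real (x $ k) * (\<Sum>i\<in>UNIV. of_real (v $ i) * partial_deriv i f x) + of_real (v $ k) * f x
       + (\<Sum>i\<in>UNIV. of_real (v $ i) * partial_deriv i g x))) (at x)" for x
    unfolding h
    by (intro has_derivative_add has_derivative_mult schwartz_has_derivative f g
        bounded_linear.has_derivative[OF bounded_linear_of_real] bounded_linear_imp_has_derivative bounded_linear_vec_nth)
  then show "h differentiable (at x)" for x unfolding differentiable_def by blast
  have "partial_deriv i h = (\<lambda>x. of_real (x $ k) * partial_deriv i f x + (of_real ((axis i 1 :: R3) $ k) * f x + partial_deriv i g x))" for i
    using partial_deriv_eq[OF D] by (auto simp: axis_sum)
  then show "partial_deriv i h \<in> {\<lambda>x. of_real (x $ k) * f x + g x | f g. f \<in> schwartz \<and> g \<in> schwartz}" for i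
    using schwartz_partial_deriv[OF f, of i]
      schwartz_add[OF schwartz_cmult[OF f, of "of_real ((axis i 1 :: R3) $ k)"] schwartz_partial_deriv[OF g, of i]]
    by (intro CollectI exI[of _ "partial_deriv i f"] exI[of _ "\<lambda>x. of_real ((axis i 1 :: R3) $ k) * f x + partial_deriv i g x"]) auto
  fix N
  obtain C D where C: "\<And>x. (1 + norm x) ^ Suc N * cmod (f x) \<le> C" and D: "\<And>x. (1 + norm x) ^ N * cmod (g x) \<le> D"
    using schwartz_bound[OF f] schwartz_bound[OF g] by meson
  have "(1 + norm x) ^ N * cmod (h x) \<le> C + D" for x
  proof -
    have "cmod (of_real (x $ k) * f x) \<le> (1 + norm x) * cmod (f x)"
      using component_le_norm_cart[of x k] by (simp add: norm_mult mult_right_mono)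
    then have "cmod (h x) \<le> (1 + norm x) * cmod (f x) + cmod (g x)"
      unfolding h using norm_triangle_ineq[of "of_real (x $ k) * f x" "g x"] by linarith
    then have "(1 + norm x) ^ N * cmod (h x) \<le> (1 + norm x) ^ N * ((1 + norm x) * cmod (f x) + cmod (g x))"
      by (intro mult_left_mono) auto
    also have "\<dots> = (1 + norm x) ^ Suc N * cmod (f x) + (1 + norm x) ^ N * cmod (g x)"
      by (simp add: algebra_simps)
    also have "\<dots> \<le> C + D" by (intro add_mono C D)
    finally show ?thesis .
  qed
  then show "\<exists>C. \<forall>x. (1 + norm x) ^ N * cmod (h x) \<le> C" by blast
qed

lemma schwartz_sum:
  assumes "finite I" "\<And>i. i \<in> I \<Longrightarrow> f i \<in> schwartz" "I \<noteq> {}"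
  shows "(\<lambda>x. \<Sum>i\<in>I. f i x) \<in> schwartz"
  using assms(1,3,2) by (induction I rule: finite_ne_induct) (auto intro: schwartz_add)

lemma schwartz_orthogonal:
  assumes R: "orthogonal_transformation R" and f: "f \<in> schwartz"
  shows "(\<lambda>x. f (R x)) \<in> schwartz"
proof (rule schwartz_coinduct[of _ "{\<lambda>x. f (R x) | f. f \<in> schwartz}"])
  show "(\<lambda>x. f (R x)) \<in> {\<lambda>x. f (R x) | f. f \<in> schwartz}" using f by blast
  have lin: "bounded_linear R" using orthogonal_transformation_linear[OF R] by (simp add: linear_conv_bounded_linear)
  fix h assume "h \<in> {\<lambda>x. f (R x) | f. f \<in> schwartz}"
  then obtain f where h: "h = (\<lambda>x. f (R x))" and f: "f \<in> schwartz" by blast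
  have D: "(h has_derivative (\<lambda>v. \<Sum>i\<in>UNIV. of_real (R v $ i) * partial_deriv i f (R x))) (at x)" for x
    unfolding h
    by (rule has_derivative_compose[OF bounded_linear_imp_has_derivative[OF lin] schwartz_has_derivative[OF f]])
  then show "h differentiable (at x)" for x unfolding differentiable_def by blast
  have "partial_deriv j h = (\<lambda>x. (\<lambda>y. \<Sum>i\<in>UNIV. of_real (R (axis j 1) $ i) * partial_deriv i f y) (R x))" for j
    using partial_deriv_eq[OF D] by auto
  moreover have "(\<lambda>y. \<Sum>i\<in>UNIV. of_real (R (axis j 1) $ i) * partial_deriv i f y) \<in> schwartz" for j
    by (intro schwartz_sum schwartz_cmult schwartz_partial_deriv f) auto
  ultimately show "partial_deriv j h \<in> {\<lambda>x. f (R x) | f. f \<in> schwartz}" for j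
    by (intro CollectI exI[of _ "\<lambda>y. \<Sum>i\<in>UNIV. of_real (R (axis j 1) $ i) * partial_deriv i f y"]) auto
  fix N
  obtain C where C: "\<And>x. (1 + norm x) ^ N * cmod (f x) \<le> C" using schwartz_bound[OF f] by meson
  show "\<exists>C. \<forall>x. (1 + norm x) ^ N * cmod (h x) \<le> C"
    using C orthogonal_transformation_norm[OF R] unfolding h by metis
qed

lemma schwartz_reflect: "f \<in> schwartz \<Longrightarrow> (\<lambda>x. f (- x)) \<in> schwartz"
  by (rule schwartz_orthogonal) (simp_all add: orthogonal_transformation_def linear_iff)

lemma schwartz_continuous: "f \<in> schwartz \<Longrightarrow> continuous_on UNIV f"
  by (auto intro!: continuous_at_imp_continuous_on differentiable_imp_continuous_within schwartz_differentiable)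

lemma schwartz_isCont: "f \<in> schwartz \<Longrightarrow> isCont f x"
  by (auto intro!: differentiable_imp_continuous_within schwartz_differentiable)

lemma schwartz_measurable [measurable_dest]: "f \<in> schwartz \<Longrightarrow> f \<in> borel_measurable borel"
  by (intro borel_measurable_continuous_onI schwartz_continuous)

text \<open>\<open>1 + |x|^2 <= (1 + |x|)^2\<close>, hence the exponent \<open>8 = 2 * 4\<close>.
  This converts Schwartz bounds into domination by \<open>decay\<close>.\<close>

lemma decay_ge: "1 \<le> (1 + norm x) ^ 8 * decay x"
proof -
  have "1 + (norm x)\<^sup>2 \<le> (1 + norm x)\<^sup>2" by (simp add: power2_eq_square algebra_simps)
  then have "(1 + (norm x)\<^sup>2) ^ 4 \<le> ((1 + norm x)\<^sup>2) ^ 4" by (intro power_mono) auto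
  also have "\<dots> = (1 + norm x) ^ 8" by (simp flip: power_mult)
  finally have "(1 + (norm x)\<^sup>2) ^ 4 \<le> (1 + norm x) ^ 8" .
  moreover have "0 < (1 + (norm x)\<^sup>2) ^ 4" by (metis add_pos_nonneg zero_le_power2 zero_less_one zero_less_power)
  ultimately show ?thesis by (simp add: decay_def field_simps)
qed

lemma schwartz_le_decay:
  assumes "f \<in> schwartz"
  obtains C where "C \<ge> 0" "\<And>x. cmod (f x) \<le> C * decay x"
proof -
  obtain C where C: "\<And>x. (1 + norm x) ^ 8 * cmod (f x) \<le> C" using schwartz_bound[OF assms] by meson
  have "cmod (f x) \<le> C * decay x" for x
  proof -
    have "1 * cmod (f x) \<le> ((1 + norm x) ^ 8 * decay x) * cmod (f x)"
      by (intro mult_right_mono decay_ge) auto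
    also have "\<dots> = ((1 + norm x) ^ 8 * cmod (f x)) * decay x" by simp
    also have "\<dots> \<le> C * decay x" by (intro mult_right_mono C) auto
    finally show ?thesis by simp
  qed
  moreover have "C \<ge> 0" using C[of 0] norm_ge_zero[of "f 0"] by (simp add: order.trans[of 0 "cmod (f 0)" C])
  ultimately show ?thesis using that by blast
qed

lemma integrable_le_decay:
  fixes f :: "R3 \<Rightarrow> 'b::{banach,second_countable_topology}"
  assumes "f \<in> borel_measurable borel" "\<And>x. norm (f x) \<le> C * decay x"
  shows "integrable lborel f"
proof (rule Bochner_Integration.integrable_bound[of _ "\<lambda>x. C * decay x"])
  show "AE x in lborel. norm (f x) \<le> norm (C * decay x)"
    using assms(2) by (intro AE_I2) (metis abs_ge_self order_trans real_norm_def)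
qed (use assms in auto)

lemma schwartz_integrable: "f \<in> schwartz \<Longrightarrow> integrable lborel f"
  by (metis integrable_le_decay schwartz_le_decay schwartz_measurable)

lemma schwartz_bounded: 
  assumes "f \<in> schwartz"
  obtains C where "\<And>x. cmod (f x) \<le> C"
  using schwartz_bound[OF assms, of 0] by auto

text \<open>Polynomials times one fixed Gaussian, generated by the operations that differentiation
  produces. Stability under derivatives is then a plain induction, and the set serves as the
  invariant class in \<open>schwartz_coinduct\<close>.\<close>

inductive_set gaussian_polynomials :: "real \<Rightarrow> R3 \<Rightarrow> (R3 \<Rightarrow> complex) set" for a b where
  base: "(\<lambda>x. of_real (exp (- a * (norm (x - b))\<^sup>2))) \<in> gaussian_polynomials a b"
| coord: "f \<in> gaussian_polynomials a b \<Longrightarrow> (\<lambda>x. of_real (x $ k) * f x) \<in> gaussian_polynomials a b"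
| add: "f \<in> gaussian_polynomials a b \<Longrightarrow> g \<in> gaussian_polynomials a b \<Longrightarrow> (\<lambda>x. f x + g x) \<in> gaussian_polynomials a b"
| cmult: "f \<in> gaussian_polynomials a b \<Longrightarrow> (\<lambda>x. c * f x) \<in> gaussian_polynomials a b"

lemma gaussian_polynomials_derivative:
  assumes "f \<in> gaussian_polynomials a b"
  shows "\<exists>D. (\<forall>x. (f has_derivative D x) (at x)) \<and> (\<forall>j. (\<lambda>x. D x (axis j 1)) \<in> gaussian_polynomials a b)"
  using assms
proof induction
  case base
  let ?g = "\<lambda>x. complex_of_real (exp (- a * (norm (x - b))\<^sup>2))"
  let ?D = "\<lambda>x v. complex_of_real (exp (- a * (norm (x - b))\<^sup>2) * (- a * (2 * ((x - b) \<bullet> v))))"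
  have "(?g has_derivative ?D x) (at x)" for x
    unfolding power2_norm_eq_inner
    by (rule bounded_linear.has_derivative[OF bounded_linear_of_real])
      (auto intro!: derivative_eq_intros simp: inner_commute algebra_simps)
  moreover have "(\<lambda>x. ?D x (axis j 1)) \<in> gaussian_polynomials a b" for j
  proof -
    have "(\<lambda>x. of_real (- 2 * a) * (of_real (x $ j) * ?g x) + of_real (2 * a * (b $ j)) * ?g x) \<in> gaussian_polynomials a b"
      by (intro gaussian_polynomials.intros)
    also have "(\<lambda>x. of_real (- 2 * a) * (of_real (x $ j) * ?g x) + of_real (2 * a * (b $ j)) * ?g x) = (\<lambda>x. ?D x (axis j 1))"
      by (simp add: fun_eq_iff inner_axis algebra_simps del: of_real_exp)
    finally show ?thesis .
  qed
  ultimately show ?case by (intro exI[of _ ?D] conjI allI)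
next
  case (coord f k)
  then obtain D where D: "\<And>x. (f has_derivative D x) (at x)" "\<And>j. (\<lambda>x. D x (axis j 1)) \<in> gaussian_polynomials a b" by blast
  show ?case
  proof (intro exI conjI allI)
    show "((\<lambda>x. of_real (x $ k) * f x) has_derivative (\<lambda>v. of_real (x $ k) * D x v + of_real (v $ k) * f x)) (at x)" for x
      by (intro has_derivative_mult D bounded_linear.has_derivative[OF bounded_linear_of_real] bounded_linear_imp_has_derivative bounded_linear_vec_nth)
    show "(\<lambda>x. of_real (x $ k) * D x (axis j 1) + of_real (axis j 1 $ k) * f x) \<in> gaussian_polynomials a b" for j
      by (intro gaussian_polynomials.intros D coord)
  qed
next
  case (add f g)
  then obtain D E where D: "\<And>x. (f has_derivative D x) (at x)" "\<And>j. (\<lambda>x. D x (axis j 1)) \<in> gaussian_polynomials a b" 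
    and E: "\<And>x. (g has_derivative E x) (at x)" "\<And>j. (\<lambda>x. E x (axis j 1)) \<in> gaussian_polynomials a b" by blast
  show ?case
    by (intro exI[of _ "\<lambda>x v. D x v + E x v"] conjI allI has_derivative_add gaussian_polynomials.intros D E)
next
  case (cmult f c)
  then obtain D where D: "\<And>x. (f has_derivative D x) (at x)" "\<And>j. (\<lambda>x. D x (axis j 1)) \<in> gaussian_polynomials a b" by blast
  show ?case
    by (intro exI[of _ "\<lambda>x v. c * D x v"] conjI allI has_derivative_mult_right gaussian_polynomials.intros D)
qed

lemma gaussian_polynomials_bound:
  assumes "f \<in> gaussian_polynomials a b"
  shows "\<exists>C k. C \<ge> 0 \<and> (\<forall>x. cmod (f x) \<le> C * (1 + norm x) ^ k * exp (- a * (norm (x - b))\<^sup>2))"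
  using assms
proof induction
  case base
  show ?case by (rule exI[of _ 1], rule exI[of _ 0]) simp
next
  case (coord f k)
  then obtain C n where C: "C \<ge> 0" "\<And>x. cmod (f x) \<le> C * (1 + norm x) ^ n * exp (- a * (norm (x - b))\<^sup>2)" by blast
  have "cmod (of_real (x $ k) * f x) \<le> C * (1 + norm x) ^ Suc n * exp (- a * (norm (x - b))\<^sup>2)" for x
  proof -
    have "cmod (of_real (x $ k) * f x) \<le> (1 + norm x) * (C * (1 + norm x) ^ n * exp (- a * (norm (x - b))\<^sup>2))"
      unfolding norm_mult using component_le_norm_cart[of x k] by (intro mult_mono C(2)) auto
    then show ?thesis by (simp add: mult_ac)
  qed
  then show ?case using C(1) by blast
next
  case (add f g)
  then obtain C n D m where C: "C \<ge> 0" "\<And>x. cmod (f x) \<le> C * (1 + norm x) ^ n * exp (- a * (norm (x - b))\<^sup>2)"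
    and D: "D \<ge> 0" "\<And>x. cmod (g x) \<le> D * (1 + norm x) ^ m * exp (- a * (norm (x - b))\<^sup>2)" by blast
  have "cmod (f x + g x) \<le> (C + D) * (1 + norm x) ^ (n + m) * exp (- a * (norm (x - b))\<^sup>2)" for x
  proof -
    have "C * (1 + norm x) ^ n * exp (- a * (norm (x - b))\<^sup>2) \<le> C * (1 + norm x) ^ (n + m) * exp (- a * (norm (x - b))\<^sup>2)"
      using C(1) by (intro mult_right_mono mult_left_mono power_increasing) auto
    moreover have "D * (1 + norm x) ^ m * exp (- a * (norm (x - b))\<^sup>2) \<le> D * (1 + norm x) ^ (n + m) * exp (- a * (norm (x - b))\<^sup>2)"
      using D(1) by (intro mult_right_mono mult_left_mono power_increasing) auto
    ultimately have "cmod (f x + g x) \<le> C * (1 + norm x) ^ (n + m) * exp (- a * (norm (x - b))\<^sup>2) + D * (1 + norm x) ^ (n + m) * exp (- a * (norm (x - b))\<^sup>2)"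
      using C(2)[of x] D(2)[of x] norm_triangle_ineq[of "f x" "g x"] by linarith
    then show ?thesis by (simp add: distrib_right)
  qed
  then show ?case using C(1) D(1) by (meson add_nonneg_nonneg)
next
  case (cmult f c)
  then obtain C n where C: "C \<ge> 0" "\<And>x. cmod (f x) \<le> C * (1 + norm x) ^ n * exp (- a * (norm (x - b))\<^sup>2)" by blast
  have "cmod (c * f x) \<le> (cmod c * C) * (1 + norm x) ^ n * exp (- a * (norm (x - b))\<^sup>2)" for x
    using mult_left_mono[OF C(2), of "cmod c" x] by (simp add: norm_mult mult_ac)
  then show ?case using C(1) by (meson mult_nonneg_nonneg norm_ge_zero)
qed

lemma power_over_fact_le_exp:
  assumes "(x::real) \<ge> 0"
  shows "x ^ N / fact N \<le> exp x"
proof -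
  have "(\<Sum>n\<in>{N}. x ^ n /\<^sub>R fact n) \<le> (\<Sum>n. x ^ n /\<^sub>R fact n)"
    by (rule sum_le_suminf[OF summable_exp_generic]) (use assms in auto)
  then show ?thesis by (simp add: exp_def divide_inverse mult.commute)
qed

lemma polynomial_times_gaussian_bounded:
  assumes a: "a > 0"
  shows "\<exists>C. \<forall>x. (1 + norm x) ^ N * exp (- a * (norm (x - b))\<^sup>2) \<le> C"
proof (intro exI allI)
  fix x :: "'a::real_normed_vector"
  let ?r = "norm (x - b)"
  have "norm x \<le> norm b + ?r" using norm_triangle_ineq[of b "x - b"] by simp
  then have "(1 + norm x) ^ N \<le> (1 + norm b + ?r) ^ N" by (intro power_mono) auto
  \<comment> \<open>One term of the exponential series bounds the polynomial by an exponential,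
    after which only a quadratic exponent has to be bounded.\<close>
  also have "\<dots> \<le> fact N * exp (1 + norm b + ?r)"
  proof -
    have "(1 + norm b + ?r) ^ N / fact N \<le> exp (1 + norm b + ?r)"
      by (rule power_over_fact_le_exp) (auto intro: add_nonneg_nonneg)
    then show ?thesis by (simp add: field_simps)
  qed
  finally have "(1 + norm x) ^ N * exp (- a * ?r\<^sup>2) \<le> fact N * exp (1 + norm b + ?r) * exp (- a * ?r\<^sup>2)"
    by (intro mult_right_mono) auto
  also have "\<dots> = fact N * exp (1 + norm b + (?r - a * ?r\<^sup>2))"
    by (simp add: exp_add[symmetric] add_ac)
  also have "\<dots> \<le> fact N * exp (1 + norm b + 1 / (4 * a))"
  proof -
    \<comment> \<open>Completing the square: the maximum of \<open>r - a r^2\<close> is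
      \<open>1 / (4 a)\<close>.\<close>
    have "0 \<le> (2 * a * ?r - 1)\<^sup>2 / (4 * a)" using a by simp
    also have "\<dots> = a * ?r\<^sup>2 - ?r + 1 / (4 * a)" using a by (simp add: field_simps power2_eq_square)
    finally show ?thesis by simp
  qed
  finally show "(1 + norm x) ^ N * exp (- a * ?r\<^sup>2) \<le> fact N * exp (1 + norm b + 1 / (4 * a))" .
qed

lemma gaussian_schwartz:
  assumes a: "a > 0"
  shows "(\<lambda>x. of_real (exp (- a * (norm (x - b))\<^sup>2))) \<in> schwartz"
proof (rule schwartz_coinduct[of _ "gaussian_polynomials a b"])
  fix f assume f: "f \<in> gaussian_polynomials a b"
  obtain D where D: "\<And>x. (f has_derivative D x) (at x)" "\<And>j. (\<lambda>x. D x (axis j 1)) \<in> gaussian_polynomials a b"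
    using gaussian_polynomials_derivative[OF f] by blast
  show "f differentiable (at x)" for x using D(1) unfolding differentiable_def by blast
  have "partial_deriv i f = (\<lambda>x. D x (axis i 1))" for i using partial_deriv_eq[OF D(1)] by blast
  then show "partial_deriv i f \<in> gaussian_polynomials a b" for i using D(2) by simp
  fix N
  obtain C k where C: "C \<ge> 0" "\<And>x. cmod (f x) \<le> C * (1 + norm x) ^ k * exp (- a * (norm (x - b))\<^sup>2)"
    using gaussian_polynomials_bound[OF f] by blast
  obtain K where K: "\<And>x. (1 + norm x) ^ (N + k) * exp (- a * (norm (x - b))\<^sup>2) \<le> K"
    using polynomial_times_gaussian_bounded[OF a] by blast
  have "(1 + norm x) ^ N * cmod (f x) \<le> C * K" for x
  proof -
    have "(1 + norm x) ^ N * cmod (f x) \<le> (1 + norm x) ^ N * (C * (1 + norm x) ^ k * exp (- a * (norm (x - b))\<^sup>2))"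
      by (intro mult_left_mono C(2)) auto
    also have "\<dots> = C * ((1 + norm x) ^ (N + k) * exp (- a * (norm (x - b))\<^sup>2))" by (simp add: power_add mult_ac)
    also have "\<dots> \<le> C * K" by (intro mult_left_mono K C)
    finally show ?thesis .
  qed
  then show "\<exists>C. \<forall>x. (1 + norm x) ^ N * cmod (f x) \<le> C" by blast
qed (rule gaussian_polynomials.base)

section \<open>The Fourier transform\<close>

lemma norm_integral_le:
  fixes f :: "'a \<Rightarrow> 'b::{banach,second_countable_topology}"
  assumes f: "integrable M f" and g: "integrable M g" and le: "\<And>x. norm (f x) \<le> g x"
  shows "norm (LINT x|M. f x) \<le> (LINT x|M. g x)"
proof -
  have "norm (LINT x|M. f x) \<le> (LINT x|M. norm (f x))" by (rule integral_norm_bound)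
  also have "\<dots> \<le> (LINT x|M. g x)" by (rule integral_mono[OF integrable_norm[OF f] g le])
  finally show ?thesis .
qed

lemma fourier_kernel_norm [simp]: "cmod (exp (- (\<i> * complex_of_real t))) = 1"
  by (simp add: norm_exp_eq_Re)

lemma fourier_integrand_measurable [measurable]:
  assumes [measurable]: "\<psi> \<in> borel_measurable borel"
  shows "(\<lambda>(\<xi>, x). exp (- (\<i> * of_real (x \<bullet> \<xi>))) * \<psi> x) \<in> borel_measurable (lborel \<Otimes>\<^sub>M (lborel :: R3 measure))"
  by measurable

lemma fourier_integrand_integrable:
  assumes "integrable lborel \<psi>"
  shows "integrable lborel (\<lambda>x. exp (- (\<i> * of_real (x \<bullet> \<xi>))) * \<psi> x)"
proof (rule Bochner_Integration.integrable_bound[OF assms])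
  have [measurable]: "\<psi> \<in> borel_measurable borel" using assms by auto
  show "(\<lambda>x. exp (- (\<i> * of_real (x \<bullet> \<xi>))) * \<psi> x) \<in> borel_measurable lborel" by measurable
qed (simp add: norm_mult)

lemma fourier_measurable [measurable]:
  assumes [measurable]: "\<psi> \<in> borel_measurable borel"
  shows "fourier \<psi> \<in> borel_measurable borel"
proof -
  have "(\<lambda>\<xi>. LINT x|lborel. exp (- (\<i> * of_real (x \<bullet> \<xi>))) * \<psi> x) \<in> borel_measurable (lborel :: R3 measure)"
    by (rule lborel.borel_measurable_lebesgue_integral) measurable
  then show ?thesis unfolding fourier_def[abs_def] by simp
qed

definition fourier_const :: real
  where "fourier_const = (2 * pi) powr (- 3 / 2)"

lemma fourier_const_pos [simp]: "fourier_const > 0"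
  by (simp add: fourier_const_def)

lemma fourier_const_square: "fourier_const * fourier_const = 1 / (2 * pi) ^ 3"
proof -
  have "fourier_const * fourier_const = (2 * pi) powr (- 3 / 2 + - 3 / 2)"
    unfolding fourier_const_def by (rule powr_add[symmetric])
  also have "\<dots> = inverse ((2 * pi) powr 3)"
    using powr_minus[of "2 * pi" 3] by simp
  also have "(2 * pi) powr 3 = (2 * pi) ^ 3" by (rule powr_numeral) simp
  finally show ?thesis by (simp only: inverse_eq_divide)
qed

lemma fourier_eq: "fourier \<psi> \<xi> = of_real fourier_const * (LINT x|lborel. exp (- (\<i> * of_real (x \<bullet> \<xi>))) * \<psi> x)"
  by (simp add: fourier_def fourier_const_def)

lemma fourier_bound: "cmod (fourier \<psi> \<xi>) \<le> fourier_const * (LINT x|lborel. cmod (\<psi> x))"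
proof -
  have "cmod (LINT x|lborel. exp (- (\<i> * of_real (x \<bullet> \<xi>))) * \<psi> x) \<le> (LINT x|lborel. cmod (exp (- (\<i> * of_real (x \<bullet> \<xi>))) * \<psi> x))"
    by (rule integral_norm_bound)
  then show ?thesis by (simp add: fourier_eq norm_mult less_imp_le)
qed

lemma fourier_cmult: "fourier (\<lambda>x. c * \<psi> x) \<xi> = c * fourier \<psi> \<xi>"
  by (simp add: fourier_eq mult.left_commute[of _ c])

lemma fourier_add:
  assumes "integrable lborel \<psi>" "integrable lborel \<eta>"
  shows "fourier (\<lambda>x. \<psi> x + \<eta> x) \<xi> = fourier \<psi> \<xi> + fourier \<eta> \<xi>"
  by (simp add: fourier_eq distrib_left fourier_integrand_integrable assms)

text \<open>Fubini for the symmetric kernel \<open>exp (- i x y)\<close>. Integrability of both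
  functions suffices, so one of them may be a spectral density without any smoothness.\<close>

lemma fourier_multiplication:
  assumes v: "integrable lborel v" and \<psi>: "integrable lborel \<psi>"
  shows "(LINT x|lborel. fourier v x * \<psi> x) = (LINT x|lborel. v x * fourier \<psi> x)"
    and "integrable lborel (\<lambda>x. fourier v x * \<psi> x)"
proof -
  have [measurable]: "v \<in> borel_measurable borel" "\<psi> \<in> borel_measurable borel" using v \<psi> by auto
  let ?f = "\<lambda>x y. exp (- (\<i> * complex_of_real (y \<bullet> x))) * (v y * \<psi> x)"
  have i: "integrable (lborel \<Otimes>\<^sub>M lborel) (\<lambda>(x, y). ?f x y)"
  proof (rule Bochner_Integration.integrable_bound)
    show "integrable (lborel \<Otimes>\<^sub>M lborel) (\<lambda>(x, y). \<psi> x * v y)"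
      by (rule integrable_pair_mult[OF lborel.sigma_finite_measure_axioms lborel.sigma_finite_measure_axioms \<psi> v])
  qed (auto simp: norm_mult)
  have eq1: "fourier v x * \<psi> x = of_real fourier_const * (LINT y|lborel. ?f x y)" for x
    unfolding fourier_eq mult.assoc by (subst integral_mult_left_zero[symmetric]) (simp only: mult.assoc)
  have eq2: "v y * fourier \<psi> y = of_real fourier_const * (LINT x|lborel. ?f x y)" for y
  proof -
    have "v y * fourier \<psi> y = of_real fourier_const * (v y * (LINT x|lborel. exp (- (\<i> * of_real (x \<bullet> y))) * \<psi> x))"
      unfolding fourier_eq by (rule mult.left_commute)
    also have "v y * (LINT x|lborel. exp (- (\<i> * of_real (x \<bullet> y))) * \<psi> x) = (LINT x|lborel. ?f x y)"
      by (subst integral_mult_right_zero[symmetric]) (simp only: mult.left_commute inner_commute[of y])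
    finally show ?thesis .
  qed
  show "integrable lborel (\<lambda>x. fourier v x * \<psi> x)"
    unfolding eq1 by (intro integrable_mult_right lborel_pair.integrable_fst[OF i])
  show "(LINT x|lborel. fourier v x * \<psi> x) = (LINT x|lborel. v x * fourier \<psi> x)"
    unfolding eq1 eq2 using lborel_pair.Fubini_integral[OF i] by simp
qed

lemma norm_iexp_minus_linear: "cmod (exp (- (\<i> * complex_of_real r)) - 1 + \<i> * of_real r) \<le> r\<^sup>2 / 2"
proof -
  have "cmod (iexp (-r) - (\<Sum>k\<le>1. (\<i> * (-r))^k / fact k)) \<le> \<bar>-r\<bar>^(Suc 1) / fact (Suc 1)"
    by (rule iexp_approx1)
  moreover have "iexp (-r) - (\<Sum>k\<le>1. (\<i> * complex_of_real (-r))^k / fact k) = exp (- (\<i> * complex_of_real r)) - 1 + \<i> * of_real r"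
    by (simp add: algebra_simps)
  ultimately have "cmod (exp (- (\<i> * complex_of_real r)) - 1 + \<i> * of_real r) \<le> \<bar>-r\<bar>^(Suc 1) / fact (Suc 1)"
    by (simp only:)
  also have "\<dots> = r\<^sup>2 / 2" by (simp add: numeral_2_eq_2)
  finally show ?thesis .
qed

text \<open>The second-order Taylor bound for the exponential makes the error quadratic in the
  increment, with the second moment of \<open>\<psi>\<close> as constant.\<close>

lemma fourier_has_derivative:
  assumes [measurable]: "\<psi> \<in> borel_measurable borel"
    and i0: "integrable lborel \<psi>"
    and i2: "integrable lborel (\<lambda>x. of_real ((norm x)\<^sup>2) * \<psi> x)"
  shows "(fourier \<psi> has_derivative (\<lambda>h. fourier (\<lambda>x. - (\<i> * of_real (x \<bullet> h)) * \<psi> x) \<xi>)) (at \<xi>)"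
proof -
  \<comment> \<open>First moments are controlled by the moments of order 0 and 2, since
    \<open>|x| <= 1 + |x|^2\<close>.\<close>
  have i1: "integrable lborel (\<lambda>x. - (\<i> * of_real (x \<bullet> h)) * \<psi> x)" for h
  proof (rule Bochner_Integration.integrable_bound)
    show "integrable lborel (\<lambda>x. norm h * (cmod (\<psi> x) + cmod (of_real ((norm x)\<^sup>2) * \<psi> x)))"
      using i0 i2 by (intro integrable_mult_right Bochner_Integration.integrable_add integrable_norm)
    show "AE x in lborel. norm (- (\<i> * of_real (x \<bullet> h)) * \<psi> x) \<le> norm (norm h * (cmod (\<psi> x) + cmod (of_real ((norm x)\<^sup>2) * \<psi> x)))"
    proof (rule AE_I2)
      fix x :: R3
      have "\<bar>x \<bullet> h\<bar> \<le> norm x * norm h" by (rule Cauchy_Schwarz_ineq2)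
      also have "\<dots> \<le> (1 + (norm x)\<^sup>2) * norm h"
      proof (rule mult_right_mono)
        show "norm x \<le> 1 + (norm x)\<^sup>2"
        proof -
          have "2 * norm x \<le> 1 + (norm x)\<^sup>2"
            using zero_le_power2[of "norm x - 1"] by (simp add: power2_eq_square algebra_simps)
          then show ?thesis using zero_le_power2[of "norm x"] by linarith
        qed
      qed simp
      finally have "\<bar>x \<bullet> h\<bar> * cmod (\<psi> x) \<le> ((1 + (norm x)\<^sup>2) * norm h) * cmod (\<psi> x)" by (rule mult_right_mono) simp
      then show "norm (- (\<i> * of_real (x \<bullet> h)) * \<psi> x) \<le> norm (norm h * (cmod (\<psi> x) + cmod (of_real ((norm x)\<^sup>2) * \<psi> x)))"
        by (simp add: norm_mult norm_power algebra_simps)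
    qed
  qed measurable
  let ?L = "\<lambda>h. fourier (\<lambda>x. - (\<i> * of_real (x \<bullet> h)) * \<psi> x) \<xi>"
  have lin: "linear ?L"
  proof (rule linearI)
    fix h k :: R3 and c :: real
    have "(\<lambda>x. - (\<i> * of_real (x \<bullet> (h + k))) * \<psi> x) = (\<lambda>x. - (\<i> * of_real (x \<bullet> h)) * \<psi> x + - (\<i> * of_real (x \<bullet> k)) * \<psi> x)"
      by (simp add: fun_eq_iff inner_add_right algebra_simps)
    then show "?L (h + k) = ?L h + ?L k" using fourier_add[OF i1 i1] by simp
    have "(\<lambda>x. - (\<i> * of_real (x \<bullet> (c *\<^sub>R h))) * \<psi> x) = (\<lambda>x. of_real c * (- (\<i> * of_real (x \<bullet> h)) * \<psi> x))"
      by (simp add: fun_eq_iff)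
    then show "?L (c *\<^sub>R h) = c *\<^sub>R ?L h" by (simp only: fourier_cmult scaleR_conv_of_real)
  qed
  define K where "K = fourier_const * (LINT x|lborel. cmod (of_real ((norm x)\<^sup>2) * \<psi> x))"
  have err: "cmod (fourier \<psi> y - fourier \<psi> \<xi> - ?L (y - \<xi>)) \<le> K * (norm (y - \<xi>))\<^sup>2" for y
  proof -
    let ?h = "y - \<xi>"
    let ?g = "\<lambda>x. exp (- (\<i> * of_real (x \<bullet> y))) * \<psi> x - exp (- (\<i> * of_real (x \<bullet> \<xi>))) * \<psi> x
       - exp (- (\<i> * of_real (x \<bullet> \<xi>))) * (- (\<i> * of_real (x \<bullet> ?h)) * \<psi> x)"
    note ii = fourier_integrand_integrable[OF i0, of y] fourier_integrand_integrable[OF i0, of \<xi>]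
       fourier_integrand_integrable[OF i1, of \<xi> ?h]
    have "fourier \<psi> y - fourier \<psi> \<xi> - ?L ?h = of_real fourier_const * (LINT x|lborel. ?g x)"
      unfolding fourier_eq
      by (simp only: Bochner_Integration.integral_diff[OF Bochner_Integration.integrable_diff[OF ii(1,2)] ii(3)]
          Bochner_Integration.integral_diff[OF ii(1,2)] right_diff_distrib)
    then have "cmod (fourier \<psi> y - fourier \<psi> \<xi> - ?L ?h) = fourier_const * cmod (LINT x|lborel. ?g x)"
      by (simp add: norm_mult less_imp_le)
    also have "cmod (LINT x|lborel. ?g x) \<le> (LINT x|lborel. (norm ?h)\<^sup>2 * cmod (of_real ((norm x)\<^sup>2) * \<psi> x))"
    proof (rule norm_integral_le)
      show "integrable lborel ?g" using ii by (intro Bochner_Integration.integrable_diff)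
      show "integrable lborel (\<lambda>x. (norm ?h)\<^sup>2 * cmod (of_real ((norm x)\<^sup>2) * \<psi> x))"
        using i2 by (intro integrable_mult_right integrable_norm)
      fix x :: R3
      have "?g x = exp (- (\<i> * of_real (x \<bullet> \<xi>))) * \<psi> x * (exp (- (\<i> * of_real (x \<bullet> ?h))) - 1 + \<i> * of_real (x \<bullet> ?h))"
      proof -
        have "exp (- (\<i> * of_real (x \<bullet> y))) = exp (- (\<i> * of_real (x \<bullet> \<xi>))) * exp (- (\<i> * of_real (x \<bullet> ?h)))"
          by (simp add: exp_add[symmetric] inner_diff_right algebra_simps)
        then show ?thesis by (simp add: algebra_simps)
      qed
      then have "cmod (?g x) = cmod (\<psi> x) * cmod (exp (- (\<i> * of_real (x \<bullet> ?h))) - 1 + \<i> * of_real (x \<bullet> ?h))"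
        by (simp only: norm_mult fourier_kernel_norm mult_1)
      also have "\<dots> \<le> cmod (\<psi> x) * ((x \<bullet> ?h)\<^sup>2 / 2)"
        by (intro mult_left_mono norm_iexp_minus_linear) auto
      also have "\<dots> \<le> cmod (\<psi> x) * ((norm x)\<^sup>2 * (norm ?h)\<^sup>2)"
      proof (rule mult_left_mono)
        have "\<bar>x \<bullet> ?h\<bar>\<^sup>2 \<le> (norm x * norm ?h)\<^sup>2" by (intro power_mono Cauchy_Schwarz_ineq2) auto
        then have "(x \<bullet> ?h)\<^sup>2 \<le> (norm x)\<^sup>2 * (norm ?h)\<^sup>2" by (simp add: power_mult_distrib)
        then show "(x \<bullet> ?h)\<^sup>2 / 2 \<le> (norm x)\<^sup>2 * (norm ?h)\<^sup>2"
          using zero_le_power2[of "x \<bullet> ?h"] by linarith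
      qed simp
      finally show "cmod (?g x) \<le> (norm ?h)\<^sup>2 * cmod (of_real ((norm x)\<^sup>2) * \<psi> x)"
        by (simp add: norm_mult norm_power mult_ac)
    qed
    finally show ?thesis using less_imp_le[OF fourier_const_pos] by (simp add: K_def mult_ac mult_left_mono)
  qed
  have blin: "bounded_linear ?L" using lin by (simp add: linear_conv_bounded_linear)
  show ?thesis
  proof (rule has_derivativeI_sandwich[of 1 _ _ _ _ "\<lambda>y. K * norm (y - \<xi>)"])
    show "bounded_linear ?L" by (rule blin)
    fix y assume "y \<noteq> \<xi>"
    then show "norm (fourier \<psi> y - fourier \<psi> \<xi> - ?L (y - \<xi>)) / norm (y - \<xi>) \<le> K * norm (y - \<xi>)"
      using err[of y] by (simp add: pos_divide_le_eq power2_eq_square mult.assoc)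
  next
    have "((\<lambda>y. K * norm (y - \<xi>)) \<longlongrightarrow> K * norm (\<xi> - \<xi>)) (at \<xi>)" by (intro tendsto_intros)
    then show "((\<lambda>y. K * norm (y - \<xi>)) \<longlongrightarrow> 0) (at \<xi>)" by simp
  qed simp
qed

lemma fourier_partial_deriv:
  assumes f: "\<psi> \<in> schwartz"
  shows "fourier \<psi> differentiable (at \<xi>)"
    and "partial_deriv j (fourier \<psi>) = fourier (\<lambda>x. - \<i> * (of_real (x $ j) * \<psi> x))"
proof -
  have "(\<lambda>x. of_real ((norm x)\<^sup>2) * \<psi> x) = (\<lambda>x. \<Sum>k\<in>UNIV. of_real (x $ k) * (of_real (x $ k) * \<psi> x))"
  proof
    fix x :: R3
    have "(norm x)\<^sup>2 = (\<Sum>k\<in>UNIV. (x $ k) * (x $ k))"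
      unfolding power2_norm_eq_inner inner_vec_def by simp
    then show "of_real ((norm x)\<^sup>2) * \<psi> x = (\<Sum>k\<in>UNIV. of_real (x $ k) * (of_real (x $ k) * \<psi> x))"
      by (simp add: sum_distrib_right mult.assoc)
  qed
  moreover have "(\<lambda>x. \<Sum>k\<in>UNIV. of_real (x $ k) * (of_real (x $ k) * \<psi> x)) \<in> schwartz"
    by (intro schwartz_sum schwartz_coordinate_mult f) auto
  ultimately have i2: "integrable lborel (\<lambda>x. of_real ((norm x)\<^sup>2) * \<psi> x)"
    using schwartz_integrable by simp
  note D = fourier_has_derivative[OF schwartz_measurable[OF f] schwartz_integrable[OF f] i2]
  show "fourier \<psi> differentiable (at \<xi>)" using D unfolding differentiable_def by blast
  have "(\<lambda>x. - (\<i> * of_real (x \<bullet> axis j 1)) * \<psi> x) = (\<lambda>x. - \<i> * (of_real (x $ j) * \<psi> x))"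
    by (simp add: fun_eq_iff inner_axis)
  then show "partial_deriv j (fourier \<psi>) = fourier (\<lambda>x. - \<i> * (of_real (x $ j) * \<psi> x))"
    using partial_deriv_eq[OF D] by auto
qed

text \<open>Differentiate the translation invariance of the integral.\<close>

lemma integral_partial_deriv_zero:
  assumes diff: "\<And>x. (g has_derivative D x) (at x)"
    and [measurable]: "(\<lambda>x. D x (axis i 1)) \<in> borel_measurable borel"
    and g: "\<And>x. cmod (g x) \<le> C * decay x" and D: "\<And>x. cmod (D x (axis i 1)) \<le> C * decay x"
  shows "(LINT x|lborel. D x (axis i 1)) = 0"
proof -
  let ?e = "axis i 1 :: R3"
  have "decay 0 = 1" by (simp add: decay_def)
  then have C: "C \<ge> 0" using order_trans[OF norm_ge_zero g[of 0]] by simp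
  have g_meas [measurable]: "g \<in> borel_measurable borel"
    by (intro borel_measurable_continuous_onI continuous_at_imp_continuous_on ballI has_derivative_continuous[OF diff])
  have vd: "((\<lambda>r. g (x + r *\<^sub>R ?e)) has_vector_derivative D (x + r *\<^sub>R ?e) ?e) (at r within S)" for x r S
  proof -
    have lin': "D y (r' *\<^sub>R ?e) = r' *\<^sub>R D y ?e" for y r'
      by (rule linear_cmul[OF has_derivative_linear[OF diff]])
    have "((\<lambda>r. x + r *\<^sub>R ?e) has_derivative (\<lambda>r. r *\<^sub>R ?e)) (at r within S)"
      by (rule has_derivative_eq_rhs, (rule derivative_intros)+) simp
    from has_derivative_compose[OF this diff]
    have "((\<lambda>r. g (x + r *\<^sub>R ?e)) has_derivative (\<lambda>r'. D (x + r *\<^sub>R ?e) (r' *\<^sub>R ?e))) (at r within S)" .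
    then show ?thesis
      unfolding has_vector_derivative_def lin' .
  qed
  \<comment> \<open>Translations are restricted to \<open>|r| < 1\<close> so that
    \<open>decay_shift\<close> provides one majorant for all of them.\<close>
  have "((\<lambda>r. LINT x|lborel. g (x + r *\<^sub>R ?e)) has_vector_derivative (LINT x|lborel. D x ?e)) (at 0 within {-1<..<1})"
  proof (rule has_vector_derivative_integral_dominated[where g = "\<lambda>x. 81 * C * decay x"])
    show "integrable lborel (\<lambda>x. g (x + r *\<^sub>R ?e))" for r
      using lborel_integral_shift(2)[OF g_meas, of "r *\<^sub>R ?e"] integrable_le_decay[OF g_meas g] by simp
    show "((\<lambda>r. g (x + r *\<^sub>R ?e)) has_vector_derivative D x ?e) (at 0 within {-1<..<1})" for x
      using vd[of x 0] by simp
    show "norm (g (x + r *\<^sub>R ?e) - g (x + 0 *\<^sub>R ?e)) \<le> \<bar>r - 0\<bar> * (81 * C * decay x)" if r: "r \<in> {-1<..<1}" for r x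
    proof -
      have "norm ((\<lambda>r. g (x + r *\<^sub>R ?e)) r - (\<lambda>r. g (x + r *\<^sub>R ?e)) 0) \<le> (81 * C * decay x) * norm (r - 0)"
      proof (rule differentiable_bound[of "{-1<..<1}" "\<lambda>r. g (x + r *\<^sub>R ?e)" "\<lambda>r h. h *\<^sub>R D (x + r *\<^sub>R ?e) ?e"])
        fix s :: real assume s: "s \<in> {-1<..<1}"
        show "((\<lambda>r. g (x + r *\<^sub>R ?e)) has_derivative (\<lambda>h. h *\<^sub>R D (x + s *\<^sub>R ?e) ?e)) (at s within {-1<..<1})"
          by (rule vd[unfolded has_vector_derivative_def])
        have "cmod (D (x + s *\<^sub>R ?e) ?e) \<le> C * decay (x + s *\<^sub>R ?e)" by (rule D)
        also have "\<dots> \<le> C * (81 * decay x)" using s C by (intro mult_left_mono decay_shift) auto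
        finally have "cmod (D (x + s *\<^sub>R ?e) ?e) \<le> 81 * C * decay x" by simp
        then have "\<bar>h\<bar> * cmod (D (x + s *\<^sub>R ?e) ?e) \<le> \<bar>h\<bar> * (81 * C * decay x)" for h
          by (rule mult_left_mono) simp
        then have "norm (h *\<^sub>R D (x + s *\<^sub>R ?e) ?e) \<le> (81 * C * decay x) * norm h" for h
          unfolding norm_scaleR real_norm_def by (subst mult.commute[of _ "\<bar>h\<bar>"])
        then show "onorm (\<lambda>h. h *\<^sub>R D (x + s *\<^sub>R ?e) ?e) \<le> 81 * C * decay x"
          by (rule onorm_le)
      qed (use r in auto)
      then show ?thesis by (simp add: mult.commute)
    qed
  qed auto
  moreover have "(LINT x|lborel. g (x + r *\<^sub>R ?e)) = (LINT x|lborel. g x)" for r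
    by (rule lborel_integral_shift(1)[OF g_meas])
  ultimately have "((\<lambda>r. LINT x|lborel. g x) has_vector_derivative (LINT x|lborel. D x ?e)) (at 0 within {-1<..<1})"
    by (simp only:)
  moreover have "at (0::real) within {-1<..<1} = at 0" by (rule at_within_open) auto
  ultimately have "((\<lambda>r::real. LINT x|lborel. g x) has_vector_derivative (LINT x|lborel. D x ?e)) (at 0)"
    by (simp only:)
  then show ?thesis by (rule vector_derivative_unique_at[OF _ has_vector_derivative_const])
qed

text \<open>Integration by parts: the partial derivative of \<open>exp (- i x \<xi>) \<psi>\<close>
  has integral zero, and the product rule splits it into the two sides.\<close>

lemma fourier_of_partial_deriv:
  assumes f: "\<psi> \<in> schwartz"
  shows "fourier (partial_deriv j \<psi>) \<xi> = \<i> * of_real (\<xi> $ j) * fourier \<psi> \<xi>"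
proof -
  let ?E = "\<lambda>x. exp (- (\<i> * complex_of_real (x \<bullet> \<xi>)))"
  let ?g = "\<lambda>x. ?E x * \<psi> x"
  let ?D = "\<lambda>x v. ?E x * (\<Sum>i\<in>UNIV. of_real (v $ i) * partial_deriv i \<psi> x) + (?E x * (- (\<i> * of_real (v \<bullet> \<xi>)))) * \<psi> x"
  have D: "(?g has_derivative ?D x) (at x)" for x
  proof (rule has_derivative_mult[OF _ schwartz_has_derivative[OF f]])
    have "((\<lambda>x. - (\<i> * complex_of_real (x \<bullet> \<xi>))) has_derivative (\<lambda>v. - (\<i> * of_real (v \<bullet> \<xi>)))) (at x)"
      by (intro has_derivative_minus has_derivative_mult_right bounded_linear.has_derivative[OF bounded_linear_of_real]
          bounded_linear_imp_has_derivative bounded_linear_inner_left)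
    then show "(?E has_derivative (\<lambda>v. ?E x * (- (\<i> * of_real (v \<bullet> \<xi>))))) (at x)"
      by (rule has_derivative_compose[OF _ DERIV_exp[unfolded has_field_derivative_def]])
  qed
  have De: "?D x (axis j 1) = ?E x * partial_deriv j \<psi> x - \<i> * of_real (\<xi> $ j) * (?E x * \<psi> x)" for x
    by (simp only: axis_sum) (simp add: inner_axis')
  have m: "?E \<in> borel_measurable borel" by measurable
  obtain A where A: "A \<ge> 0" "\<And>x. cmod (\<psi> x) \<le> A * decay x" using schwartz_le_decay[OF f] by blast
  obtain B where B: "B \<ge> 0" "\<And>x. cmod (partial_deriv j \<psi> x) \<le> B * decay x"
    using schwartz_le_decay[OF schwartz_partial_deriv[OF f]] by blast
  have "(LINT x|lborel. ?D x (axis j 1)) = 0"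
  proof (rule integral_partial_deriv_zero[where C = "A + B + \<bar>\<xi> $ j\<bar> * A", OF D])
    show "(\<lambda>x. ?D x (axis j 1)) \<in> borel_measurable borel"
      unfolding De using schwartz_measurable[OF f] schwartz_measurable[OF schwartz_partial_deriv[OF f]] m
      by (intro borel_measurable_diff borel_measurable_times) auto
    fix x
    have "cmod (?g x) \<le> A * decay x" using A(2) by (simp add: norm_mult)
    also have "\<dots> \<le> (A + B + \<bar>\<xi> $ j\<bar> * A) * decay x" using A(1) B(1) by (intro mult_right_mono) auto
    finally show "cmod (?g x) \<le> (A + B + \<bar>\<xi> $ j\<bar> * A) * decay x" .
    have "cmod (?D x (axis j 1)) \<le> cmod (?E x * partial_deriv j \<psi> x) + cmod (\<i> * of_real (\<xi> $ j) * (?E x * \<psi> x))"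
      unfolding De by (rule norm_triangle_ineq4)
    also have "\<dots> \<le> B * decay x + \<bar>\<xi> $ j\<bar> * (A * decay x)"
      using A(2)[of x] B(2)[of x] by (simp add: norm_mult add_mono mult_left_mono)
    also have "\<dots> \<le> (A + B + \<bar>\<xi> $ j\<bar> * A) * decay x"
      using mult_nonneg_nonneg[OF A(1) decay_nonneg[of x]] by (simp add: algebra_simps)
    finally show "cmod (?D x (axis j 1)) \<le> (A + B + \<bar>\<xi> $ j\<bar> * A) * decay x" .
  qed
  then have "(LINT x|lborel. ?E x * partial_deriv j \<psi> x) - \<i> * of_real (\<xi> $ j) * (LINT x|lborel. ?E x * \<psi> x) = 0"
    unfolding De using fourier_integrand_integrable[OF schwartz_integrable[OF f], of \<xi>]
      fourier_integrand_integrable[OF schwartz_integrable[OF schwartz_partial_deriv[OF f, of j]], of \<xi>] by simp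
  then show ?thesis by (simp add: fourier_eq mult_ac)
qed

lemma fourier_schwartz:
  assumes "\<psi> \<in> schwartz"
  shows "fourier \<psi> \<in> schwartz"
proof (rule schwartz_coinduct[of _ "fourier ` schwartz"])
  fix f assume "f \<in> fourier ` schwartz"
  then obtain \<psi> where f: "f = fourier \<psi>" and \<psi>: "\<psi> \<in> schwartz" by blast
  show "f differentiable (at x)" for x unfolding f by (rule fourier_partial_deriv[OF \<psi>])
  show "partial_deriv i f \<in> fourier ` schwartz" for i
    unfolding f fourier_partial_deriv(2)[OF \<psi>]
    by (intro imageI schwartz_cmult schwartz_coordinate_mult \<psi>)
  fix N :: nat
  \<comment> \<open>Each factor \<open>\<xi> $ j\<close> is traded for a derivative of
    \<open>\<psi>\<close>, and a Fourier transform is bounded by an \<open>L^1\<close> norm; hence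
    the induction generalises over \<open>\<psi>\<close>.\<close>
  have pd: "\<exists>C\<ge>0. \<forall>\<xi>. \<bar>\<xi> $ j\<bar> ^ n * cmod (fourier \<psi> \<xi>) \<le> C" if "\<psi> \<in> schwartz" for j n \<psi>
    using that
  proof (induction n arbitrary: \<psi>)
    case 0
    show ?case
      by (rule exI[of _ "fourier_const * (LINT x|lborel. cmod (\<psi> x))"])
        (use fourier_bound in \<open>auto intro!: mult_nonneg_nonneg less_imp_le[OF fourier_const_pos] integral_nonneg_AE\<close>)
  next
    case (Suc n)
    from Suc.IH[OF schwartz_partial_deriv[OF Suc.prems, of j]]
    show ?case by (simp add: fourier_of_partial_deriv[OF Suc.prems] norm_mult mult_ac)
  qed
  have "\<forall>j. \<exists>C. \<forall>\<xi>. \<bar>\<xi> $ j\<bar> ^ N * cmod (fourier \<psi> \<xi>) \<le> C" using pd[OF \<psi>] by blast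
  then obtain B where B: "\<And>j \<xi>. \<bar>\<xi> $ j\<bar> ^ N * cmod (fourier \<psi> \<xi>) \<le> B j" unfolding choice_iff by blast
  obtain B0 where B0: "\<And>\<xi>. \<bar>\<xi> $ 1\<bar> ^ 0 * cmod (fourier \<psi> \<xi>) \<le> B0" using pd[OF \<psi>] by blast
  have "(1 + norm \<xi>) ^ N * cmod (f \<xi>) \<le> 4 ^ N * (B0 + (\<Sum>j\<in>UNIV. B j))" for \<xi>
  proof -
    \<comment> \<open>With \<open>M\<close> the maximum of 1 and the coordinates in absolute value,
      \<open>1 + |\<xi>| <= 4 M\<close> (the 4 is \<open>1 + 3\<close>), and \<open>M ^ N\<close> is
      one of the summands on the right of \<open>MN\<close>.\<close>
    define M where "M = Max (insert 1 (range (\<lambda>j. \<bar>\<xi> $ j\<bar>)))"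
    have M1: "1 \<le> M" "\<And>j. \<bar>\<xi> $ j\<bar> \<le> M" unfolding M_def by (rule Max_ge; simp)+
    have "M \<in> insert 1 (range (\<lambda>j. \<bar>\<xi> $ j\<bar>))" unfolding M_def by (rule Max_in) auto
    then have MN: "M ^ N \<le> 1 + (\<Sum>j\<in>UNIV. \<bar>\<xi> $ j\<bar> ^ N)"
    proof
      assume "M \<in> range (\<lambda>j. \<bar>\<xi> $ j\<bar>)"
      then obtain k where "M = \<bar>\<xi> $ k\<bar>" by blast
      moreover have "\<bar>\<xi> $ k\<bar> ^ N \<le> (\<Sum>j\<in>UNIV. \<bar>\<xi> $ j\<bar> ^ N)" by (rule member_le_sum) auto
      ultimately show ?thesis by simp
    qed (simp add: sum_nonneg)
    have "norm \<xi> \<le> (\<Sum>j\<in>UNIV. \<bar>\<xi> $ j\<bar>)" by (rule norm_le_l1_cart)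
    also have "\<dots> \<le> (\<Sum>j\<in>(UNIV::3 set). M)" by (intro sum_mono M1)
    finally have "1 + norm \<xi> \<le> 4 * M" using M1(1) by simp
    then have "(1 + norm \<xi>) ^ N \<le> (4 * M) ^ N" by (intro power_mono) auto
    also have "\<dots> \<le> 4 ^ N * (1 + (\<Sum>j\<in>UNIV. \<bar>\<xi> $ j\<bar> ^ N))"
      using MN by (simp add: power_mult_distrib)
    finally have "(1 + norm \<xi>) ^ N * cmod (f \<xi>) \<le> 4 ^ N * (1 + (\<Sum>j\<in>UNIV. \<bar>\<xi> $ j\<bar> ^ N)) * cmod (f \<xi>)"
      by (rule mult_right_mono) simp
    also have "\<dots> = 4 ^ N * (cmod (f \<xi>) + (\<Sum>j\<in>UNIV. \<bar>\<xi> $ j\<bar> ^ N * cmod (f \<xi>)))"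
      by (simp add: distrib_right sum_distrib_right mult.assoc)
    also have "\<dots> \<le> 4 ^ N * (B0 + (\<Sum>j\<in>UNIV. B j))"
      unfolding f using B0[of \<xi>] by (intro mult_left_mono add_mono sum_mono B) auto
    finally show ?thesis .
  qed
  then show "\<exists>C. \<forall>\<xi>. (1 + norm \<xi>) ^ N * cmod (f \<xi>) \<le> C" by blast
qed (use assms in auto)

text \<open>A Gaussian factor \<open>exp (- (c / 2)\<^sup>2 |\<xi>|\<^sup>2)\<close> regularizes the double integral; by Fubini it
  becomes a Gaussian average of \<open>\<psi>\<close> at scale \<open>c\<close>, and \<open>c \<rightarrow> 0\<close>.\<close>

lemma fourier_inversion:
  assumes \<psi>: "\<psi> \<in> schwartz"
  shows "fourier (fourier \<psi>) x = \<psi> (- x)"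
proof -
  note [measurable] = schwartz_measurable[OF \<psi>] schwartz_measurable[OF fourier_schwartz[OF \<psi>]]
  define c where "c n = inverse (real (Suc n))" for n
  have c: "c n > 0" "c \<longlonglongrightarrow> 0" for n
    using LIMSEQ_inverse_real_of_nat by (auto simp: c_def[abs_def])
  let ?G = "\<lambda>n \<xi>. complex_of_real (exp (- (c n / 2)\<^sup>2 * (norm \<xi>)\<^sup>2))"
  let ?E = "\<lambda>y \<xi>. exp (- (\<i> * complex_of_real (y \<bullet> \<xi>)))"
  have lim1: "(\<lambda>n. LINT \<xi>|lborel. ?E \<xi> x * (fourier \<psi> \<xi> * ?G n \<xi>)) \<longlonglongrightarrow> (LINT \<xi>|lborel. ?E \<xi> x * fourier \<psi> \<xi>)"
  proof (rule integral_dominated_convergence[where w = "\<lambda>\<xi>. cmod (fourier \<psi> \<xi>)"])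
    show "integrable lborel (\<lambda>\<xi>. cmod (fourier \<psi> \<xi>))"
      by (intro integrable_norm schwartz_integrable fourier_schwartz \<psi>)
    show "AE \<xi> in lborel. (\<lambda>n. ?E \<xi> x * (fourier \<psi> \<xi> * ?G n \<xi>)) \<longlonglongrightarrow> ?E \<xi> x * fourier \<psi> \<xi>"
    proof (rule AE_I2)
      fix \<xi> :: R3
      have "(\<lambda>n. ?E \<xi> x * (fourier \<psi> \<xi> * ?G n \<xi>)) \<longlonglongrightarrow> ?E \<xi> x * (fourier \<psi> \<xi> * of_real (exp (- (0 / 2)\<^sup>2 * (norm \<xi>)\<^sup>2)))"
        by (intro tendsto_intros c)  auto
      then show "(\<lambda>n. ?E \<xi> x * (fourier \<psi> \<xi> * ?G n \<xi>)) \<longlonglongrightarrow> ?E \<xi> x * fourier \<psi> \<xi>" by simp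
    qed
    show "AE \<xi> in lborel. norm (?E \<xi> x * (fourier \<psi> \<xi> * ?G n \<xi>)) \<le> cmod (fourier \<psi> \<xi>)" for n
      by (intro AE_I2) (simp add: norm_mult mult_left_le)
  qed measurable
  have avg: "of_real fourier_const * (LINT \<xi>|lborel. ?E \<xi> x * (fourier \<psi> \<xi> * ?G n \<xi>)) =
     of_real (1 / pi ^ 3 * sqrt pi ^ 3) * (LINT z|lborel. \<psi> (- x + c n *\<^sub>R z) * of_real (exp (- (norm z)\<^sup>2)))" for n
  proof -
    have a: "(c n / 2)\<^sup>2 > 0" using c(1)[of n] by simp
    have Gi: "integrable lborel (\<lambda>\<xi>. ?G n \<xi> * ?E \<xi> x)"
      using gaussian_fourier(1)[OF a, of x] by (simp add: mult.commute)
    have "(LINT \<xi>|lborel. ?E \<xi> x * (fourier \<psi> \<xi> * ?G n \<xi>)) = (LINT \<xi>|lborel. fourier \<psi> \<xi> * (?G n \<xi> * ?E \<xi> x))"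
      by (simp add: mult_ac)
    also have "\<dots> = (LINT y|lborel. \<psi> y * fourier (\<lambda>\<xi>. ?G n \<xi> * ?E \<xi> x) y)"
      by (rule fourier_multiplication(1)[OF schwartz_integrable[OF \<psi>] Gi])
    also have "\<dots> = (LINT y|lborel. \<psi> y * of_real (fourier_const * (sqrt (pi / (c n / 2)\<^sup>2) ^ 3 * exp (- (norm (y + x))\<^sup>2 / (4 * (c n / 2)\<^sup>2)))))"
    proof (rule arg_cong[where f = "integral\<^sup>L lborel"], rule ext)
      fix y
      have "fourier (\<lambda>\<xi>. ?G n \<xi> * ?E \<xi> x) y = of_real fourier_const * (LINT \<xi>|lborel. ?E \<xi> (y + x) * ?G n \<xi>)"
      proof -
        have "?E \<xi> y * (?G n \<xi> * ?E \<xi> x) = ?E \<xi> (y + x) * ?G n \<xi>" for \<xi>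
        proof -
          have "?E \<xi> (y + x) = ?E \<xi> y * ?E \<xi> x"
            unfolding exp_add[symmetric] by (simp add: inner_add_right distrib_left)
          then show ?thesis by (simp only: mult_ac)
        qed
        then show ?thesis unfolding fourier_eq by (simp only:)
      qed
      then show "\<psi> y * fourier (\<lambda>\<xi>. ?G n \<xi> * ?E \<xi> x) y = \<psi> y * of_real (fourier_const * (sqrt (pi / (c n / 2)\<^sup>2) ^ 3 * exp (- (norm (y + x))\<^sup>2 / (4 * (c n / 2)\<^sup>2))))"
        using gaussian_fourier(2)[OF a, of "y + x"] by simp
    qed
    also have "\<dots> = c n ^ 3 *\<^sub>R (LINT z|lborel. \<psi> (- x + c n *\<^sub>R z) * of_real (fourier_const * (sqrt (pi / (c n / 2)\<^sup>2) ^ 3 * exp (- (norm (- x + c n *\<^sub>R z + x))\<^sup>2 / (4 * (c n / 2)\<^sup>2)))))"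
      by (subst lborel_integral_scaleR[OF _ c(1), where t = "- x" and n1 = n]) auto
    also have "(\<lambda>z. \<psi> (- x + c n *\<^sub>R z) * of_real (fourier_const * (sqrt (pi / (c n / 2)\<^sup>2) ^ 3 * exp (- (norm (- x + c n *\<^sub>R z + x))\<^sup>2 / (4 * (c n / 2)\<^sup>2)))))
       = (\<lambda>z. of_real (fourier_const * sqrt (pi / (c n / 2)\<^sup>2) ^ 3) * (\<psi> (- x + c n *\<^sub>R z) * of_real (exp (- (norm z)\<^sup>2))))"
      using c(1)[of n] by (simp add: fun_eq_iff power_mult_distrib power_divide mult_ac)
    finally have "(LINT \<xi>|lborel. ?E \<xi> x * (fourier \<psi> \<xi> * ?G n \<xi>)) =
        of_real (c n ^ 3 * (fourier_const * sqrt (pi / (c n / 2)\<^sup>2) ^ 3)) * (LINT z|lborel. \<psi> (- x + c n *\<^sub>R z) * of_real (exp (- (norm z)\<^sup>2)))"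
      by (simp add: scaleR_conv_of_real)
    \<comment> \<open>The scale \<open>c n\<close> cancels because
      \<open>sqrt (pi / (c / 2)^2) = 2 sqrt pi / c\<close>; the resulting \<open>8 = 2^3\<close> is
      absorbed by \<open>(2 pi)^(-3)\<close>. In the limit the second \<open>sqrt pi ^ 3\<close>,
      the mass of the Gaussian, makes the constant 1.\<close>
    moreover have "fourier_const * (c n ^ 3 * (fourier_const * sqrt (pi / (c n / 2)\<^sup>2) ^ 3)) = 1 / pi ^ 3 * sqrt pi ^ 3"
    proof -
      have "sqrt (pi / (c n / 2)\<^sup>2) = 2 * sqrt pi / c n" using c(1)[of n] by (simp add: real_sqrt_divide)
      then have "fourier_const * (c n ^ 3 * (fourier_const * sqrt (pi / (c n / 2)\<^sup>2) ^ 3)) = (fourier_const * fourier_const) * (8 * sqrt pi ^ 3)"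
        using c(1)[of n] by (simp add: power_divide power_mult_distrib)
      then show ?thesis by (simp add: fourier_const_square power_mult_distrib)
    qed
    ultimately show ?thesis by (simp only: mult.assoc[symmetric] of_real_mult[symmetric])
  qed
  obtain B where B: "\<And>x. cmod (\<psi> x) \<le> B" using schwartz_bounded[OF \<psi>] by blast
  have "(\<lambda>n. of_real (1 / pi ^ 3 * sqrt pi ^ 3) * (LINT z|lborel. \<psi> (- x + c n *\<^sub>R z) * of_real (exp (- (norm z)\<^sup>2))))
    \<longlonglongrightarrow> of_real (1 / pi ^ 3 * sqrt pi ^ 3) * (\<psi> (- x) * of_real (sqrt pi ^ DIM(R3)))"
    by (intro tendsto_mult tendsto_const gaussian_approximate_identity[OF _ B schwartz_isCont[OF \<psi>] c(2)]) measurable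
  moreover have "of_real (1 / pi ^ 3 * sqrt pi ^ 3) * (\<psi> (- x) * of_real (sqrt pi ^ DIM(R3))) = \<psi> (- x)"
  proof -
    have "1 / pi ^ 3 * sqrt pi ^ 3 * sqrt pi ^ 3 = 1"
      by (simp add: power_mult_distrib[symmetric])
    then have "complex_of_real (1 / pi ^ 3 * sqrt pi ^ 3) * of_real (sqrt pi ^ DIM(R3)) = 1"
      by (simp only: of_real_mult[symmetric]) simp
    then show ?thesis by (metis mult.left_commute mult.right_neutral)
  qed
  ultimately have "(\<lambda>n. of_real fourier_const * (LINT \<xi>|lborel. ?E \<xi> x * (fourier \<psi> \<xi> * ?G n \<xi>))) \<longlonglongrightarrow> \<psi> (- x)"
    by (simp only: avg)
  moreover have "(\<lambda>n. of_real fourier_const * (LINT \<xi>|lborel. ?E \<xi> x * (fourier \<psi> \<xi> * ?G n \<xi>))) \<longlonglongrightarrow> fourier (fourier \<psi>) x"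
    unfolding fourier_eq[of "fourier \<psi>"] by (intro tendsto_mult tendsto_const lim1)
  ultimately show ?thesis using LIMSEQ_unique by blast
qed

section \<open>Distributions with integrable Fourier transform\<close>

lemma fourier_reflect:
  assumes [measurable]: "\<psi> \<in> borel_measurable borel"
  shows "fourier (\<lambda>x. \<psi> (- x)) \<xi> = fourier \<psi> (- \<xi>)"
proof -
  have m: "(\<lambda>x. exp (- (\<i> * of_real (x \<bullet> - \<xi>))) * \<psi> x) \<in> borel_measurable borel" by measurable
  show ?thesis
    unfolding fourier_eq using lborel_integral_shift(3)[OF m, of 0] by simp
qed

definition inverse_fourier :: "(R3 \<Rightarrow> complex) \<Rightarrow> R3 \<Rightarrow> complex"
  where "inverse_fourier v x = fourier v (- x)"

lemma inverse_fourier_measurable [measurable]: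
  assumes "v \<in> borel_measurable borel"
  shows "inverse_fourier v \<in> borel_measurable borel"
proof -
  note [measurable] = fourier_measurable[OF assms]
  show ?thesis unfolding inverse_fourier_def[abs_def] by measurable
qed

lemma inverse_fourier_multiplication:
  assumes v: "integrable lborel v" and \<psi>: "integrable lborel \<psi>"
  shows "(LINT x|lborel. inverse_fourier v x * \<psi> x) = (LINT x|lborel. v x * inverse_fourier \<psi> x)"
    and "integrable lborel (\<lambda>x. inverse_fourier v x * \<psi> x)"
proof -
  have vm: "v \<in> borel_measurable borel" and pm [measurable]: "\<psi> \<in> borel_measurable borel" using v \<psi> by auto
  note [measurable] = fourier_measurable[OF vm]
  have m: "(\<lambda>x. fourier v x * \<psi> (- x)) \<in> borel_measurable borel" by measurable
  have r: "integrable lborel (\<lambda>x. \<psi> (- x))" using lborel_integral_shift(4)[OF pm, of 0] \<psi> by simp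
  show "integrable lborel (\<lambda>x. inverse_fourier v x * \<psi> x)"
    using lborel_integral_shift(4)[OF m, of 0] fourier_multiplication(2)[OF v r] by (simp add: inverse_fourier_def)
  show "(LINT x|lborel. inverse_fourier v x * \<psi> x) = (LINT x|lborel. v x * inverse_fourier \<psi> x)"
    using lborel_integral_shift(3)[OF m, of 0] fourier_multiplication(1)[OF v r]
    by (simp add: inverse_fourier_def fourier_reflect[OF pm])
qed

lemma inverse_fourier_schwartz: "\<psi> \<in> schwartz \<Longrightarrow> inverse_fourier \<psi> \<in> schwartz"
  unfolding inverse_fourier_def[abs_def] by (intro schwartz_reflect fourier_schwartz)

text \<open>Data and solutions are described by their Fourier transforms: for integrable
  \<open>v\<close> this is the tempered distribution with transform \<open>v\<close>, and it is
  given by a bounded function.\<close>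

definition spectral :: "(R3 \<Rightarrow> complex) \<Rightarrow> dist3"
  where "spectral v = dist_of (inverse_fourier v)"

lemma spectral_apply:
  assumes "integrable lborel v" "\<psi> \<in> schwartz"
  shows "spectral v \<psi> = (LINT \<xi>|lborel. v \<xi> * inverse_fourier \<psi> \<xi>)"
  using inverse_fourier_multiplication(1)[OF assms(1) schwartz_integrable[OF assms(2)]] assms(2)
  by (simp add: spectral_def dist_of_def)

lemma represented_by_spectral:
  assumes v: "integrable lborel v"
  shows "represented_by (spectral v) (inverse_fourier v)"
  unfolding represented_by_def
  using inverse_fourier_multiplication(2)[OF v schwartz_integrable] inverse_fourier_measurable[of v] v
  by (auto simp: spectral_def)

text \<open>Pairing with \<open>fourier \<psi>\<close> applies the inverse transform to
  \<open>fourier \<psi>\<close>, so Fourier inversion on Schwartz functions returns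
  \<open>\<psi>\<close>.\<close>

lemma fourier_dist_spectral:
  assumes v: "integrable lborel v"
  shows "represented_by (fourier_dist (spectral v)) v"
proof -
  have "fourier_dist (spectral v) \<psi> = dist_of v \<psi>" for \<psi>
  proof (cases "\<psi> \<in> schwartz")
    case True
    have "spectral v (fourier \<psi>) = (LINT \<xi>|lborel. v \<xi> * \<psi> \<xi>)"
      by (simp add: spectral_apply[OF v fourier_schwartz[OF True]] inverse_fourier_def fourier_inversion[OF True])
    then show ?thesis using True by (simp add: fourier_dist_def dist_of_def)
  qed (simp add: fourier_dist_def dist_of_def)
  moreover have "integrable lborel (\<lambda>x. v x * \<psi> x)" if \<psi>: "\<psi> \<in> schwartz" for \<psi>
  proof -
    obtain B where B: "\<And>x. cmod (\<psi> x) \<le> B" using schwartz_bounded[OF \<psi>] by blast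
    show ?thesis
    proof (rule Bochner_Integration.integrable_bound)
      show "integrable lborel (\<lambda>x. of_real B * v x)" using v by (intro integrable_mult_right)
      show "(\<lambda>x. v x * \<psi> x) \<in> borel_measurable lborel"
        using v schwartz_measurable[OF \<psi>] by (intro borel_measurable_times) auto
      show "AE x in lborel. norm (v x * \<psi> x) \<le> norm (of_real B * v x)"
      proof (rule AE_I2)
        fix x
        have "cmod (\<psi> x) \<le> \<bar>B\<bar>" using B[of x] by simp
        then show "norm (v x * \<psi> x) \<le> norm (of_real B * v x)"
          by (simp add: norm_mult mult.commute[of "cmod (v x)"] mult_right_mono)
      qed
    qed
  qed
  ultimately show ?thesis using v unfolding represented_by_def by auto
qed

section \<open>Tempered distributions and uniqueness of representing functions\<close>

lemma schwartz_seminorm_upper: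
  assumes \<psi>: "\<psi> \<in> schwartz" and "length \<alpha> \<le> N"
  shows "(1 + norm x) ^ N * cmod (partial_derivs \<alpha> \<psi> x) \<le> schwartz_seminorm N \<psi>"
proof -
  have fin: "finite {\<alpha> :: 3 list. length \<alpha> \<le> N}" using finite_lists_length_le[of "UNIV :: 3 set" N] by simp
  have "\<forall>\<alpha>. \<exists>C. \<forall>x. (1 + norm x) ^ N * cmod (partial_derivs \<alpha> \<psi> x) \<le> C"
    using schwartz_partial_derivs_bound[OF \<psi>] by blast
  then obtain C where C: "\<And>\<alpha> x. (1 + norm x) ^ N * cmod (partial_derivs \<alpha> \<psi> x) \<le> C \<alpha>" unfolding choice_iff by blast
  \<comment> \<open>The bounds depend on the list \<open>\<alpha>\<close>, but only finitely many
    lists have length at most \<open>N\<close>, so their maximum bounds the whole family.\<close>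
  have "bdd_above ((\<lambda>(\<alpha>, x). (1 + norm x) ^ N * cmod (partial_derivs \<alpha> \<psi> x)) ` ({\<alpha>. length \<alpha> \<le> N} \<times> UNIV))"
  proof (rule bdd_aboveI2)
    fix p assume "p \<in> {\<alpha> :: 3 list. length \<alpha> \<le> N} \<times> (UNIV :: R3 set)"
    then obtain \<alpha> x where p: "p = (\<alpha>, x)" "length \<alpha> \<le> N" by auto
    have "C \<alpha> \<le> Max (C ` {\<alpha>. length \<alpha> \<le> N})" using fin p(2) by (intro Max_ge) auto
    then show "(case p of (\<alpha>, x) \<Rightarrow> (1 + norm x) ^ N * cmod (partial_derivs \<alpha> \<psi> x)) \<le> Max (C ` {\<alpha>. length \<alpha> \<le> N})"
      using C[where x = x and \<alpha> = \<alpha>] p(1) by simp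
  qed
  from cSUP_upper[OF _ this, of "(\<alpha>, x)"] assms(2) show ?thesis by (simp add: schwartz_seminorm_def)
qed

lemma schwartz_seminorm_nonneg: "\<psi> \<in> schwartz \<Longrightarrow> 0 \<le> schwartz_seminorm N \<psi>"
  using schwartz_seminorm_upper[of \<psi> "[]" N 0] by (simp add: order_trans[rotated])

lemma schwartz_seminorm_mono:
  assumes \<psi>: "\<psi> \<in> schwartz" and "N \<le> M"
  shows "schwartz_seminorm N \<psi> \<le> schwartz_seminorm M \<psi>"
  unfolding schwartz_seminorm_def[of N]
proof (rule cSUP_least)
  fix p assume "p \<in> {\<alpha> :: 3 list. length \<alpha> \<le> N} \<times> (UNIV :: R3 set)"
  then obtain \<alpha> x where p: "p = (\<alpha>, x)" "length \<alpha> \<le> N" by auto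
  have "(1 + norm x) ^ N * cmod (partial_derivs \<alpha> \<psi> x) \<le> (1 + norm x) ^ M * cmod (partial_derivs \<alpha> \<psi> x)"
    using assms(2) by (intro mult_right_mono power_increasing) auto
  also have "\<dots> \<le> schwartz_seminorm M \<psi>" by (rule schwartz_seminorm_upper[OF \<psi>]) (use p assms(2) in simp)
  finally show "(case p of (\<alpha>, x) \<Rightarrow> (1 + norm x) ^ N * cmod (partial_derivs \<alpha> \<psi> x)) \<le> schwartz_seminorm M \<psi>"
    using p(1) by simp
qed (auto intro: exI[of _ "[]"])

lemma spectral_tempered:
  assumes v: "integrable lborel v"
  shows "spectral v \<in> tempered"
  unfolding tempered_def
proof (intro CollectI conjI ballI allI impI)
  show "spectral v \<psi> = 0" if "\<psi> \<notin> schwartz" for \<psi> using that by (simp add: spectral_def dist_of_def)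
  fix \<psi> assume \<psi>: "\<psi> \<in> schwartz"
  note i = inverse_fourier_multiplication(2)[OF v schwartz_integrable]
  show "spectral v (\<lambda>x. \<psi> x + \<eta> x) = spectral v \<psi> + spectral v \<eta>" if \<eta>: "\<eta> \<in> schwartz" for \<eta>
    using \<psi> \<eta> schwartz_add[OF \<psi> \<eta>] by (simp add: spectral_def dist_of_def distrib_left i)
  show "spectral v (\<lambda>x. c * \<psi> x) = c * spectral v \<psi>" for c
    using \<psi> schwartz_cmult[OF \<psi>, of c] by (simp add: spectral_def dist_of_def mult.left_commute[of _ c])
next
  define B where "B = fourier_const * (LINT x|lborel. cmod (v x))"
  have B: "cmod (inverse_fourier v x) \<le> B" for x unfolding inverse_fourier_def B_def by (rule fourier_bound)
  have B0: "B \<ge> 0" using order_trans[OF norm_ge_zero B] .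
  show "\<exists>N C. \<forall>\<psi>\<in>schwartz. cmod (spectral v \<psi>) \<le> C * schwartz_seminorm N \<psi>"
  proof (intro exI ballI)
    fix \<psi> assume \<psi>: "\<psi> \<in> schwartz"
    let ?n = "schwartz_seminorm 8 \<psi>"
    have le: "cmod (\<psi> x) \<le> ?n * decay x" for x
    proof -
      have "1 * cmod (\<psi> x) \<le> ((1 + norm x) ^ 8 * decay x) * cmod (\<psi> x)"
        by (intro mult_right_mono decay_ge) auto
      also have "\<dots> = ((1 + norm x) ^ 8 * cmod (\<psi> x)) * decay x" by simp
      also have "\<dots> \<le> ?n * decay x"
        using schwartz_seminorm_upper[OF \<psi>, of "[]" 8 x] by (intro mult_right_mono) (auto simp: partial_derivs_def)
      finally show ?thesis by simp
    qed
    have "cmod (spectral v \<psi>) = cmod (LINT x|lborel. inverse_fourier v x * \<psi> x)"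
      using \<psi> by (simp add: spectral_def dist_of_def)
    also have "\<dots> \<le> (LINT x|lborel. B * (?n * decay x))"
    proof (rule norm_integral_le)
      show "cmod (inverse_fourier v x * \<psi> x) \<le> B * (?n * decay x)" for x
        unfolding norm_mult by (intro mult_mono B le B0) auto
    qed (use inverse_fourier_multiplication(2)[OF v schwartz_integrable[OF \<psi>]] in auto)
    also have "\<dots> = (B * (LINT x|lborel. decay x)) * ?n" by simp
    finally show "cmod (spectral v \<psi>) \<le> (B * (LINT x|lborel. decay x)) * ?n" .
  qed
qed

text \<open>By inversion every Schwartz function is the Fourier transform of a Schwartz function;
  outside the Schwartz space both functionals are 0 by convention.\<close>

lemma tempered_fourier_dist_inj:
  assumes "u \<in> tempered" "v \<in> tempered" and eq: "fourier_dist u = fourier_dist v"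
  shows "u = v"
proof
  fix \<psi>
  show "u \<psi> = v \<psi>"
  proof (cases "\<psi> \<in> schwartz")
    case True
    let ?\<eta> = "\<lambda>x. fourier \<psi> (- x)"
    have \<eta>: "?\<eta> \<in> schwartz" by (intro schwartz_reflect fourier_schwartz True)
    have "fourier ?\<eta> = \<psi>"
      by (simp add: fun_eq_iff fourier_reflect[OF schwartz_measurable[OF fourier_schwartz[OF True]]] fourier_inversion[OF True])
    then show ?thesis using fun_cong[OF eq, of ?\<eta>] \<eta> by (simp add: fourier_dist_def)
  next
    case False
    then show ?thesis using assms by (simp add: tempered_def)
  qed
qed

text \<open>Completing the square: the product of two Gaussians is a multiple of a Gaussian. It
  allows a Gaussian weight to be absorbed into Gaussian test functions.\<close>

lemma gaussian_product:
  fixes x b :: "'a::real_inner"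
  assumes a: "a > 0"
  shows "exp (- (norm x)\<^sup>2) * exp (- a * (norm (x - b))\<^sup>2)
     = exp (- (a / (1 + a)) * (norm b)\<^sup>2) * exp (- (1 + a) * (norm (x - (a / (1 + a)) *\<^sub>R b))\<^sup>2)"
proof -
  define c where "c = a / (1 + a)"
  have c: "(1 + a) * c = a" using a by (simp add: c_def)
  have "- (norm x)\<^sup>2 + - a * (norm (x - b))\<^sup>2 = - (1 + a) * (x \<bullet> x) + 2 * a * (x \<bullet> b) - a * (b \<bullet> b)"
    by (simp add: power2_norm_eq_inner inner_diff_left inner_diff_right inner_commute algebra_simps)
  also have "\<dots> = - (1 + a) * (x \<bullet> x) + 2 * ((1 + a) * c) * (x \<bullet> b) - ((1 + a) * c) * c * (b \<bullet> b) - c * (b \<bullet> b)"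
  proof -
    have "((1 + a) * c) * c + c = a" using c by (metis distrib_right mult.commute mult_1 add.commute)
    then have "((1 + a) * c) * c * (b \<bullet> b) + c * (b \<bullet> b) = a * (b \<bullet> b)" by (metis distrib_right)
    then show ?thesis using c by simp
  qed
  also have "\<dots> = - c * (norm b)\<^sup>2 + - (1 + a) * (norm (x - c *\<^sub>R b))\<^sup>2"
    by (simp add: power2_norm_eq_inner inner_diff_left inner_diff_right inner_commute algebra_simps)
  finally show ?thesis by (simp only: exp_add[symmetric] c_def)
qed

text \<open>Gaussian convolutions of \<open>k\<close> vanish, hence so do its integrals against bounded continuous
  functions, against open sets, and against all Borel sets.\<close>

lemma gaussian_test_zero:
  fixes k :: "R3 \<Rightarrow> complex"
  assumes k: "integrable lborel k"
    and test: "\<And>a b. a > 0 \<Longrightarrow> (LINT x|lborel. k x * of_real (exp (- a * (norm (x - b))\<^sup>2))) = 0"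
  shows "AE x in lborel. k x = 0"
proof -
  have km [measurable]: "k \<in> borel_measurable borel" using k by auto
  have cont: "(LINT x|lborel. k x * f x) = 0"
    if f: "continuous_on UNIV f" and B: "\<And>x. cmod (f x) \<le> B" for f :: "R3 \<Rightarrow> complex" and B
  proof -
    have fm [measurable]: "f \<in> borel_measurable borel" using f by (rule borel_measurable_continuous_onI)
    have B0: "B \<ge> 0" using order_trans[OF norm_ge_zero B] .
    define c where "c n = inverse (real (Suc n))" for n
    have c: "c n > 0" "c \<longlonglongrightarrow> 0" for n
      using LIMSEQ_inverse_real_of_nat by (auto simp: c_def[abs_def])
    define J where "J n x = (LINT z|lborel. f (x + c n *\<^sub>R z) * of_real (exp (- (norm z)\<^sup>2)))" for n x
    have gi: "integrable lborel (\<lambda>z::R3. exp (- (norm z)\<^sup>2))" using gaussian_integral(1)[of 1] by simp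
    have Jm [measurable]: "J n \<in> borel_measurable borel" for n
    proof -
      have "(\<lambda>x. LINT z|lborel. f (x + c n *\<^sub>R z) * of_real (exp (- (norm z)\<^sup>2))) \<in> borel_measurable (lborel :: R3 measure)"
        by (rule lborel.borel_measurable_lebesgue_integral) measurable
      then show ?thesis unfolding J_def[abs_def] by simp
    qed
    have fgi: "integrable lborel (\<lambda>z. f (x + c n *\<^sub>R z) * of_real (exp (- (norm z)\<^sup>2)))" for x n
    proof (rule Bochner_Integration.integrable_bound)
      show "integrable lborel (\<lambda>z::R3. B * exp (- (norm z)\<^sup>2))" using gi by (rule integrable_mult_right)
      show "AE z in lborel. norm (f (x + c n *\<^sub>R z) * of_real (exp (- (norm z)\<^sup>2))) \<le> norm (B * exp (- (norm z)\<^sup>2))"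
        using B B0 by (intro AE_I2) (simp add: norm_mult mult_right_mono)
    qed measurable
    have JB: "cmod (J n x) \<le> B * sqrt pi ^ 3" for n x
    proof -
      have "cmod (J n x) \<le> (LINT z|lborel. B * exp (- (norm (z::R3))\<^sup>2))"
        unfolding J_def by (rule norm_integral_le[OF fgi]) (use gi B in \<open>auto simp: norm_mult intro!: mult_right_mono\<close>)
      then show ?thesis using gaussian_integral(2)[of 1, where 'a = R3] by simp
    qed
    \<comment> \<open>Up to the factor \<open>c n ^ 3\<close>, \<open>J n\<close> is the convolution
      of \<open>f\<close> with a Gaussian of width \<open>c n\<close>; Fubini moves this convolution
      onto \<open>k\<close>, where the hypothesis \<open>test\<close> makes it vanish.\<close>
    have zero: "(LINT x|lborel. k x * J n x) = 0" for n
    proof -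
      let ?a = "1 / (c n)\<^sup>2"
      have a: "?a > 0" using c(1)[of n] by simp
      let ?e = "\<lambda>x y. complex_of_real (exp (- ?a * (norm (y - x))\<^sup>2))"
      have ii: "integrable lborel (\<lambda>y. exp (- ?a * (norm (y - x))\<^sup>2))" for x :: R3
      proof -
        have m: "(\<lambda>z::R3. exp (- ?a * (norm z)\<^sup>2)) \<in> borel_measurable borel" by measurable
        show ?thesis using lborel_integral_shift(2)[OF m, of "-x"] gaussian_integral(1)[OF a, where 'a = R3] by simp
      qed
      have J: "c n ^ 3 *\<^sub>R J n x = (LINT y|lborel. f y * ?e x y)" for x
      proof -
        have m: "(\<lambda>y. f y * ?e x y) \<in> borel_measurable borel" by measurable
        have "?e x (x + c n *\<^sub>R z) = of_real (exp (- (norm z)\<^sup>2))" for z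
          using c(1)[of n] by (simp add: power_mult_distrib)
        then show ?thesis unfolding J_def lborel_integral_scaleR[OF m c(1)[of n], of x] by simp
      qed
      have int: "integrable (lborel \<Otimes>\<^sub>M lborel) (\<lambda>(x, y). k x * (f y * ?e x y))"
      proof (rule lborel_pair.Fubini_integrable)
        show "(\<lambda>(x, y). k x * (f y * ?e x y)) \<in> borel_measurable (lborel \<Otimes>\<^sub>M lborel)" by measurable
        have fe: "integrable lborel (\<lambda>y. f y * ?e x y)" for x
        proof (rule Bochner_Integration.integrable_bound)
          show "integrable lborel (\<lambda>y. B * exp (- ?a * (norm (y - x))\<^sup>2))" using ii by (rule integrable_mult_right)
          show "AE y in lborel. norm (f y * ?e x y) \<le> norm (B * exp (- ?a * (norm (y - x))\<^sup>2))"
            using B B0 by (intro AE_I2) (simp add: norm_mult mult_right_mono)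
        qed measurable
        then show "AE x in lborel. integrable lborel (\<lambda>y. case (x, y) of (x, y) \<Rightarrow> k x * (f y * ?e x y))"
          by (intro AE_I2) simp
        have *: "(LINT y|lborel. norm (k x * (f y * ?e x y))) \<le> cmod (k x) * (B * sqrt (pi / ?a) ^ 3)" for x
        proof -
          have "(LINT y|lborel. norm (k x * (f y * ?e x y))) = cmod (k x) * (LINT y|lborel. norm (f y * ?e x y))"
            by (simp add: norm_mult)
          also have "(LINT y|lborel. norm (f y * ?e x y)) \<le> (LINT y|lborel. B * exp (- ?a * (norm (y - x))\<^sup>2))"
          proof (rule integral_mono[OF integrable_norm[OF fe] integrable_mult_right[OF ii]])
            show "norm (f y * ?e x y) \<le> B * exp (- ?a * (norm (y - x))\<^sup>2)" for y
              using mult_right_mono[OF B, of "exp (- ?a * (norm (y - x))\<^sup>2)" y] by (simp add: norm_mult)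
          qed
          also have "\<dots> = B * (LINT y|lborel. exp (- ?a * (norm (y - x))\<^sup>2))" by simp
          also have "(LINT y|lborel. exp (- ?a * (norm (y - x))\<^sup>2)) = sqrt (pi / ?a) ^ 3"
          proof -
            have m: "(\<lambda>z::R3. exp (- ?a * (norm z)\<^sup>2)) \<in> borel_measurable borel" by measurable
            show ?thesis using lborel_integral_shift(1)[OF m, of "-x"] gaussian_integral(2)[OF a, where 'a = R3] by simp
          qed
          finally show ?thesis by (simp add: mult_left_mono)
        qed
        have le: "norm (LINT y|lborel. norm (k x * (f y * ?e x y))) \<le> norm (cmod (k x) * (B * sqrt (pi / ?a) ^ 3))" for x
        proof -
          have nn: "0 \<le> (LINT y|lborel. norm (k x * (f y * ?e x y)))" by (rule integral_nonneg_AE) simp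
          have "(LINT y|lborel. norm (k x * (f y * ?e x y))) \<le> \<bar>cmod (k x) * (B * sqrt (pi / ?a) ^ 3)\<bar>"
            by (rule order_trans[OF * abs_ge_self])
          then show ?thesis unfolding real_norm_def abs_of_nonneg[OF nn] .
        qed
        show "integrable lborel (\<lambda>x. LINT y|lborel. norm (case (x, y) of (x, y) \<Rightarrow> k x * (f y * ?e x y)))"
        proof (rule Bochner_Integration.integrable_bound)
          show "integrable lborel (\<lambda>x. cmod (k x) * (B * sqrt (pi / ?a) ^ 3))"
            using k by (intro integrable_mult_left integrable_norm)
          show "(\<lambda>x. LINT y|lborel. norm (case (x, y) of (x, y) \<Rightarrow> k x * (f y * ?e x y))) \<in> borel_measurable lborel"
            by (rule lborel.borel_measurable_lebesgue_integral) measurable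
          show "AE x in lborel. norm (LINT y|lborel. norm (case (x, y) of (x, y) \<Rightarrow> k x * (f y * ?e x y))) \<le> norm (cmod (k x) * (B * sqrt (pi / ?a) ^ 3))"
            using le by (intro AE_I2) simp
        qed
      qed
      have "c n ^ 3 *\<^sub>R (LINT x|lborel. k x * J n x) = (LINT x|lborel. (LINT y|lborel. k x * (f y * ?e x y)))"
      proof -
        have "c n ^ 3 *\<^sub>R (k x * J n x) = (LINT y|lborel. k x * (f y * ?e x y))" for x
        proof -
          have "c n ^ 3 *\<^sub>R (k x * J n x) = k x * (c n ^ 3 *\<^sub>R J n x)" by simp
          also have "\<dots> = (LINT y|lborel. k x * (f y * ?e x y))"
            unfolding J by (rule integral_mult_right_zero[symmetric])
          finally show ?thesis .
        qed
        then show ?thesis by (simp only: integral_scaleR_right[symmetric])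
      qed
      also have "\<dots> = (LINT y|lborel. (LINT x|lborel. k x * (f y * ?e x y)))"
        by (rule lborel_pair.Fubini_integral[OF int, symmetric])
      also have "\<dots> = (LINT y|lborel. f y * (LINT x|lborel. k x * of_real (exp (- ?a * (norm (x - y))\<^sup>2))))"
      proof -
        have "k x * (f y * ?e x y) = f y * (k x * of_real (exp (- ?a * (norm (x - y))\<^sup>2)))" for x y
          by (subst norm_minus_commute) (rule mult.left_commute)
        then show ?thesis by (simp only: integral_mult_right_zero)
      qed
      also have "\<dots> = 0" unfolding test[OF a] by simp
      finally show ?thesis using c(1)[of n] by simp
    qed
    have "(\<lambda>n. LINT x|lborel. k x * J n x) \<longlonglongrightarrow> (LINT x|lborel. k x * (f x * of_real (sqrt pi ^ 3)))"
    proof (rule integral_dominated_convergence[where w = "\<lambda>x. cmod (k x) * (B * sqrt pi ^ 3)"])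
      show "integrable lborel (\<lambda>x. cmod (k x) * (B * sqrt pi ^ 3))"
        using k by (intro integrable_mult_left integrable_norm)
      show "AE x in lborel. (\<lambda>n. k x * J n x) \<longlonglongrightarrow> k x * (f x * of_real (sqrt pi ^ 3))"
      proof (rule AE_I2)
        fix x
        have "isCont f x" using f by (simp add: continuous_on_eq_continuous_at)
        from gaussian_approximate_identity[OF fm B this c(2)]
        have "(\<lambda>n. J n x) \<longlonglongrightarrow> f x * of_real (sqrt pi ^ 3)" by (simp add: J_def)
        then show "(\<lambda>n. k x * J n x) \<longlonglongrightarrow> k x * (f x * of_real (sqrt pi ^ 3))" by (intro tendsto_intros)
      qed
      show "AE x in lborel. norm (k x * J n x) \<le> cmod (k x) * (B * sqrt pi ^ 3)" for n
        using JB by (intro AE_I2) (simp only: norm_mult mult_left_mono norm_ge_zero)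
    qed measurable
    then have "(LINT x|lborel. k x * (f x * of_real (sqrt pi ^ 3))) = 0"
      unfolding zero using LIMSEQ_unique tendsto_const by blast
    then show ?thesis by (simp flip: mult.assoc)
  qed
  have open0: "(LINT x|lborel. indicator U x *\<^sub>R k x) = 0" if U: "open U" for U :: "R3 set"
  \<comment> \<open>The whole space is separate because \<open>infdist\<close> to the empty set is
    0, which would make all cut-off functions zero.\<close>
  proof (cases "U = UNIV")
    case True
    then show ?thesis using cont[of "\<lambda>_. 1" 1] by simp
  next
    case False
    \<comment> \<open>Continuous functions between 0 and 1, zero off \<open>U\<close>, that increase
      to the indicator function of the open set \<open>U\<close>.\<close>
    define g where "g n x = min 1 (real n * infdist x (- U))" for n and x :: R3
    have gc: "continuous_on UNIV (\<lambda>x. complex_of_real (g n x))" for n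
      unfolding g_def by (intro continuous_intros continuous_on_of_real)
    have g01: "0 \<le> g n x" "g n x \<le> 1" for n x by (auto simp: g_def infdist_nonneg)
    have "(\<lambda>n. LINT x|lborel. k x * of_real (g n x)) \<longlonglongrightarrow> (LINT x|lborel. indicator U x *\<^sub>R k x)"
    proof (rule integral_dominated_convergence[where w = "\<lambda>x. cmod (k x)"])
      show "(\<lambda>x. k x * of_real (g n x)) \<in> borel_measurable lborel" for n
        using borel_measurable_times[OF km borel_measurable_continuous_onI[OF gc]] by simp
      show "(\<lambda>x. indicat_real U x *\<^sub>R k x) \<in> borel_measurable lborel"
        by (intro borel_measurable_scaleR borel_measurable_indicator) (use U km in simp_all)
      show "AE x in lborel. norm (k x * of_real (g n x)) \<le> cmod (k x)" for n
        using g01 by (intro AE_I2) (simp add: norm_mult mult_left_le)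
      show "AE x in lborel. (\<lambda>n. k x * of_real (g n x)) \<longlonglongrightarrow> indicator U x *\<^sub>R k x"
      proof (rule AE_I2)
        fix x :: R3
        have "(\<lambda>n. g n x) \<longlonglongrightarrow> indicator U x"
        proof (cases "x \<in> U")
          case False
          then show ?thesis by (simp add: g_def)
        next
          case True
          have "closed (- U)" "- U \<noteq> {}" using U False by (auto simp: closed_Compl)
          then have pos: "infdist x (- U) > 0" using True by (metis ComplD infdist_pos_not_in_closed)
          obtain N :: nat where N: "1 / infdist x (- U) \<le> real N" using real_arch_simple by blast
          have "g n x = 1" if "n \<ge> N" for n
          proof -
            have "1 / infdist x (- U) \<le> real n" using N that by (meson of_nat_le_iff order_trans)
            then have "1 \<le> real n * infdist x (- U)" using pos by (simp add: field_simps)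
            then show ?thesis by (simp add: g_def)
          qed
          then have "\<forall>\<^sub>F n in sequentially. g n x = 1" by (auto simp: eventually_sequentially)
          then show ?thesis using True by (simp add: tendsto_eventually)
        qed
        then have "(\<lambda>n. k x * of_real (g n x)) \<longlonglongrightarrow> k x * of_real (indicator U x)" by (intro tendsto_intros)
        then show "(\<lambda>n. k x * of_real (g n x)) \<longlonglongrightarrow> indicator U x *\<^sub>R k x"
          by (simp add: scaleR_conv_of_real mult.commute)
      qed
    qed (use k in auto)
    moreover have "(LINT x|lborel. k x * of_real (g n x)) = 0" for n
      by (rule cont[OF gc, where B = 1]) (use g01 in auto)
    ultimately have "(\<lambda>n::nat. 0) \<longlonglongrightarrow> (LINT x|lborel. indicator U x *\<^sub>R k x)" by (simp only:)
    then show ?thesis by (simp add: LIMSEQ_const_iff)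
  qed
  \<comment> \<open>Open sets form an intersection-stable generator of the Borel sets, and the
    property passes to complements and disjoint unions.\<close>
  have "set_lebesgue_integral lborel A k = 0" if "A \<in> sets borel" for A
  proof -
    have sb: "sets (borel :: R3 measure) = sigma_sets UNIV {S. open S}"
      unfolding borel_def by (rule sets_measure_of) simp
    have "Int_stable {S::R3 set. open S}" by (auto simp: Int_stable_def)
    moreover have "{S::R3 set. open S} \<subseteq> Pow UNIV" by simp
    moreover have "A \<in> sigma_sets UNIV {S. open S}" using that unfolding sb .
    ultimately show ?thesis
    proof (induction rule: sigma_sets_induct_disjoint)
      case (basic A)
      then show ?case using open0 by (simp add: set_lebesgue_integral_def)
    next
      case (compl A)
      then have A: "A \<in> sets borel" unfolding sb by blast
      have "indicator (UNIV - A) x *\<^sub>R k x = k x - indicator A x *\<^sub>R k x" for x by (simp split: split_indicator)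
      moreover have "integrable lborel (\<lambda>x. indicator A x *\<^sub>R k x)"
        by (rule integrable_mult_indicator[OF _ k]) (simp add: A)
      ultimately have "set_lebesgue_integral lborel (UNIV - A) k = (LINT x|lborel. k x) - set_lebesgue_integral lborel A k"
        using k by (simp add: set_lebesgue_integral_def)
      then show ?case using compl open0[of UNIV] by simp
    next
      case (union A)
      then have A: "A i \<in> sets lborel" for i unfolding sets_lborel sb by blast
      have "set_lebesgue_integral lborel (\<Union>i. A i) k = (\<Sum>i. set_lebesgue_integral lborel (A i) k)"
      proof (rule lebesgue_integral_countable_add[OF A])
        show "set_integrable lborel (\<Union>i. A i) k"
          unfolding set_integrable_def by (rule integrable_mult_indicator[OF sets.countable_UN k]) (use A in blast)
        show "i \<noteq> j \<Longrightarrow> A i \<inter> A j = {}" for i j using union(1) by (auto simp: disjoint_family_on_def)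
      qed
      then show ?case using union by simp
    qed (auto simp: set_lebesgue_integral_def)
  qed
  then show ?thesis by (intro sigma_finite_measure.density_zero[OF lborel.sigma_finite_measure_axioms] k) auto
qed

text \<open>The difference \<open>f - g\<close> need not be integrable. Multiplied by one Gaussian
  it is, and Gaussian tests of the product are Gaussian tests of \<open>f - g\<close>, which vanish
  because Gaussians are Schwartz functions. Consequently the choice in \<open>fun_of\<close> matters
  only on null sets.\<close>

lemma represented_by_unique:
  assumes f: "represented_by u f" and g: "represented_by u g"
  shows "AE x in lborel. f x = g x"
proof -
  have [measurable]: "f \<in> borel_measurable borel" "g \<in> borel_measurable borel"
    using f g by (auto simp: represented_by_def)
  have fi: "integrable lborel (\<lambda>x. f x * \<psi> x)" and gi: "integrable lborel (\<lambda>x. g x * \<psi> x)"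
    and eq: "(LINT x|lborel. f x * \<psi> x) = (LINT x|lborel. g x * \<psi> x)" if "\<psi> \<in> schwartz" for \<psi>
    using f g that unfolding represented_by_def dist_of_def by (auto dest: fun_cong[of _ _ \<psi>])
  define k where "k x = (f x - g x) * of_real (exp (- 1 * (norm (x - 0))\<^sup>2))" for x
  have S1: "(\<lambda>x::R3. complex_of_real (exp (- 1 * (norm (x - 0))\<^sup>2))) \<in> schwartz" by (rule gaussian_schwartz) simp
  have "AE x in lborel. k x = 0"
  proof (rule gaussian_test_zero)
    show "integrable lborel k"
      unfolding k_def[abs_def] left_diff_distrib by (intro Bochner_Integration.integrable_diff fi gi S1)
    fix a :: real and b :: R3 assume a: "a > 0"
    let ?c = "complex_of_real (exp (- (a / (1 + a)) * (norm b)\<^sup>2))"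
    let ?\<psi> = "\<lambda>x. ?c * of_real (exp (- (1 + a) * (norm (x - (a / (1 + a)) *\<^sub>R b))\<^sup>2))"
    have S: "?\<psi> \<in> schwartz" by (intro schwartz_cmult gaussian_schwartz) (use a in simp)
    have "k x * of_real (exp (- a * (norm (x - b))\<^sup>2)) = f x * ?\<psi> x - g x * ?\<psi> x" for x
    proof -
      have "exp (- 1 * (norm (x - 0))\<^sup>2) * exp (- a * (norm (x - b))\<^sup>2) = exp (- (a / (1 + a)) * (norm b)\<^sup>2) * exp (- (1 + a) * (norm (x - (a / (1 + a)) *\<^sub>R b))\<^sup>2)"
        using gaussian_product[OF a, of x b] by simp
      then show ?thesis
        unfolding k_def mult.assoc of_real_mult[symmetric] by (simp only: left_diff_distrib)
    qed
    then have "(LINT x|lborel. k x * of_real (exp (- a * (norm (x - b))\<^sup>2))) = (LINT x|lborel. f x * ?\<psi> x) - (LINT x|lborel. g x * ?\<psi> x)"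
      by (simp only: Bochner_Integration.integral_diff[OF fi[OF S] gi[OF S]])
    then show "(LINT x|lborel. k x * of_real (exp (- a * (norm (x - b))\<^sup>2))) = 0" using eq[OF S] by simp
  qed
  then show ?thesis by eventually_elim (simp add: k_def)
qed

lemma represented_by_fun_of:
  assumes "represented_by u f"
  shows "represented_by u (fun_of u)" and "AE x in lborel. fun_of u x = f x"
proof -
  show r: "represented_by u (fun_of u)" unfolding fun_of_def by (rule someI[of "represented_by u", OF assms])
  show "AE x in lborel. fun_of u x = f x" by (rule represented_by_unique[OF r assms])
qed

lemma represented_by_cong:
  assumes f: "represented_by u f" and g: "g \<in> borel_measurable borel" and eq: "AE x in lborel. f x = g x"
  shows "represented_by u g"
proof -
  have fm: "f \<in> borel_measurable borel" and fi: "\<And>\<psi>. \<psi> \<in> schwartz \<Longrightarrow> integrable lborel (\<lambda>x. f x * \<psi> x)"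
    and u: "u = dist_of f" using f by (auto simp: represented_by_def)
  have m: "(\<lambda>x. f x * \<psi> x) \<in> borel_measurable lborel" "(\<lambda>x. g x * \<psi> x) \<in> borel_measurable lborel" if "\<psi> \<in> schwartz" for \<psi>
    using borel_measurable_times[OF fm schwartz_measurable[OF that]] borel_measurable_times[OF g schwartz_measurable[OF that]] by auto
  have ae: "AE x in lborel. f x * \<psi> x = g x * \<psi> x" for \<psi> using eq by eventually_elim simp
  have "integrable lborel (\<lambda>x. g x * \<psi> x)" if "\<psi> \<in> schwartz" for \<psi>
    using fi[OF that] integrable_cong_AE[OF m[OF that] ae] by blast
  moreover have "dist_of f \<psi> = dist_of g \<psi>" for \<psi>
    unfolding dist_of_def using integral_cong_AE[OF m ae] by simp
  ultimately show ?thesis using g u by (auto simp: represented_by_def)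
qed

section \<open>Sobolev spaces\<close>

lemma le_sqrt_mult_of_weighted:
  fixes A B I :: real
  assumes A: "A \<ge> 0" and B: "B \<ge> 0" and le: "\<And>t. t > 0 \<Longrightarrow> 2 * I \<le> t * A + B / t"
  shows "I \<le> sqrt A * sqrt B"
proof (cases "I \<le> 0")
  case True
  have "0 \<le> sqrt A * sqrt B" using A B by simp
  then show ?thesis using True by linarith
next
  case I: False
  show ?thesis
  proof (cases "A = 0 \<or> B = 0")
    case True
    then show ?thesis
    proof
      assume "A = 0"
      \<comment> \<open>The choice \<open>t = (B + 1) / I\<close> makes \<open>B / t\<close> smaller
        than \<open>I\<close> for every \<open>B\<close>, including 0.\<close>
      have "2 * I \<le> (B + 1) / I * A + B / ((B + 1) / I)" by (rule le) (use I B in simp)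
      then have "2 * I \<le> I * (B / (B + 1))" using \<open>A = 0\<close> by (simp add: mult.commute)
      also have "\<dots> \<le> I * 1" using I B by (intro mult_left_mono) auto
      finally show ?thesis using I by simp
    next
      assume "B = 0"
      have "2 * I \<le> I / (A + 1) * A + B / (I / (A + 1))" by (rule le) (use I A in simp)
      then have "2 * I \<le> I * (A / (A + 1))" using \<open>B = 0\<close> by simp
      also have "\<dots> \<le> I * 1" using I A by (intro mult_left_mono) auto
      finally show ?thesis using I by simp
    qed
  next
    case False
    then have pos: "sqrt A > 0" "sqrt B > 0" using A B by auto
    have "2 * I \<le> sqrt B / sqrt A * A + B / (sqrt B / sqrt A)" by (rule le) (use pos in simp)
    also have "sqrt B / sqrt A * A = sqrt A * sqrt B"
      using A pos by (metis mult.commute nonzero_mult_div_cancel_right order_less_irrefl real_sqrt_mult_self abs_of_nonneg times_divide_eq_left times_divide_eq_right)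
    also have "B / (sqrt B / sqrt A) = sqrt A * sqrt B"
      using B pos by (metis mult.commute real_div_sqrt divide_divide_eq_right times_divide_eq_left)
    finally show ?thesis by simp
  qed
qed

text \<open>Integrate the weighted inequality \<open>2 a b <= t a^2 + b^2 / t\<close> and optimise
  over \<open>t\<close>. Both functions enter through absolute values, so the bound serves bilinear
  pairings as well.\<close>

lemma L2_Cauchy_Schwarz:
  fixes f g :: "'a \<Rightarrow> complex"
  assumes fm: "f \<in> borel_measurable M" and gm: "g \<in> borel_measurable M"
    and f: "integrable M (\<lambda>x. (cmod (f x))\<^sup>2)" and g: "integrable M (\<lambda>x. (cmod (g x))\<^sup>2)"
  shows "integrable M (\<lambda>x. f x * g x)"
    and "(LINT x|M. cmod (f x) * cmod (g x)) \<le> sqrt (LINT x|M. (cmod (f x))\<^sup>2) * sqrt (LINT x|M. (cmod (g x))\<^sup>2)"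
proof -
  have young: "2 * (a * b) \<le> t * a\<^sup>2 + b\<^sup>2 / t" if "t > 0" for a b t :: real
  proof -
    have "0 \<le> (t * a - b)\<^sup>2 / t" using that by simp
    also have "\<dots> = t * a\<^sup>2 + b\<^sup>2 / t - 2 * (a * b)" using that by (simp add: field_simps power2_eq_square)
    finally show ?thesis by simp
  qed
  show i: "integrable M (\<lambda>x. f x * g x)"
  proof (rule Bochner_Integration.integrable_bound)
    show "integrable M (\<lambda>x. (cmod (f x))\<^sup>2 + (cmod (g x))\<^sup>2)" using f g by (rule Bochner_Integration.integrable_add)
    show "(\<lambda>x. f x * g x) \<in> borel_measurable M" using fm gm by (rule borel_measurable_times)
    show "AE x in M. norm (f x * g x) \<le> norm ((cmod (f x))\<^sup>2 + (cmod (g x))\<^sup>2)"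
    proof (rule AE_I2)
      fix x
      have "2 * (cmod (f x) * cmod (g x)) \<le> (cmod (f x))\<^sup>2 + (cmod (g x))\<^sup>2" using young[of 1] by simp
      moreover have "0 \<le> cmod (f x) * cmod (g x)" by simp
      ultimately have "cmod (f x) * cmod (g x) \<le> (cmod (f x))\<^sup>2 + (cmod (g x))\<^sup>2" by linarith
      then show "norm (f x * g x) \<le> norm ((cmod (f x))\<^sup>2 + (cmod (g x))\<^sup>2)" unfolding norm_mult by simp
    qed
  qed
  have ia: "integrable M (\<lambda>x. cmod (f x) * cmod (g x))"
    using integrable_norm[OF i] by (simp add: norm_mult)
  show "(LINT x|M. cmod (f x) * cmod (g x)) \<le> sqrt (LINT x|M. (cmod (f x))\<^sup>2) * sqrt (LINT x|M. (cmod (g x))\<^sup>2)"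
  proof (rule le_sqrt_mult_of_weighted)
    fix t :: real assume t: "t > 0"
    have "(LINT x|M. 2 * (cmod (f x) * cmod (g x))) \<le> (LINT x|M. t * (cmod (f x))\<^sup>2 + (cmod (g x))\<^sup>2 / t)"
      by (rule integral_mono) (use f g ia young[OF t] in auto)
    then show "2 * (LINT x|M. cmod (f x) * cmod (g x)) \<le> t * (LINT x|M. (cmod (f x))\<^sup>2) + (LINT x|M. (cmod (g x))\<^sup>2) / t"
      using f g by simp
  qed (auto intro!: integral_nonneg_AE)
qed

section \<open>Sobolev norms as weighted \<open>L^2\<close> norms of the Fourier transform\<close>

definition freq :: "dist3 \<Rightarrow> R3 \<Rightarrow> complex"
  where "freq u = fun_of (fourier_dist u)"

text \<open>The weight of the squared \<open>H^s\<close> norm, that is, the Japanese bracket to the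
  power \<open>2 s\<close>.\<close>

definition bracket :: "real \<Rightarrow> R3 \<Rightarrow> real"
  where "bracket s \<xi> = (1 + (norm \<xi>)\<^sup>2) powr s"

lemma bracket_pos [simp]: "bracket s \<xi> > 0"
proof -
  have "1 + (norm \<xi>)\<^sup>2 > 0" by (metis add_pos_nonneg zero_le_power2 zero_less_one)
  then show ?thesis by (simp add: bracket_def)
qed

lemma bracket_measurable [measurable]: "bracket s \<in> borel_measurable borel"
  unfolding bracket_def[abs_def] by measurable

lemma sqrt_bracket_measurable: "(\<lambda>\<xi>. complex_of_real (sqrt (bracket s \<xi>))) \<in> borel_measurable borel"
  by measurable

lemma freq_eq_AE:
  "represented_by (fourier_dist u) g \<Longrightarrow> AE \<xi> in lborel. freq u \<xi> = g \<xi>"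
  unfolding freq_def by (rule represented_by_fun_of)

lemma Hs_carrierD:
  assumes "u \<in> ncarrier (Hs s)"
  shows "u \<in> tempered" "represented_by (fourier_dist u) (freq u)" "freq u \<in> borel_measurable borel"
    "integrable lborel (\<lambda>\<xi>. bracket s \<xi> * (cmod (freq u \<xi>))\<^sup>2)"
proof -
  obtain g where u: "u \<in> tempered" and g: "represented_by (fourier_dist u) g"
    and i: "integrable lborel (\<lambda>\<xi>. bracket s \<xi> * (cmod (g \<xi>))\<^sup>2)"
    using assms unfolding Hs_def bracket_def by auto
  show "u \<in> tempered" by (rule u)
  show r: "represented_by (fourier_dist u) (freq u)" unfolding freq_def by (rule represented_by_fun_of[OF g])
  show m: "freq u \<in> borel_measurable borel" using r by (simp add: represented_by_def)
  have gm: "g \<in> borel_measurable borel" using g by (simp add: represented_by_def)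
  have "AE \<xi> in lborel. bracket s \<xi> * (cmod (g \<xi>))\<^sup>2 = bracket s \<xi> * (cmod (freq u \<xi>))\<^sup>2"
    using freq_eq_AE[OF g] by eventually_elim simp
  then show "integrable lborel (\<lambda>\<xi>. bracket s \<xi> * (cmod (freq u \<xi>))\<^sup>2)"
    using i integrable_cong_AE[of "\<lambda>\<xi>. bracket s \<xi> * (cmod (g \<xi>))\<^sup>2" lborel "\<lambda>\<xi>. bracket s \<xi> * (cmod (freq u \<xi>))\<^sup>2"] m gm
    by (simp add: borel_measurable_times)
qed

lemma nnorm_Hs: "nnorm (Hs s) u = sqrt (LINT \<xi>|lborel. bracket s \<xi> * (cmod (freq u \<xi>))\<^sup>2)"
  by (simp add: Hs_def bracket_def freq_def)

text \<open>Lets the norm be computed with any representative \<open>g\<close> of the transform: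
  \<open>freq\<close> is a chosen one and agrees with \<open>g\<close> almost everywhere.\<close>

lemma Hs_memI:
  assumes "u \<in> tempered" and g: "represented_by (fourier_dist u) g"
    and i: "integrable lborel (\<lambda>\<xi>. bracket s \<xi> * (cmod (g \<xi>))\<^sup>2)"
  shows "u \<in> ncarrier (Hs s)"
    and "nnorm (Hs s) u = sqrt (LINT \<xi>|lborel. bracket s \<xi> * (cmod (g \<xi>))\<^sup>2)"
proof -
  show u: "u \<in> ncarrier (Hs s)" using assms unfolding Hs_def bracket_def by auto
  have gm: "g \<in> borel_measurable borel" using g by (simp add: represented_by_def)
  have "AE \<xi> in lborel. bracket s \<xi> * (cmod (freq u \<xi>))\<^sup>2 = bracket s \<xi> * (cmod (g \<xi>))\<^sup>2"
    using freq_eq_AE[OF g] by eventually_elim simp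
  then have "(LINT \<xi>|lborel. bracket s \<xi> * (cmod (freq u \<xi>))\<^sup>2) = (LINT \<xi>|lborel. bracket s \<xi> * (cmod (g \<xi>))\<^sup>2)"
    by (intro integral_cong_AE) (use Hs_carrierD(3)[OF u] gm in \<open>simp_all add: borel_measurable_times\<close>)
  then show "nnorm (Hs s) u = sqrt (LINT \<xi>|lborel. bracket s \<xi> * (cmod (g \<xi>))\<^sup>2)" by (simp add: nnorm_Hs)
qed

lemma tempered_add:
  assumes u: "u \<in> tempered" and v: "v \<in> tempered"
  shows "u + v \<in> tempered"
proof -
  obtain N C where C: "\<And>\<psi>. \<psi> \<in> schwartz \<Longrightarrow> cmod (u \<psi>) \<le> C * schwartz_seminorm N \<psi>"
    using u unfolding tempered_def by blast
  obtain M D where D: "\<And>\<psi>. \<psi> \<in> schwartz \<Longrightarrow> cmod (v \<psi>) \<le> D * schwartz_seminorm M \<psi>"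
    using v unfolding tempered_def by blast
  have bd: "cmod (u \<psi> + v \<psi>) \<le> (\<bar>C\<bar> + \<bar>D\<bar>) * schwartz_seminorm (max N M) \<psi>" if \<psi>: "\<psi> \<in> schwartz" for \<psi>
  proof -
    have le: "K * schwartz_seminorm L \<psi> \<le> \<bar>K\<bar> * schwartz_seminorm (max N M) \<psi>" if "L \<le> max N M" for K :: real and L
      using schwartz_seminorm_mono[OF \<psi> that] schwartz_seminorm_nonneg[OF \<psi>, of L] by (intro mult_mono) auto
    show ?thesis
      using le[of N C] le[of M D] C[OF \<psi>] D[OF \<psi>] norm_triangle_ineq[of "u \<psi>" "v \<psi>"] by (simp add: distrib_right)
  qed
  have "u \<psi> + v \<psi> = 0" if "\<psi> \<notin> schwartz" for \<psi> using u v that by (simp add: tempered_def)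
  moreover have "u (\<lambda>x. \<psi> x + \<eta> x) + v (\<lambda>x. \<psi> x + \<eta> x) = (u \<psi> + v \<psi>) + (u \<eta> + v \<eta>)" if "\<psi> \<in> schwartz" "\<eta> \<in> schwartz" for \<psi> \<eta>
    using u v that by (simp add: tempered_def)
  moreover have "u (\<lambda>x. c * \<psi> x) + v (\<lambda>x. c * \<psi> x) = c * (u \<psi> + v \<psi>)" if "\<psi> \<in> schwartz" for c \<psi>
    using u v that by (simp add: tempered_def distrib_left)
  ultimately show ?thesis unfolding tempered_def plus_fun_def using bd by blast
qed

lemma tempered_scaleR:
  assumes u: "u \<in> tempered"
  shows "c *\<^sub>R u \<in> tempered"
proof -
  obtain N C where C: "\<And>\<psi>. \<psi> \<in> schwartz \<Longrightarrow> cmod (u \<psi>) \<le> C * schwartz_seminorm N \<psi>"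
    using u unfolding tempered_def by blast
  have bd: "cmod (c *\<^sub>R u \<psi>) \<le> (\<bar>c\<bar> * C) * schwartz_seminorm N \<psi>" if "\<psi> \<in> schwartz" for \<psi>
    using mult_left_mono[OF C[OF that], of "\<bar>c\<bar>"] by (simp add: mult.assoc)
  have "c *\<^sub>R u \<psi> = 0" if "\<psi> \<notin> schwartz" for \<psi> using u that by (simp add: tempered_def)
  moreover have "c *\<^sub>R u (\<lambda>x. \<psi> x + \<eta> x) = c *\<^sub>R u \<psi> + c *\<^sub>R u \<eta>" if "\<psi> \<in> schwartz" "\<eta> \<in> schwartz" for \<psi> \<eta>
    using u that by (simp add: tempered_def scaleR_add_right)
  moreover have "c *\<^sub>R u (\<lambda>x. d * \<psi> x) = d * (c *\<^sub>R u \<psi>)" if "\<psi> \<in> schwartz" for d \<psi>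
    using u that by (simp add: tempered_def)
  ultimately show ?thesis unfolding tempered_def scaleR_fun_def using bd by blast
qed

lemma represented_by_add:
  assumes f: "represented_by u f" and g: "represented_by v g"
  shows "represented_by (u + v) (\<lambda>x. f x + g x)"
  unfolding represented_by_def
proof (intro conjI ballI)
  have fm: "f \<in> borel_measurable borel" "g \<in> borel_measurable borel" using f g by (auto simp: represented_by_def)
  then show "(\<lambda>x. f x + g x) \<in> borel_measurable borel" by (rule borel_measurable_add)
  have i: "integrable lborel (\<lambda>x. f x * \<psi> x)" "integrable lborel (\<lambda>x. g x * \<psi> x)" if "\<psi> \<in> schwartz" for \<psi>
    using f g that by (auto simp: represented_by_def)
  show "integrable lborel (\<lambda>x. (f x + g x) * \<psi> x)" if "\<psi> \<in> schwartz" for \<psi>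
    unfolding distrib_right by (intro Bochner_Integration.integrable_add i that)
  have "u = dist_of f" "v = dist_of g" using f g by (auto simp: represented_by_def)
  then show "u + v = dist_of (\<lambda>x. f x + g x)"
    by (auto simp: fun_eq_iff dist_of_def distrib_right i)
qed

lemma represented_by_scaleR:
  assumes f: "represented_by u f"
  shows "represented_by (c *\<^sub>R u) (\<lambda>x. of_real c * f x)"
  unfolding represented_by_def
proof (intro conjI ballI)
  have fm: "f \<in> borel_measurable borel" using f by (auto simp: represented_by_def)
  then show "(\<lambda>x. of_real c * f x) \<in> borel_measurable borel" by (intro borel_measurable_times) auto
  show "integrable lborel (\<lambda>x. of_real c * f x * \<psi> x)" if "\<psi> \<in> schwartz" for \<psi>
    unfolding mult.assoc by (intro integrable_mult_right) (use f that in \<open>auto simp: represented_by_def\<close>)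
  have "u = dist_of f" using f by (auto simp: represented_by_def)
  then show "c *\<^sub>R u = dist_of (\<lambda>x. of_real c * f x)"
    by (auto simp: fun_eq_iff dist_of_def scaleR_fun_def scaleR_conv_of_real mult.assoc)
qed

lemma fourier_dist_add: "fourier_dist (u + v) = fourier_dist u + fourier_dist v"
  by (auto simp: fourier_dist_def fun_eq_iff)

lemma fourier_dist_scaleR: "fourier_dist (c *\<^sub>R u) = c *\<^sub>R fourier_dist u"
  by (auto simp: fourier_dist_def fun_eq_iff scaleR_fun_def)

lemma cmod_sqrt_bracket_square:
  "(cmod (of_real (sqrt (bracket s \<xi>)) * z))\<^sup>2 = bracket s \<xi> * (cmod z)\<^sup>2"
  using less_imp_le[OF bracket_pos[of s \<xi>]] by (simp add: norm_mult power_mult_distrib)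

text \<open>With \<open>sqrt (bracket s)\<close> as a factor of the transforms this is Minkowski's
  inequality in \<open>L^2\<close>, obtained from Cauchy-Schwarz by expanding the square. The
  transform of a sum is represented by the sum of the chosen representatives, which suffices by
  \<open>Hs_memI\<close>.\<close>

lemma seminormed_Hs: "seminormed (Hs s)"
  unfolding seminormed_def
proof (intro conjI ballI allI)
  have zt: "0 \<in> tempered"
    unfolding tempered_def by (auto intro!: exI[of _ 0])
  have zr: "represented_by (fourier_dist 0) (\<lambda>x. 0)"
    by (auto simp: represented_by_def fourier_dist_def dist_of_def fun_eq_iff)
  show "0 \<in> ncarrier (Hs s)" by (rule Hs_memI(1)[OF zt zr]) simp
  fix u assume u: "u \<in> ncarrier (Hs s)"
  note U = Hs_carrierD[OF u]
  show "0 \<le> nnorm (Hs s) u" unfolding nnorm_Hs by (intro real_sqrt_ge_zero integral_nonneg_AE) (simp add: less_imp_le)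
  {
    fix v assume v: "v \<in> ncarrier (Hs s)"
    note V = Hs_carrierD[OF v]
    let ?W = "\<lambda>\<xi>. complex_of_real (sqrt (bracket s \<xi>))"
    let ?a = "\<lambda>\<xi>. ?W \<xi> * freq u \<xi>" and ?b = "\<lambda>\<xi>. ?W \<xi> * freq v \<xi>"
    have am: "?a \<in> borel_measurable lborel" "?b \<in> borel_measurable lborel"
      using borel_measurable_times[OF sqrt_bracket_measurable[of s] U(3)]
        borel_measurable_times[OF sqrt_bracket_measurable[of s] V(3)] by simp_all
    have ai: "integrable lborel (\<lambda>\<xi>. (cmod (?a \<xi>))\<^sup>2)" "integrable lborel (\<lambda>\<xi>. (cmod (?b \<xi>))\<^sup>2)"
      unfolding cmod_sqrt_bracket_square using U(4) V(4) .
    note CS = L2_Cauchy_Schwarz[OF am ai]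
    have ci: "integrable lborel (\<lambda>\<xi>. cmod (?a \<xi>) * cmod (?b \<xi>))"
      using integrable_norm[OF CS(1)] unfolding norm_mult .
    have pw: "(cmod (?a \<xi> + ?b \<xi>))\<^sup>2 \<le> (cmod (?a \<xi>))\<^sup>2 + 2 * (cmod (?a \<xi>) * cmod (?b \<xi>)) + (cmod (?b \<xi>))\<^sup>2" for \<xi>
    proof -
      have "(cmod (?a \<xi> + ?b \<xi>))\<^sup>2 \<le> (cmod (?a \<xi>) + cmod (?b \<xi>))\<^sup>2" by (intro power_mono norm_triangle_ineq) auto
      then show ?thesis by (simp add: power2_sum mult.assoc)
    qed
    have ri: "integrable lborel (\<lambda>\<xi>. (cmod (?a \<xi>))\<^sup>2 + 2 * (cmod (?a \<xi>) * cmod (?b \<xi>)) + (cmod (?b \<xi>))\<^sup>2)"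
      by (intro Bochner_Integration.integrable_add integrable_mult_right ai ci)
    have si: "integrable lborel (\<lambda>\<xi>. (cmod (?a \<xi> + ?b \<xi>))\<^sup>2)"
    proof (rule Bochner_Integration.integrable_bound[OF ri])
      show "(\<lambda>\<xi>. (cmod (?a \<xi> + ?b \<xi>))\<^sup>2) \<in> borel_measurable lborel"
        using borel_measurable_add[OF am] by measurable
      show "AE \<xi> in lborel. norm ((cmod (?a \<xi> + ?b \<xi>))\<^sup>2) \<le> norm ((cmod (?a \<xi>))\<^sup>2 + 2 * (cmod (?a \<xi>) * cmod (?b \<xi>)) + (cmod (?b \<xi>))\<^sup>2)"
        by (intro AE_I2, unfold real_norm_def, rule order_trans[OF _ abs_ge_self], subst abs_of_nonneg) (simp_all only: pw zero_le_power2)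
    qed
    have eq: "?a \<xi> + ?b \<xi> = ?W \<xi> * (freq u \<xi> + freq v \<xi>)" for \<xi> by (simp only: distrib_left)
    have rep: "represented_by (fourier_dist (u + v)) (\<lambda>\<xi>. freq u \<xi> + freq v \<xi>)"
      unfolding fourier_dist_add by (rule represented_by_add[OF U(2) V(2)])
    note mem = Hs_memI[OF tempered_add[OF U(1) V(1)] rep si[unfolded eq cmod_sqrt_bracket_square]]
    show "u + v \<in> ncarrier (Hs s)" by (rule mem)
    define A B where "A = (LINT \<xi>|lborel. (cmod (?a \<xi>))\<^sup>2)" and "B = (LINT \<xi>|lborel. (cmod (?b \<xi>))\<^sup>2)"
    have AB: "A \<ge> 0" "B \<ge> 0" unfolding A_def B_def by (simp_all add: integral_nonneg_AE)
    have nrm: "nnorm (Hs s) u = sqrt A" "nnorm (Hs s) v = sqrt B"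
      unfolding nnorm_Hs A_def B_def cmod_sqrt_bracket_square by (rule refl)+
    have "(LINT \<xi>|lborel. (cmod (?a \<xi> + ?b \<xi>))\<^sup>2) \<le> (LINT \<xi>|lborel. (cmod (?a \<xi>))\<^sup>2 + 2 * (cmod (?a \<xi>) * cmod (?b \<xi>)) + (cmod (?b \<xi>))\<^sup>2)"
      by (rule integral_mono[OF si ri pw])
    also have "\<dots> = A + 2 * (LINT \<xi>|lborel. cmod (?a \<xi>) * cmod (?b \<xi>)) + B"
      unfolding A_def B_def using ai ci by (subst Bochner_Integration.integral_add, auto)+
    also have "\<dots> \<le> A + 2 * (sqrt A * sqrt B) + B" using CS(2) unfolding A_def B_def by simp
    also have "\<dots> = (sqrt A + sqrt B)\<^sup>2" using AB by (simp add: power2_sum)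
    finally have "sqrt (LINT \<xi>|lborel. (cmod (?a \<xi> + ?b \<xi>))\<^sup>2) \<le> sqrt A + sqrt B"
      using AB by (intro real_le_lsqrt) auto
    then show "nnorm (Hs s) (u + v) \<le> nnorm (Hs s) u + nnorm (Hs s) v"
      unfolding nrm mem(2) eq cmod_sqrt_bracket_square .
  }
  {
    fix c
    have rep: "represented_by (fourier_dist (c *\<^sub>R u)) (\<lambda>\<xi>. of_real c * freq u \<xi>)"
      unfolding fourier_dist_scaleR by (rule represented_by_scaleR[OF U(2)])
    have eq: "bracket s \<xi> * (cmod (of_real c * freq u \<xi>))\<^sup>2 = c\<^sup>2 * (bracket s \<xi> * (cmod (freq u \<xi>))\<^sup>2)" for \<xi>
      by (simp add: norm_mult power_mult_distrib)
    have i: "integrable lborel (\<lambda>\<xi>. bracket s \<xi> * (cmod (of_real c * freq u \<xi>))\<^sup>2)"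
      unfolding eq by (rule integrable_mult_right[OF U(4)])
    note mem = Hs_memI[OF tempered_scaleR[OF U(1)] rep i]
    show "c *\<^sub>R u \<in> ncarrier (Hs s)" by (rule mem)
    show "nnorm (Hs s) (c *\<^sub>R u) = \<bar>c\<bar> * nnorm (Hs s) u"
      unfolding mem(2) eq unfolding nnorm_Hs by (simp add: real_sqrt_mult)
  }
qed

lemma seminormed_Hs_rad: "seminormed (Hs_rad s)"
proof -
  have add: "radial (u + v)" if "radial u" "radial v" for u v using that by (simp add: radial_def)
  have scale: "radial (c *\<^sub>R u)" if "radial u" for c u using that by (simp add: radial_def scaleR_fun_def)
  have "radial 0" by (simp add: radial_def)
  with add scale seminormed_Hs[of s] show ?thesis
    unfolding seminormed_def Hs_rad_def by auto
qed

text \<open>Duality between \<open>H^s\<close> and \<open>H^(-s)\<close>: Cauchy-Schwarz after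
  inserting \<open>sqrt (bracket (- s))\<close> and \<open>sqrt (bracket s)\<close>, whose product
  is 1. The real part makes the functional real valued, matching differentiability over the
  reals.\<close>

lemma frequency_functional:
  assumes am: "a \<in> borel_measurable borel" and ai: "integrable lborel (\<lambda>\<xi>. bracket (- s) \<xi> * (cmod (a \<xi>))\<^sup>2)"
  shows "bounded_functional (Hs s) (\<lambda>u. Re (LINT \<xi>|lborel. a \<xi> * freq u \<xi>))
    (sqrt (LINT \<xi>|lborel. bracket (- s) \<xi> * (cmod (a \<xi>))\<^sup>2))"
    and "\<And>u. u \<in> ncarrier (Hs s) \<Longrightarrow> integrable lborel (\<lambda>\<xi>. a \<xi> * freq u \<xi>)"
proof -
  let ?W = "\<lambda>s \<xi>. complex_of_real (sqrt (bracket s \<xi>))"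
  note Wm = sqrt_bracket_measurable
  have WW: "(?W (- s) \<xi> * a \<xi>) * (?W s \<xi> * z) = a \<xi> * z" for \<xi> z
  proof -
    have "bracket (- s) \<xi> * bracket s \<xi> = 1"
    proof -
      have "1 + (norm \<xi>)\<^sup>2 \<noteq> 0" by (metis add_pos_nonneg zero_le_power2 zero_less_one less_irrefl)
      then show ?thesis unfolding bracket_def by (simp add: powr_add[symmetric])
    qed
    then have "sqrt (bracket (- s) \<xi>) * sqrt (bracket s \<xi>) = 1" by (simp add: real_sqrt_mult[symmetric])
    then have "?W (- s) \<xi> * ?W s \<xi> = 1" by (simp add: of_real_mult[symmetric] del: of_real_mult)
    then show ?thesis by (metis mult.assoc mult.left_commute mult_1)
  qed
  have a1: "(\<lambda>\<xi>. ?W (- s) \<xi> * a \<xi>) \<in> borel_measurable lborel" using borel_measurable_times[OF Wm am] by simp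
  have a2: "integrable lborel (\<lambda>\<xi>. (cmod (?W (- s) \<xi> * a \<xi>))\<^sup>2)" unfolding cmod_sqrt_bracket_square by (rule ai)
  have u1: "(\<lambda>\<xi>. ?W s \<xi> * freq u \<xi>) \<in> borel_measurable lborel" if "u \<in> ncarrier (Hs s)" for u
    using borel_measurable_times[OF Wm Hs_carrierD(3)[OF that]] by simp
  have u2: "integrable lborel (\<lambda>\<xi>. (cmod (?W s \<xi> * freq u \<xi>))\<^sup>2)" if "u \<in> ncarrier (Hs s)" for u
    unfolding cmod_sqrt_bracket_square by (rule Hs_carrierD(4)[OF that])
  show i: "integrable lborel (\<lambda>\<xi>. a \<xi> * freq u \<xi>)" if "u \<in> ncarrier (Hs s)" for u
    using L2_Cauchy_Schwarz(1)[OF a1 u1[OF that] a2 u2[OF that]] unfolding WW .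
  have cong: "(LINT \<xi>|lborel. a \<xi> * freq w \<xi>) = (LINT \<xi>|lborel. a \<xi> * g \<xi>)"
    if w: "w \<in> ncarrier (Hs s)" and g: "represented_by (fourier_dist w) g" for w g
  proof (rule integral_cong_AE)
    have "g \<in> borel_measurable borel" using g by (simp add: represented_by_def)
    then show "(\<lambda>\<xi>. a \<xi> * g \<xi>) \<in> borel_measurable lborel" using borel_measurable_times[OF am] by simp
    show "(\<lambda>\<xi>. a \<xi> * freq w \<xi>) \<in> borel_measurable lborel" using borel_measurable_times[OF am Hs_carrierD(3)[OF w]] by simp
    show "AE \<xi> in lborel. a \<xi> * freq w \<xi> = a \<xi> * g \<xi>" using freq_eq_AE[OF g] by eventually_elim simp
  qed
  show "bounded_functional (Hs s) (\<lambda>u. Re (LINT \<xi>|lborel. a \<xi> * freq u \<xi>))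
    (sqrt (LINT \<xi>|lborel. bracket (- s) \<xi> * (cmod (a \<xi>))\<^sup>2))"
    unfolding bounded_functional_def
  proof (intro conjI ballI allI)
    show "0 \<le> sqrt (LINT \<xi>|lborel. bracket (- s) \<xi> * (cmod (a \<xi>))\<^sup>2)"
      by (intro real_sqrt_ge_zero integral_nonneg_AE) (simp add: less_imp_le)
    fix u assume u: "u \<in> ncarrier (Hs s)"
    note U = Hs_carrierD[OF u]
    have "cmod (LINT \<xi>|lborel. a \<xi> * freq u \<xi>) \<le> (LINT \<xi>|lborel. cmod (a \<xi> * freq u \<xi>))" by (rule integral_norm_bound)
    also have "\<dots> = (LINT \<xi>|lborel. cmod (?W (- s) \<xi> * a \<xi>) * cmod (?W s \<xi> * freq u \<xi>))"
      unfolding norm_mult[symmetric] WW ..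
    also have "\<dots> \<le> sqrt (LINT \<xi>|lborel. (cmod (?W (- s) \<xi> * a \<xi>))\<^sup>2) * sqrt (LINT \<xi>|lborel. (cmod (?W s \<xi> * freq u \<xi>))\<^sup>2)"
      by (rule L2_Cauchy_Schwarz(2)[OF a1 u1[OF u] a2 u2[OF u]])
    finally show "\<bar>Re (LINT \<xi>|lborel. a \<xi> * freq u \<xi>)\<bar> \<le> sqrt (LINT \<xi>|lborel. bracket (- s) \<xi> * (cmod (a \<xi>))\<^sup>2) * nnorm (Hs s) u"
      unfolding cmod_sqrt_bracket_square nnorm_Hs using abs_Re_le_cmod order_trans by blast
    {
      fix v assume v: "v \<in> ncarrier (Hs s)"
      note V = Hs_carrierD[OF v]
      have "represented_by (fourier_dist (u + v)) (\<lambda>\<xi>. freq u \<xi> + freq v \<xi>)"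
        unfolding fourier_dist_add by (rule represented_by_add[OF U(2) V(2)])
      from cong[OF seminormedD(2)[OF seminormed_Hs u v] this]
      show "Re (LINT \<xi>|lborel. a \<xi> * freq (u + v) \<xi>) = Re (LINT \<xi>|lborel. a \<xi> * freq u \<xi>) + Re (LINT \<xi>|lborel. a \<xi> * freq v \<xi>)"
        unfolding distrib_left using i[OF u] i[OF v] by simp
    }
    {
      fix c
      have "represented_by (fourier_dist (c *\<^sub>R u)) (\<lambda>\<xi>. of_real c * freq u \<xi>)"
        unfolding fourier_dist_scaleR by (rule represented_by_scaleR[OF U(2)])
      from cong[OF seminormedD(4)[OF seminormed_Hs u] this]
      show "Re (LINT \<xi>|lborel. a \<xi> * freq (c *\<^sub>R u) \<xi>) = c * Re (LINT \<xi>|lborel. a \<xi> * freq u \<xi>)"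
        unfolding mult.left_commute[of "a _"] by simp
    }
  qed
qed

text \<open>Evaluation at a fixed time is a contraction for the supremum norm, so the constant does
  not change.\<close>

lemma bounded_functional_at_time:
  assumes X: "seminormed X" and L: "bounded_functional X L C" and t: "t \<in> {0..T}"
  shows "bounded_functional (curves T X) (\<lambda>u. L (u t)) C"
  unfolding bounded_functional_def
proof (intro conjI ballI allI)
  show "0 \<le> C" by (rule bounded_functionalD(4)[OF L])
  fix u assume u: "u \<in> ncarrier (curves T X)"
  note ut = curves_carrierD(1)[OF u t]
  show "L ((c *\<^sub>R u) t) = c * L (u t)" for c using bounded_functionalD(2)[OF L ut] by (simp add: scaleR_fun_def)
  have "\<bar>L (u t)\<bar> \<le> C * nnorm X (u t)" by (rule bounded_functionalD(3)[OF L ut])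
  also have "\<dots> \<le> C * nnorm (curves T X) u" by (rule mult_left_mono[OF curves_at[OF X u t] bounded_functionalD(4)[OF L]])
  finally show "\<bar>L (u t)\<bar> \<le> C * nnorm (curves T X) u" .
  fix v assume v: "v \<in> ncarrier (curves T X)"
  show "L ((u + v) t) = L (u t) + L (v t)" using bounded_functionalD(1)[OF L ut curves_carrierD(1)[OF v t]] by simp
qed

section \<open>Spectral data: membership, linearity, rotations\<close>

lemma spectral_in_Hs:
  assumes v: "integrable lborel v" and i: "integrable lborel (\<lambda>\<xi>. bracket s \<xi> * (cmod (v \<xi>))\<^sup>2)"
  shows "spectral v \<in> ncarrier (Hs s)"
    and "nnorm (Hs s) (spectral v) = sqrt (LINT \<xi>|lborel. bracket s \<xi> * (cmod (v \<xi>))\<^sup>2)"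
  by (rule Hs_memI[OF spectral_tempered[OF v] fourier_dist_spectral[OF v] i])+

lemma spectral_diff:
  assumes v: "integrable lborel v" and w: "integrable lborel w"
  shows "spectral v - spectral w = spectral (\<lambda>\<xi>. v \<xi> - w \<xi>)"
proof
  fix \<psi>
  have d: "integrable lborel (\<lambda>\<xi>. v \<xi> - w \<xi>)" using v w by (rule Bochner_Integration.integrable_diff)
  show "(spectral v - spectral w) \<psi> = spectral (\<lambda>\<xi>. v \<xi> - w \<xi>) \<psi>"
  proof (cases "\<psi> \<in> schwartz")
    case True
    have i: "integrable lborel (\<lambda>\<xi>. f \<xi> * inverse_fourier \<psi> \<xi>)" if "integrable lborel f" for f
      using fourier_dist_spectral[OF that] inverse_fourier_schwartz[OF True] by (simp add: represented_by_def)
    show ?thesis unfolding minus_apply spectral_apply[OF v True] spectral_apply[OF w True] spectral_apply[OF d True]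
      left_diff_distrib by (rule Bochner_Integration.integral_diff[OF i[OF v] i[OF w], symmetric])
  qed (simp add: spectral_def dist_of_def)
qed

lemma spectral_scaleR:
  assumes v: "integrable lborel v"
  shows "c *\<^sub>R spectral v = spectral (\<lambda>\<xi>. of_real c * v \<xi>)"
proof
  fix \<psi>
  have d: "integrable lborel (\<lambda>\<xi>. of_real c * v \<xi>)" using v by (intro integrable_mult_right)
  show "(c *\<^sub>R spectral v) \<psi> = spectral (\<lambda>\<xi>. of_real c * v \<xi>) \<psi>"
  proof (cases "\<psi> \<in> schwartz")
    case True
    show ?thesis unfolding scaleR_fun_def spectral_apply[OF v True] spectral_apply[OF d True]
      by (simp add: scaleR_conv_of_real mult.assoc)
  qed (simp add: spectral_def dist_of_def scaleR_fun_def)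
qed

text \<open>Lebesgue measure is determined by boxes. The preimage of a box under \<open>R\<close> is
  its image under the inverse, and orthogonal images preserve measure.\<close>

lemma lborel_distr_orthogonal:
  fixes R :: "R3 \<Rightarrow> R3"
  assumes R: "orthogonal_transformation R"
  shows "distr lborel borel R = lborel"
proof (rule lborel_eqI[symmetric])
  have Rm: "R \<in> borel_measurable borel"
    using orthogonal_transformation_linear[OF R] by (intro borel_measurable_continuous_onI linear_continuous_on) (simp add: linear_conv_bounded_linear)
  obtain Q where Q: "orthogonal_transformation Q" "Q \<circ> R = id" "R \<circ> Q = id"
    using orthogonal_transformation_inv[OF R] orthogonal_transformation_bij[OF R]
    by (metis bij_is_inj bij_is_surj inv_o_cancel surj_iff)
  fix l u :: R3 assume le: "\<And>b. b \<in> Basis \<Longrightarrow> l \<bullet> b \<le> u \<bullet> b"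
  have "R -` box l u = Q ` box l u"
    using Q(2,3) by (auto simp: fun_eq_iff image_iff) metis+
  then have "emeasure (distr lborel borel R) (box l u) = emeasure lborel (Q ` box l u)"
    using Rm by (simp add: emeasure_distr)
  also have "\<dots> = emeasure lebesgue (Q ` box l u)"
  proof -
    have "Q ` box l u \<in> sets borel" using measurable_sets[OF Rm, of "box l u"] \<open>R -` box l u = Q ` box l u\<close> by simp
    then show ?thesis by simp
  qed
  also have "\<dots> = ennreal (measure lebesgue (Q ` box l u))"
    by (rule emeasure_eq_measure2) (rule measurable_orthogonal_image[OF Q(1)], simp)
  also have "measure lebesgue (Q ` box l u) = measure lebesgue (box l u)"
    by (rule measure_orthogonal_image[OF Q(1)]) simp
  also have "ennreal \<dots> = (\<Prod>b\<in>Basis. (u - l) \<bullet> b)"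
    using le by (simp add: measure_lborel_box)
  finally show "emeasure (distr lborel borel R) (box l u) = (\<Prod>b\<in>Basis. (u - l) \<bullet> b)" .
qed simp

lemma lborel_integral_orthogonal:
  fixes f :: "R3 \<Rightarrow> complex" and R :: "R3 \<Rightarrow> R3"
  assumes R: "orthogonal_transformation R" and f: "f \<in> borel_measurable borel"
  shows "(LINT x|lborel. f (R x)) = (LINT x|lborel. f x)"
proof -
  have Rm: "R \<in> measurable lborel borel"
    using orthogonal_transformation_linear[OF R] linear_continuous_on[of R UNIV]
    by (simp add: linear_conv_bounded_linear borel_measurable_continuous_onI)
  show ?thesis by (subst (2) lborel_distr_orthogonal[OF R, symmetric]) (rule integral_distr[OF Rm f, symmetric])
qed

text \<open>The Fourier transform commutes with rotations, because they preserve inner products and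
  Lebesgue measure.\<close>

lemma spectral_radial:
  assumes v: "integrable lborel v" and rad: "\<And>R \<xi>. orthogonal_transformation R \<Longrightarrow> v (R \<xi>) = v \<xi>"
  shows "radial (spectral v)"
  unfolding radial_def
proof (intro allI impI ballI)
  fix R :: "R3 \<Rightarrow> R3" and \<psi> assume R: "orthogonal_transformation R" and \<psi>: "\<psi> \<in> schwartz"
  note S = schwartz_orthogonal[OF R \<psi>]
  have inner: "R x \<bullet> R y = x \<bullet> y" for x y using R by (simp add: orthogonal_transformation_def)
  have "fourier (\<lambda>x. \<psi> (R x)) \<xi> = fourier \<psi> (R \<xi>)" for \<xi>
  proof -
    have m: "(\<lambda>x. exp (- (\<i> * of_real (x \<bullet> R \<xi>))) * \<psi> x) \<in> borel_measurable borel"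
      using schwartz_measurable[OF \<psi>] by (intro borel_measurable_times) measurable
    show ?thesis unfolding fourier_eq using lborel_integral_orthogonal[OF R m] by (simp add: inner)
  qed
  then have eq: "inverse_fourier (\<lambda>x. \<psi> (R x)) \<xi> = inverse_fourier \<psi> (R \<xi>)" for \<xi>
    using linear_neg[OF orthogonal_transformation_linear[OF R]] by (simp add: inverse_fourier_def)
  have m: "(\<lambda>\<xi>. v \<xi> * inverse_fourier \<psi> \<xi>) \<in> borel_measurable borel"
    using v schwartz_measurable[OF inverse_fourier_schwartz[OF \<psi>]] by (intro borel_measurable_times) auto
  show "spectral v (\<lambda>x. \<psi> (R x)) = spectral v \<psi>"
    unfolding spectral_apply[OF v S] spectral_apply[OF v \<psi>] eq
    using lborel_integral_orthogonal[OF R m] by (simp add: rad[OF R])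
qed

section \<open>The Coulomb kernel on the Fourier side\<close>

text \<open>For \<open>l\<close> different from 0 this is the Fourier transform of
  \<open>exp (- l^2 |x|^2)\<close> without normalising factor. At \<open>l = 0\<close> division by
  zero makes it 0.\<close>

definition gauss_kernel :: "real \<Rightarrow> R3 \<Rightarrow> real"
  where "gauss_kernel l \<eta> = sqrt (pi / l\<^sup>2) ^ 3 * exp (- (norm \<eta>)\<^sup>2 / (4 * l\<^sup>2))"

lemma gauss_kernel_nonneg [simp]: "0 \<le> gauss_kernel l \<eta>"
  by (simp add: gauss_kernel_def)

lemma gauss_kernel_measurable [measurable]:
  "(\<lambda>p. gauss_kernel (fst p) (snd p)) \<in> borel_measurable borel"
  "(\<lambda>\<eta>. gauss_kernel l \<eta>) \<in> borel_measurable borel"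
  "(\<lambda>l. gauss_kernel l \<eta>) \<in> borel_measurable borel"
proof -
  show "(\<lambda>p. gauss_kernel (fst p) (snd p)) \<in> borel_measurable borel"
    unfolding gauss_kernel_def borel_prod[symmetric] by measurable
  show "(\<lambda>\<eta>. gauss_kernel l \<eta>) \<in> borel_measurable borel" unfolding gauss_kernel_def by measurable
  show "(\<lambda>l. gauss_kernel l \<eta>) \<in> borel_measurable borel" unfolding gauss_kernel_def by measurable
qed

text \<open>For \<open>l > 0\<close> the integrand is a multiple of
  \<open>exp (- q / (4 l^2)) / l^3\<close>, with the explicit antiderivative \<open>F\<close>;
  evenness in \<open>l\<close> doubles the result.\<close>

lemma integral_gauss_kernel_scale:
  assumes \<eta>: "\<eta> \<noteq> 0"
  shows "integrable lborel (\<lambda>l. gauss_kernel l \<eta>)"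
    and "(LINT l|lborel. gauss_kernel l \<eta>) = 4 * pi * sqrt pi / (norm \<eta>)\<^sup>2"
proof -
  define q where "q = (norm \<eta>)\<^sup>2"
  have q: "q > 0" using \<eta> by (simp add: q_def)
  define F where "F l = pi * sqrt pi * (2 / q) * exp (- q / (4 * l\<^sup>2))" for l :: real
  define f where "f l = pi * sqrt pi * inverse (l ^ 3) * exp (- q / (4 * l\<^sup>2))" for l :: real
  have keq: "gauss_kernel l \<eta> = f l" if "l > 0" for l
  proof -
    have "sqrt (pi / l\<^sup>2) = sqrt pi / l" using that by (simp add: real_sqrt_divide)
    moreover have "(sqrt pi / l) ^ 3 = pi * sqrt pi * inverse (l ^ 3)"
      by (simp add: power_divide power3_eq_cube field_simps)
    ultimately show ?thesis by (simp add: gauss_kernel_def f_def q_def)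
  qed
  have deriv: "DERIV F l :> f l" and cont: "isCont f l" if "ereal 0 < ereal l" for l
  proof -
    have l: "l > 0" using that by simp
    have "(F has_real_derivative pi * sqrt pi * (2 / q) * (exp (- q / (4 * l\<^sup>2)) * (q / (2 * l ^ 3)))) (at l)"
      unfolding F_def[abs_def] using l
      by (auto intro!: derivative_eq_intros simp: field_simps power2_eq_square power3_eq_cube)
    moreover have "pi * sqrt pi * (2 / q) * (exp (- q / (4 * l\<^sup>2)) * (q / (2 * l ^ 3))) = f l"
      using l q by (simp add: f_def field_simps)
    ultimately show "DERIV F l :> f l" by simp
    show "isCont f l" unfolding f_def[abs_def] using l by (intro continuous_intros) auto
  qed
  have "((\<lambda>l::real. c * exp (- q / (4 * l\<^sup>2))) \<longlongrightarrow> 0) (at_right 0)" for c using q by real_asymp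
  then have "(F \<longlongrightarrow> 0) (at_right 0)" unfolding F_def[abs_def] .
  then have lim0: "((F \<circ> real_of_ereal) \<longlongrightarrow> 0) (at_right (ereal 0))" by (simp add: ereal_tendsto_simps1)
  have "((\<lambda>l::real. c * exp (- q / (4 * l\<^sup>2))) \<longlongrightarrow> c) at_top" for c using q by real_asymp
  then have "(F \<longlongrightarrow> pi * sqrt pi * (2 / q)) at_top" unfolding F_def[abs_def] .
  then have lim1: "((F \<circ> real_of_ereal) \<longlongrightarrow> pi * sqrt pi * (2 / q)) (at_left \<infinity>)"
    by (simp only: ereal_tendsto_simps1)
  have nn: "AE l in lborel. ereal 0 < ereal l \<longrightarrow> ereal l < \<infinity> \<longrightarrow> 0 \<le> f l" by (auto simp: f_def)
  have lt: "ereal 0 < \<infinity>" by simp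
  note FTC = interval_integral_FTC_nonneg[OF lt deriv cont nn lim0 lim1]
  define g where "g l = indicator {0<..} l * f l" for l
  have e: "einterval (ereal 0) \<infinity> = {0<..}" by (auto simp: einterval_def)
  have gi: "integrable lborel g" using FTC(1) unfolding e set_integrable_def g_def by simp
  have gI: "(LINT l|lborel. g l) = 2 * pi * sqrt pi / q"
    using FTC(2) by (simp add: interval_lebesgue_integral_def e set_lebesgue_integral_def g_def)
  \<comment> \<open>The negative half line is the reflection of the positive one; at
    \<open>l = 0\<close> all terms vanish.\<close>
  have split: "gauss_kernel l \<eta> = g l + g (0 + (-1) * l)" for l
  proof -
    have "gauss_kernel l \<eta> = gauss_kernel (- l) \<eta>" by (simp add: gauss_kernel_def)
    moreover have "gauss_kernel 0 \<eta> = 0" by (simp add: gauss_kernel_def)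
    ultimately show ?thesis using keq[of l] keq[of "- l"] by (cases l "0 :: real" rule: linorder_cases) (simp_all add: g_def)
  qed
  have gi': "integrable lborel (\<lambda>l. g (0 + (-1) * l))" by (rule lborel_integrable_real_affine[OF gi]) simp
  show "integrable lborel (\<lambda>l. gauss_kernel l \<eta>)" unfolding split using gi gi' by (rule Bochner_Integration.integrable_add)
  have "(LINT l|lborel. g (0 + (-1) * l)) = (LINT l|lborel. g l)"
    using lborel_integral_real_affine[of "-1" g 0] by simp
  then show "(LINT l|lborel. gauss_kernel l \<eta>) = 4 * pi * sqrt pi / (norm \<eta>)\<^sup>2"
    unfolding split using gi gi' gI by (simp add: q_def)
qed

text \<open>In place of polar coordinates, \<open>1 / |\<eta>|^2\<close> is written as an integral
  of \<open>gauss_kernel\<close> over all scales. After exchanging the integrals the inner one is an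
  explicit Gaussian integral of size \<open>1 / (1 + l^2)\<close>.\<close>

lemma integrable_gaussian_over_square: "integrable lborel (\<lambda>\<eta>::R3. exp (- (norm \<eta>)\<^sup>2) / (norm \<eta>)\<^sup>2)"
proof -
  let ?f = "\<lambda>l \<eta>. gauss_kernel l \<eta> * exp (- (norm \<eta>)\<^sup>2)"
  have m: "(\<lambda>p. gauss_kernel (fst p) (snd p) * exp (- (norm (snd p))\<^sup>2)) \<in> borel_measurable borel"
    unfolding gauss_kernel_def borel_prod[symmetric] by measurable
  have comb: "?f l \<eta> = sqrt (pi / l\<^sup>2) ^ 3 * exp (- (1 + 1 / (4 * l\<^sup>2)) * (norm \<eta>)\<^sup>2)" for l \<eta>
    by (simp add: gauss_kernel_def exp_add[symmetric] left_diff_distrib)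
  have pos: "1 + 1 / (4 * l\<^sup>2) > 0" for l :: real by (simp add: add_pos_nonneg)
  have ii: "integrable lborel (\<lambda>\<eta>. ?f l \<eta>)" for l
    unfolding comb by (intro integrable_mult_right gaussian_integral(1) pos)
  have I: "(LINT \<eta>|lborel. ?f l \<eta>) = sqrt (pi / l\<^sup>2) ^ 3 * sqrt (pi / (1 + 1 / (4 * l\<^sup>2))) ^ 3" for l
    unfolding comb using gaussian_integral(2)[OF pos[of l], where 'a = R3] by simp
  have bd: "sqrt (pi / l\<^sup>2) ^ 3 * sqrt (pi / (1 + 1 / (4 * l\<^sup>2))) ^ 3 \<le> 8 * pi ^ 3 * (1 / (1 + l\<^sup>2))" for l :: real
  proof (cases "l = 0")
    case False
    have "sqrt (pi / l\<^sup>2) * sqrt (pi / (1 + 1 / (4 * l\<^sup>2))) = sqrt (pi / l\<^sup>2 * (pi / (1 + 1 / (4 * l\<^sup>2))))"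
      by (simp only: real_sqrt_mult)
    also have "pi / l\<^sup>2 * (pi / (1 + 1 / (4 * l\<^sup>2))) = 4 * pi\<^sup>2 / (1 + 4 * l\<^sup>2)"
      using False by (simp add: field_simps power2_eq_square)
    finally have s: "sqrt (pi / l\<^sup>2) * sqrt (pi / (1 + 1 / (4 * l\<^sup>2))) = sqrt (4 * pi\<^sup>2 / (1 + 4 * l\<^sup>2))" .
    \<comment> \<open>One of the three factors of \<open>r ^ 3\<close> is bounded by
      \<open>2 * pi\<close>; the other two give \<open>r^2\<close>, which has the decay
      \<open>1 / (1 + l^2)\<close>.\<close>
    define r where "r = sqrt (4 * pi\<^sup>2 / (1 + 4 * l\<^sup>2))"
    have p: "1 + 4 * l\<^sup>2 > 0" by (simp add: add_pos_nonneg)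
    have r0: "0 \<le> r" by (simp add: r_def)
    have r2: "r\<^sup>2 = 4 * pi\<^sup>2 / (1 + 4 * l\<^sup>2)" using p by (simp add: r_def)
    have "4 * pi\<^sup>2 / (1 + 4 * l\<^sup>2) \<le> 4 * pi\<^sup>2 / 1" by (rule divide_left_mono) (use p in auto)
    then have "r\<^sup>2 \<le> (2 * pi)\<^sup>2" unfolding r2 by (simp add: power_mult_distrib)
    then have r1: "r \<le> 2 * pi" by (rule power2_le_imp_le) simp
    have "r ^ 3 = r * r\<^sup>2" by (simp add: power3_eq_cube power2_eq_square)
    also have "\<dots> \<le> (2 * pi) * r\<^sup>2" by (rule mult_right_mono[OF r1]) simp
    also have "\<dots> \<le> (2 * pi) * (4 * pi\<^sup>2 * (1 / (1 + l\<^sup>2)))"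
    proof (rule mult_left_mono)
      have "1 + l\<^sup>2 > 0" by (simp add: add_pos_nonneg)
      then show "r\<^sup>2 \<le> 4 * pi\<^sup>2 * (1 / (1 + l\<^sup>2))" unfolding r2 using p
        by (simp add: divide_left_mono)
    qed simp
    also have "\<dots> = 8 * pi ^ 3 * (1 / (1 + l\<^sup>2))" by (simp add: power3_eq_cube power2_eq_square)
    finally show ?thesis unfolding power_mult_distrib[symmetric] s r_def[symmetric] .
  qed simp
  have int: "integrable (lborel \<Otimes>\<^sub>M lborel) (\<lambda>(l, \<eta>). ?f l \<eta>)"
  proof (rule lborel_pair.Fubini_integrable)
    show "(\<lambda>(l, \<eta>). ?f l \<eta>) \<in> borel_measurable (lborel \<Otimes>\<^sub>M lborel)"
      using m by (simp add: lborel_prod case_prod_unfold)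
    show "AE l in lborel. integrable lborel (\<lambda>\<eta>. case (l, \<eta>) of (l, \<eta>) \<Rightarrow> ?f l \<eta>)"
      using ii by simp
    have "integrable lborel (\<lambda>l. LINT \<eta>|lborel. ?f l \<eta>)"
    proof (rule Bochner_Integration.integrable_bound)
      show "integrable lborel (\<lambda>l::real. 8 * pi ^ 3 * (1 / (1 + l\<^sup>2)))"
        by (intro integrable_mult_right integrable_inverse_1_plus_square)
      show "(\<lambda>l. LINT \<eta>|lborel. ?f l \<eta>) \<in> borel_measurable lborel" unfolding I by measurable
      show "AE l in lborel. norm (LINT \<eta>|lborel. ?f l \<eta>) \<le> norm (8 * pi ^ 3 * (1 / (1 + l\<^sup>2)))"
      proof (rule AE_I2)
        fix l :: real
        have "0 \<le> sqrt (pi / l\<^sup>2) ^ 3 * sqrt (pi / (1 + 1 / (4 * l\<^sup>2))) ^ 3"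
        proof -
          have "0 \<le> pi / (1 + 1 / (4 * l\<^sup>2))" by (rule divide_nonneg_pos[OF _ pos]) simp
          then show ?thesis by (intro mult_nonneg_nonneg zero_le_power real_sqrt_ge_zero) simp_all
        qed
        then show "norm (LINT \<eta>|lborel. ?f l \<eta>) \<le> norm (8 * pi ^ 3 * (1 / (1 + l\<^sup>2)))"
          unfolding I real_norm_def by (subst abs_of_nonneg) (assumption, rule order_trans[OF bd abs_ge_self])
      qed
    qed
    then show "integrable lborel (\<lambda>l. LINT \<eta>|lborel. norm (case (l, \<eta>) of (l, \<eta>) \<Rightarrow> ?f l \<eta>))"
      by (simp add: abs_of_nonneg)
  qed
  have "integrable lborel (\<lambda>\<eta>. LINT l|lborel. ?f l \<eta>)" by (rule lborel_pair.integrable_snd[OF int])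
  then have "integrable lborel (\<lambda>\<eta>. (LINT l|lborel. gauss_kernel l \<eta>) * exp (- (norm \<eta>)\<^sup>2))" by simp
  moreover have "AE \<eta> in lborel. (LINT l|lborel. gauss_kernel l \<eta>) * exp (- (norm \<eta>)\<^sup>2) = 4 * pi * sqrt pi * (exp (- (norm \<eta>)\<^sup>2) / (norm \<eta>)\<^sup>2)"
    using AE_lborel_singleton[of "0::R3"] by eventually_elim (simp add: integral_gauss_kernel_scale(2))
  ultimately have i: "integrable lborel (\<lambda>\<eta>::R3. 4 * pi * sqrt pi * (exp (- (norm \<eta>)\<^sup>2) / (norm \<eta>)\<^sup>2))"
    by (subst integrable_cong_AE[symmetric]) (auto dest: borel_measurable_integrable)
  have eq: "1 / (4 * pi * sqrt pi) * (4 * pi * sqrt pi * X) = X" for X by simp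
  show ?thesis using integrable_mult_right[OF i, of "1 / (4 * pi * sqrt pi)"] unfolding eq .
qed

text \<open>For \<open>|\<eta>| <= 1\<close> the factor \<open>decay\<close> is at most 1 and the
  Gaussian is at least \<open>1 / e\<close>; for \<open>|\<eta>| > 1\<close> the singular factor is
  at most 1. Translation invariance makes the bound uniform in \<open>\<xi>\<close>.\<close>

lemma riesz_decay_bound:
  obtains C where "C > 0"
    and "\<And>\<xi>. integrable lborel (\<lambda>\<eta>. decay (\<xi> - \<eta>) / (norm \<eta>)\<^sup>2)"
    and "\<And>\<xi>. (LINT \<eta>|lborel. decay (\<xi> - \<eta>) / (norm \<eta>)\<^sup>2) \<le> C"
proof -
  let ?g = "\<lambda>\<xi> \<eta>. exp 1 * (exp (- (norm (\<eta>::R3))\<^sup>2) / (norm \<eta>)\<^sup>2) + decay (\<xi> - \<eta>)"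
  have di: "integrable lborel (\<lambda>\<eta>. decay (\<xi> - \<eta>))" "(LINT \<eta>|lborel. decay (\<xi> - \<eta>)) = (LINT \<eta>|lborel. decay \<eta>)" for \<xi>
    using lborel_integral_shift(3,4)[OF decay_measurable, of \<xi>] by simp_all
  have gi: "integrable lborel (?g \<xi>)" for \<xi>
    by (intro Bochner_Integration.integrable_add integrable_mult_right integrable_gaussian_over_square di)
  have le: "decay (\<xi> - \<eta>) / (norm \<eta>)\<^sup>2 \<le> ?g \<xi> \<eta>" for \<xi> \<eta>
  proof (cases "norm \<eta> \<le> 1")
    case True
    have "(norm \<eta>)\<^sup>2 \<le> 1" using True by (simp add: power_le_one)
    then have "1 \<le> exp 1 * exp (- (norm \<eta>)\<^sup>2)" by (simp add: exp_add[symmetric])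
    then have "decay (\<xi> - \<eta>) \<le> exp 1 * exp (- (norm \<eta>)\<^sup>2)" using decay_le_1 order_trans by blast
    then have "decay (\<xi> - \<eta>) / (norm \<eta>)\<^sup>2 \<le> exp 1 * exp (- (norm \<eta>)\<^sup>2) / (norm \<eta>)\<^sup>2"
      by (rule divide_right_mono) simp
    then show ?thesis using decay_nonneg[of "\<xi> - \<eta>"] unfolding times_divide_eq_right by linarith
  next
    case False
    then have "1 \<le> (norm \<eta>)\<^sup>2" by (simp add: one_le_power)
    then have "decay (\<xi> - \<eta>) / (norm \<eta>)\<^sup>2 \<le> decay (\<xi> - \<eta>) / 1"
      by (intro divide_left_mono) auto
    moreover have "0 \<le> exp 1 * (exp (- (norm \<eta>)\<^sup>2) / (norm \<eta>)\<^sup>2)" by simp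
    ultimately show ?thesis by linarith
  qed
  have i: "integrable lborel (\<lambda>\<eta>. decay (\<xi> - \<eta>) / (norm \<eta>)\<^sup>2)" for \<xi>
  proof (rule Bochner_Integration.integrable_bound[OF gi])
    show "(\<lambda>\<eta>. decay (\<xi> - \<eta>) / (norm \<eta>)\<^sup>2) \<in> borel_measurable lborel" by measurable
    show "AE \<eta> in lborel. norm (decay (\<xi> - \<eta>) / (norm \<eta>)\<^sup>2) \<le> norm (?g \<xi> \<eta>)"
    proof (rule AE_I2)
      fix \<eta>
      have "0 \<le> decay (\<xi> - \<eta>) / (norm \<eta>)\<^sup>2" by simp
      then show "norm (decay (\<xi> - \<eta>) / (norm \<eta>)\<^sup>2) \<le> norm (?g \<xi> \<eta>)"
        using le[of \<xi> \<eta>] unfolding real_norm_def by linarith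
    qed
  qed
  define C where "C = exp 1 * (LINT \<eta>|lborel. exp (- (norm (\<eta>::R3))\<^sup>2) / (norm \<eta>)\<^sup>2) + (LINT \<eta>|lborel. decay \<eta>)"
  have bd: "(LINT \<eta>|lborel. decay (\<xi> - \<eta>) / (norm \<eta>)\<^sup>2) \<le> C" for \<xi>
  proof -
    have "(LINT \<eta>|lborel. decay (\<xi> - \<eta>) / (norm \<eta>)\<^sup>2) \<le> (LINT \<eta>|lborel. ?g \<xi> \<eta>)" by (rule integral_mono[OF i gi le])
    also have "\<dots> = C"
      unfolding C_def
      by (subst Bochner_Integration.integral_add[OF integrable_mult_right[OF integrable_gaussian_over_square] di(1)])
        (simp only: integral_mult_right_zero di(2))
    finally show ?thesis .
  qed
  have "0 \<le> (LINT \<eta>|lborel. decay (0 - \<eta>) / (norm \<eta>)\<^sup>2)" by (rule integral_nonneg_AE) simp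
  then have "C \<ge> 0" using bd[of 0] by linarith
  then show ?thesis using that[of "C + 1"] i bd by (meson add_nonneg_pos less_add_one less_imp_le order_trans zero_less_one)
qed

text \<open>The longer of \<open>a\<close> and \<open>b\<close> has at least half the length of
  \<open>a + b\<close>, so \<open>1 + |a + b|^2\<close> is at most four times the corresponding
  expression for it; \<open>256 = 4^4\<close>. The other factor is kept for integration.\<close>

lemma decay_product: "decay a * decay b \<le> 256 * decay (a + b) * (decay a + decay b)"
proof -
  have pos: "0 < (1 + (norm y)\<^sup>2) ^ 4" "0 < 1 + (norm y)\<^sup>2" for y :: R3
  proof -
    show p: "0 < 1 + (norm y)\<^sup>2" by (simp add: add_pos_nonneg)
    show "0 < (1 + (norm y)\<^sup>2) ^ 4" by (rule zero_less_power[OF p])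
  qed
  have *: "decay b \<le> 256 * decay (a + b)" if "norm a \<le> norm b" for a b
  proof -
    have "norm (a + b) \<le> 2 * norm b" using norm_triangle_ineq[of a b] that by linarith
    then have "(norm (a + b))\<^sup>2 \<le> (2 * norm b)\<^sup>2" by (intro power_mono) auto
    then have "1 + (norm (a + b))\<^sup>2 \<le> 4 * (1 + (norm b)\<^sup>2)" by (simp add: power_mult_distrib)
    then have "(1 + (norm (a + b))\<^sup>2) ^ 4 \<le> (4 * (1 + (norm b)\<^sup>2)) ^ 4" by (intro power_mono) auto
    then have "(1 + (norm (a + b))\<^sup>2) ^ 4 \<le> 256 * (1 + (norm b)\<^sup>2) ^ 4" by (simp only: power_mult_distrib) simp
    then show ?thesis using pos by (simp add: decay_def field_simps)
  qed
  have nn: "0 \<le> 256 * decay (a + b) * decay a" "0 \<le> 256 * decay (a + b) * decay b" by simp_all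
  show ?thesis
  proof (cases "norm a \<le> norm b")
    case True
    have "decay a * decay b \<le> decay a * (256 * decay (a + b))" by (rule mult_left_mono[OF *[OF True]]) simp
    also have "\<dots> = 256 * decay (a + b) * decay a" by simp
    finally show ?thesis using nn unfolding distrib_left by linarith
  next
    case False
    then have "decay a \<le> 256 * decay (b + a)" by (intro *) simp
    then have "decay a * decay b \<le> 256 * decay (b + a) * decay b" by (rule mult_right_mono) simp
    then have "decay a * decay b \<le> 256 * decay (a + b) * decay b" by (simp only: add.commute)
    then show ?thesis using nn unfolding distrib_left by linarith
  qed
qed

section \<open>Trilinear estimates in the decay weight\<close>

lemma borel_measurable_pairI:
  "f \<in> borel_measurable borel \<Longrightarrow> f \<in> borel_measurable (lborel \<Otimes>\<^sub>M lborel)"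
  for f :: "('a::euclidean_space \<times> 'b::euclidean_space) \<Rightarrow> 'c::topological_space"
  by (simp add: lborel_prod)

definition trilinear_weight :: "R3 \<Rightarrow> R3 \<times> R3 \<Rightarrow> real"
  where "trilinear_weight \<xi> p = decay (fst p) * decay (fst p - snd p) * decay (\<xi> - snd p) / (norm (snd p))\<^sup>2"

lemma trilinear_weight_nonneg [simp]: "0 \<le> trilinear_weight \<xi> p"
  by (simp add: trilinear_weight_def)

text \<open>\<open>decay_product\<close> extracts \<open>decay \<eta>\<close>; the two remaining
  summands have the same integral, whence \<open>512 = 2 * 256\<close>.\<close>

lemma decay_convolution:
  shows "integrable lborel (\<lambda>\<zeta>. decay \<zeta> * decay (\<zeta> - \<eta>))"
    and "(LINT \<zeta>|lborel. decay \<zeta> * decay (\<zeta> - \<eta>)) \<le> 512 * (LINT \<zeta>|lborel. decay \<zeta>) * decay \<eta>"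
proof -
  have di: "integrable lborel (\<lambda>\<zeta>. decay (\<eta> - \<zeta>))" "(LINT \<zeta>|lborel. decay (\<eta> - \<zeta>)) = (LINT \<zeta>|lborel. decay \<zeta>)"
    using lborel_integral_shift(3,4)[OF decay_measurable, of \<eta>] by simp_all
  have le: "decay \<zeta> * decay (\<zeta> - \<eta>) \<le> 256 * decay \<eta> * (decay \<zeta> + decay (\<eta> - \<zeta>))" for \<zeta>
    using decay_product[of \<zeta> "\<eta> - \<zeta>"] decay_minus[of "\<eta> - \<zeta>"] by simp
  have ri: "integrable lborel (\<lambda>\<zeta>. 256 * decay \<eta> * (decay \<zeta> + decay (\<eta> - \<zeta>)))"
    by (intro integrable_mult_right Bochner_Integration.integrable_add di integrable_decay)
  show i: "integrable lborel (\<lambda>\<zeta>. decay \<zeta> * decay (\<zeta> - \<eta>))"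
  proof (rule Bochner_Integration.integrable_bound[OF ri])
    show "AE \<zeta> in lborel. norm (decay \<zeta> * decay (\<zeta> - \<eta>)) \<le> norm (256 * decay \<eta> * (decay \<zeta> + decay (\<eta> - \<zeta>)))"
      by (intro AE_I2, unfold real_norm_def, subst abs_of_nonneg) (simp, rule order_trans[OF le abs_ge_self])
  qed measurable
  have "(LINT \<zeta>|lborel. decay \<zeta> * decay (\<zeta> - \<eta>)) \<le> (LINT \<zeta>|lborel. 256 * decay \<eta> * (decay \<zeta> + decay (\<eta> - \<zeta>)))"
    by (rule integral_mono[OF i ri le])
  also have "\<dots> = 512 * (LINT \<zeta>|lborel. decay \<zeta>) * decay \<eta>" using di by simp
  finally show "(LINT \<zeta>|lborel. decay \<zeta> * decay (\<zeta> - \<eta>)) \<le> 512 * (LINT \<zeta>|lborel. decay \<zeta>) * decay \<eta>" .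
qed

definition bilinear_weight :: "R3 \<times> R3 \<Rightarrow> real"
  where "bilinear_weight p = decay (fst p) * decay (fst p - snd p) / (norm (snd p))\<^sup>2"

lemma bilinear_weight_nonneg [simp]: "0 \<le> bilinear_weight p"
  by (simp add: bilinear_weight_def)

lemma integrable_pair_swap_iff:
  fixes f :: "R3 \<times> R3 \<Rightarrow> 'c::{banach,second_countable_topology}"
  shows "integrable (lborel \<Otimes>\<^sub>M lborel) (\<lambda>(\<eta>, \<zeta>). f (\<zeta>, \<eta>)) \<longleftrightarrow> integrable lborel f"
  using lborel_pair.integrable_product_swap_iff[of f] by (simp add: lborel_prod)

lemma integrable_bilinear_weight: "integrable lborel bilinear_weight"
proof -
  obtain C where ri: "\<And>\<xi>. integrable lborel (\<lambda>\<eta>. decay (\<xi> - \<eta>) / (norm \<eta>)\<^sup>2)"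
    using riesz_decay_bound by blast
  define D where "D = 512 * (LINT \<zeta>|lborel. decay \<zeta>)"
  have m': "(\<lambda>(\<eta>, \<zeta>). bilinear_weight (\<zeta>, \<eta>)) \<in> borel_measurable (lborel \<Otimes>\<^sub>M lborel)"
    unfolding bilinear_weight_def by measurable
  have eq: "bilinear_weight (\<zeta>, \<eta>) = (decay \<zeta> * decay (\<zeta> - \<eta>)) * (1 / (norm \<eta>)\<^sup>2)" for \<zeta> \<eta>
    by (simp add: bilinear_weight_def)
  have ii: "integrable lborel (\<lambda>\<zeta>. bilinear_weight (\<zeta>, \<eta>))" for \<eta>
    unfolding eq by (rule integrable_mult_left[OF decay_convolution(1)])
  have inner: "(LINT \<zeta>|lborel. bilinear_weight (\<zeta>, \<eta>)) \<le> D * (decay (0 - \<eta>) / (norm \<eta>)\<^sup>2)" for \<eta>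
  proof -
    have "(LINT \<zeta>|lborel. bilinear_weight (\<zeta>, \<eta>)) = (LINT \<zeta>|lborel. decay \<zeta> * decay (\<zeta> - \<eta>)) * (1 / (norm \<eta>)\<^sup>2)"
      unfolding eq by (rule integral_mult_left_zero)
    also have "\<dots> \<le> (D * decay \<eta>) * (1 / (norm \<eta>)\<^sup>2)"
      unfolding D_def by (rule mult_right_mono[OF decay_convolution(2)]) simp
    finally show ?thesis by simp
  qed
  have "integrable (lborel \<Otimes>\<^sub>M lborel) (\<lambda>(\<eta>, \<zeta>). bilinear_weight (\<zeta>, \<eta>))"
  proof (rule lborel_pair.Fubini_integrable[OF m'])
    show "AE \<eta> in lborel. integrable lborel (\<lambda>\<zeta>. case (\<eta>, \<zeta>) of (\<eta>, \<zeta>) \<Rightarrow> bilinear_weight (\<zeta>, \<eta>))" using ii by simp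
    have "integrable lborel (\<lambda>\<eta>. LINT \<zeta>|lborel. bilinear_weight (\<zeta>, \<eta>))"
    proof (rule Bochner_Integration.integrable_bound[OF integrable_mult_right[OF ri[of 0], of D]])
      show "(\<lambda>\<eta>. LINT \<zeta>|lborel. bilinear_weight (\<zeta>, \<eta>)) \<in> borel_measurable lborel"
        by (rule lborel.borel_measurable_lebesgue_integral) (use m' in simp)
      show "AE \<eta> in lborel. norm (LINT \<zeta>|lborel. bilinear_weight (\<zeta>, \<eta>)) \<le> norm (D * (decay (0 - \<eta>) / (norm \<eta>)\<^sup>2))"
        by (intro AE_I2, unfold real_norm_def, subst abs_of_nonneg)
          (rule integral_nonneg_AE, simp, rule order_trans[OF inner abs_ge_self])
    qed
    then show "integrable lborel (\<lambda>\<eta>. LINT \<zeta>|lborel. norm (case (\<eta>, \<zeta>) of (\<eta>, \<zeta>) \<Rightarrow> bilinear_weight (\<zeta>, \<eta>)))"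
      by (simp add: abs_of_nonneg)
  qed
  then show ?thesis unfolding integrable_pair_swap_iff .
qed

text \<open>This is the invariance of the weight under the nonlinearity. Integrating in
  \<open>\<zeta>\<close> leaves \<open>decay \<eta> * decay (\<xi> - \<eta>)\<close>, from which
  \<open>decay_product\<close> extracts \<open>decay \<xi>\<close>; what remains is bounded
  uniformly by \<open>riesz_decay_bound\<close>.\<close>

lemma trilinear_weight_bound:
  obtains C where "C > 0"
    and "\<And>\<xi>. integrable lborel (trilinear_weight \<xi>)"
    and "\<And>\<xi>. (LINT p|lborel. trilinear_weight \<xi> p) \<le> C * decay \<xi>"
proof -
  obtain C where C: "C > 0" and ri: "\<And>\<xi>. integrable lborel (\<lambda>\<eta>. decay (\<xi> - \<eta>) / (norm \<eta>)\<^sup>2)"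
    and rb: "\<And>\<xi>. (LINT \<eta>|lborel. decay (\<xi> - \<eta>) / (norm \<eta>)\<^sup>2) \<le> C"
    using riesz_decay_bound by blast
  define D where "D = (LINT \<zeta>|lborel. decay \<zeta>)"
  have D0: "D \<ge> 0" unfolding D_def by (rule integral_nonneg_AE) simp
  define K where "K = 512 * D * 256"
  have K0: "K \<ge> 0" using D0 by (simp add: K_def)
  have inner: "(LINT \<zeta>|lborel. trilinear_weight \<xi> (\<zeta>, \<eta>)) \<le> K * decay \<xi> * (decay (0 - \<eta>) / (norm \<eta>)\<^sup>2 + decay (\<xi> - \<eta>) / (norm \<eta>)\<^sup>2)" for \<xi> \<eta>
  proof -
    have "(LINT \<zeta>|lborel. trilinear_weight \<xi> (\<zeta>, \<eta>)) = (LINT \<zeta>|lborel. decay \<zeta> * decay (\<zeta> - \<eta>)) * (decay (\<xi> - \<eta>) / (norm \<eta>)\<^sup>2)"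
    proof -
      have "trilinear_weight \<xi> (\<zeta>, \<eta>) = (decay \<zeta> * decay (\<zeta> - \<eta>)) * (decay (\<xi> - \<eta>) / (norm \<eta>)\<^sup>2)" for \<zeta>
        by (simp add: trilinear_weight_def)
      then show ?thesis by (simp only: integral_mult_left_zero)
    qed
    also have "\<dots> \<le> (512 * D * decay \<eta>) * (decay (\<xi> - \<eta>) / (norm \<eta>)\<^sup>2)"
      unfolding D_def by (rule mult_right_mono[OF decay_convolution(2)]) simp
    also have "\<dots> = 512 * D * ((decay \<eta> * decay (\<xi> - \<eta>)) / (norm \<eta>)\<^sup>2)" by simp
    also have "\<dots> \<le> 512 * D * ((256 * decay \<xi> * (decay \<eta> + decay (\<xi> - \<eta>))) / (norm \<eta>)\<^sup>2)"
      using decay_product[of \<eta> "\<xi> - \<eta>"] D0 by (intro mult_left_mono divide_right_mono) auto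
    also have "\<dots> = K * decay \<xi> * (decay (0 - \<eta>) / (norm \<eta>)\<^sup>2 + decay (\<xi> - \<eta>) / (norm \<eta>)\<^sup>2)"
      by (simp add: K_def add_divide_distrib distrib_left mult_ac)
    finally show ?thesis .
  qed
  have oi: "integrable lborel (\<lambda>\<eta>. K * decay \<xi> * (decay (0 - \<eta>) / (norm \<eta>)\<^sup>2 + decay (\<xi> - \<eta>) / (norm \<eta>)\<^sup>2))" for \<xi>
    by (intro integrable_mult_right Bochner_Integration.integrable_add ri)
  have m: "trilinear_weight \<xi> \<in> borel_measurable borel" for \<xi>
    unfolding trilinear_weight_def[abs_def] borel_prod[symmetric] by measurable
  have int: "integrable lborel (trilinear_weight \<xi>)" for \<xi>
  proof (rule Bochner_Integration.integrable_bound[OF integrable_bilinear_weight])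
    show "trilinear_weight \<xi> \<in> borel_measurable lborel" using m by simp
    have "trilinear_weight \<xi> p = bilinear_weight p * decay (\<xi> - snd p)" for p
      by (simp add: trilinear_weight_def bilinear_weight_def)
    also have "\<dots> p \<le> bilinear_weight p" for p by (rule mult_left_le[OF decay_le_1]) simp
    finally show "AE p in lborel. norm (trilinear_weight \<xi> p) \<le> norm (bilinear_weight p)"
      by (simp add: abs_of_nonneg)
  qed
  have int': "integrable (lborel \<Otimes>\<^sub>M lborel) (\<lambda>(\<eta>, \<zeta>). trilinear_weight \<xi> (\<zeta>, \<eta>))" for \<xi>
    unfolding integrable_pair_swap_iff by (rule int)
  have "(LINT p|lborel. trilinear_weight \<xi> p) \<le> (K * 2 * C + 1) * decay \<xi>" for \<xi>
  proof -
    have "(LINT p|lborel. trilinear_weight \<xi> p) = (LINT p|(lborel \<Otimes>\<^sub>M lborel). (\<lambda>(\<eta>, \<zeta>). trilinear_weight \<xi> (\<zeta>, \<eta>)) p)"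
      using lborel_pair.integral_product_swap[OF borel_measurable_pairI[OF m[of \<xi>]]] by (simp add: lborel_prod)
    also have "\<dots> = (LINT \<eta>|lborel. LINT \<zeta>|lborel. trilinear_weight \<xi> (\<zeta>, \<eta>))"
      by (rule lborel_pair.integral_fst[OF int', symmetric])
    also have "\<dots> \<le> (LINT \<eta>|lborel. K * decay \<xi> * (decay (0 - \<eta>) / (norm \<eta>)\<^sup>2 + decay (\<xi> - \<eta>) / (norm \<eta>)\<^sup>2))"
      by (rule integral_mono[OF lborel_pair.integrable_fst[OF int'] oi inner])
    also have "\<dots> = K * decay \<xi> * ((LINT \<eta>|lborel. decay (0 - \<eta>) / (norm \<eta>)\<^sup>2) + (LINT \<eta>|lborel. decay (\<xi> - \<eta>) / (norm \<eta>)\<^sup>2))"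
      by (subst integral_mult_right_zero, subst Bochner_Integration.integral_add[OF ri ri]) (rule refl)
    also have "\<dots> \<le> K * decay \<xi> * (C + C)" using K0 by (intro mult_left_mono add_mono rb) auto
    also have "\<dots> \<le> (K * 2 * C + 1) * decay \<xi>" by (simp add: algebra_simps)
    finally show ?thesis .
  qed
  moreover have "K * 2 * C + 1 > 0" using K0 C by (simp add: add_nonneg_pos)
  ultimately show ?thesis using that int by blast
qed

text \<open>The cubic nonlinearity on the Fourier side up to a constant: \<open>snd p\<close> is the
  frequency transferred by the potential, whose transform is a multiple of the reciprocal of its
  square.\<close>

definition quad :: "(R3 \<Rightarrow> complex) \<Rightarrow> R3 \<Rightarrow> complex"
  where "quad v \<xi> = (LINT p|lborel. v (fst p) * cnj (v (fst p - snd p)) * v (\<xi> - snd p) / of_real ((norm (snd p))\<^sup>2))"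

text \<open>The Coulomb potential has transform \<open>4 pi / |\<eta>|^2\<close> before
  normalisation, and the two products in the nonlinearity contribute \<open>(2 pi)^(-3/2)\<close>
  each: \<open>4 pi / (2 pi)^3 = 1 / (2 pi^2)\<close>.\<close>

definition hart :: "(R3 \<Rightarrow> complex) \<Rightarrow> R3 \<Rightarrow> complex"
  where "hart v \<xi> = quad v \<xi> / of_real (2 * pi\<^sup>2)"

lemma borel_measurable_cnj_compose [measurable (raw)]:
  "f \<in> borel_measurable M \<Longrightarrow> (\<lambda>x. cnj (f x)) \<in> borel_measurable M"
  by (rule measurable_compose[OF _ borel_measurable_continuous_onI[OF continuous_on_cnj[OF continuous_on_id]]])

lemma quad_integrand_measurable:
  assumes [measurable]: "a \<in> borel_measurable borel" "b \<in> borel_measurable borel" "c \<in> borel_measurable borel"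
  shows "(\<lambda>p. a (fst p) * cnj (b (fst p - snd p)) * c (\<xi> - snd p) / of_real ((norm (snd p))\<^sup>2)) \<in> borel_measurable (borel :: (R3 \<times> R3) measure)"
  unfolding borel_prod[symmetric] by measurable

lemma quad_integrand_bound:
  assumes "\<And>\<xi>. cmod (a \<xi>) \<le> A * decay \<xi>" "\<And>\<xi>. cmod (b \<xi>) \<le> B * decay \<xi>" "\<And>\<xi>. cmod (c \<xi>) \<le> C * decay \<xi>"
  shows "cmod (a (fst p) * cnj (b (fst p - snd p)) * c (\<xi> - snd p) / of_real ((norm (snd p))\<^sup>2)) \<le> A * B * C * trilinear_weight \<xi> p"
proof -
  have nn: "0 \<le> A * decay \<xi>" "0 \<le> B * decay \<xi>" "0 \<le> C * decay \<xi>" for \<xi>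
    by (rule order_trans[OF norm_ge_zero assms(1)], rule order_trans[OF norm_ge_zero assms(2)], rule order_trans[OF norm_ge_zero assms(3)])
  have "cmod (a (fst p)) * cmod (b (fst p - snd p)) * cmod (c (\<xi> - snd p))
     \<le> (A * decay (fst p)) * (B * decay (fst p - snd p)) * (C * decay (\<xi> - snd p))"
    by (intro mult_mono assms mult_nonneg_nonneg nn) auto
  then have "cmod (a (fst p)) * cmod (b (fst p - snd p)) * cmod (c (\<xi> - snd p)) / (norm (snd p))\<^sup>2
     \<le> (A * decay (fst p)) * (B * decay (fst p - snd p)) * (C * decay (\<xi> - snd p)) / (norm (snd p))\<^sup>2"
    by (rule divide_right_mono) simp
  then show ?thesis by (simp add: norm_mult norm_divide norm_power trilinear_weight_def mult_ac)
qed

lemma quad_integrand_integrable: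
  assumes m: "a \<in> borel_measurable borel" "b \<in> borel_measurable borel" "c \<in> borel_measurable borel"
    and bd: "\<And>\<xi>. cmod (a \<xi>) \<le> A * decay \<xi>" "\<And>\<xi>. cmod (b \<xi>) \<le> B * decay \<xi>" "\<And>\<xi>. cmod (c \<xi>) \<le> C * decay \<xi>"
  shows "integrable lborel (\<lambda>p. a (fst p) * cnj (b (fst p - snd p)) * c (\<xi> - snd p) / of_real ((norm (snd p))\<^sup>2))"
proof (rule Bochner_Integration.integrable_bound)
  obtain K where "integrable lborel (trilinear_weight \<xi>)" using trilinear_weight_bound by blast
  then show "integrable lborel (\<lambda>p. A * B * C * trilinear_weight \<xi> p)" by (rule integrable_mult_right)
  show "(\<lambda>p. a (fst p) * cnj (b (fst p - snd p)) * c (\<xi> - snd p) / of_real ((norm (snd p))\<^sup>2)) \<in> borel_measurable lborel"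
    using quad_integrand_measurable[OF m] by simp
  show "AE p in lborel. norm (a (fst p) * cnj (b (fst p - snd p)) * c (\<xi> - snd p) / of_real ((norm (snd p))\<^sup>2)) \<le> norm (A * B * C * trilinear_weight \<xi> p)"
    unfolding real_norm_def by (intro AE_I2 order_trans[OF quad_integrand_bound[OF bd] abs_ge_self])
qed

text \<open>One trilinear estimate gives both bounds: the difference telescopes into three terms
  with one difference factor each, whence the 3. The constant \<open>1 / (2 pi^2)\<close> is at most
  1 and is dropped.\<close>

lemma hart_estimates:
  obtains C where "C > 0"
    and "\<And>v M \<xi>. v \<in> borel_measurable borel \<Longrightarrow> (\<And>\<xi>. cmod (v \<xi>) \<le> M * decay \<xi>) \<Longrightarrow> cmod (hart v \<xi>) \<le> C * M ^ 3 * decay \<xi>"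
    and "\<And>v w M \<delta> \<xi>. v \<in> borel_measurable borel \<Longrightarrow> w \<in> borel_measurable borel \<Longrightarrow>
      (\<And>\<xi>. cmod (v \<xi>) \<le> M * decay \<xi>) \<Longrightarrow> (\<And>\<xi>. cmod (w \<xi>) \<le> M * decay \<xi>) \<Longrightarrow>
      (\<And>\<xi>. cmod (v \<xi> - w \<xi>) \<le> \<delta> * decay \<xi>) \<Longrightarrow> cmod (hart v \<xi> - hart w \<xi>) \<le> 3 * C * M\<^sup>2 * \<delta> * decay \<xi>"
proof -
  obtain C where C: "C > 0" and ti: "\<And>\<xi>. integrable lborel (trilinear_weight \<xi>)"
    and tb: "\<And>\<xi>. (LINT p|lborel. trilinear_weight \<xi> p) \<le> C * decay \<xi>"
    using trilinear_weight_bound by blast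
  define I where "I a b c \<xi> = (LINT p|lborel. a (fst p) * cnj (b (fst p - snd p)) * c (\<xi> - snd p) / of_real ((norm (snd p))\<^sup>2))"
    for a b c :: "R3 \<Rightarrow> complex" and \<xi>
  have Ib: "cmod (I a b c \<xi>) \<le> C * (A * B * D) * decay \<xi>"
    if m: "a \<in> borel_measurable borel" "b \<in> borel_measurable borel" "c \<in> borel_measurable borel"
    and bd: "\<And>\<xi>. cmod (a \<xi>) \<le> A * decay \<xi>" "\<And>\<xi>. cmod (b \<xi>) \<le> B * decay \<xi>" "\<And>\<xi>. cmod (c \<xi>) \<le> D * decay \<xi>"
    for a b c A B D \<xi>
  proof -
    have "0 \<le> A * decay 0" "0 \<le> B * decay 0" "0 \<le> D * decay 0"
      by (rule order_trans[OF norm_ge_zero bd(1)], rule order_trans[OF norm_ge_zero bd(2)], rule order_trans[OF norm_ge_zero bd(3)])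
    then have ABD: "0 \<le> A * B * D" by (simp add: zero_le_mult_iff decay_def)
    have "cmod (I a b c \<xi>) \<le> (LINT p|lborel. A * B * D * trilinear_weight \<xi> p)"
      unfolding I_def by (rule norm_integral_le[OF quad_integrand_integrable[OF m bd] integrable_mult_right[OF ti] quad_integrand_bound[OF bd]])
    also have "\<dots> = A * B * D * (LINT p|lborel. trilinear_weight \<xi> p)" by (rule integral_mult_right_zero)
    also have "\<dots> \<le> A * B * D * (C * decay \<xi>)" by (rule mult_left_mono[OF tb ABD])
    finally show ?thesis by (simp add: mult_ac)
  qed
  have pi1: "2 * pi\<^sup>2 \<ge> 1"
  proof -
    have "1 \<le> pi" using pi_gt3 by linarith
    then have "1 \<le> pi\<^sup>2" by (rule one_le_power)
    then show ?thesis by linarith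
  qed
  have div: "cmod (z / of_real (2 * pi\<^sup>2)) \<le> cmod z" for z
  proof -
    have "cmod z / (2 * pi\<^sup>2) \<le> cmod z / 1" by (rule divide_left_mono) (use pi1 in auto)
    then show ?thesis by (simp add: norm_divide norm_mult norm_power)
  qed
  show ?thesis
  proof (rule that[OF C])
    fix v :: "R3 \<Rightarrow> complex" and M \<xi>
    assume m: "v \<in> borel_measurable borel" and bd: "\<And>\<xi>. cmod (v \<xi>) \<le> M * decay \<xi>"
    have "cmod (hart v \<xi>) \<le> cmod (I v v v \<xi>)" unfolding hart_def quad_def I_def by (rule div)
    also have "\<dots> \<le> C * (M * M * M) * decay \<xi>" by (rule Ib[OF m m m bd bd bd])
    finally show "cmod (hart v \<xi>) \<le> C * M ^ 3 * decay \<xi>" by (simp add: power3_eq_cube)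
  next
    fix v w :: "R3 \<Rightarrow> complex" and M \<delta> \<xi>
    assume v: "v \<in> borel_measurable borel" and w: "w \<in> borel_measurable borel"
      and vb: "\<And>\<xi>. cmod (v \<xi>) \<le> M * decay \<xi>" and wb: "\<And>\<xi>. cmod (w \<xi>) \<le> M * decay \<xi>"
      and db: "\<And>\<xi>. cmod (v \<xi> - w \<xi>) \<le> \<delta> * decay \<xi>"
    let ?d = "\<lambda>\<xi>. v \<xi> - w \<xi>"
    have d: "?d \<in> borel_measurable borel" using v w by (rule borel_measurable_diff)
    note i1 = quad_integrand_integrable[OF d v v db vb vb, of \<xi>]
    note i2 = quad_integrand_integrable[OF w d v wb db vb, of \<xi>]
    note i3 = quad_integrand_integrable[OF w w d wb wb db, of \<xi>]
    note iv = quad_integrand_integrable[OF v v v vb vb vb, of \<xi>]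
    note iw = quad_integrand_integrable[OF w w w wb wb wb, of \<xi>]
    have tele: "a * cnj b * c / n - a' * cnj b' * c' / n
       = (a - a') * cnj b * c / n + a' * cnj (b - b') * c / n + a' * cnj b' * (c - c') / n" for a b c a' b' c' n :: complex
      unfolding complex_cnj_diff diff_divide_distrib left_diff_distrib right_diff_distrib by simp
    have "I v v v \<xi> - I w w w \<xi> = I ?d v v \<xi> + I w ?d v \<xi> + I w w ?d \<xi>"
      unfolding I_def
      by (simp only: Bochner_Integration.integral_diff[OF iv iw, symmetric]
          Bochner_Integration.integral_add[OF i1 i2, symmetric]
          Bochner_Integration.integral_add[OF Bochner_Integration.integrable_add[OF i1 i2] i3, symmetric])
        (simp only: tele)
    then have "cmod (I v v v \<xi> - I w w w \<xi>) \<le> cmod (I ?d v v \<xi>) + cmod (I w ?d v \<xi>) + cmod (I w w ?d \<xi>)"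
      using norm_triangle_ineq[of "I ?d v v \<xi> + I w ?d v \<xi>" "I w w ?d \<xi>"]
        norm_triangle_ineq[of "I ?d v v \<xi>" "I w ?d v \<xi>"] by simp
    also have "\<dots> \<le> C * (\<delta> * M * M) * decay \<xi> + C * (M * \<delta> * M) * decay \<xi> + C * (M * M * \<delta>) * decay \<xi>"
      by (intro add_mono Ib d v w db vb wb)
    also have "\<dots> = 3 * C * M\<^sup>2 * \<delta> * decay \<xi>" by (simp add: power2_eq_square)
    finally have "cmod (I v v v \<xi> - I w w w \<xi>) \<le> 3 * C * M\<^sup>2 * \<delta> * decay \<xi>" .
    moreover have "hart v \<xi> - hart w \<xi> = (I v v v \<xi> - I w w w \<xi>) / of_real (2 * pi\<^sup>2)"
      by (simp add: hart_def quad_def I_def diff_divide_distrib)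
    ultimately show "cmod (hart v \<xi> - hart w \<xi>) \<le> 3 * C * M\<^sup>2 * \<delta> * decay \<xi>"
      by (simp only:) (rule order_trans[OF div])
  qed
qed

lemma hart_scale: "hart (\<lambda>\<xi>. of_real h * v \<xi>) \<xi> = of_real (h ^ 3) * hart v \<xi>"
proof -
  have "of_real h * v (fst p) * cnj (of_real h * v (fst p - snd p)) * (of_real h * v (\<xi> - snd p)) / of_real ((norm (snd p))\<^sup>2)
    = of_real (h ^ 3) * (v (fst p) * cnj (v (fst p - snd p)) * v (\<xi> - snd p) / of_real ((norm (snd p))\<^sup>2))" for p
    by (simp add: power3_eq_cube mult_ac)
  then have "quad (\<lambda>\<xi>. of_real h * v \<xi>) \<xi> = of_real (h ^ 3) * quad v \<xi>"
    unfolding quad_def by (simp only: integral_mult_right_zero)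
  then show ?thesis by (simp add: hart_def)
qed

section \<open>The Hartree nonlinearity as an operation on Fourier transforms\<close>

lemma fourier_cnj: "fourier (\<lambda>x. cnj (v x)) y = cnj (fourier v (- y))"
proof -
  have "cnj (exp (- (\<i> * of_real (x \<bullet> - y))) * v x) = exp (- (\<i> * of_real (x \<bullet> y))) * cnj (v x)" for x
    by (simp add: exp_cnj)
  then show ?thesis
    unfolding fourier_eq complex_cnj_mult[of "of_real fourier_const"] Bochner_Integration.integral_cnj[symmetric] complex_cnj_complex_of_real
    by (simp only:)
qed

lemma inverse_fourier_bound:
  assumes "integrable lborel v"
  obtains B where "B \<ge> 0" "\<And>x. cmod (inverse_fourier v x) \<le> B"
proof
  show "cmod (inverse_fourier v x) \<le> fourier_const * (LINT x|lborel. cmod (v x))" for x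
    unfolding inverse_fourier_def by (rule fourier_bound)
  show "0 \<le> fourier_const * (LINT x|lborel. cmod (v x))"
    by (intro mult_nonneg_nonneg integral_nonneg_AE) (auto simp: less_imp_le)
qed

lemma integrable_shifted_gaussian:
  fixes x :: R3
  assumes "a > 0"
  shows "integrable lborel (\<lambda>y. exp (- a * (norm (x - y))\<^sup>2))"
proof -
  have m: "(\<lambda>z::R3. exp (- a * (norm z)\<^sup>2)) \<in> borel_measurable borel" by measurable
  show ?thesis using lborel_integral_shift(4)[OF m, of x] gaussian_integral(1)[OF assms, where 'a = R3] by simp
qed

lemma fourier_modulated_gaussian:
  assumes l: "l \<noteq> 0"
  shows "fourier (\<lambda>y. exp (- (\<i> * of_real (y \<bullet> - \<zeta>))) * of_real (exp (- l\<^sup>2 * (norm (x - y))\<^sup>2))) \<zeta>'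
     = of_real fourier_const * (exp (\<i> * of_real (x \<bullet> (\<zeta> - \<zeta>'))) * of_real (gauss_kernel l (\<zeta> - \<zeta>')))"
proof -
  let ?F = "\<lambda>y. exp (- (\<i> * of_real (y \<bullet> \<zeta>'))) * (exp (- (\<i> * of_real (y \<bullet> - \<zeta>))) * complex_of_real (exp (- l\<^sup>2 * (norm (x - y))\<^sup>2)))"
  have m: "?F \<in> borel_measurable borel" by measurable
  have a: "l\<^sup>2 > 0" using l by simp
  have "?F (x - z) = exp (\<i> * of_real (x \<bullet> (\<zeta> - \<zeta>'))) * (exp (- (\<i> * of_real (z \<bullet> (\<zeta> - \<zeta>')))) * complex_of_real (exp (- l\<^sup>2 * (norm z)\<^sup>2)))" for z
  proof -
    have "exp (- (\<i> * complex_of_real ((x - z) \<bullet> \<zeta>'))) * exp (- (\<i> * of_real ((x - z) \<bullet> - \<zeta>)))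
      = exp (\<i> * of_real (x \<bullet> (\<zeta> - \<zeta>'))) * exp (- (\<i> * of_real (z \<bullet> (\<zeta> - \<zeta>'))))"
      unfolding exp_add[symmetric] by (simp add: inner_diff_left inner_diff_right algebra_simps)
    then show ?thesis by (simp add: mult.assoc[symmetric])
  qed
  then have "(LINT y|lborel. ?F y) = (LINT z|lborel. exp (\<i> * of_real (x \<bullet> (\<zeta> - \<zeta>'))) * (exp (- (\<i> * of_real (z \<bullet> (\<zeta> - \<zeta>')))) * complex_of_real (exp (- l\<^sup>2 * (norm z)\<^sup>2))))"
    using lborel_integral_shift(3)[OF m, of x] by (simp only:)
  also have "\<dots> = exp (\<i> * of_real (x \<bullet> (\<zeta> - \<zeta>'))) * of_real (gauss_kernel l (\<zeta> - \<zeta>'))"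
    unfolding integral_mult_right_zero gaussian_fourier(2)[OF a] by (simp add: gauss_kernel_def)
  finally show ?thesis unfolding fourier_eq by (simp only:)
qed

text \<open>The multiplication formula is applied twice, once for \<open>v\<close> and once for its
  conjugate. The Gaussian ends up transformed, as a kernel in the difference \<open>\<eta>\<close>
  of the two frequencies.\<close>

lemma gaussian_average_of_square:
  assumes v: "integrable lborel v" and l: "l \<noteq> 0"
  shows "(LINT y|lborel. inverse_fourier v y * (of_real (exp (- l\<^sup>2 * (norm (x - y))\<^sup>2)) * cnj (inverse_fourier v y)))
     = of_real (fourier_const * fourier_const) *
       (LINT \<zeta>|lborel. (LINT \<eta>|lborel. v \<zeta> * cnj (v (\<zeta> - \<eta>)) * exp (\<i> * of_real (x \<bullet> \<eta>)) * of_real (gauss_kernel l \<eta>)))"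
proof -
  have vm: "v \<in> borel_measurable borel" using v by auto
  note Um = inverse_fourier_measurable[OF vm]
  have a: "l\<^sup>2 > 0" using l by simp
  obtain B where B: "B \<ge> 0" "\<And>x. cmod (inverse_fourier v x) \<le> B" using inverse_fourier_bound[OF v] by blast
  have cv: "integrable lborel (\<lambda>x. cnj (v x))" using v by simp
  let ?e = "\<lambda>y. complex_of_real (exp (- l\<^sup>2 * (norm (x - y))\<^sup>2))"
  let ?g = "\<lambda>\<zeta> y. exp (- (\<i> * of_real (y \<bullet> - \<zeta>))) * ?e y"
  have em: "?e \<in> borel_measurable borel" by measurable
  have h: "integrable lborel (\<lambda>y. ?e y * cnj (inverse_fourier v y))"
  proof (rule Bochner_Integration.integrable_bound)
    show "integrable lborel (\<lambda>y. B * exp (- l\<^sup>2 * (norm (x - y))\<^sup>2))"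
      by (intro integrable_mult_right integrable_shifted_gaussian a)
    show "(\<lambda>y. ?e y * cnj (inverse_fourier v y)) \<in> borel_measurable lborel"
      using borel_measurable_times[OF em borel_measurable_cnj_compose[OF Um]] by simp
    show "AE y in lborel. norm (?e y * cnj (inverse_fourier v y)) \<le> norm (B * exp (- l\<^sup>2 * (norm (x - y))\<^sup>2))"
    proof (rule AE_I2)
      fix y
      have "cmod (inverse_fourier v y) * exp (- l\<^sup>2 * (norm (x - y))\<^sup>2) \<le> B * exp (- l\<^sup>2 * (norm (x - y))\<^sup>2)"
        by (rule mult_right_mono[OF B(2)]) simp
      then show "norm (?e y * cnj (inverse_fourier v y)) \<le> norm (B * exp (- l\<^sup>2 * (norm (x - y))\<^sup>2))"
        using B(1) by (simp add: norm_mult mult.commute)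
    qed
  qed
  have gi: "integrable lborel (?g \<zeta>)" for \<zeta>
  proof (rule fourier_integrand_integrable)
    show "integrable lborel ?e" using integrable_shifted_gaussian[OF a, of x] by (simp del: of_real_exp)
  qed
  have "(LINT y|lborel. inverse_fourier v y * (?e y * cnj (inverse_fourier v y))) = (LINT \<zeta>|lborel. v \<zeta> * inverse_fourier (\<lambda>y. ?e y * cnj (inverse_fourier v y)) \<zeta>)"
    by (rule inverse_fourier_multiplication(1)[OF v h])
  also have "\<dots> = (LINT \<zeta>|lborel. of_real (fourier_const * fourier_const) * (LINT \<eta>|lborel. v \<zeta> * cnj (v (\<zeta> - \<eta>)) * exp (\<i> * of_real (x \<bullet> \<eta>)) * of_real (gauss_kernel l \<eta>)))"
  proof (rule Bochner_Integration.integral_cong[OF refl])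
    fix \<zeta>
    let ?f = "\<lambda>\<zeta>'. cnj (v \<zeta>') * (exp (\<i> * of_real (x \<bullet> (\<zeta> - \<zeta>'))) * of_real (gauss_kernel l (\<zeta> - \<zeta>')))"
    have fm: "?f \<in> borel_measurable borel"
    proof -
      note [measurable] = vm
      show ?thesis by measurable
    qed
    \<comment> \<open>The conjugate of the inverse transform of \<open>v\<close> is the Fourier
      transform of \<open>cnj v\<close>, so the multiplication formula applies again, with the
      modulated Gaussian as second function.\<close>
    have "inverse_fourier (\<lambda>y. ?e y * cnj (inverse_fourier v y)) \<zeta> = of_real fourier_const * (LINT y|lborel. fourier (\<lambda>x. cnj (v x)) y * ?g \<zeta> y)"
      unfolding inverse_fourier_def fourier_eq[of _ "- \<zeta>"] fourier_cnj by (simp only: mult_ac)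
    also have "(LINT y|lborel. fourier (\<lambda>x. cnj (v x)) y * ?g \<zeta> y) = (LINT \<zeta>'|lborel. cnj (v \<zeta>') * fourier (?g \<zeta>) \<zeta>')"
      by (rule fourier_multiplication(1)[OF cv gi])
    also have "\<dots> = (LINT \<zeta>'|lborel. of_real fourier_const * ?f \<zeta>')"
      unfolding fourier_modulated_gaussian[OF l] by (simp only: mult.left_commute)
    also have "\<dots> = of_real fourier_const * (LINT \<eta>|lborel. ?f (\<zeta> - \<eta>))"
      unfolding integral_mult_right_zero lborel_integral_shift(3)[OF fm, of \<zeta>] ..
    finally have "v \<zeta> * inverse_fourier (\<lambda>y. ?e y * cnj (inverse_fourier v y)) \<zeta> = of_real (fourier_const * fourier_const) * (v \<zeta> * (LINT \<eta>|lborel. ?f (\<zeta> - \<eta>)))"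
      by (simp only: of_real_mult mult_ac)
    also have "v \<zeta> * (LINT \<eta>|lborel. ?f (\<zeta> - \<eta>)) = (LINT \<eta>|lborel. v \<zeta> * cnj (v (\<zeta> - \<eta>)) * exp (\<i> * of_real (x \<bullet> \<eta>)) * of_real (gauss_kernel l \<eta>))"
      unfolding integral_mult_right_zero[symmetric] by (rule Bochner_Integration.integral_cong[OF refl]) (simp add: mult.assoc)
    finally show "v \<zeta> * inverse_fourier (\<lambda>y. ?e y * cnj (inverse_fourier v y)) \<zeta> = of_real (fourier_const * fourier_const) * (LINT \<eta>|lborel. v \<zeta> * cnj (v (\<zeta> - \<eta>)) * exp (\<i> * of_real (x \<bullet> \<eta>)) * of_real (gauss_kernel l \<eta>))" .
  qed
  also have "\<dots> = of_real (fourier_const * fourier_const) *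
       (LINT \<zeta>|lborel. (LINT \<eta>|lborel. v \<zeta> * cnj (v (\<zeta> - \<eta>)) * exp (\<i> * of_real (x \<bullet> \<eta>)) * of_real (gauss_kernel l \<eta>)))"
    by (rule integral_mult_right_zero)
  finally show ?thesis .
qed

lemma borel_compose_continuous:
  "f \<in> borel_measurable borel \<Longrightarrow> continuous_on UNIV g \<Longrightarrow> (\<lambda>x. f (g x)) \<in> borel_measurable borel"
  by (rule measurable_compose[OF borel_measurable_continuous_onI])

lemma AE_snd_nonzero:
  "AE p in (lborel :: ('a::euclidean_space \<times> 'b::euclidean_space) measure). snd p \<noteq> 0"
proof -
  have "AE p in ((lborel :: 'a measure) \<Otimes>\<^sub>M (lborel :: 'b measure)). snd p \<noteq> 0"
  proof (rule lborel_pair.AE_pair_measure)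
    show "{p \<in> space ((lborel :: 'a measure) \<Otimes>\<^sub>M (lborel :: 'b measure)). snd p \<noteq> 0} \<in> sets (lborel \<Otimes>\<^sub>M lborel)"
      by measurable
  qed (simp add: AE_lborel_singleton)
  then show ?thesis unfolding lborel_prod .
qed

lemma autocorrelation_integrable:
  assumes vm: "v \<in> borel_measurable borel" and vb: "\<And>\<xi>. cmod (v \<xi>) \<le> M * decay \<xi>"
    and em: "e \<in> borel_measurable borel" and e1: "\<And>\<eta>. cmod (e \<eta>) \<le> 1"
  shows "integrable lborel (\<lambda>p. v (fst p) * cnj (v (fst p - snd p)) * e (snd p) / of_real ((norm (snd p))\<^sup>2))"
proof (rule Bochner_Integration.integrable_bound)
  show "integrable lborel (\<lambda>p. M * M * bilinear_weight p)" by (rule integrable_mult_right[OF integrable_bilinear_weight])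
  note [measurable] = vm em
  have "(\<lambda>p. v (fst p) * cnj (v (fst p - snd p)) * e (snd p) / of_real ((norm (snd p))\<^sup>2)) \<in> borel_measurable (borel :: (R3 \<times> R3) measure)"
    unfolding borel_prod[symmetric] by measurable
  then show "(\<lambda>p. v (fst p) * cnj (v (fst p - snd p)) * e (snd p) / of_real ((norm (snd p))\<^sup>2)) \<in> borel_measurable lborel" by simp
  show "AE p in lborel. norm (v (fst p) * cnj (v (fst p - snd p)) * e (snd p) / of_real ((norm (snd p))\<^sup>2)) \<le> norm (M * M * bilinear_weight p)"
  proof (rule AE_I2)
    fix p :: "R3 \<times> R3"
    have nn: "0 \<le> M * decay \<xi>" for \<xi> by (rule order_trans[OF norm_ge_zero vb])
    have "cmod (v (fst p)) * cmod (v (fst p - snd p)) * cmod (e (snd p)) \<le> (M * decay (fst p)) * (M * decay (fst p - snd p)) * 1"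
      by (intro mult_mono vb e1 mult_nonneg_nonneg nn) auto
    then have "cmod (v (fst p)) * cmod (v (fst p - snd p)) * cmod (e (snd p)) / (norm (snd p))\<^sup>2
       \<le> (M * decay (fst p)) * (M * decay (fst p - snd p)) * 1 / (norm (snd p))\<^sup>2"
      by (rule divide_right_mono) simp
    then have "norm (v (fst p) * cnj (v (fst p - snd p)) * e (snd p) / of_real ((norm (snd p))\<^sup>2)) \<le> M * M * bilinear_weight p"
      by (simp add: norm_mult norm_divide norm_power bilinear_weight_def mult_ac)
    then show "norm (v (fst p) * cnj (v (fst p - snd p)) * e (snd p) / of_real ((norm (snd p))\<^sup>2)) \<le> norm (M * M * bilinear_weight p)"
      unfolding real_norm_def by (rule order_trans[OF _ abs_ge_self])
  qed
qed

text \<open>Subordination to Gaussians: \<open>1 / |z|\<close> is the integral of \<open>exp (- l\<^sup>2 |z|\<^sup>2) / sqrt pi\<close> over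
  \<open>l \<in> \<real>\<close>, while the Gaussians' Fourier transforms integrate to a multiple of \<open>1 / |\<eta>|\<^sup>2\<close>.  No
  square integrability of the inverse Fourier transform is needed.\<close>

lemma coulomb_potential:
  assumes vm: "v \<in> borel_measurable borel" and vb: "\<And>\<xi>. cmod (v \<xi>) \<le> M * decay \<xi>"
  shows "of_real (LINT y|lborel. 1 / norm (x - y) * (cmod (inverse_fourier v y))\<^sup>2)
     = (LINT p|lborel. v (fst p) * cnj (v (fst p - snd p)) * exp (\<i> * of_real (x \<bullet> snd p)) / of_real ((norm (snd p))\<^sup>2)) / of_real (2 * pi\<^sup>2)"
proof -
  have v: "integrable lborel v" by (rule integrable_le_decay[OF vm vb])
  let ?U = "inverse_fourier v"
  note Um = inverse_fourier_measurable[OF vm]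
  obtain B0 where B0: "B0 \<ge> 0" "\<And>x. cmod (?U x) \<le> B0" using inverse_fourier_bound[OF v] by blast
  define B where "B p = v (fst p) * cnj (v (fst p - snd p)) * exp (\<i> * of_real (x \<bullet> snd p))" for p
  have Bm: "B \<in> borel_measurable borel"
  proof -
    note [measurable] = vm
    show ?thesis unfolding B_def[abs_def] borel_prod[symmetric] by measurable
  qed
  have Bi: "integrable lborel (\<lambda>p. B p / of_real ((norm (snd p))\<^sup>2))"
    unfolding B_def
  proof (rule autocorrelation_integrable[OF vm vb])
    show "(\<lambda>\<eta>. exp (\<i> * complex_of_real (x \<bullet> \<eta>))) \<in> borel_measurable borel" by measurable
    show "cmod (exp (\<i> * complex_of_real (x \<bullet> \<eta>))) \<le> 1" for \<eta> by (simp add: norm_exp_eq_Re)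
  qed
  let ?K = "\<lambda>p l. B p * of_real (gauss_kernel l (snd p))"
  have Kb: "(\<lambda>q. ?K (fst q) (snd q)) \<in> borel_measurable (borel :: ((R3 \<times> R3) \<times> real) measure)"
  proof -
    have "(\<lambda>q::(R3 \<times> R3) \<times> real. B (fst q)) \<in> borel_measurable borel"
      by (rule borel_compose_continuous[OF Bm]) (intro continuous_intros)
    moreover have "(\<lambda>q::(R3 \<times> R3) \<times> real. gauss_kernel (fst (snd q, snd (fst q))) (snd (snd q, snd (fst q)))) \<in> borel_measurable borel"
      by (rule borel_compose_continuous[OF gauss_kernel_measurable(1)]) (intro continuous_intros)
    ultimately show ?thesis by (intro borel_measurable_times measurable_compose[OF _ borel_measurable_of_real]) simp_all
  qed
  have Km: "(\<lambda>(p, l). ?K p l) \<in> borel_measurable (lborel \<Otimes>\<^sub>M lborel)"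
    using borel_measurable_pairI[OF Kb] by (simp add: case_prod_unfold)
  have nz: "AE p in (lborel :: (R3 \<times> R3) measure). snd p \<noteq> 0" by (rule AE_snd_nonzero)
  \<comment> \<open>Absolute convergence: integrating out \<open>l\<close> first turns the kernel
    into a multiple of \<open>1 / |\<eta>|^2\<close>, and then \<open>Bi\<close> applies.\<close>
  have int1: "integrable (lborel \<Otimes>\<^sub>M lborel) (\<lambda>(p, l). ?K p l)"
  proof (rule lborel_pair.Fubini_integrable[OF Km])
    show "AE p in lborel. integrable lborel (\<lambda>l. case (p, l) of (p, l) \<Rightarrow> ?K p l)"
      using nz
    proof eventually_elim
      case (elim p)
      have "integrable lborel (\<lambda>l. complex_of_real (gauss_kernel l (snd p)))"
        using integral_gauss_kernel_scale(1)[OF elim] by simp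
      then show ?case by simp
    qed
    have eq: "(LINT l|lborel. norm (?K p l)) = cmod (B p) * (LINT l|lborel. gauss_kernel l (snd p))" for p
      by (simp add: norm_mult)
    have m: "(\<lambda>p. LINT l|lborel. norm (?K p l)) \<in> borel_measurable lborel"
    proof (rule lborel.borel_measurable_lebesgue_integral)
      show "(\<lambda>(p, l). norm (?K p l)) \<in> borel_measurable (lborel \<Otimes>\<^sub>M lborel)"
        using measurable_compose[OF Km borel_measurable_norm] by (simp add: case_prod_unfold)
    qed
    have "integrable lborel (\<lambda>p. LINT l|lborel. norm (?K p l))"
    proof (rule Bochner_Integration.integrable_bound[OF integrable_mult_right[OF Bi, of "of_real (4 * pi * sqrt pi)"] m])
      show "AE p in lborel. norm (LINT l|lborel. norm (?K p l)) \<le> norm (of_real (4 * pi * sqrt pi) * (B p / of_real ((norm (snd p))\<^sup>2)))"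
        using nz
      proof eventually_elim
        case (elim p)
        show ?case unfolding eq integral_gauss_kernel_scale(2)[OF elim]
          by (simp add: norm_mult norm_divide norm_power abs_mult mult_ac)
      qed
    qed
    then show "integrable lborel (\<lambda>p. LINT l|lborel. norm (case (p, l) of (p, l) \<Rightarrow> ?K p l))" by simp
  qed
  define Y where "Y l = (LINT p|lborel. ?K p l)" for l
  have Yi: "integrable lborel Y" unfolding Y_def[abs_def] by (rule lborel_pair.integrable_snd[OF int1])
  have YI: "(LINT l|lborel. Y l) = of_real (4 * pi * sqrt pi) * (LINT p|lborel. B p / of_real ((norm (snd p))\<^sup>2))"
  proof -
    have "(LINT l|lborel. Y l) = (LINT p|lborel. (LINT l|lborel. ?K p l))"
      unfolding Y_def by (rule lborel_pair.Fubini_integral[OF int1])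
    also have "\<dots> = (LINT p|lborel. of_real (4 * pi * sqrt pi) * (B p / of_real ((norm (snd p))\<^sup>2)))"
    proof (rule integral_cong_AE)
      show "(\<lambda>p. LINT l|lborel. ?K p l) \<in> borel_measurable lborel"
        by (rule lborel.borel_measurable_lebesgue_integral[OF Km])
      show "(\<lambda>p. of_real (4 * pi * sqrt pi) * (B p / of_real ((norm (snd p))\<^sup>2))) \<in> borel_measurable lborel"
        using integrable_mult_right[OF Bi, of "of_real (4 * pi * sqrt pi)"] by (rule borel_measurable_integrable)
      show "AE p in lborel. (LINT l|lborel. ?K p l) = of_real (4 * pi * sqrt pi) * (B p / of_real ((norm (snd p))\<^sup>2))"
        using nz
      proof eventually_elim
        case (elim p)
        have "(LINT l|lborel. ?K p l) = B p * of_real (LINT l|lborel. gauss_kernel l (snd p))"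
          by (simp only: integral_mult_right_zero integral_complex_of_real)
        then show ?case unfolding integral_gauss_kernel_scale(2)[OF elim] by simp
      qed
    qed
    finally show ?thesis by (simp only: integral_mult_right_zero)
  qed
  let ?e = "\<lambda>l y. exp (- l\<^sup>2 * (norm (x - y))\<^sup>2) * (cmod (?U y))\<^sup>2"
  define z where "z l = (LINT y|lborel. ?e l y)" for l
  \<comment> \<open>Only for almost every \<open>l\<close>: the slices in \<open>p\<close> are
    integrable off a null set, and \<open>l = 0\<close> is excluded as the Gaussian is then
    constant.\<close>
  have zY: "AE l in lborel. of_real (z l) = of_real (fourier_const * fourier_const) * Y l"
    using lborel_pair.AE_integrable_snd[OF int1] AE_lborel_singleton[of "0::real"]
  proof eventually_elim
    case (elim l)
    have i: "integrable (lborel \<Otimes>\<^sub>M lborel) (\<lambda>(\<zeta>, \<eta>). ?K (\<zeta>, \<eta>) l)"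
      using elim(1) by (simp add: lborel_prod case_prod_unfold)
    have "Y l = (LINT p|(lborel \<Otimes>\<^sub>M lborel). (case p of (\<zeta>, \<eta>) \<Rightarrow> ?K (\<zeta>, \<eta>) l))"
      unfolding Y_def by (simp add: lborel_prod case_prod_unfold)
    also have "\<dots> = (LINT \<zeta>|lborel. (LINT \<eta>|lborel. ?K (\<zeta>, \<eta>) l))"
      by (rule lborel_pair.integral_fst[OF i, symmetric])
    finally have "of_real (fourier_const * fourier_const) * Y l = (LINT y|lborel. ?U y * (of_real (exp (- l\<^sup>2 * (norm (x - y))\<^sup>2)) * cnj (?U y)))"
      unfolding gaussian_average_of_square[OF v elim(2)] by (simp add: B_def)
    also have "\<dots> = (LINT y|lborel. complex_of_real (?e l y))"
      by (rule Bochner_Integration.integral_cong[OF refl]) (simp only: of_real_mult complex_norm_square mult_ac)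
    also have "\<dots> = of_real (z l)" unfolding z_def by (rule integral_complex_of_real)
    finally show ?case ..
  qed
  have em: "(\<lambda>(l, y). ?e l y) \<in> borel_measurable (lborel \<Otimes>\<^sub>M lborel)"
  proof -
    note [measurable] = Um
    show ?thesis by measurable
  qed
  have zm: "z \<in> borel_measurable lborel" unfolding z_def[abs_def] by (rule lborel.borel_measurable_lebesgue_integral[OF em])
  \<comment> \<open>Integrability of \<open>z\<close> is inherited from \<open>Y\<close> through
    \<open>zY\<close>. Since the integrand of \<open>z\<close> is nonnegative, the second Fubini
    argument \<open>int2\<close> follows without a bound on the total mass of
    \<open>|?U|^2\<close>.\<close>
  have zi: "integrable lborel z"
  proof (rule Bochner_Integration.integrable_bound[OF integrable_mult_right[OF Yi, of "of_real (fourier_const * fourier_const)"] zm])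
    show "AE l in lborel. norm (z l) \<le> norm (of_real (fourier_const * fourier_const) * Y l)"
      using zY by eventually_elim (metis norm_of_real order_refl real_norm_def)
  qed
  have int2: "integrable (lborel \<Otimes>\<^sub>M lborel) (\<lambda>(l, y). ?e l y)"
  proof (rule lborel_pair.Fubini_integrable[OF em])
    show "AE l in lborel. integrable lborel (\<lambda>y. case (l, y) of (l, y) \<Rightarrow> ?e l y)"
      using AE_lborel_singleton[of "0::real"]
    proof eventually_elim
      case (elim l)
      then have "l\<^sup>2 > 0" by simp
      note gi = integrable_mult_left[OF integrable_shifted_gaussian[OF this, of x], of "B0\<^sup>2"]
      have "integrable lborel (\<lambda>y. ?e l y)"
      proof (rule Bochner_Integration.integrable_bound[OF gi])
        note [measurable] = Um
        show "(\<lambda>y. ?e l y) \<in> borel_measurable lborel" by measurable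
        show "AE y in lborel. norm (?e l y) \<le> norm (exp (- l\<^sup>2 * (norm (x - y))\<^sup>2) * B0\<^sup>2)"
        proof (rule AE_I2)
          fix y
          have "?e l y \<le> exp (- l\<^sup>2 * (norm (x - y))\<^sup>2) * B0\<^sup>2"
            by (intro mult_left_mono power_mono B0) auto
          then show "norm (?e l y) \<le> norm (exp (- l\<^sup>2 * (norm (x - y))\<^sup>2) * B0\<^sup>2)" by simp
        qed
      qed
      then show ?case by simp
    qed
    have "(LINT y|lborel. norm (?e l y)) = z l" for l unfolding z_def by simp
    then show "integrable lborel (\<lambda>l. LINT y|lborel. norm (case (l, y) of (l, y) \<Rightarrow> ?e l y))" using zi by simp
  qed
  let ?P = "LINT y|lborel. 1 / norm (x - y) * (cmod (?U y))\<^sup>2"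
  have "(LINT l|lborel. z l) = (LINT y|lborel. (LINT l|lborel. ?e l y))"
    unfolding z_def by (rule lborel_pair.Fubini_integral[OF int2, symmetric])
  also have "\<dots> = (LINT y|lborel. sqrt pi * (1 / norm (x - y) * (cmod (?U y))\<^sup>2))"
  proof (rule integral_cong_AE)
    show "(\<lambda>y. LINT l|lborel. ?e l y) \<in> borel_measurable lborel"
      using lborel_pair.integrable_snd[OF int2] by (rule borel_measurable_integrable)
    note [measurable] = Um
    show "(\<lambda>y. sqrt pi * (1 / norm (x - y) * (cmod (?U y))\<^sup>2)) \<in> borel_measurable lborel" by measurable
    show "AE y in lborel. (LINT l|lborel. ?e l y) = sqrt pi * (1 / norm (x - y) * (cmod (?U y))\<^sup>2)"
      using AE_lborel_singleton[of x]
    proof eventually_elim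
      case (elim y)
      then have n: "norm (x - y) > 0" by simp
      then have a: "(norm (x - y))\<^sup>2 > 0" by simp
      have "(LINT l|lborel. exp (- l\<^sup>2 * (norm (x - y))\<^sup>2)) = sqrt (pi / (norm (x - y))\<^sup>2)"
        using gaussian_integral(2)[OF a, where 'a = real] by (simp add: mult.commute)
      also have "\<dots> = sqrt pi / norm (x - y)" using n by (simp add: real_sqrt_divide)
      finally have "(LINT l|lborel. exp (- l\<^sup>2 * (norm (x - y))\<^sup>2)) = sqrt pi / norm (x - y)" .
      then show ?case by (simp only: integral_mult_left_zero) simp
    qed
  qed
  also have "\<dots> = sqrt pi * ?P" by (rule integral_mult_right_zero)
  finally have zP: "(LINT l|lborel. z l) = sqrt pi * ?P" .
  have "complex_of_real (sqrt pi * ?P) = (LINT l|lborel. complex_of_real (z l))"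
    unfolding zP[symmetric] by (rule integral_complex_of_real[symmetric])
  also have "\<dots> = (LINT l|lborel. of_real (fourier_const * fourier_const) * Y l)"
  proof (rule integral_cong_AE[OF _ _ zY])
    show "(\<lambda>l. complex_of_real (z l)) \<in> borel_measurable lborel" by (rule measurable_compose[OF zm borel_measurable_of_real])
    show "(\<lambda>l. of_real (fourier_const * fourier_const) * Y l) \<in> borel_measurable lborel"
      using integrable_mult_right[OF Yi, of "of_real (fourier_const * fourier_const)"] by (rule borel_measurable_integrable)
  qed
  also have "\<dots> = of_real (fourier_const * fourier_const) * (of_real (4 * pi * sqrt pi) * (LINT p|lborel. B p / of_real ((norm (snd p))\<^sup>2)))"
    unfolding integral_mult_right_zero YI ..
  also have "\<dots> = of_real (sqrt pi) * ((LINT p|lborel. B p / of_real ((norm (snd p))\<^sup>2)) / of_real (2 * pi\<^sup>2))"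
  proof -
    \<comment> \<open>\<open>4 pi / (2 pi)^3 = 1 / (2 pi^2)\<close>, the constant of
      \<open>hart\<close>.\<close>
    have "fourier_const * fourier_const * (4 * pi * sqrt pi) = sqrt pi * (1 / (2 * pi\<^sup>2))"
      unfolding fourier_const_square by (simp add: power3_eq_cube power2_eq_square)
    then have "complex_of_real (fourier_const * fourier_const) * of_real (4 * pi * sqrt pi) = of_real (sqrt pi) * of_real (1 / (2 * pi\<^sup>2))"
      unfolding of_real_mult[symmetric] by (simp only:)
    then show ?thesis by (simp add: mult.assoc[symmetric])
  qed
  finally have "complex_of_real (sqrt pi) * of_real ?P = of_real (sqrt pi) * ((LINT p|lborel. B p / of_real ((norm (snd p))\<^sup>2)) / of_real (2 * pi\<^sup>2))"
    by (simp only: of_real_mult)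
  then have "of_real ?P = (LINT p|lborel. B p / of_real ((norm (snd p))\<^sup>2)) / of_real (2 * pi\<^sup>2)"
    by (subst (asm) mult_cancel_left) simp
  then show ?thesis by (simp only: B_def)
qed

text \<open>After Fubini the shift of \<open>\<xi>\<close> by the transferred frequency splits the
  exponential, and the triple integral factors into the potential and the inverse transform of
  \<open>v\<close>.\<close>

lemma coulomb_times_inverse_fourier:
  assumes vm: "v \<in> borel_measurable borel" and vb: "\<And>\<xi>. cmod (v \<xi>) \<le> M * decay \<xi>"
  shows "of_real (LINT y|lborel. 1 / norm (x - y) * (cmod (inverse_fourier v y))\<^sup>2) * inverse_fourier v x = inverse_fourier (hart v) x"
proof -
  have v: "integrable lborel v" by (rule integrable_le_decay[OF vm vb])
  let ?E = "\<lambda>\<xi>. exp (\<i> * complex_of_real (x \<bullet> \<xi>))"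
  have E1: "cmod (?E \<xi>) = 1" for \<xi> by (simp add: norm_exp_eq_Re)
  have Eif: "inverse_fourier f x = of_real fourier_const * (LINT \<xi>|lborel. ?E \<xi> * f \<xi>)" for f
    by (simp add: inverse_fourier_def fourier_eq inner_commute)
  define G where "G p = v (fst p) * cnj (v (fst p - snd p)) / of_real ((norm (snd p))\<^sup>2)" for p
  have Gi: "integrable lborel G"
    using autocorrelation_integrable[OF vm vb, of "\<lambda>_. 1"] by (simp add: G_def[abs_def])
  let ?T = "\<lambda>p \<xi>. G p * (?E \<xi> * v (\<xi> - snd p))"
  have sm: "(\<lambda>\<xi>. ?E (\<xi> + \<eta>) * v \<xi>) \<in> borel_measurable borel" for \<eta>
  proof -
    note [measurable] = vm
    show ?thesis by measurable
  qed
  have Tm: "(\<lambda>(p, \<xi>). ?T p \<xi>) \<in> borel_measurable (lborel \<Otimes>\<^sub>M lborel)"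
  proof -
    have "(\<lambda>q::(R3 \<times> R3) \<times> R3. G (fst q)) \<in> borel_measurable borel"
      by (rule borel_compose_continuous[OF _ continuous_on_fst[OF continuous_on_id]]) (use Gi in simp)
    moreover have "(\<lambda>q::(R3 \<times> R3) \<times> R3. v (snd q - snd (fst q))) \<in> borel_measurable borel"
      by (rule borel_compose_continuous[OF vm]) (intro continuous_intros)
    moreover have "(\<lambda>q::(R3 \<times> R3) \<times> R3. ?E (snd q)) \<in> borel_measurable borel"
      by (intro borel_measurable_continuous_onI continuous_intros)
    ultimately have "(\<lambda>q::(R3 \<times> R3) \<times> R3. ?T (fst q) (snd q)) \<in> borel_measurable borel"
      by (intro borel_measurable_times)
    from borel_measurable_pairI[OF this] show ?thesis by (simp add: case_prod_unfold)
  qed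
  have shift: "integrable lborel (\<lambda>\<xi>. ?E \<xi> * v (\<xi> - \<eta>))"
    "(LINT \<xi>|lborel. ?E \<xi> * v (\<xi> - \<eta>)) = ?E \<eta> * (LINT \<xi>|lborel. ?E \<xi> * v \<xi>)" for \<eta>
  proof -
    have Ei: "integrable lborel (\<lambda>\<xi>. ?E (\<xi> + \<eta>) * v \<xi>)"
      by (rule Bochner_Integration.integrable_bound[OF v]) (use sm[of \<eta>] in \<open>auto simp: norm_mult E1\<close>)
    show "integrable lborel (\<lambda>\<xi>. ?E \<xi> * v (\<xi> - \<eta>))"
      using lborel_integral_shift(2)[OF sm[of \<eta>], of "- \<eta>"] Ei by simp
    have "(LINT \<xi>|lborel. ?E \<xi> * v (\<xi> - \<eta>)) = (LINT \<xi>|lborel. ?E (\<xi> + \<eta>) * v \<xi>)"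
      using lborel_integral_shift(1)[OF sm[of \<eta>], of "- \<eta>"] by simp
    also have "\<dots> = (LINT \<xi>|lborel. ?E \<eta> * (?E \<xi> * v \<xi>))"
      by (rule Bochner_Integration.integral_cong[OF refl]) (simp add: inner_add_right distrib_left exp_add mult_ac)
    finally show "(LINT \<xi>|lborel. ?E \<xi> * v (\<xi> - \<eta>)) = ?E \<eta> * (LINT \<xi>|lborel. ?E \<xi> * v \<xi>)"
      by (simp only: integral_mult_right_zero)
  qed
  have vi: "integrable lborel (\<lambda>\<xi>. cmod (v \<xi>))" "(LINT \<xi>|lborel. cmod (v (\<xi> - \<eta>))) = (LINT \<xi>|lborel. cmod (v \<xi>))" for \<eta>
  proof -
    show "integrable lborel (\<lambda>\<xi>. cmod (v \<xi>))" using v by (rule integrable_norm)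
    have m: "(\<lambda>\<xi>. cmod (v \<xi>)) \<in> borel_measurable borel" by (rule measurable_compose[OF vm borel_measurable_norm])
    show "(LINT \<xi>|lborel. cmod (v (\<xi> - \<eta>))) = (LINT \<xi>|lborel. cmod (v \<xi>))" using lborel_integral_shift(1)[OF m, of "- \<eta>"] by simp
  qed
  have int: "integrable (lborel \<Otimes>\<^sub>M lborel) (\<lambda>(p, \<xi>). ?T p \<xi>)"
  proof (rule lborel_pair.Fubini_integrable[OF Tm])
    show "AE p in lborel. integrable lborel (\<lambda>\<xi>. case (p, \<xi>) of (p, \<xi>) \<Rightarrow> ?T p \<xi>)"
      using shift(1) by simp
    have "(LINT \<xi>|lborel. norm (?T p \<xi>)) = cmod (G p) * (LINT \<xi>|lborel. cmod (v \<xi>))" for p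
      by (simp add: norm_mult vi(2))
    then show "integrable lborel (\<lambda>p. LINT \<xi>|lborel. norm (case (p, \<xi>) of (p, \<xi>) \<Rightarrow> ?T p \<xi>))"
      using Gi by simp
  qed
  have "(LINT \<xi>|lborel. ?E \<xi> * quad v \<xi>) = (LINT \<xi>|lborel. (LINT p|lborel. ?T p \<xi>))"
  proof (rule Bochner_Integration.integral_cong[OF refl])
    fix \<xi>
    have "?E \<xi> * quad v \<xi> = (LINT p|lborel. ?E \<xi> * (v (fst p) * cnj (v (fst p - snd p)) * v (\<xi> - snd p) / of_real ((norm (snd p))\<^sup>2)))"
      unfolding quad_def by (rule integral_mult_right_zero[symmetric])
    also have "\<dots> = (LINT p|lborel. ?T p \<xi>)"
      by (rule Bochner_Integration.integral_cong[OF refl]) (simp add: G_def mult_ac)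
    finally show "?E \<xi> * quad v \<xi> = (LINT p|lborel. ?T p \<xi>)" .
  qed
  also have "\<dots> = (LINT p|lborel. (LINT \<xi>|lborel. ?T p \<xi>))" by (rule lborel_pair.Fubini_integral[OF int])
  also have "\<dots> = (LINT p|lborel. (G p * ?E (snd p)) * (LINT \<xi>|lborel. ?E \<xi> * v \<xi>))"
    by (simp only: integral_mult_right_zero shift(2) mult.assoc)
  also have "\<dots> = (LINT p|lborel. G p * ?E (snd p)) * (LINT \<xi>|lborel. ?E \<xi> * v \<xi>)" by (rule integral_mult_left_zero)
  finally have key: "(LINT \<xi>|lborel. ?E \<xi> * quad v \<xi>) = (LINT p|lborel. G p * ?E (snd p)) * (LINT \<xi>|lborel. ?E \<xi> * v \<xi>)" .
  have "inverse_fourier (hart v) x = of_real fourier_const * ((LINT \<xi>|lborel. ?E \<xi> * quad v \<xi>) / of_real (2 * pi\<^sup>2))"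
    unfolding Eif hart_def by (simp only: times_divide_eq_right integral_divide_zero)
  also have "\<dots> = ((LINT p|lborel. G p * ?E (snd p)) / of_real (2 * pi\<^sup>2)) * inverse_fourier v x"
    unfolding key Eif by simp
  also have "(LINT p|lborel. G p * ?E (snd p)) / of_real (2 * pi\<^sup>2) = of_real (LINT y|lborel. 1 / norm (x - y) * (cmod (inverse_fourier v y))\<^sup>2)"
    unfolding coulomb_potential[OF vm vb] G_def by simp
  finally show ?thesis ..
qed

lemma hart_measurable:
  assumes vm: "v \<in> borel_measurable borel"
  shows "hart v \<in> borel_measurable borel"
proof -
  have "(\<lambda>q::R3 \<times> (R3 \<times> R3). v (fst (snd q))) \<in> borel_measurable borel"
    "(\<lambda>q::R3 \<times> (R3 \<times> R3). v (fst (snd q) - snd (snd q))) \<in> borel_measurable borel"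
    "(\<lambda>q::R3 \<times> (R3 \<times> R3). v (fst q - snd (snd q))) \<in> borel_measurable borel"
    by (rule borel_compose_continuous[OF vm], intro continuous_intros)+
  moreover have "(\<lambda>q::R3 \<times> (R3 \<times> R3). complex_of_real ((norm (snd (snd q)))\<^sup>2)) \<in> borel_measurable borel"
    by (intro borel_measurable_continuous_onI continuous_intros)
  ultimately have "(\<lambda>q::R3 \<times> (R3 \<times> R3). v (fst (snd q)) * cnj (v (fst (snd q) - snd (snd q))) * v (fst q - snd (snd q)) / of_real ((norm (snd (snd q)))\<^sup>2)) \<in> borel_measurable borel"
    by (intro borel_measurable_times borel_measurable_divide borel_measurable_cnj_compose)
  from borel_measurable_pairI[OF this]
  have "(\<lambda>(\<xi>, p). v (fst p) * cnj (v (fst p - snd p)) * v (\<xi> - snd p) / of_real ((norm (snd p))\<^sup>2)) \<in> borel_measurable (lborel \<Otimes>\<^sub>M lborel)"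
    by (simp add: case_prod_unfold)
  from lborel.borel_measurable_lebesgue_integral[OF this]
  have "quad v \<in> borel_measurable borel" unfolding quad_def[abs_def] by simp
  then show ?thesis unfolding hart_def[abs_def] by (intro borel_measurable_divide) auto
qed

text \<open>\<open>fun_of\<close> is known only up to null sets. The potential is an integral and
  hence unaffected at every point; the outer factor is corrected under the integral against a
  Schwartz function.\<close>

lemma hartree_spectral:
  assumes vm: "v \<in> borel_measurable borel" and vb: "\<And>\<xi>. cmod (v \<xi>) \<le> M * decay \<xi>"
  shows "hartree (spectral v) = spectral (hart v)"
proof -
  have v: "integrable lborel v" by (rule integrable_le_decay[OF vm vb])
  let ?u = "spectral v" and ?U = "inverse_fourier v"
  note Um = inverse_fourier_measurable[OF vm]
  have fm: "fun_of ?u \<in> borel_measurable borel" and ae: "AE x in lborel. fun_of ?u x = ?U x"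
    using represented_by_fun_of[OF represented_by_spectral[OF v]] by (auto simp: represented_by_def)
  have conv: "convolution3 (\<lambda>y. 1 / norm y) (\<lambda>y. (cmod (fun_of ?u y))\<^sup>2) x = (LINT y|lborel. 1 / norm (x - y) * (cmod (?U y))\<^sup>2)" for x
    unfolding convolution3_def
  proof (rule integral_cong_AE)
    note [measurable] = Um fm
    show "(\<lambda>y. 1 / norm (x - y) * (cmod (fun_of ?u y))\<^sup>2) \<in> borel_measurable lborel" by measurable
    show "(\<lambda>y. 1 / norm (x - y) * (cmod (?U y))\<^sup>2) \<in> borel_measurable lborel" by measurable
    show "AE y in lborel. 1 / norm (x - y) * (cmod (fun_of ?u y))\<^sup>2 = 1 / norm (x - y) * (cmod (?U y))\<^sup>2"
      using ae by eventually_elim simp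
  qed
  let ?V = "\<lambda>x. LINT y|lborel. 1 / norm (x - y) * (cmod (?U y))\<^sup>2"
  have Vm: "?V \<in> borel_measurable lborel"
  proof (rule lborel.borel_measurable_lebesgue_integral)
    note [measurable] = Um
    show "(\<lambda>(x, y). 1 / norm (x - y) * (cmod (?U y))\<^sup>2) \<in> borel_measurable (lborel \<Otimes>\<^sub>M lborel)" by measurable
  qed
  have "dist_of (\<lambda>x. of_real (?V x) * fun_of ?u x) \<psi> = dist_of (inverse_fourier (hart v)) \<psi>" for \<psi>
  proof (cases "\<psi> \<in> schwartz")
    case True
    have "(LINT x|lborel. of_real (?V x) * fun_of ?u x * \<psi> x) = (LINT x|lborel. inverse_fourier (hart v) x * \<psi> x)"
    proof (rule integral_cong_AE)
      have \<psi>m: "\<psi> \<in> borel_measurable lborel" using schwartz_measurable[OF True] by simp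
      show "(\<lambda>x. of_real (?V x) * fun_of ?u x * \<psi> x) \<in> borel_measurable lborel"
        by (intro borel_measurable_times measurable_compose[OF Vm borel_measurable_of_real] \<psi>m) (use fm in simp)
      show "(\<lambda>x. inverse_fourier (hart v) x * \<psi> x) \<in> borel_measurable lborel"
        by (intro borel_measurable_times \<psi>m) (use inverse_fourier_measurable[OF hart_measurable[OF vm]] in simp)
      show "AE x in lborel. of_real (?V x) * fun_of ?u x * \<psi> x = inverse_fourier (hart v) x * \<psi> x"
        using ae by eventually_elim (simp only: coulomb_times_inverse_fourier[OF vm vb, symmetric])
    qed
    then show ?thesis using True by (simp add: dist_of_def)
  qed (simp add: dist_of_def)
  then show ?thesis unfolding hartree_def conv spectral_def[of "hart v"] by (rule ext)
qed

text \<open>The definite description is met because a tempered distribution is determined by its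
  Fourier transform; the multiplied representatives agree almost everywhere.\<close>

lemma fourier_multiplier_spectral:
  assumes v: "integrable lborel v" and sm: "\<sigma> \<in> borel_measurable borel" and sv: "integrable lborel (\<lambda>\<xi>. \<sigma> \<xi> * v \<xi>)"
  shows "fourier_multiplier \<sigma> (spectral v) = spectral (\<lambda>\<xi>. \<sigma> \<xi> * v \<xi>)"
proof -
  let ?f = "\<lambda>\<xi>. \<sigma> \<xi> * fun_of (fourier_dist (spectral v)) \<xi>"
  have r: "represented_by (fourier_dist (spectral v)) (fun_of (fourier_dist (spectral v)))"
    and ae: "AE \<xi> in lborel. fun_of (fourier_dist (spectral v)) \<xi> = v \<xi>"
    by (rule represented_by_fun_of[OF fourier_dist_spectral[OF v]])+
  have rep: "represented_by (fourier_dist (spectral (\<lambda>\<xi>. \<sigma> \<xi> * v \<xi>))) ?f"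
  proof (rule represented_by_cong[OF fourier_dist_spectral[OF sv]])
    show "?f \<in> borel_measurable borel" using r sm by (intro borel_measurable_times) (auto simp: represented_by_def)
    show "AE \<xi> in lborel. \<sigma> \<xi> * v \<xi> = ?f \<xi>" using ae by eventually_elim simp
  qed
  show ?thesis
    unfolding fourier_multiplier_def
  proof (rule the_equality)
    show "spectral (\<lambda>\<xi>. \<sigma> \<xi> * v \<xi>) \<in> tempered \<and> represented_by (fourier_dist (spectral (\<lambda>\<xi>. \<sigma> \<xi> * v \<xi>))) ?f"
      using rep spectral_tempered[OF sv] by blast
    fix u assume u: "u \<in> tempered \<and> represented_by (fourier_dist u) ?f"
    have "fourier_dist u = fourier_dist (spectral (\<lambda>\<xi>. \<sigma> \<xi> * v \<xi>))"
      using u rep by (auto simp: represented_by_def)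
    then show "u = spectral (\<lambda>\<xi>. \<sigma> \<xi> * v \<xi>)"
      using u spectral_tempered[OF sv] tempered_fourier_dist_inj by blast
  qed
qed

section \<open>Small solutions on the Fourier side\<close>

definition dispersion :: "real \<Rightarrow> R3 \<Rightarrow> real"
  where "dispersion m \<xi> = sqrt ((norm \<xi>)\<^sup>2 + m\<^sup>2)"

definition phase :: "real \<Rightarrow> real \<Rightarrow> R3 \<Rightarrow> complex"
  where "phase m t \<xi> = exp (\<i> * of_real (t * dispersion m \<xi>))"

text \<open>The free evolution is factored out, so that only the backward phase stays under the
  integral. Cutting off with \<open>if\<close> over the whole line makes this an integral with
  jointly measurable integrand in \<open>t\<close>, \<open>\<xi>\<close> and
  \<open>\<tau>\<close>.\<close>

definition duhamel :: "real \<Rightarrow> (R3 \<Rightarrow> complex) \<Rightarrow> (real \<times> R3 \<Rightarrow> complex) \<Rightarrow> real \<Rightarrow> R3 \<Rightarrow> complex"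
  where "duhamel m \<phi> V t \<xi> = phase m (- t) \<xi> *
    (\<phi> \<xi> + \<i> * (LINT \<tau>|lborel. (if 0 \<le> \<tau> \<and> \<tau> \<le> t then phase m \<tau> \<xi> * hart (\<lambda>\<zeta>. V (\<tau>, \<zeta>)) \<xi> else 0)))"

text \<open>Bundles the size and the Lipschitz estimate, so that one constant can be fixed and
  passed on as a single hypothesis.\<close>

definition hart_constant :: "real \<Rightarrow> bool"
  where "hart_constant C \<longleftrightarrow> C > 0 \<and>
    (\<forall>v M. v \<in> borel_measurable borel \<longrightarrow> (\<forall>\<xi>. cmod (v \<xi>) \<le> M * decay \<xi>) \<longrightarrow> (\<forall>\<xi>. cmod (hart v \<xi>) \<le> C * M ^ 3 * decay \<xi>)) \<and>
    (\<forall>v w M \<delta>. v \<in> borel_measurable borel \<longrightarrow> w \<in> borel_measurable borel \<longrightarrow>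
      (\<forall>\<xi>. cmod (v \<xi>) \<le> M * decay \<xi>) \<longrightarrow> (\<forall>\<xi>. cmod (w \<xi>) \<le> M * decay \<xi>) \<longrightarrow>
      (\<forall>\<xi>. cmod (v \<xi> - w \<xi>) \<le> \<delta> * decay \<xi>) \<longrightarrow> (\<forall>\<xi>. cmod (hart v \<xi> - hart w \<xi>) \<le> 3 * C * M\<^sup>2 * \<delta> * decay \<xi>))"

lemma hart_constant_exists: obtains C where "hart_constant C"
proof -
  obtain C where "C > 0"
    and "\<And>v M \<xi>. v \<in> borel_measurable borel \<Longrightarrow> (\<And>\<xi>. cmod (v \<xi>) \<le> M * decay \<xi>) \<Longrightarrow> cmod (hart v \<xi>) \<le> C * M ^ 3 * decay \<xi>"
    and "\<And>v w M \<delta> \<xi>. v \<in> borel_measurable borel \<Longrightarrow> w \<in> borel_measurable borel \<Longrightarrow>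
      (\<And>\<xi>. cmod (v \<xi>) \<le> M * decay \<xi>) \<Longrightarrow> (\<And>\<xi>. cmod (w \<xi>) \<le> M * decay \<xi>) \<Longrightarrow>
      (\<And>\<xi>. cmod (v \<xi> - w \<xi>) \<le> \<delta> * decay \<xi>) \<Longrightarrow> cmod (hart v \<xi> - hart w \<xi>) \<le> 3 * C * M\<^sup>2 * \<delta> * decay \<xi>"
    using hart_estimates by blast
  then have "hart_constant C" unfolding hart_constant_def by blast
  then show ?thesis by (rule that)
qed

lemma hart_constantD:
  assumes "hart_constant C"
  shows "C > 0"
    and "v \<in> borel_measurable borel \<Longrightarrow> (\<And>\<xi>. cmod (v \<xi>) \<le> M * decay \<xi>) \<Longrightarrow> cmod (hart v \<xi>) \<le> C * M ^ 3 * decay \<xi>"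
    and "v \<in> borel_measurable borel \<Longrightarrow> w \<in> borel_measurable borel \<Longrightarrow>
      (\<And>\<xi>. cmod (v \<xi>) \<le> M * decay \<xi>) \<Longrightarrow> (\<And>\<xi>. cmod (w \<xi>) \<le> M * decay \<xi>) \<Longrightarrow>
      (\<And>\<xi>. cmod (v \<xi> - w \<xi>) \<le> \<delta> * decay \<xi>) \<Longrightarrow> cmod (hart v \<xi> - hart w \<xi>) \<le> 3 * C * M\<^sup>2 * \<delta> * decay \<xi>"
  using assms unfolding hart_constant_def by blast+

section \<open>Phases, measurability and bounds for the Duhamel integral\<close>

lemma dispersion_nonneg [simp]: "0 \<le> dispersion m \<xi>"
  by (simp add: dispersion_def)

lemma dispersion_continuous: "continuous_on UNIV (dispersion m)"
  unfolding dispersion_def[abs_def] by (intro continuous_intros)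

text \<open>Quadratic growth is a crude bound, chosen to match the spare factor
  \<open>1 + |\<xi>|^2\<close> in \<open>decay\<close>.\<close>

lemma dispersion_le: "dispersion m \<xi> \<le> (1 + \<bar>m\<bar>) * (1 + (norm \<xi>)\<^sup>2)"
proof -
  have "dispersion m \<xi> \<le> sqrt ((norm \<xi>)\<^sup>2) + sqrt (m\<^sup>2)" unfolding dispersion_def by (rule sqrt_add_le_add_sqrt) auto
  then have "dispersion m \<xi> \<le> norm \<xi> + \<bar>m\<bar>" by simp
  moreover have "norm \<xi> \<le> 1 + (norm \<xi>)\<^sup>2"
  proof -
    have "2 * norm \<xi> \<le> 1 + (norm \<xi>)\<^sup>2"
      using zero_le_power2[of "norm \<xi> - 1"] by (simp add: power2_eq_square algebra_simps)
    then show ?thesis using zero_le_power2[of "norm \<xi>"] by linarith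
  qed
  moreover have "\<bar>m\<bar> * 1 \<le> \<bar>m\<bar> * (1 + (norm \<xi>)\<^sup>2)" by (rule mult_left_mono) auto
  ultimately have "dispersion m \<xi> \<le> (1 + (norm \<xi>)\<^sup>2) + \<bar>m\<bar> * (1 + (norm \<xi>)\<^sup>2)" by linarith
  then show ?thesis by (simp add: distrib_right)
qed

lemma phase_norm [simp]: "cmod (phase m t \<xi>) = 1"
  by (simp add: phase_def norm_exp_eq_Re)

lemma phase_continuous: "continuous_on UNIV (\<lambda>q. phase m (fst q) (snd q))"
  unfolding phase_def by (intro continuous_intros continuous_on_compose2[OF dispersion_continuous]) auto

lemma phase_measurable:
  "phase m t \<in> borel_measurable borel" "(\<lambda>t. phase m t \<xi>) \<in> borel_measurable borel"
proof -
  have "continuous_on UNIV (phase m t)"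
    using continuous_on_compose2[OF phase_continuous[of m], of UNIV "\<lambda>\<xi>. (t, \<xi>)"] by (simp add: continuous_intros)
  then show "phase m t \<in> borel_measurable borel" by (rule borel_measurable_continuous_onI)
  have "continuous_on UNIV (\<lambda>t. phase m t \<xi>)"
    using continuous_on_compose2[OF phase_continuous[of m], of UNIV "\<lambda>t. (t, \<xi>)"] by (simp add: continuous_intros)
  then show "(\<lambda>t. phase m t \<xi>) \<in> borel_measurable borel" by (rule borel_measurable_continuous_onI)
qed

lemma phase_cancel: "phase m (- t) \<xi> * phase m t \<xi> = 1"
  by (simp add: phase_def exp_add[symmetric])

lemma phase_derivative:
  "((\<lambda>t. phase m (- t) \<xi>) has_vector_derivative - (\<i> * of_real (dispersion m \<xi>)) * phase m (- t) \<xi>) (at t within S)"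
proof -
  have "((\<lambda>t. exp (t *\<^sub>R (- (\<i> * of_real (dispersion m \<xi>))))) has_vector_derivative
      exp (t *\<^sub>R (- (\<i> * of_real (dispersion m \<xi>)))) * (- (\<i> * of_real (dispersion m \<xi>)))) (at t within S)"
    by (rule exp_scaleR_has_vector_derivative_right)
  then show ?thesis by (simp add: phase_def scaleR_conv_of_real mult_ac)
qed

lemma slice_measurable:
  "V \<in> borel_measurable borel \<Longrightarrow> (\<lambda>\<zeta>. V (t, \<zeta>)) \<in> borel_measurable borel"
  by (rule borel_compose_continuous[of V "\<lambda>\<zeta>. (t, \<zeta>)"]) (simp_all add: continuous_intros)

text \<open>The Duhamel map is iterated, so measurability is required in time and frequency
  together; it passes through integrals depending on parameters.\<close>

lemma hart_joint_measurable:
  fixes V :: "real \<times> R3 \<Rightarrow> complex"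
  assumes V: "V \<in> borel_measurable borel"
  shows "(\<lambda>q. hart (\<lambda>\<zeta>. V (fst q, \<zeta>)) (snd q)) \<in> borel_measurable (borel :: (real \<times> R3) measure)"
proof -
  let ?Q = "\<lambda>q::(real \<times> R3) \<times> (R3 \<times> R3). q"
  have "(\<lambda>q::(real \<times> R3) \<times> (R3 \<times> R3). V (fst (fst q), fst (snd q))) \<in> borel_measurable borel"
    "(\<lambda>q::(real \<times> R3) \<times> (R3 \<times> R3). V (fst (fst q), fst (snd q) - snd (snd q))) \<in> borel_measurable borel"
    "(\<lambda>q::(real \<times> R3) \<times> (R3 \<times> R3). V (fst (fst q), snd (fst q) - snd (snd q))) \<in> borel_measurable borel"
    by (rule borel_compose_continuous[OF V], intro continuous_intros)+
  moreover have "(\<lambda>q::(real \<times> R3) \<times> (R3 \<times> R3). complex_of_real ((norm (snd (snd q)))\<^sup>2)) \<in> borel_measurable borel"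
    by (intro borel_measurable_continuous_onI continuous_intros)
  ultimately have "(\<lambda>q::(real \<times> R3) \<times> (R3 \<times> R3). V (fst (fst q), fst (snd q)) * cnj (V (fst (fst q), fst (snd q) - snd (snd q)))
      * V (fst (fst q), snd (fst q) - snd (snd q)) / of_real ((norm (snd (snd q)))\<^sup>2)) \<in> borel_measurable borel"
    by (intro borel_measurable_times borel_measurable_divide borel_measurable_cnj_compose)
  from borel_measurable_pairI[OF this]
  have "(\<lambda>(q, p). V (fst q, fst p) * cnj (V (fst q, fst p - snd p)) * V (fst q, snd q - snd p) / of_real ((norm (snd p))\<^sup>2)) \<in> borel_measurable (lborel \<Otimes>\<^sub>M lborel)"
    by (simp add: case_prod_unfold)
  from lborel.borel_measurable_lebesgue_integral[OF this]
  have "(\<lambda>q. quad (\<lambda>\<zeta>. V (fst q, \<zeta>)) (snd q)) \<in> borel_measurable borel" unfolding quad_def by simp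
  then show ?thesis unfolding hart_def by (intro borel_measurable_divide) auto
qed

lemma hart_time_measurable:
  fixes V :: "real \<times> R3 \<Rightarrow> complex"
  assumes V: "V \<in> borel_measurable borel"
  shows "(\<lambda>\<tau>. hart (\<lambda>\<zeta>. V (\<tau>, \<zeta>)) \<xi>) \<in> borel_measurable borel"
  using borel_compose_continuous[OF hart_joint_measurable[OF V], of "\<lambda>\<tau>. (\<tau>, \<xi>)"] by (simp add: continuous_intros)

lemma duhamel_measurable:
  assumes V: "V \<in> borel_measurable borel" and \<phi>: "\<phi> \<in> borel_measurable borel"
  shows "(\<lambda>q. duhamel m \<phi> V (fst q) (snd q)) \<in> borel_measurable (borel :: (real \<times> R3) measure)"
proof -
  have cl: "closed {r :: (real \<times> R3) \<times> real. 0 \<le> snd r \<and> snd r \<le> fst (fst r)}"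
    by (intro closed_Collect_conj closed_Collect_le continuous_intros)
  have "(\<lambda>r::(real \<times> R3) \<times> real. hart (\<lambda>\<zeta>. V (fst (snd r, snd (fst r)), \<zeta>)) (snd (snd r, snd (fst r)))) \<in> borel_measurable borel"
    by (rule borel_compose_continuous[OF hart_joint_measurable[OF V]]) (intro continuous_intros)
  moreover have "(\<lambda>r::(real \<times> R3) \<times> real. phase m (snd r) (snd (fst r))) \<in> borel_measurable borel"
    using continuous_on_compose2[OF phase_continuous[of m], of UNIV "\<lambda>r::(real \<times> R3) \<times> real. (snd r, snd (fst r))"]
    by (intro borel_measurable_continuous_onI) (simp add: continuous_intros)
  ultimately have "(\<lambda>r::(real \<times> R3) \<times> real. if 0 \<le> snd r \<and> snd r \<le> fst (fst r) then phase m (snd r) (snd (fst r)) * hart (\<lambda>\<zeta>. V (snd r, \<zeta>)) (snd (fst r)) else 0) \<in> borel_measurable borel"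
    using cl by (intro measurable_If borel_measurable_times) (simp_all add: borel_closed)
  from borel_measurable_pairI[OF this]
  have "(\<lambda>(q, \<tau>). if 0 \<le> \<tau> \<and> \<tau> \<le> fst q then phase m \<tau> (snd q) * hart (\<lambda>\<zeta>. V (\<tau>, \<zeta>)) (snd q) else 0) \<in> borel_measurable (lborel \<Otimes>\<^sub>M lborel)"
    by (simp add: case_prod_unfold)
  from lborel.borel_measurable_lebesgue_integral[OF this]
  have J: "(\<lambda>q. LINT \<tau>|lborel. (if 0 \<le> \<tau> \<and> \<tau> \<le> fst q then phase m \<tau> (snd q) * hart (\<lambda>\<zeta>. V (\<tau>, \<zeta>)) (snd q) else 0)) \<in> borel_measurable borel"
    by simp
  have p: "(\<lambda>q::real \<times> R3. phase m (- fst q) (snd q)) \<in> borel_measurable borel"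
    using continuous_on_compose2[OF phase_continuous[of m], of UNIV "\<lambda>q::real \<times> R3. (- fst q, snd q)"]
    by (intro borel_measurable_continuous_onI) (simp add: continuous_intros)
  have f: "(\<lambda>q::real \<times> R3. \<phi> (snd q)) \<in> borel_measurable borel"
    by (rule borel_compose_continuous[OF \<phi>]) (intro continuous_intros)
  show ?thesis unfolding duhamel_def
    by (intro borel_measurable_times borel_measurable_add borel_measurable_const J p f)
qed

lemma time_integral:
  fixes g :: "real \<Rightarrow> complex"
  assumes g: "g \<in> borel_measurable borel" and t: "0 \<le> t" and B: "\<And>\<tau>. \<tau> \<in> {0..t} \<Longrightarrow> cmod (g \<tau>) \<le> B"
  shows "integrable lborel (\<lambda>\<tau>. if 0 \<le> \<tau> \<and> \<tau> \<le> t then g \<tau> else 0)"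
    and "cmod (LINT \<tau>|lborel. (if 0 \<le> \<tau> \<and> \<tau> \<le> t then g \<tau> else 0)) \<le> t * B"
proof -
  have eq: "(if 0 \<le> \<tau> \<and> \<tau> \<le> t then g \<tau> else 0) = indicator {0..t} \<tau> *\<^sub>R g \<tau>" for \<tau> by (simp split: split_indicator)
  have B0: "B \<ge> 0" using order_trans[OF norm_ge_zero B[of 0]] t by simp
  have bi: "integrable lborel (\<lambda>\<tau>. B * indicator {0..t} \<tau>)"
    using t by (intro integrable_mult_right integrable_real_indicator) auto
  have le: "cmod (if 0 \<le> \<tau> \<and> \<tau> \<le> t then g \<tau> else 0) \<le> B * indicator {0..t} \<tau>" for \<tau>
    using B[of \<tau>] by (simp split: split_indicator)
  show i: "integrable lborel (\<lambda>\<tau>. if 0 \<le> \<tau> \<and> \<tau> \<le> t then g \<tau> else 0)"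
  proof (rule Bochner_Integration.integrable_bound[OF bi])
    show "(\<lambda>\<tau>. if 0 \<le> \<tau> \<and> \<tau> \<le> t then g \<tau> else 0) \<in> borel_measurable lborel"
      unfolding eq using g by (intro borel_measurable_scaleR borel_measurable_indicator) auto
    show "AE \<tau> in lborel. norm (if 0 \<le> \<tau> \<and> \<tau> \<le> t then g \<tau> else 0) \<le> norm (B * indicator {0..t} \<tau>)"
      by (intro AE_I2 order_trans[OF le]) simp
  qed
  have "cmod (LINT \<tau>|lborel. (if 0 \<le> \<tau> \<and> \<tau> \<le> t then g \<tau> else 0)) \<le> (LINT \<tau>|lborel. B * indicator {0..t} \<tau>)"
    by (rule norm_integral_le[OF i bi le])
  also have "\<dots> = t * B" using t by simp
  finally show "cmod (LINT \<tau>|lborel. (if 0 \<le> \<tau> \<and> \<tau> \<le> t then g \<tau> else 0)) \<le> t * B" .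
qed

lemma duhamel_integral_bound:
  assumes C: "hart_constant C" and t: "t \<in> {0..T}" and V: "V \<in> borel_measurable borel"
    and Vb: "\<And>\<tau> \<xi>. \<tau> \<in> {0..T} \<Longrightarrow> cmod (V (\<tau>, \<xi>)) \<le> M * decay \<xi>"
  shows "integrable lborel (\<lambda>\<tau>. if 0 \<le> \<tau> \<and> \<tau> \<le> t then phase m \<tau> \<xi> * hart (\<lambda>\<zeta>. V (\<tau>, \<zeta>)) \<xi> else 0)"
    and "cmod (LINT \<tau>|lborel. (if 0 \<le> \<tau> \<and> \<tau> \<le> t then phase m \<tau> \<xi> * hart (\<lambda>\<zeta>. V (\<tau>, \<zeta>)) \<xi> else 0)) \<le> T * C * M ^ 3 * decay \<xi>"
proof -
  have gm: "(\<lambda>\<tau>. phase m \<tau> \<xi> * hart (\<lambda>\<zeta>. V (\<tau>, \<zeta>)) \<xi>) \<in> borel_measurable borel"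
    by (intro borel_measurable_times phase_measurable hart_time_measurable V)
  have gb: "cmod (phase m \<tau> \<xi> * hart (\<lambda>\<zeta>. V (\<tau>, \<zeta>)) \<xi>) \<le> C * M ^ 3 * decay \<xi>" if "\<tau> \<in> {0..T}" for \<tau>
    unfolding norm_mult phase_norm mult_1 by (rule hart_constantD(2)[OF C slice_measurable[OF V]]) (rule Vb[OF that])
  have gb': "cmod (phase m \<tau> \<xi> * hart (\<lambda>\<zeta>. V (\<tau>, \<zeta>)) \<xi>) \<le> C * M ^ 3 * decay \<xi>" if "\<tau> \<in> {0..t}" for \<tau>
    using gb[of \<tau>] that t by simp
  have t0: "0 \<le> t" using t by simp
  show "integrable lborel (\<lambda>\<tau>. if 0 \<le> \<tau> \<and> \<tau> \<le> t then phase m \<tau> \<xi> * hart (\<lambda>\<zeta>. V (\<tau>, \<zeta>)) \<xi> else 0)"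
    by (rule time_integral(1)[OF gm t0 gb'])
  have "cmod (LINT \<tau>|lborel. (if 0 \<le> \<tau> \<and> \<tau> \<le> t then phase m \<tau> \<xi> * hart (\<lambda>\<zeta>. V (\<tau>, \<zeta>)) \<xi> else 0)) \<le> t * (C * M ^ 3 * decay \<xi>)"
    by (rule time_integral(2)[OF gm t0 gb'])
  also have "\<dots> \<le> T * (C * M ^ 3 * decay \<xi>)"
    using t order_trans[OF norm_ge_zero gb[OF t]] by (intro mult_right_mono) auto
  finally show "cmod (LINT \<tau>|lborel. (if 0 \<le> \<tau> \<and> \<tau> \<le> t then phase m \<tau> \<xi> * hart (\<lambda>\<zeta>. V (\<tau>, \<zeta>)) \<xi> else 0)) \<le> T * C * M ^ 3 * decay \<xi>"
    by (simp add: mult.assoc)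
qed

lemma duhamel_integral_diff:
  assumes C: "hart_constant C" and t: "t \<in> {0..T}"
    and V: "V \<in> borel_measurable borel" and W: "W \<in> borel_measurable borel"
    and Vb: "\<And>\<tau> \<xi>. \<tau> \<in> {0..T} \<Longrightarrow> cmod (V (\<tau>, \<xi>)) \<le> M * decay \<xi>"
    and Wb: "\<And>\<tau> \<xi>. \<tau> \<in> {0..T} \<Longrightarrow> cmod (W (\<tau>, \<xi>)) \<le> M * decay \<xi>"
    and db: "\<And>\<tau> \<xi>. \<tau> \<in> {0..T} \<Longrightarrow> cmod (V (\<tau>, \<xi>) - W (\<tau>, \<xi>)) \<le> \<delta> * decay \<xi>"
  shows "cmod ((LINT \<tau>|lborel. (if 0 \<le> \<tau> \<and> \<tau> \<le> t then phase m \<tau> \<xi> * hart (\<lambda>\<zeta>. V (\<tau>, \<zeta>)) \<xi> else 0))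
     - (LINT \<tau>|lborel. (if 0 \<le> \<tau> \<and> \<tau> \<le> t then phase m \<tau> \<xi> * hart (\<lambda>\<zeta>. W (\<tau>, \<zeta>)) \<xi> else 0))) \<le> T * (3 * C * M\<^sup>2 * \<delta> * decay \<xi>)"
proof -
  let ?g = "\<lambda>\<tau>. phase m \<tau> \<xi> * (hart (\<lambda>\<zeta>. V (\<tau>, \<zeta>)) \<xi> - hart (\<lambda>\<zeta>. W (\<tau>, \<zeta>)) \<xi>)"
  have gm: "?g \<in> borel_measurable borel"
    by (intro borel_measurable_times borel_measurable_diff phase_measurable hart_time_measurable V W)
  have gb: "cmod (?g \<tau>) \<le> 3 * C * M\<^sup>2 * \<delta> * decay \<xi>" if "\<tau> \<in> {0..T}" for \<tau>
    unfolding norm_mult phase_norm mult_1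
    by (rule hart_constantD(3)[OF C slice_measurable[OF V] slice_measurable[OF W] Vb[OF that] Wb[OF that] db[OF that]])
  have t0: "0 \<le> t" using t by simp
  have "(LINT \<tau>|lborel. (if 0 \<le> \<tau> \<and> \<tau> \<le> t then phase m \<tau> \<xi> * hart (\<lambda>\<zeta>. V (\<tau>, \<zeta>)) \<xi> else 0))
     - (LINT \<tau>|lborel. (if 0 \<le> \<tau> \<and> \<tau> \<le> t then phase m \<tau> \<xi> * hart (\<lambda>\<zeta>. W (\<tau>, \<zeta>)) \<xi> else 0))
     = (LINT \<tau>|lborel. (if 0 \<le> \<tau> \<and> \<tau> \<le> t then ?g \<tau> else 0))"
  proof -
    have i: "integrable lborel (\<lambda>\<tau>. if 0 \<le> \<tau> \<and> \<tau> \<le> t then phase m \<tau> \<xi> * hart (\<lambda>\<zeta>. V (\<tau>, \<zeta>)) \<xi> else 0)"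
      "integrable lborel (\<lambda>\<tau>. if 0 \<le> \<tau> \<and> \<tau> \<le> t then phase m \<tau> \<xi> * hart (\<lambda>\<zeta>. W (\<tau>, \<zeta>)) \<xi> else 0)"
      using duhamel_integral_bound(1)[OF C t V Vb] duhamel_integral_bound(1)[OF C t W Wb] by blast+
    show ?thesis
      unfolding Bochner_Integration.integral_diff[OF i, symmetric]
      by (rule Bochner_Integration.integral_cong[OF refl]) (simp add: right_diff_distrib)
  qed
  also have "cmod \<dots> \<le> t * (3 * C * M\<^sup>2 * \<delta> * decay \<xi>)"
    by (rule time_integral(2)[OF gm t0 gb]) (use t in auto)
  also have "\<dots> \<le> T * (3 * C * M\<^sup>2 * \<delta> * decay \<xi>)"
    using t order_trans[OF norm_ge_zero gb[OF t]] by (intro mult_right_mono) auto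
  finally show ?thesis .
qed

text \<open>Picard iteration in the ball of radius \<open>2 * \<kappa>\<close>. The smallness
  condition gives \<open>T C (2 \<kappa>)^3 <= \<kappa> / 3\<close> for the self-mapping property
  and \<open>3 T C (2 \<kappa>)^2 <= 1 / 2\<close> for the contraction. The iterates are plain
  functions of \<open>(t, \<xi>)\<close>, whose pointwise limits stay measurable.\<close>

lemma duhamel_fixed_point:
  assumes C: "hart_constant C" and T: "T > 0" and \<phi>: "\<phi> \<in> borel_measurable borel"
    and \<phi>b: "\<And>\<xi>. cmod (\<phi> \<xi>) \<le> \<kappa> * decay \<xi>" and small: "24 * T * C * \<kappa>\<^sup>2 \<le> 1"
  obtains V where "V \<in> borel_measurable borel"
    "\<And>t \<xi>. t \<in> {0..T} \<Longrightarrow> cmod (V (t, \<xi>)) \<le> 2 * \<kappa> * decay \<xi>"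
    "\<And>t \<xi>. t \<in> {0..T} \<Longrightarrow> V (t, \<xi>) = duhamel m \<phi> V t \<xi>"
proof -
  have \<kappa>0: "\<kappa> \<ge> 0" using order_trans[OF norm_ge_zero \<phi>b[of 0]] by (simp add: zero_le_mult_iff decay_def)
  define adm where "adm V \<longleftrightarrow> V \<in> borel_measurable borel \<and> (\<forall>t\<in>{0..T}. \<forall>\<xi>. cmod (V (t, \<xi>)) \<le> 2 * \<kappa> * decay \<xi>)"
    for V :: "real \<times> R3 \<Rightarrow> complex"
  define \<Gamma> where "\<Gamma> V q = duhamel m \<phi> V (fst q) (snd q)" for V q
  have admD: "V \<in> borel_measurable borel" "\<And>t \<xi>. t \<in> {0..T} \<Longrightarrow> cmod (V (t, \<xi>)) \<le> (2 * \<kappa>) * decay \<xi>" if "adm V" for V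
    using that unfolding adm_def by auto
  have self: "adm (\<Gamma> V)" if V: "adm V" for V
    unfolding adm_def
  proof (intro conjI ballI allI)
    show "\<Gamma> V \<in> borel_measurable borel" unfolding \<Gamma>_def[abs_def] by (rule duhamel_measurable[OF admD(1)[OF V] \<phi>])
    fix t \<xi> assume t: "t \<in> {0..T}"
    have "cmod (\<Gamma> V (t, \<xi>)) = cmod (\<phi> \<xi> + \<i> * (LINT \<tau>|lborel. (if 0 \<le> \<tau> \<and> \<tau> \<le> t then phase m \<tau> \<xi> * hart (\<lambda>\<zeta>. V (\<tau>, \<zeta>)) \<xi> else 0)))"
      by (simp add: \<Gamma>_def duhamel_def norm_mult)
    also have "\<dots> \<le> cmod (\<phi> \<xi>) + cmod (LINT \<tau>|lborel. (if 0 \<le> \<tau> \<and> \<tau> \<le> t then phase m \<tau> \<xi> * hart (\<lambda>\<zeta>. V (\<tau>, \<zeta>)) \<xi> else 0))"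
      by (rule order_trans[OF norm_triangle_ineq]) (simp add: norm_mult)
    also have "\<dots> \<le> \<kappa> * decay \<xi> + T * C * (2 * \<kappa>) ^ 3 * decay \<xi>"
      by (intro add_mono \<phi>b duhamel_integral_bound(2)[OF C t admD[OF V]])
    also have "\<dots> = \<kappa> * decay \<xi> + (24 * T * C * \<kappa>\<^sup>2) * (\<kappa> * decay \<xi> / 3)"
      by (simp add: power3_eq_cube power2_eq_square)
    also have "\<dots> \<le> \<kappa> * decay \<xi> + 1 * (\<kappa> * decay \<xi> / 3)"
      using \<kappa>0 by (intro add_left_mono mult_right_mono small) auto
    also have "\<dots> \<le> 2 * \<kappa> * decay \<xi>" using mult_nonneg_nonneg[OF \<kappa>0 decay_nonneg[of \<xi>]] by simp
    finally show "cmod (\<Gamma> V (t, \<xi>)) \<le> 2 * \<kappa> * decay \<xi>" .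
  qed
  have contr: "cmod (\<Gamma> V (t, \<xi>) - \<Gamma> W (t, \<xi>)) \<le> \<delta> / 2 * decay \<xi>"
    if V: "adm V" and W: "adm W" and d: "\<And>\<tau> \<xi>. \<tau> \<in> {0..T} \<Longrightarrow> cmod (V (\<tau>, \<xi>) - W (\<tau>, \<xi>)) \<le> \<delta> * decay \<xi>"
      and t: "t \<in> {0..T}" for V W \<delta> t \<xi>
  proof -
    have d0: "0 \<le> \<delta> * decay \<xi>" by (rule order_trans[OF norm_ge_zero d[OF t]])
    have "\<Gamma> V (t, \<xi>) - \<Gamma> W (t, \<xi>) = phase m (- t) \<xi> * (\<i> * ((LINT \<tau>|lborel. (if 0 \<le> \<tau> \<and> \<tau> \<le> t then phase m \<tau> \<xi> * hart (\<lambda>\<zeta>. V (\<tau>, \<zeta>)) \<xi> else 0))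
       - (LINT \<tau>|lborel. (if 0 \<le> \<tau> \<and> \<tau> \<le> t then phase m \<tau> \<xi> * hart (\<lambda>\<zeta>. W (\<tau>, \<zeta>)) \<xi> else 0))))"
      by (simp only: \<Gamma>_def duhamel_def fst_conv snd_conv right_diff_distrib[symmetric] add_diff_cancel_left)
    then have "cmod (\<Gamma> V (t, \<xi>) - \<Gamma> W (t, \<xi>)) \<le> T * (3 * C * (2 * \<kappa>)\<^sup>2 * \<delta> * decay \<xi>)"
      using duhamel_integral_diff[OF C t admD(1)[OF V] admD(1)[OF W] admD(2)[OF V] admD(2)[OF W] d] by (simp add: norm_mult)
    also have "\<dots> = (24 * T * C * \<kappa>\<^sup>2) * (\<delta> * decay \<xi> / 2)" by (simp add: power2_eq_square)
    also have "\<dots> \<le> 1 * (\<delta> * decay \<xi> / 2)" using d0 by (intro mult_right_mono small) auto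
    finally show ?thesis by simp
  qed
  define Vs where "Vs n = (\<Gamma> ^^ n) (\<lambda>_. 0)" for n
  have Vs: "adm (Vs n)" for n
  proof (induction n)
    case 0
    then show ?case using \<kappa>0 by (simp add: Vs_def adm_def)
  next
    case (Suc n)
    then show ?case using self by (simp add: Vs_def)
  qed
  have step: "cmod (Vs (Suc n) (t, \<xi>) - Vs n (t, \<xi>)) \<le> (2 * \<kappa> * (1/2) ^ n) * decay \<xi>" if "t \<in> {0..T}" for n t \<xi>
    using that
  proof (induction n arbitrary: t \<xi>)
    case 0
    then show ?case using admD(2)[OF Vs[of 1], of t \<xi>] by (simp add: Vs_def)
  next
    case (Suc n)
    have "cmod (\<Gamma> (Vs (Suc n)) (t, \<xi>) - \<Gamma> (Vs n) (t, \<xi>)) \<le> (2 * \<kappa> * (1/2) ^ n) / 2 * decay \<xi>"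
      by (rule contr[OF Vs Vs Suc.IH Suc.prems])
    then show ?case by (simp add: Vs_def)
  qed
  \<comment> \<open>Exact partial sums of the geometric series with terms
    \<open>2 \<kappa> / 2^j\<close>, in a form suited to induction on \<open>k\<close>.\<close>
  have far: "cmod (Vs (n + k) (t, \<xi>) - Vs n (t, \<xi>)) \<le> 4 * \<kappa> * decay \<xi> * ((1/2) ^ n - (1/2) ^ (n + k))" if t: "t \<in> {0..T}" for n k t \<xi>
  proof (induction k)
    case (Suc k)
    have "cmod (Vs (n + Suc k) (t, \<xi>) - Vs n (t, \<xi>)) \<le> cmod (Vs (n + Suc k) (t, \<xi>) - Vs (n + k) (t, \<xi>)) + cmod (Vs (n + k) (t, \<xi>) - Vs n (t, \<xi>))"
      using norm_triangle_ineq[of "Vs (n + Suc k) (t, \<xi>) - Vs (n + k) (t, \<xi>)" "Vs (n + k) (t, \<xi>) - Vs n (t, \<xi>)"] by simp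
    also have "\<dots> \<le> (2 * \<kappa> * (1/2) ^ (n + k)) * decay \<xi> + 4 * \<kappa> * decay \<xi> * ((1/2) ^ n - (1/2) ^ (n + k))"
      using step[OF t, of "n + k" \<xi>] Suc.IH by simp
    also have "\<dots> = 4 * \<kappa> * decay \<xi> * ((1/2) ^ n - (1/2) ^ (n + Suc k))" by (simp add: algebra_simps)
    finally show ?case .
  qed simp
  have far': "cmod (Vs (n + k) (t, \<xi>) - Vs n (t, \<xi>)) \<le> (4 * \<kappa> * (1/2) ^ n) * decay \<xi>" if t: "t \<in> {0..T}" for n k t \<xi>
  proof -
    have "4 * \<kappa> * decay \<xi> * ((1/2) ^ n - (1/2) ^ (n + k)) \<le> 4 * \<kappa> * decay \<xi> * (1/2) ^ n"
      using \<kappa>0 by (intro mult_left_mono) auto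
    then show ?thesis using far[OF t, of n k \<xi>] by (simp add: mult_ac)
  qed
  \<comment> \<open>Convergence is shown for \<open>t\<close> in \<open>{0..T}\<close> only.
    Elsewhere \<open>lim\<close> may be a default value, which does not affect measurability of
    \<open>V\<close>.\<close>
  define V where "V q = lim (\<lambda>n. Vs n q)" for q
  have halves: "(\<lambda>n. (K * (1/2) ^ n) * D) \<longlonglongrightarrow> 0" for K D :: real
  proof -
    have "(\<lambda>n. (K * (1/2) ^ n) * D) \<longlonglongrightarrow> (K * 0) * D" by (intro tendsto_intros LIMSEQ_power_zero) simp
    then show ?thesis by simp
  qed
  have lim: "(\<lambda>n. Vs n (t, \<xi>)) \<longlonglongrightarrow> V (t, \<xi>)" if t: "t \<in> {0..T}" for t \<xi>
  proof -
    have "Cauchy (\<lambda>n. Vs n (t, \<xi>))"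
    proof (rule metric_CauchyI)
      fix e :: real assume e: "e > 0"
      have "\<forall>\<^sub>F n in sequentially. (4 * \<kappa> * (1/2) ^ n) * decay \<xi> < e / 2"
        by (rule order_tendstoD(2)[OF halves]) (use e in simp)
      then obtain N where N: "(4 * \<kappa> * (1/2) ^ N) * decay \<xi> < e / 2" by (auto simp: eventually_sequentially)
      have "dist (Vs n (t, \<xi>)) (Vs N (t, \<xi>)) < e / 2" if "n \<ge> N" for n
        using far'[OF t, of N "n - N" \<xi>] N that by (simp add: dist_norm)
      then show "\<exists>M. \<forall>m\<ge>M. \<forall>n\<ge>M. dist (Vs m (t, \<xi>)) (Vs n (t, \<xi>)) < e"
        using dist_triangle_half_l[of _ "Vs N (t, \<xi>)" e] by (metis dist_commute)
    qed
    then show ?thesis unfolding V_def using Cauchy_convergent convergent_LIMSEQ_iff by blast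
  qed
  have VVs: "cmod (V (t, \<xi>) - Vs n (t, \<xi>)) \<le> (4 * \<kappa> * (1/2) ^ n) * decay \<xi>" if t: "t \<in> {0..T}" for n t \<xi>
  proof (rule LIMSEQ_le_const2)
    show "(\<lambda>k. cmod (Vs (n + k) (t, \<xi>) - Vs n (t, \<xi>))) \<longlonglongrightarrow> cmod (V (t, \<xi>) - Vs n (t, \<xi>))"
      using LIMSEQ_ignore_initial_segment[OF lim[OF t, of \<xi>], of n] by (intro tendsto_intros) (simp add: add.commute)
    show "\<exists>N. \<forall>k\<ge>N. cmod (Vs (n + k) (t, \<xi>) - Vs n (t, \<xi>)) \<le> (4 * \<kappa> * (1/2) ^ n) * decay \<xi>" using far'[OF t] by blast
  qed
  have Vadm: "adm V"
    unfolding adm_def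
  proof (intro conjI ballI allI)
    show "V \<in> borel_measurable borel" unfolding V_def[abs_def] by (rule borel_measurable_lim_metric) (rule admD(1)[OF Vs])
    fix t \<xi> assume t: "t \<in> {0..T}"
    show "cmod (V (t, \<xi>)) \<le> 2 * \<kappa> * decay \<xi>"
      by (rule LIMSEQ_le_const2[OF tendsto_norm[OF lim[OF t]]]) (use admD(2)[OF Vs t] in auto)
  qed
  have fixed: "V (t, \<xi>) = \<Gamma> V (t, \<xi>)" if t: "t \<in> {0..T}" for t \<xi>
  proof -
    have "(\<lambda>n. \<Gamma> V (t, \<xi>) - Vs (Suc n) (t, \<xi>)) \<longlonglongrightarrow> 0"
    proof (rule Lim_null_comparison[OF _ halves])
      have "cmod (\<Gamma> V (t, \<xi>) - Vs (Suc n) (t, \<xi>)) \<le> (2 * \<kappa> * (1/2) ^ n) * decay \<xi>" for n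
        using contr[OF Vadm Vs[of n] VVs t, of \<xi>] by (simp add: Vs_def)
      then show "\<forall>\<^sub>F n in sequentially. norm (\<Gamma> V (t, \<xi>) - Vs (Suc n) (t, \<xi>)) \<le> (2 * \<kappa> * (1/2) ^ n) * decay \<xi>" by simp
    qed
    moreover have "(\<lambda>n. \<Gamma> V (t, \<xi>) - Vs (Suc n) (t, \<xi>)) \<longlonglongrightarrow> \<Gamma> V (t, \<xi>) - V (t, \<xi>)"
      by (intro tendsto_intros LIMSEQ_Suc lim t)
    ultimately have "\<Gamma> V (t, \<xi>) - V (t, \<xi>) = 0" using LIMSEQ_unique by blast
    then show ?thesis by simp
  qed
  show ?thesis
  proof (rule that[of V])
    show "V \<in> borel_measurable borel" by (rule admD(1)[OF Vadm])
    show "cmod (V (t, \<xi>)) \<le> 2 * \<kappa> * decay \<xi>" if "t \<in> {0..T}" for t \<xi> by (rule admD(2)[OF Vadm that])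
    show "V (t, \<xi>) = duhamel m \<phi> V t \<xi>" if "t \<in> {0..T}" for t \<xi> using fixed[OF that] by (simp add: \<Gamma>_def)
  qed
qed

text \<open>With the extra factor the weight is \<open>(1 + |\<xi>|^2)^(-3)\<close>: integrable
  itself, and its square times \<open>bracket 1\<close> is the power \<open>-5\<close>. The extra
  factor accommodates time derivatives, which cost one power of the dispersion.\<close>

lemma bracket_1_weighted:
  assumes vm: "v \<in> borel_measurable borel" and vb: "\<And>\<xi>. cmod (v \<xi>) \<le> K * ((1 + (norm \<xi>)\<^sup>2) * decay \<xi>)"
  shows "integrable lborel v" and "integrable lborel (\<lambda>\<xi>. bracket 1 \<xi> * (cmod (v \<xi>))\<^sup>2)"
    and "(LINT \<xi>|lborel. bracket 1 \<xi> * (cmod (v \<xi>))\<^sup>2) \<le> K\<^sup>2 * (LINT \<xi>|lborel. 1 / (1 + (norm (\<xi>::R3))\<^sup>2) ^ 5)"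
proof -
  have pos: "0 < 1 + (norm \<xi>)\<^sup>2" for \<xi> :: R3 by (simp add: add_pos_nonneg)
  have w3: "(1 + (norm \<xi>)\<^sup>2) * decay \<xi> = 1 / (1 + (norm \<xi>)\<^sup>2) ^ 3" for \<xi> :: R3
  proof -
    have "(1 + (norm \<xi>)\<^sup>2) ^ 4 = (1 + (norm \<xi>)\<^sup>2) * (1 + (norm \<xi>)\<^sup>2) ^ 3" by (simp add: power_Suc[symmetric])
    then show ?thesis using pos[of \<xi>] by (simp add: decay_def)
  qed
  show "integrable lborel v"
  proof (rule Bochner_Integration.integrable_bound)
    show "integrable lborel (\<lambda>\<xi>::R3. K * (1 / (1 + (norm \<xi>)\<^sup>2) ^ 3))"
      by (intro integrable_mult_right integrable_decay_power) simp
    show "AE \<xi> in lborel. norm (v \<xi>) \<le> norm (K * (1 / (1 + (norm \<xi>)\<^sup>2) ^ 3))"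
      using vb unfolding w3 real_norm_def by (intro AE_I2 order_trans[OF _ abs_ge_self])
  qed (use vm in simp)
  have le: "bracket 1 \<xi> * (cmod (v \<xi>))\<^sup>2 \<le> K\<^sup>2 * (1 / (1 + (norm \<xi>)\<^sup>2) ^ 5)" for \<xi>
  proof -
    define r where "r = 1 + (norm \<xi>)\<^sup>2"
    have r: "r > 0" using pos[of \<xi>] by (simp add: r_def)
    have "(cmod (v \<xi>))\<^sup>2 \<le> (K * (1 / r ^ 3))\<^sup>2"
      using vb[of \<xi>] unfolding w3 r_def by (intro power_mono) auto
    then have "r * (cmod (v \<xi>))\<^sup>2 \<le> r * (K * (1 / r ^ 3))\<^sup>2" using r by (intro mult_left_mono) auto
    also have "\<dots> = K\<^sup>2 * (1 / r ^ 5)"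
    proof -
      have "r * (1 / r ^ 3)\<^sup>2 = 1 / r ^ 5" using r by (simp add: power_divide field_simps flip: power_mult power_Suc)
      then have "K\<^sup>2 * (r * (1 / r ^ 3)\<^sup>2) = K\<^sup>2 * (1 / r ^ 5)" by (simp only:)
      then show ?thesis by (simp only: power_mult_distrib mult.left_commute)
    qed
    finally show ?thesis using pos[of \<xi>] by (simp add: bracket_def r_def)
  qed
  have ri: "integrable lborel (\<lambda>\<xi>::R3. K\<^sup>2 * (1 / (1 + (norm \<xi>)\<^sup>2) ^ 5))"
    by (intro integrable_mult_right integrable_decay_power) simp
  show i: "integrable lborel (\<lambda>\<xi>. bracket 1 \<xi> * (cmod (v \<xi>))\<^sup>2)"
  proof (rule Bochner_Integration.integrable_bound[OF ri])
    note [measurable] = vm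
    show "(\<lambda>\<xi>. bracket 1 \<xi> * (cmod (v \<xi>))\<^sup>2) \<in> borel_measurable lborel" by measurable
    show "AE \<xi> in lborel. norm (bracket 1 \<xi> * (cmod (v \<xi>))\<^sup>2) \<le> norm (K\<^sup>2 * (1 / (1 + (norm \<xi>)\<^sup>2) ^ 5))"
    proof (rule AE_I2)
      fix \<xi>
      have "0 \<le> bracket 1 \<xi> * (cmod (v \<xi>))\<^sup>2" by (simp add: less_imp_le)
      then show "norm (bracket 1 \<xi> * (cmod (v \<xi>))\<^sup>2) \<le> norm (K\<^sup>2 * (1 / (1 + (norm \<xi>)\<^sup>2) ^ 5))"
        using le[of \<xi>] unfolding real_norm_def by linarith
    qed
  qed
  show "(LINT \<xi>|lborel. bracket 1 \<xi> * (cmod (v \<xi>))\<^sup>2) \<le> K\<^sup>2 * (LINT \<xi>|lborel. 1 / (1 + (norm (\<xi>::R3))\<^sup>2) ^ 5)"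
    unfolding integral_mult_right_zero[symmetric] by (rule integral_mono[OF i ri le])
qed

lemma le_weighted_decay:
  "K \<ge> 0 \<Longrightarrow> z \<le> K * decay \<xi> \<Longrightarrow> z \<le> K * ((1 + (norm \<xi>)\<^sup>2) * decay \<xi>)"
proof -
  assume K: "K \<ge> 0" and z: "z \<le> K * decay \<xi>"
  have "1 * decay \<xi> \<le> (1 + (norm \<xi>)\<^sup>2) * decay \<xi>" by (rule mult_right_mono) auto
  then have "K * decay \<xi> \<le> K * ((1 + (norm \<xi>)\<^sup>2) * decay \<xi>)" using K by (intro mult_left_mono) auto
  then show ?thesis using z by linarith
qed

section \<open>From the Duhamel equation to a solution in \<open>H^1\<close>\<close>

context
  fixes C T M m :: real and \<phi> :: "R3 \<Rightarrow> complex" and V :: "real \<times> R3 \<Rightarrow> complex"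
  assumes C: "hart_constant C" and T: "T > 0" and M: "M \<ge> 0" and \<phi>: "\<phi> \<in> borel_measurable borel"
    and V: "V \<in> borel_measurable borel"
    and Vb: "\<And>t \<xi>. t \<in> {0..T} \<Longrightarrow> cmod (V (t, \<xi>)) \<le> M * decay \<xi>"
    and fp: "\<And>t \<xi>. t \<in> {0..T} \<Longrightarrow> V (t, \<xi>) = duhamel m \<phi> V t \<xi>"
begin

private definition g :: "R3 \<Rightarrow> real \<Rightarrow> complex"
  where "g \<xi> \<tau> = phase m \<tau> \<xi> * hart (\<lambda>\<zeta>. V (\<tau>, \<zeta>)) \<xi>"

private lemma g_set_integrable:
  assumes t: "t \<in> {0..T}"
  shows "set_integrable lborel {0..t} (g \<xi>)"
    and "(LINT \<tau>|lborel. (if 0 \<le> \<tau> \<and> \<tau> \<le> t then g \<xi> \<tau> else 0)) = integral {0..t} (g \<xi>)"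
proof -
  have eq: "(if 0 \<le> \<tau> \<and> \<tau> \<le> t then g \<xi> \<tau> else 0) = indicator {0..t} \<tau> *\<^sub>R g \<xi> \<tau>" for \<tau> by (simp split: split_indicator)
  show si: "set_integrable lborel {0..t} (g \<xi>)"
  proof -
    have "integrable lborel (\<lambda>\<tau>. if 0 \<le> \<tau> \<and> \<tau> \<le> t then g \<xi> \<tau> else 0)"
      unfolding g_def by (rule duhamel_integral_bound(1)[OF C t V Vb])
    then show ?thesis unfolding eq set_integrable_def .
  qed
  show "(LINT \<tau>|lborel. (if 0 \<le> \<tau> \<and> \<tau> \<le> t then g \<xi> \<tau> else 0)) = integral {0..t} (g \<xi>)"
    unfolding eq set_borel_integral_eq_integral(2)[OF si, symmetric] set_lebesgue_integral_def ..
qed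

private lemma V_eq: "t \<in> {0..T} \<Longrightarrow> V (t, \<xi>) = phase m (- t) \<xi> * (\<phi> \<xi> + \<i> * integral {0..t} (g \<xi>))"
  unfolding fp[of t \<xi>] duhamel_def g_def[symmetric] by (simp only: g_set_integrable(2))

text \<open>Start of a bootstrap. So far \<open>g\<close> is merely integrable in time, which gives
  continuity of \<open>V\<close>; dominated convergence then gives continuity of the nonlinearity,
  and only then can the Duhamel integral be differentiated.\<close>

private lemma V_continuous: "continuous_on {0..T} (\<lambda>t. V (t, \<xi>))"
proof -
  have "g \<xi> integrable_on {0..T}"
    using set_borel_integral_eq_integral(1)[OF g_set_integrable(1)[of T \<xi>]] T by simp
  then have "continuous_on {0..T} (\<lambda>t. integral {0..t} (g \<xi>))" by (rule indefinite_integral_continuous_1)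
  moreover have "continuous_on {0..T} (\<lambda>t. phase m (- t) \<xi>)"
    using continuous_on_compose2[OF phase_continuous[of m], of "{0..T}" "\<lambda>t. (- t, \<xi>)"] by (simp add: continuous_intros)
  ultimately have "continuous_on {0..T} (\<lambda>t. phase m (- t) \<xi> * (\<phi> \<xi> + \<i> * integral {0..t} (g \<xi>)))"
    by (intro continuous_intros)
  then show ?thesis by (rule continuous_on_eq) (simp add: V_eq)
qed

private lemma hart_continuous: "continuous_on {0..T} (\<lambda>t. hart (\<lambda>\<zeta>. V (t, \<zeta>)) \<xi>)"
  unfolding continuous_on_sequentially
proof (intro allI ballI impI)
  fix x :: "nat \<Rightarrow> real" and a assume a: "a \<in> {0..T}" and xa: "(\<forall>n. x n \<in> {0..T}) \<and> x \<longlonglongrightarrow> a"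
  obtain K where ti: "integrable lborel (trilinear_weight \<xi>)" using trilinear_weight_bound by blast
  have Vl: "(\<lambda>n. V (x n, \<zeta>)) \<longlonglongrightarrow> V (a, \<zeta>)" for \<zeta>
    using V_continuous[of \<zeta>] a xa unfolding continuous_on_sequentially by (auto simp: comp_def)
  have xn: "x n \<in> {0..T}" for n using xa by blast
  have "(\<lambda>n. quad (\<lambda>\<zeta>. V (x n, \<zeta>)) \<xi>) \<longlonglongrightarrow> quad (\<lambda>\<zeta>. V (a, \<zeta>)) \<xi>"
    unfolding quad_def
  proof (rule integral_dominated_convergence[where w = "\<lambda>p. M * M * M * trilinear_weight \<xi> p"])
    note m = quad_integrand_measurable[OF slice_measurable[OF V] slice_measurable[OF V] slice_measurable[OF V]]
    show "(\<lambda>p. V (a, fst p) * cnj (V (a, fst p - snd p)) * V (a, \<xi> - snd p) / of_real ((norm (snd p))\<^sup>2)) \<in> borel_measurable lborel"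
      using m[of a a a \<xi>] by simp
    show "(\<lambda>p. V (x n, fst p) * cnj (V (x n, fst p - snd p)) * V (x n, \<xi> - snd p) / of_real ((norm (snd p))\<^sup>2)) \<in> borel_measurable lborel" for n
      using m[of "x n" "x n" "x n" \<xi>] by simp
    show "integrable lborel (\<lambda>p. M * M * M * trilinear_weight \<xi> p)" by (rule integrable_mult_right[OF ti])
    show "AE p in lborel. (\<lambda>n. V (x n, fst p) * cnj (V (x n, fst p - snd p)) * V (x n, \<xi> - snd p) / of_real ((norm (snd p))\<^sup>2))
       \<longlonglongrightarrow> V (a, fst p) * cnj (V (a, fst p - snd p)) * V (a, \<xi> - snd p) / of_real ((norm (snd p))\<^sup>2)"
      unfolding divide_inverse by (intro AE_I2 tendsto_mult tendsto_const tendsto_cnj Vl)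
    show "AE p in lborel. norm (V (x n, fst p) * cnj (V (x n, fst p - snd p)) * V (x n, \<xi> - snd p) / of_real ((norm (snd p))\<^sup>2)) \<le> M * M * M * trilinear_weight \<xi> p" for n
      by (rule AE_I2, rule quad_integrand_bound[of "\<lambda>\<zeta>. V (x n, \<zeta>)" M "\<lambda>\<zeta>. V (x n, \<zeta>)" M "\<lambda>\<zeta>. V (x n, \<zeta>)" M]) (rule Vb[OF xn])+
  qed
  then show "((\<lambda>t. hart (\<lambda>\<zeta>. V (t, \<zeta>)) \<xi>) \<circ> x) \<longlonglongrightarrow> hart (\<lambda>\<zeta>. V (a, \<zeta>)) \<xi>"
    unfolding hart_def comp_def by (intro tendsto_divide tendsto_const) auto
qed

text \<open>The right-hand side of the equation at a single frequency, where it is an ordinary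
  differential equation in time.\<close>

private definition V' :: "R3 \<Rightarrow> real \<Rightarrow> complex"
  where "V' \<xi> t = - \<i> * (of_real (dispersion m \<xi>) * V (t, \<xi>) - hart (\<lambda>\<zeta>. V (t, \<zeta>)) \<xi>)"

private lemma V_derivative:
  assumes t: "t \<in> {0..T}"
  shows "((\<lambda>t. V (t, \<xi>)) has_vector_derivative V' \<xi> t) (at t within {0..T})"
proof -
  have gc: "continuous_on {0..T} (g \<xi>)"
  proof -
    have "continuous_on {0..T} (\<lambda>t. phase m t \<xi>)"
      using continuous_on_compose2[OF phase_continuous[of m], of "{0..T}" "\<lambda>t. (t, \<xi>)"] by (simp add: continuous_intros)
    then show ?thesis unfolding g_def[abs_def] by (intro continuous_intros hart_continuous)
  qed
  have J: "((\<lambda>t. \<phi> \<xi> + \<i> * integral {0..t} (g \<xi>)) has_vector_derivative 0 + \<i> * g \<xi> t) (at t within {0..T})"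
    by (intro has_vector_derivative_add has_vector_derivative_const has_vector_derivative_mult_right integral_has_vector_derivative[OF gc t])
  have "((\<lambda>t. phase m (- t) \<xi> * (\<phi> \<xi> + \<i> * integral {0..t} (g \<xi>))) has_vector_derivative
      phase m (- t) \<xi> * (0 + \<i> * g \<xi> t) + - (\<i> * of_real (dispersion m \<xi>)) * phase m (- t) \<xi> * (\<phi> \<xi> + \<i> * integral {0..t} (g \<xi>))) (at t within {0..T})"
    by (rule has_vector_derivative_mult[OF phase_derivative J])
  moreover have "phase m (- t) \<xi> * (0 + \<i> * g \<xi> t) + - (\<i> * of_real (dispersion m \<xi>)) * phase m (- t) \<xi> * (\<phi> \<xi> + \<i> * integral {0..t} (g \<xi>)) = V' \<xi> t"
  proof -
    have "phase m (- t) \<xi> * (0 + \<i> * g \<xi> t) = \<i> * hart (\<lambda>\<zeta>. V (t, \<zeta>)) \<xi> * (phase m (- t) \<xi> * phase m t \<xi>)"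
      by (simp add: g_def)
    moreover have "- (\<i> * of_real (dispersion m \<xi>)) * phase m (- t) \<xi> * (\<phi> \<xi> + \<i> * integral {0..t} (g \<xi>)) = - (\<i> * of_real (dispersion m \<xi>)) * V (t, \<xi>)"
      unfolding V_eq[OF t] by (simp only: mult.assoc)
    ultimately have "phase m (- t) \<xi> * (0 + \<i> * g \<xi> t) + - (\<i> * of_real (dispersion m \<xi>)) * phase m (- t) \<xi> * (\<phi> \<xi> + \<i> * integral {0..t} (g \<xi>))
       = \<i> * hart (\<lambda>\<zeta>. V (t, \<zeta>)) \<xi> * (phase m (- t) \<xi> * phase m t \<xi>) + - (\<i> * of_real (dispersion m \<xi>)) * V (t, \<xi>)"
      by (simp only:)
    also have "\<dots> = V' \<xi> t" unfolding V'_def phase_cancel by (simp add: algebra_simps)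
    finally show ?thesis .
  qed
  ultimately have "((\<lambda>t. phase m (- t) \<xi> * (\<phi> \<xi> + \<i> * integral {0..t} (g \<xi>))) has_vector_derivative V' \<xi> t) (at t within {0..T})"
    by simp
  from has_vector_derivative_transform[OF t _ this] show ?thesis by (simp add: V_eq)
qed

private definition K where "K = (1 + \<bar>m\<bar>) * M + C * M ^ 3"

private lemma K_nonneg: "0 \<le> K"
  using hart_constantD(1)[OF C] M by (simp add: K_def)

text \<open>Mean value inequality; the time derivative costs one dispersion factor, hence the extra
  \<open>1 + |\<xi>|^2\<close>. This gives continuity in \<open>H^1\<close> and also the majorant
  for differentiating the pairings with Schwartz functions.\<close>

private lemma V_Lipschitz:
  assumes t: "t \<in> {0..T}" and r: "r \<in> {0..T}"
  shows "cmod (V (r, \<xi>) - V (t, \<xi>)) \<le> \<bar>r - t\<bar> * (K * ((1 + (norm \<xi>)\<^sup>2) * decay \<xi>))"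
proof -
  have V'b: "cmod (V' \<xi> s) \<le> K * ((1 + (norm \<xi>)\<^sup>2) * decay \<xi>)" if s: "s \<in> {0..T}" for s
  proof -
    have "cmod (V' \<xi> s) \<le> cmod (of_real (dispersion m \<xi>) * V (s, \<xi>)) + cmod (hart (\<lambda>\<zeta>. V (s, \<zeta>)) \<xi>)"
    proof -
      have "cmod (- \<i> * z) = cmod z" for z by (simp add: norm_mult)
      then show ?thesis unfolding V'_def by (simp only: norm_triangle_ineq4)
    qed
    also have "\<dots> \<le> ((1 + \<bar>m\<bar>) * (1 + (norm \<xi>)\<^sup>2)) * (M * decay \<xi>) + C * M ^ 3 * decay \<xi>"
    proof (rule add_mono)
      show "cmod (of_real (dispersion m \<xi>) * V (s, \<xi>)) \<le> ((1 + \<bar>m\<bar>) * (1 + (norm \<xi>)\<^sup>2)) * (M * decay \<xi>)"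
        unfolding norm_mult using dispersion_le[of m \<xi>] Vb[OF s] by (intro mult_mono) auto
      show "cmod (hart (\<lambda>\<zeta>. V (s, \<zeta>)) \<xi>) \<le> C * M ^ 3 * decay \<xi>"
        by (rule hart_constantD(2)[OF C slice_measurable[OF V]]) (rule Vb[OF s])
    qed
    also have "\<dots> \<le> ((1 + \<bar>m\<bar>) * (1 + (norm \<xi>)\<^sup>2)) * (M * decay \<xi>) + C * M ^ 3 * ((1 + (norm \<xi>)\<^sup>2) * decay \<xi>)"
      using hart_constantD(1)[OF C] M by (intro add_left_mono le_weighted_decay) auto
    also have "\<dots> = K * ((1 + (norm \<xi>)\<^sup>2) * decay \<xi>)" by (simp add: K_def algebra_simps)
    finally show ?thesis .
  qed
  have "cmod (V (r, \<xi>) - V (t, \<xi>)) \<le> (K * ((1 + (norm \<xi>)\<^sup>2) * decay \<xi>)) * norm (r - t)"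
  proof (rule differentiable_bound[of "{0..T}" "\<lambda>t. V (t, \<xi>)" "\<lambda>s h. h *\<^sub>R V' \<xi> s"])
    fix s assume s: "s \<in> {0..T}"
    show "((\<lambda>t. V (t, \<xi>)) has_derivative (\<lambda>h. h *\<^sub>R V' \<xi> s)) (at s within {0..T})"
      using V_derivative[OF s] by (simp add: has_vector_derivative_def)
    show "onorm (\<lambda>h. h *\<^sub>R V' \<xi> s) \<le> K * ((1 + (norm \<xi>)\<^sup>2) * decay \<xi>)"
    proof (rule onorm_le)
      fix h :: real
      have "\<bar>h\<bar> * cmod (V' \<xi> s) \<le> \<bar>h\<bar> * (K * ((1 + (norm \<xi>)\<^sup>2) * decay \<xi>))" by (rule mult_left_mono[OF V'b[OF s]]) simp
      then show "norm (h *\<^sub>R V' \<xi> s) \<le> K * ((1 + (norm \<xi>)\<^sup>2) * decay \<xi>) * norm h"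
        unfolding norm_scaleR real_norm_def by (subst mult.commute[of _ "\<bar>h\<bar>"])
    qed
  qed (use t r in auto)
  then show ?thesis by (simp add: mult.commute)
qed

private definition u :: "real \<Rightarrow> dist3"
  where "u t = (if t \<in> {0..T} then spectral (\<lambda>\<xi>. V (t, \<xi>)) else 0)"

private lemma slice_weighted: "t \<in> {0..T} \<Longrightarrow> cmod (V (t, \<xi>)) \<le> M * ((1 + (norm \<xi>)\<^sup>2) * decay \<xi>)"
  by (rule le_weighted_decay[OF M Vb])

private lemma slice_integrable: "t \<in> {0..T} \<Longrightarrow> integrable lborel (\<lambda>\<xi>. V (t, \<xi>))"
  by (rule bracket_1_weighted(1)[OF slice_measurable[OF V] slice_weighted])

private lemma u_curve: "u \<in> ncarrier (curves T (Hs 1))"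
  unfolding curves_def fst_conv
proof (intro CollectI conjI ballI allI impI)
  show "u t \<in> ncarrier (Hs 1)" if t: "t \<in> {0..T}" for t
    using spectral_in_Hs(1)[OF slice_integrable[OF t] bracket_1_weighted(2)[OF slice_measurable[OF V] slice_weighted[OF t]]] t
    by (simp add: u_def)
  show "u t = 0" if "t \<notin> {0..T}" for t using that by (auto simp: u_def)
  fix t assume t: "t \<in> {0..T}"
  define Q where "Q = sqrt (LINT \<xi>|lborel. 1 / (1 + (norm (\<xi>::R3))\<^sup>2) ^ 5)"
  have bd: "norm (nnorm (Hs 1) (u r - u t)) \<le> \<bar>r - t\<bar> * (K * Q)" if r: "r \<in> {0..T}" for r
  proof -
    let ?d = "\<lambda>\<xi>. V (r, \<xi>) - V (t, \<xi>)"
    have dm: "?d \<in> borel_measurable borel" by (intro borel_measurable_diff slice_measurable V)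
    have db: "cmod (?d \<xi>) \<le> (\<bar>r - t\<bar> * K) * ((1 + (norm \<xi>)\<^sup>2) * decay \<xi>)" for \<xi>
      using V_Lipschitz[OF t r, of \<xi>] by (simp only: mult.assoc)
    note b = bracket_1_weighted[OF dm db]
    have "u r - u t = spectral ?d"
      using spectral_diff[OF slice_integrable[OF r] slice_integrable[OF t]] r t by (simp add: u_def)
    then have n: "nnorm (Hs 1) (u r - u t) = sqrt (LINT \<xi>|lborel. bracket 1 \<xi> * (cmod (?d \<xi>))\<^sup>2)"
      using spectral_in_Hs(2)[OF b(1,2)] by simp
    also have "\<dots> \<le> sqrt ((\<bar>r - t\<bar> * K)\<^sup>2 * (LINT \<xi>|lborel. 1 / (1 + (norm (\<xi>::R3))\<^sup>2) ^ 5))"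
      by (rule real_sqrt_le_mono[OF b(3)])
    also have "\<dots> = \<bar>r - t\<bar> * (K * Q)" using K_nonneg by (simp add: real_sqrt_mult Q_def)
    finally show ?thesis using n by (simp add: real_sqrt_ge_zero integral_nonneg_AE less_imp_le)
  qed
  show "((\<lambda>r. nnorm (Hs 1) (u r - u t)) \<longlongrightarrow> 0) (at t within {0..T})"
  proof (rule Lim_null_comparison)
    show "\<forall>\<^sub>F r in at t within {0..T}. norm (nnorm (Hs 1) (u r - u t)) \<le> \<bar>r - t\<bar> * (K * Q)"
      using bd by (auto simp: eventually_at_filter)
    have "((\<lambda>r. \<bar>r - t\<bar> * (K * Q)) \<longlongrightarrow> \<bar>t - t\<bar> * (K * Q)) (at t within {0..T})" by (intro tendsto_intros)
    then show "((\<lambda>r. \<bar>r - t\<bar> * (K * Q)) \<longlongrightarrow> 0) (at t within {0..T})" by simp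
  qed
qed

text \<open>Pairing with \<open>\<psi>\<close> is integration against the bounded function
  \<open>inverse_fourier \<psi>\<close>, so the frequencywise equation may be differentiated under
  the integral, with the Lipschitz bound as majorant.\<close>

private lemma u_derivative:
  assumes t: "t \<in> {0..T}" and \<psi>: "\<psi> \<in> schwartz"
  shows "((\<lambda>r. u r \<psi>) has_vector_derivative (- \<i> * (half_wave m (u t) \<psi> - hartree (u t) \<psi>))) (at t within {0..T})"
proof -
  let ?F = "inverse_fourier \<psi>"
  have FS: "?F \<in> schwartz" by (rule inverse_fourier_schwartz[OF \<psi>])
  obtain B where B: "\<And>x. cmod (?F x) \<le> B" using schwartz_bounded[OF FS] by blast
  have B0: "B \<ge> 0" by (rule order_trans[OF norm_ge_zero B])
  let ?v = "\<lambda>\<xi>. V (t, \<xi>)"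
  have dm: "dispersion m \<in> borel_measurable borel" by (rule borel_measurable_continuous_onI[OF dispersion_continuous])
  have dm': "(\<lambda>\<xi>. complex_of_real (dispersion m \<xi>)) \<in> borel_measurable borel" by (rule measurable_compose[OF dm borel_measurable_of_real])
  have wv: "integrable lborel (\<lambda>\<xi>. of_real (dispersion m \<xi>) * ?v \<xi>)"
  proof (rule bracket_1_weighted(1)[of _ "(1 + \<bar>m\<bar>) * M"])
    show "(\<lambda>\<xi>. of_real (dispersion m \<xi>) * ?v \<xi>) \<in> borel_measurable borel"
      by (intro borel_measurable_times dm' slice_measurable V)
    fix \<xi>
    have "cmod (of_real (dispersion m \<xi>) * ?v \<xi>) \<le> ((1 + \<bar>m\<bar>) * (1 + (norm \<xi>)\<^sup>2)) * (M * decay \<xi>)"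
      unfolding norm_mult using dispersion_le[of m \<xi>] Vb[OF t] by (intro mult_mono) auto
    then show "cmod (of_real (dispersion m \<xi>) * ?v \<xi>) \<le> (1 + \<bar>m\<bar>) * M * ((1 + (norm \<xi>)\<^sup>2) * decay \<xi>)"
      by (simp add: mult_ac)
  qed
  have hv: "integrable lborel (hart ?v)"
    by (rule integrable_le_decay[OF hart_measurable[OF slice_measurable[OF V]]])
      (rule hart_constantD(2)[OF C slice_measurable[OF V]], rule Vb[OF t])
  have Fi: "integrable lborel (\<lambda>\<xi>. f \<xi> * ?F \<xi>)" if "integrable lborel f" for f
    using fourier_dist_spectral[OF that] FS by (simp add: represented_by_def)
  have hw: "half_wave m (u t) \<psi> = (LINT \<xi>|lborel. (of_real (dispersion m \<xi>) * ?v \<xi>) * ?F \<xi>)"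
  proof -
    have "half_wave m (spectral ?v) = spectral (\<lambda>\<xi>. of_real (dispersion m \<xi>) * ?v \<xi>)"
      unfolding half_wave_def dispersion_def[symmetric] by (rule fourier_multiplier_spectral[OF slice_integrable[OF t] dm' wv])
    then show ?thesis using t by (simp add: u_def spectral_apply[OF wv \<psi>])
  qed
  have ha: "hartree (u t) \<psi> = (LINT \<xi>|lborel. hart ?v \<xi> * ?F \<xi>)"
    using hartree_spectral[OF slice_measurable[OF V] Vb[OF t]] t by (simp add: u_def spectral_apply[OF hv \<psi>])
  have "((\<lambda>r. LINT \<xi>|lborel. V (r, \<xi>) * ?F \<xi>) has_vector_derivative (LINT \<xi>|lborel. V' \<xi> t * ?F \<xi>)) (at t within {0..T})"
  proof (rule has_vector_derivative_integral_dominated[where g = "\<lambda>\<xi>. K * ((1 + (norm \<xi>)\<^sup>2) * decay \<xi>) * B"])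
    show "t \<in> {0..T}" by (rule t)
    show "integrable lborel (\<lambda>\<xi>. V (r, \<xi>) * ?F \<xi>)" if "r \<in> {0..T}" for r by (rule Fi[OF slice_integrable[OF that]])
    show "(\<lambda>\<xi>. V' \<xi> t * ?F \<xi>) \<in> borel_measurable lborel"
    proof -
      have "(\<lambda>\<xi>. V' \<xi> t * ?F \<xi>) \<in> borel_measurable borel"
        unfolding V'_def by (intro borel_measurable_times borel_measurable_diff borel_measurable_const dm' slice_measurable V
            hart_measurable schwartz_measurable FS)
      then show ?thesis by simp
    qed
    show "((\<lambda>r. V (r, \<xi>) * ?F \<xi>) has_vector_derivative V' \<xi> t * ?F \<xi>) (at t within {0..T})" for \<xi>
      by (rule has_vector_derivative_mult_left[OF V_derivative[OF t]])
    show "integrable lborel (\<lambda>\<xi>. K * ((1 + (norm \<xi>)\<^sup>2) * decay \<xi>) * B)"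
    proof -
      have "integrable lborel (\<lambda>\<xi>. complex_of_real (K * ((1 + (norm (\<xi>::R3))\<^sup>2) * decay \<xi>)))"
      proof (rule bracket_1_weighted(1)[of _ K])
        show "(\<lambda>\<xi>. complex_of_real (K * ((1 + (norm (\<xi>::R3))\<^sup>2) * decay \<xi>))) \<in> borel_measurable borel" by measurable
        fix \<xi> :: R3
        have "0 \<le> K * ((1 + (norm \<xi>)\<^sup>2) * decay \<xi>)" using K_nonneg by simp
        then show "cmod (complex_of_real (K * ((1 + (norm \<xi>)\<^sup>2) * decay \<xi>))) \<le> K * ((1 + (norm \<xi>)\<^sup>2) * decay \<xi>)"
          unfolding norm_of_real by simp
      qed
      then have "integrable lborel (\<lambda>\<xi>. K * ((1 + (norm (\<xi>::R3))\<^sup>2) * decay \<xi>))" by (simp only: complex_of_real_integrable_eq)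
      then show ?thesis by (rule integrable_mult_left)
    qed
    show "norm (V (r, \<xi>) * ?F \<xi> - V (t, \<xi>) * ?F \<xi>) \<le> \<bar>r - t\<bar> * (K * ((1 + (norm \<xi>)\<^sup>2) * decay \<xi>) * B)" if r: "r \<in> {0..T}" for r \<xi>
    proof -
      have "cmod (V (r, \<xi>) - V (t, \<xi>)) * cmod (?F \<xi>) \<le> (\<bar>r - t\<bar> * (K * ((1 + (norm \<xi>)\<^sup>2) * decay \<xi>))) * B"
        using K_nonneg by (intro mult_mono V_Lipschitz[OF t r] B) auto
      then show ?thesis unfolding left_diff_distrib[symmetric] norm_mult by (simp only: mult.assoc)
    qed
  qed
  moreover have "(LINT \<xi>|lborel. V' \<xi> t * ?F \<xi>) = - \<i> * (half_wave m (u t) \<psi> - hartree (u t) \<psi>)"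
    unfolding hw ha Bochner_Integration.integral_diff[OF Fi[OF wv] Fi[OF hv], symmetric] integral_mult_right_zero[symmetric]
    by (rule Bochner_Integration.integral_cong[OF refl]) (simp add: V'_def algebra_simps)
  ultimately have "((\<lambda>r. LINT \<xi>|lborel. V (r, \<xi>) * ?F \<xi>) has_vector_derivative (- \<i> * (half_wave m (u t) \<psi> - hartree (u t) \<psi>))) (at t within {0..T})"
    by simp
  from has_vector_derivative_transform[OF t _ this, of "\<lambda>r. u r \<psi>"] show ?thesis
    by (simp add: u_def spectral_apply[OF slice_integrable \<psi>])
qed

lemma duhamel_H1_solution:
  "H1_solution m T (spectral \<phi>) (\<lambda>t. if t \<in> {0..T} then spectral (\<lambda>\<xi>. V (t, \<xi>)) else 0)"
proof -
  have "V (0, \<xi>) = \<phi> \<xi>" for \<xi>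
  proof -
    have "integral {0..0} (g \<xi>) = 0" by simp
    then show ?thesis using V_eq[of 0 \<xi>] T by (simp add: phase_def)
  qed
  then have "u 0 = spectral \<phi>" using T by (simp add: u_def)
  then have "H1_solution m T (spectral \<phi>) u" unfolding H1_solution_def using u_curve u_derivative by blast
  then show ?thesis unfolding u_def[abs_def] .
qed

end

section \<open>Expansion of small solutions in the size of the datum\<close>

definition linear_flow :: "real \<Rightarrow> (R3 \<Rightarrow> complex) \<Rightarrow> real \<times> R3 \<Rightarrow> complex"
  where "linear_flow m \<theta> q = phase m (- fst q) (snd q) * \<theta> (snd q)"

text \<open>The Duhamel integral of the nonlinearity along the linear flow: the coefficient of
  \<open>h^3\<close> in the solution with datum \<open>h \<theta>\<close>.\<close>

definition cubic_term :: "real \<Rightarrow> (R3 \<Rightarrow> complex) \<Rightarrow> real \<Rightarrow> R3 \<Rightarrow> complex"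
  where "cubic_term m \<theta> t \<xi> = phase m (- t) \<xi> *
    (\<i> * (LINT \<tau>|lborel. (if 0 \<le> \<tau> \<and> \<tau> \<le> t then phase m \<tau> \<xi> * hart (\<lambda>\<zeta>. linear_flow m \<theta> (\<tau>, \<zeta>)) \<xi> else 0)))"

lemma linear_flow_measurable:
  assumes \<theta>: "\<theta> \<in> borel_measurable borel"
  shows "linear_flow m \<theta> \<in> borel_measurable borel"
proof -
  have p: "(\<lambda>q::real \<times> R3. phase m (- fst q) (snd q)) \<in> borel_measurable borel"
    using continuous_on_compose2[OF phase_continuous[of m], of UNIV "\<lambda>q::real \<times> R3. (- fst q, snd q)"]
    by (intro borel_measurable_continuous_onI) (simp add: continuous_intros)
  have f: "(\<lambda>q::real \<times> R3. \<theta> (snd q)) \<in> borel_measurable borel"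
    by (rule borel_compose_continuous[OF \<theta>]) (intro continuous_intros)
  show ?thesis unfolding linear_flow_def[abs_def] by (intro borel_measurable_times p f)
qed

text \<open>The solution and the linear flow differ by \<open>O((h L)^3)\<close>; replacing one by
  the other in the Duhamel integral costs a further factor \<open>O((h L)^2)\<close> by the
  Lipschitz estimate. What is left is exactly homogeneous of degree 3 in the real number
  \<open>h\<close>.\<close>

lemma small_data_solution:
  assumes C: "hart_constant C" and T: "T > 0" and \<theta>: "\<theta> \<in> borel_measurable borel"
    and \<theta>b: "\<And>\<xi>. cmod (\<theta> \<xi>) \<le> L * decay \<xi>" and h: "h > 0" and small: "24 * T * C * (h * L)\<^sup>2 \<le> 1"
  obtains V where "V \<in> borel_measurable borel"
    "\<And>t \<xi>. t \<in> {0..T} \<Longrightarrow> cmod (V (t, \<xi>)) \<le> 2 * (h * L) * decay \<xi>"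
    "H1_solution m T (spectral (\<lambda>\<xi>. of_real h * \<theta> \<xi>)) (\<lambda>t. if t \<in> {0..T} then spectral (\<lambda>\<xi>. V (t, \<xi>)) else 0)"
    "\<And>t \<xi>. t \<in> {0..T} \<Longrightarrow> cmod (V (t, \<xi>) - (of_real h * linear_flow m \<theta> (t, \<xi>) + of_real (h ^ 3) * cubic_term m \<theta> t \<xi>))
      \<le> 96 * T\<^sup>2 * C\<^sup>2 * (h * L) ^ 5 * decay \<xi>"
proof -
  have L0: "L \<ge> 0" using order_trans[OF norm_ge_zero \<theta>b[of 0]] by (simp add: zero_le_mult_iff decay_def)
  define \<kappa> where "\<kappa> = h * L"
  have \<kappa>0: "\<kappa> \<ge> 0" using h L0 by (simp add: \<kappa>_def)
  let ?\<phi> = "\<lambda>\<xi>. of_real h * \<theta> \<xi>"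
  have \<phi>: "?\<phi> \<in> borel_measurable borel" by (intro borel_measurable_times borel_measurable_const \<theta>)
  have \<phi>b: "cmod (?\<phi> \<xi>) \<le> \<kappa> * decay \<xi>" for \<xi>
    using mult_left_mono[OF \<theta>b[of \<xi>], of h] h by (simp add: norm_mult \<kappa>_def)
  obtain V where V: "V \<in> borel_measurable borel" and Vb: "\<And>t \<xi>. t \<in> {0..T} \<Longrightarrow> cmod (V (t, \<xi>)) \<le> 2 * \<kappa> * decay \<xi>"
    and fp: "\<And>t \<xi>. t \<in> {0..T} \<Longrightarrow> V (t, \<xi>) = duhamel m ?\<phi> V t \<xi>"
    using duhamel_fixed_point[OF C T \<phi> \<phi>b small[folded \<kappa>_def]] by blast
  show ?thesis
  proof (rule that[of V])
    show "V \<in> borel_measurable borel" by (rule V)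
    show "cmod (V (t, \<xi>)) \<le> 2 * (h * L) * decay \<xi>" if "t \<in> {0..T}" for t \<xi> using Vb[OF that] by (simp add: \<kappa>_def)
    show "H1_solution m T (spectral ?\<phi>) (\<lambda>t. if t \<in> {0..T} then spectral (\<lambda>\<xi>. V (t, \<xi>)) else 0)"
      by (rule duhamel_H1_solution[OF C T _ \<phi> V Vb fp]) (use \<kappa>0 in auto)
    fix t \<xi> assume t: "t \<in> {0..T}"
    let ?J = "\<lambda>W t \<xi>. LINT \<tau>|lborel. (if 0 \<le> \<tau> \<and> \<tau> \<le> t then phase m \<tau> \<xi> * hart (\<lambda>\<zeta>. W (\<tau>, \<zeta>)) \<xi> else 0)"
    let ?W = "\<lambda>q. of_real h * linear_flow m \<theta> q"
    have W: "?W \<in> borel_measurable borel" by (intro borel_measurable_times borel_measurable_const linear_flow_measurable \<theta>)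
    have Vexp: "V (t, \<xi>) = ?W (t, \<xi>) + phase m (- t) \<xi> * (\<i> * ?J V t \<xi>)" if "t \<in> {0..T}" for t \<xi>
      using fp[OF that, of \<xi>] by (simp add: duhamel_def linear_flow_def algebra_simps)
    have Wb: "cmod (?W (\<tau>, \<zeta>)) \<le> 2 * \<kappa> * decay \<zeta>" for \<tau> \<zeta>
    proof -
      have "cmod (?W (\<tau>, \<zeta>)) = cmod (?\<phi> \<zeta>)" by (simp add: linear_flow_def norm_mult)
      also have "\<dots> \<le> \<kappa> * decay \<zeta>" by (rule \<phi>b)
      also have "\<dots> \<le> 2 * \<kappa> * decay \<zeta>" using mult_nonneg_nonneg[OF \<kappa>0 decay_nonneg[of \<zeta>]] by simp
      finally show ?thesis .
    qed
    have d: "cmod (V (\<tau>, \<zeta>) - ?W (\<tau>, \<zeta>)) \<le> (T * C * (2 * \<kappa>) ^ 3) * decay \<zeta>" if \<tau>: "\<tau> \<in> {0..T}" for \<tau> \<zeta>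
      using duhamel_integral_bound(2)[OF C \<tau> V Vb, of m \<zeta>] unfolding Vexp[OF \<tau>] by (simp add: norm_mult)
    have JW: "?J ?W t \<xi> = of_real (h ^ 3) * ?J (linear_flow m \<theta>) t \<xi>"
      unfolding integral_mult_right_zero[symmetric] hart_scale
      by (rule Bochner_Integration.integral_cong[OF refl]) (simp add: mult_ac)
    have "V (t, \<xi>) - (of_real h * linear_flow m \<theta> (t, \<xi>) + of_real (h ^ 3) * cubic_term m \<theta> t \<xi>) = phase m (- t) \<xi> * (\<i> * (?J V t \<xi> - ?J ?W t \<xi>))"
      unfolding Vexp[OF t] cubic_term_def JW by (simp add: algebra_simps)
    then have "cmod (V (t, \<xi>) - (of_real h * linear_flow m \<theta> (t, \<xi>) + of_real (h ^ 3) * cubic_term m \<theta> t \<xi>)) = cmod (?J V t \<xi> - ?J ?W t \<xi>)"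
      by (simp add: norm_mult)
    \<comment> \<open>The Lipschitz estimate at radius \<open>2 * \<kappa>\<close>, applied to the
      cubic difference \<open>d\<close>; the numbers multiply to
      \<open>3 * 4 * 8 = 96\<close>.\<close>
    also have "\<dots> \<le> T * (3 * C * (2 * \<kappa>)\<^sup>2 * (T * C * (2 * \<kappa>) ^ 3) * decay \<xi>)"
      by (rule duhamel_integral_diff[OF C t V W Vb Wb d])
    also have "\<dots> = 96 * T\<^sup>2 * C\<^sup>2 * \<kappa> ^ 5 * decay \<xi>"
      by (simp add: power_mult_distrib) (simp add: power2_eq_square eval_nat_numeral)
    finally show "cmod (V (t, \<xi>) - (of_real h * linear_flow m \<theta> (t, \<xi>) + of_real (h ^ 3) * cubic_term m \<theta> t \<xi>)) \<le> 96 * T\<^sup>2 * C\<^sup>2 * (h * L) ^ 5 * decay \<xi>"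
      by (simp only: \<kappa>_def)
  qed
qed

section \<open>Resonant data\<close>

text \<open>Oscillation of the interaction with inputs \<open>\<zeta>\<close>,
  \<open>\<xi> - \<eta>\<close> and, conjugated, \<open>\<zeta> - \<eta>\<close>, and output
  \<open>\<xi>\<close>. As
  \<open>\<xi> - \<zeta> + (\<zeta> - \<eta>) - (\<xi> - \<eta>) = 0\<close>, a linear part of the
  dispersion cancels.\<close>

definition phase_mismatch :: "real \<Rightarrow> R3 \<Rightarrow> R3 \<Rightarrow> R3 \<Rightarrow> real"
  where "phase_mismatch m \<xi> \<zeta> \<eta> = dispersion m \<xi> - dispersion m \<zeta> + dispersion m (\<zeta> - \<eta>) - dispersion m (\<xi> - \<eta>)"

text \<open>\<open>A\<close> supports the datum, \<open>E\<close> contains transferred frequencies,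
  and \<open>B\<close> is a part of \<open>A\<close> from which subtracting any of them stays in
  \<open>A\<close>: for \<open>\<xi>\<close> and \<open>\<zeta>\<close> in \<open>B\<close> and
  \<open>\<eta>\<close> in \<open>E\<close> all inputs lie in \<open>A\<close>. The last condition
  covers all interactions within \<open>A\<close>, so that those outside \<open>B\<close> and
  \<open>E\<close> cannot contribute with negative sign. Excluding \<open>\<eta> = 0\<close> matters
  because \<open>1 / 0\<close> is 0.\<close>

definition resonant :: "real \<Rightarrow> R3 set \<Rightarrow> R3 set \<Rightarrow> R3 set \<Rightarrow> real \<Rightarrow> real \<Rightarrow> bool"
  where "resonant m A B E R t \<longleftrightarrow> A \<in> sets borel \<and> B \<in> sets borel \<and> E \<in> sets borel \<and> bounded A \<and> bounded E \<and>
    B \<subseteq> A \<and> (\<forall>\<zeta>\<in>B. \<forall>\<eta>\<in>E. \<zeta> - \<eta> \<in> A) \<and> (\<forall>\<eta>\<in>E. \<eta> \<noteq> 0 \<and> (norm \<eta>)\<^sup>2 \<le> R) \<and> R > 0 \<and> t \<ge> 0 \<and>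
    (\<forall>\<xi>\<in>A. \<forall>\<zeta>\<in>A. \<forall>\<eta>. \<zeta> - \<eta> \<in> A \<longrightarrow> \<xi> - \<eta> \<in> A \<longrightarrow> t * \<bar>phase_mismatch m \<xi> \<zeta> \<eta>\<bar> \<le> 1)"

lemma cos_ge_half: "\<bar>x\<bar> \<le> 1 \<Longrightarrow> 1 / 2 \<le> cos (x::real)"
proof -
  assume x: "\<bar>x\<bar> \<le> 1"
  have "cos (pi / 3) \<le> cos \<bar>x\<bar>" using x pi_gt3 by (intro cos_monotone_0_pi_le) auto
  then show ?thesis by (simp add: cos_60)
qed

text \<open>The constant grows with the diameter of \<open>A\<close>, which is harmless: it affects
  only the admissible range of \<open>h\<close> and the error constant.\<close>

lemma indicator_le_decay:
  assumes "bounded A"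
  obtains L where "\<And>\<xi>. cmod (indicator A \<xi>) \<le> L * decay \<xi>"
proof -
  obtain \<rho> where \<rho>: "\<And>\<xi>. \<xi> \<in> A \<Longrightarrow> norm \<xi> \<le> \<rho>" using assms unfolding bounded_iff by blast
  have "cmod (indicator A \<xi>) \<le> (1 + \<rho>\<^sup>2) ^ 4 * decay \<xi>" for \<xi>
  proof (cases "\<xi> \<in> A")
    case True
    have "(norm \<xi>)\<^sup>2 \<le> \<rho>\<^sup>2" by (intro power_mono \<rho> True) simp
    then have "(1 + (norm \<xi>)\<^sup>2) ^ 4 \<le> (1 + \<rho>\<^sup>2) ^ 4" by (intro power_mono) auto
    moreover have "0 < (1 + (norm \<xi>)\<^sup>2) ^ 4" by (intro zero_less_power add_pos_nonneg) auto
    ultimately show ?thesis using True by (simp add: decay_def)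
  qed simp
  then show ?thesis by (rule that)
qed

text \<open>Reading the cubic term as a Duhamel expression with zero datum transfers measurability
  to it.\<close>

lemma duhamel_zero_eq_cubic_term: "duhamel m (\<lambda>_. 0) (linear_flow m \<theta>) t \<xi> = cubic_term m \<theta> t \<xi>"
  by (simp add: duhamel_def cubic_term_def)

lemma cubic_term_measurable:
  assumes "\<theta> \<in> borel_measurable borel"
  shows "cubic_term m \<theta> t \<in> borel_measurable borel"
  using slice_measurable[OF duhamel_measurable[OF linear_flow_measurable[OF assms] borel_measurable_const], of m 0 m t]
  by (simp add: duhamel_zero_eq_cubic_term)

lemma linear_flow_bound: "cmod (\<theta> \<xi>) \<le> L * decay \<xi> \<Longrightarrow> cmod (linear_flow m \<theta> (t, \<xi>)) \<le> L * decay \<xi>"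
  by (simp add: linear_flow_def norm_mult)

text \<open>The real part of the integrand is a cosine, at least one half on the support, times a
  nonnegative function that is at least \<open>1 / R\<close> when \<open>\<xi>\<close> is in
  \<open>B\<close> and \<open>p\<close> in \<open>B \<times> E\<close>. The constant
  \<open>4 pi^2\<close> combines this one half with the \<open>2 pi^2\<close> of
  \<open>hart\<close>.\<close>

lemma hart_linear_flow_lower_bound:
  assumes res: "resonant m A B E R t" and \<tau>: "0 \<le> \<tau>" "\<tau> \<le> t" and \<xi>: "\<xi> \<in> A"
  shows "indicator B \<xi> * (measure lborel B * measure lborel E / (4 * pi\<^sup>2 * R))
    \<le> Re (phase m \<tau> \<xi> * hart (\<lambda>\<zeta>. linear_flow m (indicator A) (\<tau>, \<zeta>)) \<xi>)"
proof -
  note r = res[unfolded resonant_def]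
  have sets: "A \<in> sets borel" "B \<in> sets borel" "E \<in> sets borel" and bA: "bounded A" and bE: "bounded E" and BA: "B \<subseteq> A"
    and BE: "\<And>\<zeta> \<eta>. \<zeta> \<in> B \<Longrightarrow> \<eta> \<in> E \<Longrightarrow> \<zeta> - \<eta> \<in> A" and ER: "\<And>\<eta>. \<eta> \<in> E \<Longrightarrow> \<eta> \<noteq> 0 \<and> (norm \<eta>)\<^sup>2 \<le> R" and R: "R > 0"
    and ph: "\<And>\<zeta> \<eta>. \<zeta> \<in> A \<Longrightarrow> \<zeta> - \<eta> \<in> A \<Longrightarrow> \<xi> - \<eta> \<in> A \<Longrightarrow> t * \<bar>phase_mismatch m \<xi> \<zeta> \<eta>\<bar> \<le> 1"
    using r \<xi> by blast+
  obtain L where L: "\<And>\<xi>. cmod (indicator A \<xi>) \<le> L * decay \<xi>" using indicator_le_decay[OF bA] by blast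
  have \<theta>m: "(indicator A :: R3 \<Rightarrow> complex) \<in> borel_measurable borel" using sets(1) by (rule borel_measurable_indicator)
  let ?v = "\<lambda>\<zeta>. linear_flow m (indicator A) (\<tau>, \<zeta>)"
  have vm: "?v \<in> borel_measurable borel" by (rule slice_measurable[OF linear_flow_measurable[OF \<theta>m]])
  have vb: "cmod (?v \<zeta>) \<le> L * decay \<zeta>" for \<zeta> by (rule linear_flow_bound[OF L])
  let ?F = "\<lambda>p. phase m \<tau> \<xi> * (?v (fst p) * cnj (?v (fst p - snd p)) * ?v (\<xi> - snd p) / of_real ((norm (snd p))\<^sup>2))"
  have Fi: "integrable lborel ?F" by (intro integrable_mult_right quad_integrand_integrable[OF vm vm vm vb vb vb])
  define I where "I p = (indicator A (fst p) * indicator A (fst p - snd p) * indicator A (\<xi> - snd p) / (norm (snd p))\<^sup>2 :: real)" for p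
  \<comment> \<open>The four phases multiply to a single exponential; the conjugation of the second
    input produces the signs of \<open>phase_mismatch\<close>.\<close>
  have ReF: "Re (?F p) = cos (\<tau> * phase_mismatch m \<xi> (fst p) (snd p)) * I p" for p
  proof -
    have ind: "indicator S x = complex_of_real (indicator S x)" for S and x :: R3 by (simp split: split_indicator)
    have "phase m \<tau> \<xi> * (phase m (- \<tau>) \<zeta> * cnj (phase m (- \<tau>) (\<zeta> - \<eta>)) * phase m (- \<tau>) (\<xi> - \<eta>)) = exp (\<i> * of_real (\<tau> * phase_mismatch m \<xi> \<zeta> \<eta>))" for \<zeta> \<eta>
      unfolding phase_def exp_cnj exp_add[symmetric] by (simp add: phase_mismatch_def algebra_simps)
    then have e: "phase m \<tau> \<xi> * phase m (- \<tau>) \<zeta> * cnj (phase m (- \<tau>) (\<zeta> - \<eta>)) * phase m (- \<tau>) (\<xi> - \<eta>) = exp (\<i> * of_real (\<tau> * phase_mismatch m \<xi> \<zeta> \<eta>))" for \<zeta> \<eta>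
      by (simp add: mult.assoc)
    have "?F p = (phase m \<tau> \<xi> * phase m (- \<tau>) (fst p) * cnj (phase m (- \<tau>) (fst p - snd p)) * phase m (- \<tau>) (\<xi> - snd p)) * of_real (I p)"
      unfolding linear_flow_def fst_conv snd_conv I_def ind[of A]
      by (simp add: mult_ac)
    also have "\<dots> = exp (\<i> * of_real (\<tau> * phase_mismatch m \<xi> (fst p) (snd p))) * of_real (I p)"
      unfolding e ..
    finally have "Re (?F p) = Re (exp (\<i> * of_real (\<tau> * phase_mismatch m \<xi> (fst p) (snd p))) * of_real (I p))" by (simp only:)
    then show ?thesis by (simp add: Re_exp)
  qed
  have I0: "0 \<le> I p" for p by (simp add: I_def)
  have half: "I p / 2 \<le> Re (?F p)" for p
  proof (cases "fst p \<in> A \<and> fst p - snd p \<in> A \<and> \<xi> - snd p \<in> A")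
    case True
    have "\<bar>\<tau> * phase_mismatch m \<xi> (fst p) (snd p)\<bar> \<le> t * \<bar>phase_mismatch m \<xi> (fst p) (snd p)\<bar>"
      using \<tau> by (simp add: abs_mult mult_right_mono)
    also have "\<dots> \<le> 1" using ph True by blast
    finally have "1 / 2 \<le> cos (\<tau> * phase_mismatch m \<xi> (fst p) (snd p))" by (rule cos_ge_half)
    then have "1 / 2 * I p \<le> cos (\<tau> * phase_mismatch m \<xi> (fst p) (snd p)) * I p" by (rule mult_right_mono[OF _ I0])
    then show ?thesis unfolding ReF by simp
  next
    case False
    then have "I p = 0" by (auto simp: I_def)
    then show ?thesis unfolding ReF by simp
  qed
  have fin: "emeasure lborel B < \<infinity>" "emeasure lborel E < \<infinity>"
    using emeasure_bounded_finite[OF bounded_subset[OF bA BA]] emeasure_bounded_finite[OF bE] by auto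
  have BEs: "B \<times> E \<in> sets (lborel :: (R3 \<times> R3) measure)"
    using borel_Times[OF sets(2,3)] by simp
  have emBE: "emeasure lborel (B \<times> E) = emeasure lborel B * emeasure lborel E"
    using lborel.emeasure_pair_measure_Times[of B "lborel :: R3 measure" E] sets by (simp add: lborel_prod)
  have finBE: "emeasure lborel (B \<times> E) < \<infinity>" unfolding emBE using fin by (simp add: ennreal_mult_less_top)
  have mBE: "measure lborel (B \<times> E) = measure lborel B * measure lborel E"
    unfolding measure_def emBE by (rule enn2real_mult)
  have low: "indicator B \<xi> * (indicator (B \<times> E) p / (2 * R)) \<le> Re (?F p)" for p
  proof (cases "\<xi> \<in> B \<and> p \<in> B \<times> E")
    case True
    then have pB: "fst p \<in> B" and pE: "snd p \<in> E" and xB: "\<xi> \<in> B" by auto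
    have "I p = 1 / (norm (snd p))\<^sup>2" using BA BE[OF pB pE] BE[OF xB pE] pB by (auto simp: I_def)
    moreover have "1 / R \<le> 1 / (norm (snd p))\<^sup>2" using ER[OF pE] R by (intro divide_left_mono) auto
    ultimately have "1 / R \<le> I p" by simp
    then have "1 / (2 * R) \<le> I p / 2" by simp
    from order_trans[OF this half] have "1 / (2 * R) \<le> Re (?F p)" .
    moreover have "indicator B \<xi> * (indicator (B \<times> E) p / (2 * R)) = 1 / (2 * R)" using True by simp
    ultimately show ?thesis by (simp only:)
  next
    case False
    then have z: "indicator B \<xi> * (indicator (B \<times> E) p / (2 * R)) = 0" by (auto simp: indicator_def)
    show ?thesis unfolding z using half[of p] I0[of p] by linarith
  qed
  \<comment> \<open>Finiteness of the measure of \<open>B \<times> E\<close> comes from boundedness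
    of \<open>A\<close> and \<open>E\<close>.\<close>
  have ii: "integrable lborel (\<lambda>p. indicator B \<xi> * (indicator (B \<times> E) p / (2 * R)))"
    by (intro integrable_mult_right integrable_divide integrable_real_indicator BEs finBE)
  have "(LINT p|lborel. indicator B \<xi> * (indicator (B \<times> E) p / (2 * R))) \<le> (LINT p|lborel. Re (?F p))"
    by (rule integral_mono[OF ii _ low]) (rule integrable_Re[OF Fi])
  also have "\<dots> = Re (LINT p|lborel. ?F p)" by (rule integral_Re[OF Fi])
  also have "(LINT p|lborel. ?F p) = of_real (2 * pi\<^sup>2) * (phase m \<tau> \<xi> * hart ?v \<xi>)"
    unfolding hart_def quad_def integral_mult_right_zero by simp
  finally have "indicator B \<xi> * (measure lborel B * measure lborel E / (2 * R)) \<le> 2 * pi\<^sup>2 * Re (phase m \<tau> \<xi> * hart ?v \<xi>)"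
    using BEs by (simp add: mBE)
  then have "indicator B \<xi> * (measure lborel B * measure lborel E / (2 * R)) / (2 * pi\<^sup>2) \<le> Re (phase m \<tau> \<xi> * hart ?v \<xi>)"
    by (subst pos_divide_le_eq) (simp_all add: mult.commute)
  then show ?thesis by (simp add: mult_ac)
qed

text \<open>The weight in the pairing removes the factor \<open>\<i>\<close> and the outer phase of
  \<open>cubic_term\<close>, leaving the time integral of quantities with nonnegative real
  part.\<close>

lemma cubic_term_lower_bound:
  assumes res: "resonant m A B E R t"
  shows "integrable lborel (\<lambda>\<xi>. (- \<i> * phase m t \<xi> * indicator A \<xi>) * cubic_term m (indicator A) t \<xi>)"
    and "t * (measure lborel B)\<^sup>2 * measure lborel E / (4 * pi\<^sup>2 * R)
      \<le> Re (LINT \<xi>|lborel. (- \<i> * phase m t \<xi> * indicator A \<xi>) * cubic_term m (indicator A) t \<xi>)"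
proof -
  note r = res[unfolded resonant_def]
  have sets: "A \<in> sets borel" "B \<in> sets borel" and bA: "bounded A" and BA: "B \<subseteq> A" and t: "t \<ge> 0" and R: "R > 0"
    using r by blast+
  obtain C where C: "hart_constant C" by (rule hart_constant_exists)
  obtain L where L: "\<And>\<xi>. cmod (indicator A \<xi>) \<le> L * decay \<xi>" using indicator_le_decay[OF bA] by blast
  have \<theta>m: "(indicator A :: R3 \<Rightarrow> complex) \<in> borel_measurable borel" using sets(1) by (rule borel_measurable_indicator)
  have tt: "t \<in> {0..t}" using t by simp
  define H where "H \<xi> \<tau> = (if 0 \<le> \<tau> \<and> \<tau> \<le> t then phase m \<tau> \<xi> * hart (\<lambda>\<zeta>. linear_flow m (indicator A) (\<tau>, \<zeta>)) \<xi> else 0)" for \<xi> \<tau>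
  define J where "J \<xi> = (LINT \<tau>|lborel. H \<xi> \<tau>)" for \<xi>
  have lb: "cmod (linear_flow m (indicator A) (\<tau>, \<zeta>)) \<le> L * decay \<zeta>" for \<tau> \<zeta> by (rule linear_flow_bound[OF L])
  have JD1: "integrable lborel (H \<xi>)" for \<xi>
    unfolding H_def[abs_def] by (rule duhamel_integral_bound(1)[OF C tt linear_flow_measurable[OF \<theta>m] lb])
  have JD2: "cmod (J \<xi>) \<le> t * C * L ^ 3 * decay \<xi>" for \<xi>
    unfolding J_def H_def[abs_def] by (rule duhamel_integral_bound(2)[OF C tt linear_flow_measurable[OF \<theta>m] lb])
  have cub: "(- \<i> * phase m t \<xi> * indicator A \<xi>) * cubic_term m (indicator A) t \<xi> = indicator A \<xi> * J \<xi>" for \<xi>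
  proof -
    have "(- \<i> * phase m t \<xi> * indicator A \<xi>) * cubic_term m (indicator A) t \<xi> = (- \<i> * \<i>) * (phase m (- t) \<xi> * phase m t \<xi>) * (indicator A \<xi> * J \<xi>)"
      unfolding cubic_term_def H_def[symmetric] J_def[symmetric] by (simp only: mult_ac)
    then show ?thesis unfolding phase_cancel by simp
  qed
  show i: "integrable lborel (\<lambda>\<xi>. (- \<i> * phase m t \<xi> * indicator A \<xi>) * cubic_term m (indicator A) t \<xi>)"
  proof (rule integrable_le_decay)
    show "(\<lambda>\<xi>. (- \<i> * phase m t \<xi> * indicator A \<xi>) * cubic_term m (indicator A) t \<xi>) \<in> borel_measurable borel"
      by (intro borel_measurable_times borel_measurable_const phase_measurable \<theta>m cubic_term_measurable)
    fix \<xi>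
    have "cmod (indicator A \<xi> * J \<xi>) \<le> cmod (J \<xi>)" by (simp add: norm_mult split: split_indicator)
    also have "\<dots> \<le> t * C * L ^ 3 * decay \<xi>" by (rule JD2)
    finally show "cmod ((- \<i> * phase m t \<xi> * indicator A \<xi>) * cubic_term m (indicator A) t \<xi>) \<le> t * C * L ^ 3 * decay \<xi>"
      unfolding cub .
  qed
  define c where "c = measure lborel B * measure lborel E / (4 * pi\<^sup>2 * R)"
  \<comment> \<open>On \<open>A\<close> the pointwise bound is integrated over
    \<open>0 <= \<tau> <= t\<close>; off \<open>A\<close> both sides vanish because \<open>B\<close>
    is contained in \<open>A\<close>.\<close>
  have low: "indicator B \<xi> * (t * c) \<le> Re (indicator A \<xi> * J \<xi>)" for \<xi>
  proof (cases "\<xi> \<in> A")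
    case True
    have ci: "integrable lborel (\<lambda>\<tau>. indicator B \<xi> * c * indicator {0..t} \<tau>)"
      using t by (intro integrable_mult_right integrable_real_indicator) auto
    have "indicator B \<xi> * (t * c) = (LINT \<tau>|lborel. indicator B \<xi> * c * indicator {0..t} \<tau>)"
      using t by simp
    also have "\<dots> \<le> (LINT \<tau>|lborel. Re (H \<xi> \<tau>))"
    proof (rule integral_mono[OF ci integrable_Re[OF JD1]])
      fix \<tau>
      show "indicator B \<xi> * c * indicator {0..t} \<tau> \<le> Re (H \<xi> \<tau>)"
      proof (cases "0 \<le> \<tau> \<and> \<tau> \<le> t")
        case \<tau>: True
        then have "H \<xi> \<tau> = phase m \<tau> \<xi> * hart (\<lambda>\<zeta>. linear_flow m (indicator A) (\<tau>, \<zeta>)) \<xi>" by (simp only: H_def if_True simp_thms)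
        moreover have "indicator B \<xi> * c * indicator {0..t} \<tau> = indicator B \<xi> * c" using \<tau> by simp
        moreover have "indicator B \<xi> * c \<le> Re (phase m \<tau> \<xi> * hart (\<lambda>\<zeta>. linear_flow m (indicator A) (\<tau>, \<zeta>)) \<xi>)"
          unfolding c_def by (rule hart_linear_flow_lower_bound[OF res _ _ True]) (use \<tau> in auto)
        ultimately show ?thesis by (simp only:)
      next
        case False
        then have "H \<xi> \<tau> = 0" "indicator {0..t} \<tau> = (0::real)" by (simp_all only: H_def if_False) (auto simp: indicator_def)
        then show ?thesis by simp
      qed
    qed
    also have "\<dots> = Re (J \<xi>)" unfolding J_def by (rule integral_Re[OF JD1])
    finally show ?thesis using True by simp
  next
    case False
    then have "\<xi> \<notin> B" using BA by blast
    then show ?thesis using False by simp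
  qed
  have fin: "emeasure lborel B < \<infinity>" using emeasure_bounded_finite[OF bounded_subset[OF bA BA]] by auto
  have bi: "integrable lborel (\<lambda>\<xi>. indicator B \<xi> * (t * c))"
    using sets fin by (intro integrable_mult_left integrable_real_indicator) auto
  have "(LINT \<xi>|lborel. indicator B \<xi> * (t * c)) \<le> (LINT \<xi>|lborel. Re (indicator A \<xi> * J \<xi>))"
    by (rule integral_mono[OF bi integrable_Re[OF i[unfolded cub]] low])
  also have "\<dots> = Re (LINT \<xi>|lborel. indicator A \<xi> * J \<xi>)" by (rule integral_Re[OF i[unfolded cub]])
  finally have "measure lborel B * (t * c) \<le> Re (LINT \<xi>|lborel. indicator A \<xi> * J \<xi>)"
    using sets by simp
  then show "t * (measure lborel B)\<^sup>2 * measure lborel E / (4 * pi\<^sup>2 * R)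
      \<le> Re (LINT \<xi>|lborel. (- \<i> * phase m t \<xi> * indicator A \<xi>) * cubic_term m (indicator A) t \<xi>)"
    unfolding cub by (simp add: c_def power2_eq_square mult_ac)
qed

text \<open>On \<open>A\<close> the weight is comparable to \<open>N powr s\<close>, and
  \<open>\<kappa> powr \<bar>s\<bar>\<close> covers both signs of \<open>s\<close>. The exponents
  \<open>s\<close> for the datum, \<open>- s\<close> for the functional and 1 for membership in
  \<open>H^1\<close> all occur.\<close>

lemma bracket_indicator:
  assumes A: "A \<in> sets borel" and a: "measure lborel A \<le> a" and bA: "bounded A" and N: "N > 0" and \<kappa>: "\<kappa> \<ge> 1"
    and range: "\<And>\<xi>. \<xi> \<in> A \<Longrightarrow> N \<le> 1 + (norm \<xi>)\<^sup>2 \<and> 1 + (norm \<xi>)\<^sup>2 \<le> \<kappa> * N"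
  shows "integrable lborel (\<lambda>\<xi>. bracket s \<xi> * (cmod (indicator A \<xi>))\<^sup>2)"
    and "(LINT \<xi>|lborel. bracket s \<xi> * (cmod (indicator A \<xi>))\<^sup>2) \<le> a * (\<kappa> powr \<bar>s\<bar> * N powr s)"
proof -
  have le: "bracket s \<xi> * (cmod (indicator A \<xi>))\<^sup>2 \<le> (\<kappa> powr \<bar>s\<bar> * N powr s) * indicator A \<xi>" for \<xi>
  proof (cases "\<xi> \<in> A")
    case True
    define y where "y = (1 + (norm \<xi>)\<^sup>2) / N"
    have y: "1 \<le> y" "y \<le> \<kappa>" using range[OF True] N by (auto simp: y_def field_simps)
    have "bracket s \<xi> = (y * N) powr s" using N by (simp add: bracket_def y_def)
    also have "\<dots> = y powr s * N powr s" by (rule powr_mult)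
    also have "\<dots> \<le> \<kappa> powr \<bar>s\<bar> * N powr s"
    proof (rule mult_right_mono)
      have "y powr s \<le> y powr \<bar>s\<bar>" using y by (intro powr_mono) auto
      also have "\<dots> \<le> \<kappa> powr \<bar>s\<bar>" using y by (intro powr_mono2) auto
      finally show "y powr s \<le> \<kappa> powr \<bar>s\<bar>" .
    qed simp
    finally show ?thesis using True by simp
  qed simp
  have fin: "emeasure lborel A < \<infinity>" using emeasure_bounded_finite[OF bA] by auto
  have ri: "integrable lborel (\<lambda>\<xi>. (\<kappa> powr \<bar>s\<bar> * N powr s) * indicator A \<xi>)"
    using A fin by (intro integrable_mult_right integrable_real_indicator) auto
  show i: "integrable lborel (\<lambda>\<xi>. bracket s \<xi> * (cmod (indicator A \<xi>))\<^sup>2)"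
  proof (rule Bochner_Integration.integrable_bound[OF ri])
    have im: "(indicator A :: R3 \<Rightarrow> complex) \<in> borel_measurable borel" using A by (rule borel_measurable_indicator)
    note [measurable] = im
    show "(\<lambda>\<xi>. bracket s \<xi> * (cmod (indicator A \<xi>))\<^sup>2) \<in> borel_measurable lborel" by measurable
    show "AE \<xi> in lborel. norm (bracket s \<xi> * (cmod (indicator A \<xi>))\<^sup>2) \<le> norm ((\<kappa> powr \<bar>s\<bar> * N powr s) * indicator A \<xi>)"
    proof (rule AE_I2)
      fix \<xi>
      have "0 \<le> bracket s \<xi> * (cmod (indicator A \<xi>))\<^sup>2" by (simp add: less_imp_le)
      then show "norm (bracket s \<xi> * (cmod (indicator A \<xi>))\<^sup>2) \<le> norm ((\<kappa> powr \<bar>s\<bar> * N powr s) * indicator A \<xi>)"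
        using le[of \<xi>] unfolding real_norm_def by linarith
    qed
  qed
  have "(LINT \<xi>|lborel. bracket s \<xi> * (cmod (indicator A \<xi>))\<^sup>2) \<le> (LINT \<xi>|lborel. (\<kappa> powr \<bar>s\<bar> * N powr s) * indicator A \<xi>)"
    by (rule integral_mono[OF i ri le])
  also have "\<dots> = (\<kappa> powr \<bar>s\<bar> * N powr s) * measure lborel A" using A by simp
  also have "\<dots> \<le> (\<kappa> powr \<bar>s\<bar> * N powr s) * a" by (rule mult_left_mono[OF a]) simp
  finally show "(LINT \<xi>|lborel. bracket s \<xi> * (cmod (indicator A \<xi>))\<^sup>2) \<le> a * (\<kappa> powr \<bar>s\<bar> * N powr s)"
    by (simp add: mult.commute)
qed

text \<open>Every property of the flow map is condensed here into an inequality between numbers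
  attached to the sets, with \<open>M\<close> independent of them. The last hypothesis on
  \<open>A\<close> is trivial for \<open>Hs s\<close> and amounts to radiality for
  \<open>Hs_rad s\<close>, so that one proof serves both spaces.\<close>

lemma C3_flow_map_inequality:
  assumes T: "T > 0" and X: "seminormed X" and sub: "ncarrier X \<subseteq> ncarrier (Hs s)" and nrm: "nnorm X = nnorm (Hs s)"
    and flow: "flow_map m T X V \<Phi>" and C3: "C3_at X (curves T X) V \<Phi> 0"
  obtains M where "M \<ge> 0"
    "\<And>A B E R t N \<kappa> a. resonant m A B E R t \<Longrightarrow> t \<le> T \<Longrightarrow> measure lborel A \<le> a \<Longrightarrow> N > 0 \<Longrightarrow> \<kappa> \<ge> 1 \<Longrightarrow>
      (\<And>\<xi>. \<xi> \<in> A \<Longrightarrow> N \<le> 1 + (norm \<xi>)\<^sup>2 \<and> 1 + (norm \<xi>)\<^sup>2 \<le> \<kappa> * N) \<Longrightarrow> 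
      (spectral (indicator A) \<in> ncarrier (Hs s) \<Longrightarrow> spectral (indicator A) \<in> ncarrier X) \<Longrightarrow>
      t * (measure lborel B)\<^sup>2 * measure lborel E / (4 * pi\<^sup>2 * R) \<le> M * a\<^sup>2 * (\<kappa> powr \<bar>s\<bar>)\<^sup>2 * N powr s"
proof -
  obtain M where M: "M \<ge> 0"
    and Mb: "\<And>v L C d a b K. v \<in> ncarrier X \<Longrightarrow> bounded_functional (curves T X) L C \<Longrightarrow> d > 0 \<Longrightarrow>
      (\<And>h. 0 < h \<Longrightarrow> h < d \<Longrightarrow> \<bar>L (\<Phi> (h *\<^sub>R v)) - (a * h + b * h^3)\<bar> \<le> K * h^4) \<Longrightarrow>
      \<bar>b\<bar> \<le> M * C * nnorm X v ^ 3"
    using C3_at_cubic_coefficient[OF X seminormed_curves[OF X T] C3] by blast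
  note fl = flow[unfolded flow_map_def]
  from fl have "\<exists>r>0. nball X 0 r \<subseteq> V" by (elim conjE)
  then obtain r where r: "r > 0" "nball X 0 r \<subseteq> V" by (elim exE conjE)
  have flowD: "\<And>\<phi> u. \<phi> \<in> V \<Longrightarrow> \<phi> \<in> ncarrier (Hs 1) \<Longrightarrow> H1_solution m T \<phi> u \<Longrightarrow> \<Phi> \<phi> = u"
    using fl by (elim conjE) (drule bspec, rule IntI, assumption+, drule spec, drule mp, assumption+)
  have VX: "\<And>\<phi>. \<phi> \<in> V \<Longrightarrow> \<Phi> \<phi> \<in> ncarrier (curves T X)" using fl by (elim conjE) (drule bspec, assumption, erule conjunct1)
  obtain C where C: "hart_constant C" by (rule hart_constant_exists)
  show ?thesis
  proof (rule that[OF M])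
    fix A B E R t N \<kappa> a
    assume res: "resonant m A B E R t" and tT: "t \<le> T" and a: "measure lborel A \<le> a" and N: "N > 0" and \<kappa>: "\<kappa> \<ge> (1::real)"
      and range: "\<And>\<xi>. \<xi> \<in> A \<Longrightarrow> N \<le> 1 + (norm \<xi>)\<^sup>2 \<and> 1 + (norm \<xi>)\<^sup>2 \<le> \<kappa> * N"
      and inX: "spectral (indicator A) \<in> ncarrier (Hs s) \<Longrightarrow> spectral (indicator A) \<in> ncarrier X"
    have A: "A \<in> sets borel" and bA: "bounded A" and t0: "t \<ge> 0" using res unfolding resonant_def by blast+
    have t: "t \<in> {0..T}" using t0 tT by simp
    let ?\<theta> = "indicator A :: R3 \<Rightarrow> complex"
    have \<theta>m: "?\<theta> \<in> borel_measurable borel" using A by (rule borel_measurable_indicator)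
    obtain L where L: "\<And>\<xi>. cmod (?\<theta> \<xi>) \<le> L * decay \<xi>" using indicator_le_decay[OF bA] by blast
    have L0: "L \<ge> 0" using order_trans[OF norm_ge_zero L[of 0]] by (simp add: zero_le_mult_iff decay_def)
    have \<theta>i: "integrable lborel ?\<theta>" by (rule integrable_le_decay[OF \<theta>m L])
    note bs = bracket_indicator[OF A a bA N \<kappa> range]
    define v where "v = spectral ?\<theta>"
    have v: "v \<in> ncarrier X" unfolding v_def by (rule inX) (rule spectral_in_Hs(1)[OF \<theta>i bs(1)])
    have nv: "nnorm X v = sqrt (LINT \<xi>|lborel. bracket s \<xi> * (cmod (?\<theta> \<xi>))\<^sup>2)"
      unfolding nrm v_def by (rule spectral_in_Hs(2)[OF \<theta>i bs(1)])
    \<comment> \<open>The weight of \<open>cubic_term_lower_bound\<close>. Its modulus is the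
      indicator function of \<open>A\<close>, so its \<open>H^(-s)\<close> norm is as explicit as
      the norm of the datum.\<close>
    let ?w = "\<lambda>\<xi>. - \<i> * phase m t \<xi> * ?\<theta> \<xi>"
    have wm: "?w \<in> borel_measurable borel" by (intro borel_measurable_times borel_measurable_const phase_measurable \<theta>m)
    have w\<theta>: "cmod (?w \<xi>) = cmod (?\<theta> \<xi>)" for \<xi> by (simp add: norm_mult)
    have w1: "cmod (?w \<xi>) \<le> 1" for \<xi> unfolding w\<theta> by (simp split: split_indicator)
    have wi: "integrable lborel (\<lambda>\<xi>. bracket (- s) \<xi> * (cmod (?w \<xi>))\<^sup>2)" unfolding w\<theta> by (rule bs(1))
    define D where "D = sqrt (LINT \<xi>|lborel. bracket (- s) \<xi> * (cmod (?\<theta> \<xi>))\<^sup>2)"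
    define F where "F u = Re (LINT \<xi>|lborel. ?w \<xi> * freq u \<xi>)" for u
    have "bounded_functional (Hs s) F D"
      using frequency_functional(1)[OF wm wi] unfolding F_def[abs_def] D_def w\<theta> .
    then have "bounded_functional X F D" using sub unfolding bounded_functional_def nrm by blast
    then have Fb: "bounded_functional (curves T X) (\<lambda>u. F (u t)) D" by (rule bounded_functional_at_time[OF X _ t])
    have wint: "integrable lborel (\<lambda>\<xi>. ?w \<xi> * f \<xi>)" if "f \<in> borel_measurable borel" "\<And>\<xi>. cmod (f \<xi>) \<le> Q * decay \<xi>" for f Q
    proof (rule integrable_le_decay)
      show "(\<lambda>\<xi>. ?w \<xi> * f \<xi>) \<in> borel_measurable borel" by (intro borel_measurable_times wm that)
      show "norm (?w \<xi> * f \<xi>) \<le> Q * decay \<xi>" for \<xi>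
        unfolding norm_mult[of "?w \<xi>"] by (rule order_trans[OF mult_left_le_one_le that(2)]) (use w1 in auto)
    qed
    let ?lin = "\<lambda>\<xi>. linear_flow m ?\<theta> (t, \<xi>)" and ?cub = "cubic_term m ?\<theta> t"
    have li: "integrable lborel (\<lambda>\<xi>. ?w \<xi> * ?lin \<xi>)"
      by (rule wint[OF slice_measurable[OF linear_flow_measurable[OF \<theta>m]] linear_flow_bound[OF L]])
    note ci = cubic_term_lower_bound(1)[OF res]
    define p where "p = Re (LINT \<xi>|lborel. ?w \<xi> * ?lin \<xi>)"
    define b where "b = Re (LINT \<xi>|lborel. ?w \<xi> * ?cub \<xi>)"
    \<comment> \<open>Depends on \<open>A\<close> through \<open>L\<close>; this is allowed, as the
      error constant does not enter the conclusion of \<open>Mb\<close>.\<close>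
    define K where "K = 96 * T\<^sup>2 * C\<^sup>2 * L ^ 5 * (LINT \<xi>|lborel. decay \<xi>)"
    have K0: "K \<ge> 0" unfolding K_def using L0 by (intro mult_nonneg_nonneg integral_nonneg_AE) auto
    \<comment> \<open>The three bounds on \<open>h\<close> serve, in this order, to replace
      \<open>h ^ 5\<close> by \<open>h ^ 4\<close>, to keep the datum in the domain of the flow map,
      and to satisfy the smallness condition of the fixed point.\<close>
    define d where "d = min 1 (min (r / (nnorm X v + 1)) (1 / sqrt (24 * T * C * L\<^sup>2 + 1)))"
    have C0: "C > 0" by (rule hart_constantD(1)[OF C])
    have q0: "24 * T * C * L\<^sup>2 + 1 > 0" using T C0 by (simp add: add_nonneg_pos)
    have nv0: "nnorm X v \<ge> 0" by (rule seminormedD(7)[OF X v])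
    have d: "d > 0" unfolding d_def using r(1) nv0 q0 by simp
    have "\<bar>b\<bar> \<le> M * D * nnorm X v ^ 3"
    proof (rule Mb[OF v Fb d])
      fix h :: real assume h: "0 < h" "h < d"
      have h1: "h < 1" "h < r / (nnorm X v + 1)" "h < 1 / sqrt (24 * T * C * L\<^sup>2 + 1)" using h(2) by (auto simp: d_def)
      have small: "24 * T * C * (h * L)\<^sup>2 \<le> 1"
      proof -
        have "h\<^sup>2 \<le> (1 / sqrt (24 * T * C * L\<^sup>2 + 1))\<^sup>2" using h h1 by (intro power_mono) auto
        also have "\<dots> = 1 / (24 * T * C * L\<^sup>2 + 1)" using q0 by (simp add: power_divide)
        finally have "h\<^sup>2 * (24 * T * C * L\<^sup>2 + 1) \<le> 1" using q0 by (simp add: pos_le_divide_eq)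
        then have "h\<^sup>2 * (24 * T * C * L\<^sup>2) \<le> 1" using zero_le_power2[of h] unfolding distrib_left by linarith
        then show ?thesis by (simp add: power_mult_distrib mult_ac)
      qed
      obtain U where Um: "U \<in> borel_measurable borel"
        and Ub: "\<And>t \<xi>. t \<in> {0..T} \<Longrightarrow> cmod (U (t, \<xi>)) \<le> 2 * (h * L) * decay \<xi>"
        and sol: "H1_solution m T (spectral (\<lambda>\<xi>. of_real h * ?\<theta> \<xi>)) (\<lambda>t. if t \<in> {0..T} then spectral (\<lambda>\<xi>. U (t, \<xi>)) else 0)"
        and ex: "\<And>t \<xi>. t \<in> {0..T} \<Longrightarrow> cmod (U (t, \<xi>) - (of_real h * linear_flow m ?\<theta> (t, \<xi>) + of_real (h ^ 3) * cubic_term m ?\<theta> t \<xi>))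
          \<le> 96 * T\<^sup>2 * C\<^sup>2 * (h * L) ^ 5 * decay \<xi>"
        by (rule small_data_solution[OF C T \<theta>m L h(1) small, of m]) (rule that)
      have hv: "h *\<^sub>R v = spectral (\<lambda>\<xi>. of_real h * ?\<theta> \<xi>)" unfolding v_def by (rule spectral_scaleR[OF \<theta>i])
      have "h * nnorm X v < r"
      proof -
        have "h * (nnorm X v + 1) < r" using h1(2) nv0 by (simp add: pos_less_divide_eq)
        then show ?thesis using h(1) unfolding distrib_left by linarith
      qed
      then have "h *\<^sub>R v \<in> nball X 0 r"
        using seminormedD(4,6)[OF X v] h(1) by (simp add: nball_def)
      then have inV: "h *\<^sub>R v \<in> V" using r(2) by blast
      have "h *\<^sub>R v \<in> ncarrier (Hs 1)"
      proof -
        have "v \<in> ncarrier (Hs 1)"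
          unfolding v_def by (rule spectral_in_Hs(1)[OF \<theta>i bracket_indicator(1)[OF A a bA N \<kappa> range]])
        then show ?thesis by (rule seminormedD(4)[OF seminormed_Hs])
      qed
      \<comment> \<open>Here the flow map is tied to the equation: the datum lies in
        \<open>H^1\<close> and the constructed solution exists on the whole interval.\<close>
      from flowD[OF inV this sol[folded hv]] t
      have \<Phi>t: "\<Phi> (h *\<^sub>R v) t = spectral (\<lambda>\<xi>. U (t, \<xi>))" by simp
      have Utm: "(\<lambda>\<xi>. U (t, \<xi>)) \<in> borel_measurable borel" by (rule slice_measurable[OF Um])
      have Uti: "integrable lborel (\<lambda>\<xi>. U (t, \<xi>))" by (rule integrable_le_decay[OF Utm Ub[OF t]])
      have wU: "integrable lborel (\<lambda>\<xi>. ?w \<xi> * U (t, \<xi>))" by (rule wint[OF Utm Ub[OF t]])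
      have "(LINT \<xi>|lborel. ?w \<xi> * freq (\<Phi> (h *\<^sub>R v) t) \<xi>) = (LINT \<xi>|lborel. ?w \<xi> * U (t, \<xi>))"
      proof (rule integral_cong_AE)
        have "\<Phi> (h *\<^sub>R v) t \<in> ncarrier (Hs s)" using curves_carrierD(1)[OF VX[OF inV] t] sub by blast
        from borel_measurable_times[OF wm Hs_carrierD(3)[OF this]]
        show "(\<lambda>\<xi>. ?w \<xi> * freq (\<Phi> (h *\<^sub>R v) t) \<xi>) \<in> borel_measurable lborel" by simp
        show "(\<lambda>\<xi>. ?w \<xi> * U (t, \<xi>)) \<in> borel_measurable lborel" using borel_measurable_times[OF wm Utm] by simp
        show "AE \<xi> in lborel. ?w \<xi> * freq (\<Phi> (h *\<^sub>R v) t) \<xi> = ?w \<xi> * U (t, \<xi>)"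
          unfolding \<Phi>t using freq_eq_AE[OF fourier_dist_spectral[OF Uti]] by eventually_elim simp
      qed
      then have FU: "F (\<Phi> (h *\<^sub>R v) t) = Re (LINT \<xi>|lborel. ?w \<xi> * U (t, \<xi>))" by (simp only: F_def)
      let ?e = "\<lambda>\<xi>. ?w \<xi> * U (t, \<xi>) - (of_real h * (?w \<xi> * ?lin \<xi>) + of_real (h ^ 3) * (?w \<xi> * ?cub \<xi>))"
      have hl: "integrable lborel (\<lambda>\<xi>. of_real h * (?w \<xi> * ?lin \<xi>))" "integrable lborel (\<lambda>\<xi>. of_real (h ^ 3) * (?w \<xi> * ?cub \<xi>))"
        by (rule integrable_mult_right[OF li], rule integrable_mult_right[OF ci])
      have ei: "integrable lborel ?e" by (intro Bochner_Integration.integrable_diff Bochner_Integration.integrable_add wU hl)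
      have "(LINT \<xi>|lborel. ?e \<xi>) = (LINT \<xi>|lborel. ?w \<xi> * U (t, \<xi>)) - (of_real h * (LINT \<xi>|lborel. ?w \<xi> * ?lin \<xi>) + of_real (h ^ 3) * (LINT \<xi>|lborel. ?w \<xi> * ?cub \<xi>))"
        unfolding Bochner_Integration.integral_diff[OF wU Bochner_Integration.integrable_add[OF hl]] Bochner_Integration.integral_add[OF hl] integral_mult_right_zero ..
      then have "F (\<Phi> (h *\<^sub>R v) t) - (p * h + b * h ^ 3) = Re (LINT \<xi>|lborel. ?e \<xi>)"
        unfolding FU p_def b_def by (simp add: mult.commute del: of_real_power)
      then have "\<bar>F (\<Phi> (h *\<^sub>R v) t) - (p * h + b * h ^ 3)\<bar> \<le> cmod (LINT \<xi>|lborel. ?e \<xi>)"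
        using abs_Re_le_cmod by simp
      also have "\<dots> \<le> (LINT \<xi>|lborel. 96 * T\<^sup>2 * C\<^sup>2 * (h * L) ^ 5 * decay \<xi>)"
      proof (rule norm_integral_le[OF ei])
        show "integrable lborel (\<lambda>\<xi>. 96 * T\<^sup>2 * C\<^sup>2 * (h * L) ^ 5 * decay \<xi>)" by (intro integrable_mult_right integrable_decay)
        fix \<xi>
        have "?e \<xi> = ?w \<xi> * (U (t, \<xi>) - (of_real h * ?lin \<xi> + of_real (h ^ 3) * ?cub \<xi>))" by (simp add: algebra_simps)
        then have "cmod (?e \<xi>) = cmod (?w \<xi>) * cmod (U (t, \<xi>) - (of_real h * ?lin \<xi> + of_real (h ^ 3) * ?cub \<xi>))" by (simp only: norm_mult[of "?w \<xi>"])
        also have "\<dots> \<le> cmod (U (t, \<xi>) - (of_real h * ?lin \<xi> + of_real (h ^ 3) * ?cub \<xi>))"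
          by (rule mult_left_le_one_le) (use w1 in auto)
        also have "\<dots> \<le> 96 * T\<^sup>2 * C\<^sup>2 * (h * L) ^ 5 * decay \<xi>" by (rule ex[OF t])
        finally show "cmod (?e \<xi>) \<le> 96 * T\<^sup>2 * C\<^sup>2 * (h * L) ^ 5 * decay \<xi>" .
      qed
      also have "\<dots> = K * h ^ 5" by (simp add: K_def power_mult_distrib mult_ac)
      also have "\<dots> \<le> K * h ^ 4"
        using h h1(1) K0 by (intro mult_left_mono power_decreasing) auto
      finally show "\<bar>F (\<Phi> (h *\<^sub>R v) t) - (p * h + b * h ^ 3)\<bar> \<le> K * h ^ 4" .
    qed
    also have "\<dots> \<le> M * a\<^sup>2 * (\<kappa> powr \<bar>s\<bar>)\<^sup>2 * N powr s"
    proof -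
      \<comment> \<open>The functional is bounded by \<open>sqrt (a k / P)\<close> and the datum by
        \<open>sqrt (a k P)\<close>; the first times the cube of the second is
        \<open>a^2 k^2 P\<close>.\<close>
      define k P where "k = \<kappa> powr \<bar>s\<bar>" and "P = N powr s"
      have P: "P > 0" using N by (simp add: P_def)
      have k0: "k \<ge> 0" by (simp add: k_def)
      have a0: "a \<ge> 0" using a measure_nonneg order_trans by blast
      have Dle: "D \<le> sqrt (a * (k / P))"
        unfolding D_def k_def P_def using bs(2)[of "- s"] by (intro real_sqrt_le_mono) (simp add: powr_minus_divide)
      have nle: "nnorm X v \<le> sqrt (a * (k * P))"
        unfolding nv k_def P_def by (intro real_sqrt_le_mono bs(2))
      have D0: "D \<ge> 0" by (rule bounded_functionalD(4)[OF Fb])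
      have "D * nnorm X v ^ 3 \<le> sqrt (a * (k / P)) * sqrt (a * (k * P)) ^ 3"
        using nv0 D0 a0 k0 P by (intro mult_mono power_mono Dle nle zero_le_power real_sqrt_ge_zero divide_nonneg_pos mult_nonneg_nonneg) auto
      also have "\<dots> = (sqrt (a * (k / P)) * sqrt (a * (k * P))) * (sqrt (a * (k * P)))\<^sup>2"
        by (simp add: power3_eq_cube power2_eq_square mult_ac)
      also have "sqrt (a * (k / P)) * sqrt (a * (k * P)) = a * k"
      proof -
        have "a * (k / P) * (a * (k * P)) = (a * k)\<^sup>2" using P by (simp add: power2_eq_square)
        then have "sqrt (a * (k / P)) * sqrt (a * (k * P)) = sqrt ((a * k)\<^sup>2)"
          unfolding real_sqrt_mult[symmetric] by (simp only:)
        also have "\<dots> = a * k" using a0 k0 by (intro real_sqrt_unique) auto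
        finally show ?thesis .
      qed
      also have "(sqrt (a * (k * P)))\<^sup>2 = a * (k * P)" using a0 k0 P by simp
      finally have "D * nnorm X v ^ 3 \<le> a\<^sup>2 * k\<^sup>2 * P" by (simp add: power2_eq_square mult_ac)
      then have "M * (D * nnorm X v ^ 3) \<le> M * (a\<^sup>2 * k\<^sup>2 * P)" by (rule mult_left_mono[OF _ M])
      then show ?thesis by (simp add: k_def P_def mult.assoc)
    qed
    finally have "\<bar>b\<bar> \<le> M * a\<^sup>2 * (\<kappa> powr \<bar>s\<bar>)\<^sup>2 * N powr s" .
    then show "t * (measure lborel B)\<^sup>2 * measure lborel E / (4 * pi\<^sup>2 * R) \<le> M * a\<^sup>2 * (\<kappa> powr \<bar>s\<bar>)\<^sup>2 * N powr s"
      using cubic_term_lower_bound(2)[OF res] unfolding b_def by linarith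
  qed
qed

section \<open>Failure of smoothness\<close>

lemma norm_R3: "(norm (\<xi> :: R3))\<^sup>2 = (\<xi>$1)\<^sup>2 + (\<xi>$2)\<^sup>2 + (\<xi>$3)\<^sup>2"
  unfolding power2_norm_eq_inner inner_vec_def sum_3 by (simp add: power2_eq_square)

lemma mem_cbox_R3: "(\<xi> :: R3) \<in> cbox (vector [a1, a2, a3]) (vector [b1, b2, b3]) \<longleftrightarrow>
    (a1 \<le> \<xi>$1 \<and> \<xi>$1 \<le> b1) \<and> (a2 \<le> \<xi>$2 \<and> \<xi>$2 \<le> b2) \<and> (a3 \<le> \<xi>$3 \<and> \<xi>$3 \<le> b3)"
  by (simp add: mem_box_cart forall_3)

lemma measure_cbox_R3:
  assumes "a1 \<le> b1" "a2 \<le> b2" "a3 \<le> b3"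
  shows "measure lborel (cbox (vector [a1, a2, a3]) (vector [b1, b2, b3]) :: R3 set) = (b1 - a1) * (b2 - a2) * (b3 - a3)"
proof -
  have "(vector [a1, a2, a3] :: R3) \<in> cbox (vector [a1, a2, a3]) (vector [b1, b2, b3])"
    using assms by (simp add: mem_cbox_R3)
  then have "cbox (vector [a1, a2, a3]) (vector [b1, b2, b3]) \<noteq> ({} :: R3 set)" by blast
  from content_cbox_cart[OF this]
  have "measure lborel (cbox (vector [a1, a2, a3]) (vector [b1, b2, b3]) :: R3 set)
      = (\<Prod>i\<in>UNIV. (vector [b1, b2, b3] :: R3) $ i - (vector [a1, a2, a3] :: R3) $ i)" .
  also have "\<dots> = (b1 - a1) * (b2 - a2) * (b3 - a3)"
    unfolding UNIV_3 by (simp add: vector_3)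
  finally show ?thesis .
qed

lemma exists_powr_gt:
  assumes "\<delta> > 0"
  obtains K :: real where "K \<ge> K0" "K powr \<delta> > Q"
proof -
  define K where "K = max K0 ((\<bar>Q\<bar> + 1) powr (1 / \<delta>))"
  have "((\<bar>Q\<bar> + 1) powr (1 / \<delta>)) powr \<delta> \<le> K powr \<delta>"
    using assms by (intro powr_mono2) (auto simp: K_def)
  moreover have "((\<bar>Q\<bar> + 1) powr (1 / \<delta>)) powr \<delta> = \<bar>Q\<bar> + 1"
    using assms by (simp add: powr_powr)
  ultimately have "K powr \<delta> > Q" by linarith
  then show ?thesis by (rule that[rotated]) (simp add: K_def)
qed

text \<open>At distance \<open>K^2\<close> with width \<open>K\<close>, the transverse components
  and the mass contribute only \<open>O(1)\<close> to the dispersion, which is therefore the linear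
  function \<open>\<xi>$1\<close> up to an error between 0 and 2. The linear part cancels in the
  mismatch, which is at most 4; hence times up to \<open>1 / 4\<close>.\<close>

lemma resonant_parallel:
  assumes K: "K \<ge> 2" and m: "m\<^sup>2 \<le> 2 * K\<^sup>2" and t: "0 \<le> t" "t \<le> 1 / 4"
  shows "resonant m (cbox (vector [K\<^sup>2, - K, - K]) (vector [2 * K\<^sup>2, K, K]))
    (cbox (vector [3 / 2 * K\<^sup>2, 0, 0]) (vector [2 * K\<^sup>2, K, K])) (cbox (vector [K / 2, K / 2, K / 2]) (vector [K, K, K])) (3 * K\<^sup>2) t"
    (is "resonant m ?A ?B ?E ?R t")
proof -
  \<comment> \<open>This is what keeps the first component of \<open>\<zeta> - \<eta>\<close> in
    range: \<open>3 / 2 * K\<^sup>2 - K\<close> is at least \<open>K\<^sup>2\<close>.\<close>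
  have K2: "2 * K \<le> K\<^sup>2" using K by (simp add: power2_eq_square)
  have disp: "\<xi>$1 \<le> dispersion m \<xi> \<and> dispersion m \<xi> \<le> \<xi>$1 + 2" if "\<xi> \<in> ?A" for \<xi>
  proof -
    have x: "K\<^sup>2 \<le> \<xi>$1" "\<bar>\<xi>$2\<bar> \<le> \<bar>K\<bar>" "\<bar>\<xi>$3\<bar> \<le> \<bar>K\<bar>" using that K by (auto simp: mem_cbox_R3)
    have x0: "0 \<le> \<xi>$1" by (rule order_trans[OF zero_le_power2 x(1)])
    have "(\<xi>$2)\<^sup>2 \<le> K\<^sup>2" "(\<xi>$3)\<^sup>2 \<le> K\<^sup>2" using x by (simp_all only: abs_le_square_iff)
    moreover have "(\<xi>$1 + 2)\<^sup>2 = (\<xi>$1)\<^sup>2 + 4 * \<xi>$1 + 4" by (simp add: power2_sum)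
    \<comment> \<open>The two transverse squares and \<open>m\<^sup>2\<close> sum to at most
      \<open>4 * K\<^sup>2\<close>, which is at most \<open>4 * \<xi>$1\<close>.\<close>
    ultimately have "(norm \<xi>)\<^sup>2 + m\<^sup>2 \<le> (\<xi>$1 + 2)\<^sup>2" unfolding norm_R3 using m x(1) by linarith
    from real_sqrt_le_mono[OF this] have "dispersion m \<xi> \<le> \<xi>$1 + 2" using x0 by (simp add: dispersion_def)
    moreover have "\<xi>$1 \<le> dispersion m \<xi>"
      unfolding dispersion_def by (rule real_le_rsqrt) (simp add: norm_R3)
    ultimately show ?thesis by simp
  qed
  have BA: "?B \<subseteq> ?A" unfolding subset_iff mem_cbox_R3 using K K2 by auto
  have BE: "\<zeta> - \<eta> \<in> ?A" if "\<zeta> \<in> ?B" "\<eta> \<in> ?E" for \<zeta> \<eta>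
    using that K K2 unfolding mem_cbox_R3 vector_minus_component by auto
  have E: "\<eta> \<noteq> 0 \<and> (norm \<eta>)\<^sup>2 \<le> ?R" if "\<eta> \<in> ?E" for \<eta>
  proof -
    have e: "K / 2 \<le> \<eta>$1" "\<eta>$1 \<le> K" "K / 2 \<le> \<eta>$2" "\<eta>$2 \<le> K" "K / 2 \<le> \<eta>$3" "\<eta>$3 \<le> K" using that unfolding mem_cbox_R3 by auto
    have "(\<eta>$1)\<^sup>2 \<le> K\<^sup>2" "(\<eta>$2)\<^sup>2 \<le> K\<^sup>2" "(\<eta>$3)\<^sup>2 \<le> K\<^sup>2" using e K by (intro power_mono; linarith)+
    moreover have "\<eta> \<noteq> 0" using e(1) K by auto
    ultimately show ?thesis unfolding norm_R3 by linarith
  qed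
  have ph: "t * \<bar>phase_mismatch m \<xi> \<zeta> \<eta>\<bar> \<le> 1" if "\<xi> \<in> ?A" "\<zeta> \<in> ?A" "\<zeta> - \<eta> \<in> ?A" "\<xi> - \<eta> \<in> ?A" for \<xi> \<zeta> \<eta>
  proof -
    have "\<bar>phase_mismatch m \<xi> \<zeta> \<eta>\<bar> \<le> 4"
      using disp[OF that(1)] disp[OF that(2)] disp[OF that(3)] disp[OF that(4)]
      unfolding phase_mismatch_def vector_minus_component by linarith
    then have "t * \<bar>phase_mismatch m \<xi> \<zeta> \<eta>\<bar> \<le> (1 / 4) * 4" using t by (intro mult_mono) auto
    then show ?thesis by simp
  qed
  show ?thesis unfolding resonant_def using BA BE E ph K t by (intro conjI ballI allI impI) (auto simp: borel_closed)
qed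

text \<open>No cancellation in the mismatch is exploited: the dispersion lies between 0 and
  \<open>5 N\<close> on the shell, so two terms of each sign differ by at most \<open>10 N\<close>,
  and the time is the reciprocal of this.\<close>

lemma resonant_shell:
  assumes N: "N > 0" and m: "m\<^sup>2 \<le> N\<^sup>2"
  shows "resonant m {\<xi>. N \<le> norm \<xi> \<and> norm \<xi> \<le> 4 * N}
    (cbox (vector [2 * N, 0, 0]) (vector [12 / 5 * N, N / 2, N / 2])) (cbox (vector [N / 4, N / 4, N / 4]) (vector [N / 2, N / 2, N / 2]))
    (N\<^sup>2) (1 / (10 * N))"
    (is "resonant m ?A ?B ?E ?R ?t")
proof -
  \<comment> \<open>One box inside the shell that contains both \<open>?B\<close> and all
    differences of elements of \<open>?B\<close> and \<open>?E\<close>; its lower end is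
    \<open>2 * N - N / 2\<close>.\<close>
  have A: "\<xi> \<in> ?A" if "3 / 2 * N \<le> \<xi>$1" "\<xi>$1 \<le> 12 / 5 * N" "\<bar>\<xi>$2\<bar> \<le> N / 2" "\<bar>\<xi>$3\<bar> \<le> N / 2" for \<xi> :: R3
  proof -
    have "(\<xi>$1)\<^sup>2 \<le> (12 / 5 * N)\<^sup>2" "N\<^sup>2 \<le> (\<xi>$1)\<^sup>2" using that N by (intro power_mono; linarith)+
    moreover have "(\<xi>$2)\<^sup>2 \<le> (N / 2)\<^sup>2" "(\<xi>$3)\<^sup>2 \<le> (N / 2)\<^sup>2" using that N by (simp_all flip: abs_le_square_iff)
    moreover have "(12 / 5 * N)\<^sup>2 = 144 / 25 * N\<^sup>2" "(N / 2)\<^sup>2 = N\<^sup>2 / 4" "(4 * N)\<^sup>2 = 16 * N\<^sup>2"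
      by (simp_all add: power_mult_distrib power_divide)
    ultimately have "N\<^sup>2 \<le> (norm \<xi>)\<^sup>2" "(norm \<xi>)\<^sup>2 \<le> (4 * N)\<^sup>2"
      unfolding norm_R3 using zero_le_power2[of "\<xi>$2"] zero_le_power2[of "\<xi>$3"] zero_le_power2[of N] by linarith+
    then show ?thesis using N by (auto intro: power2_le_imp_le)
  qed
  have BA: "?B \<subseteq> ?A"
  proof
    fix \<zeta> assume "\<zeta> \<in> ?B"
    then show "\<zeta> \<in> ?A" unfolding mem_cbox_R3 using N by (intro A) auto
  qed
  have BE: "\<zeta> - \<eta> \<in> ?A" if "\<zeta> \<in> ?B" "\<eta> \<in> ?E" for \<zeta> \<eta>
  proof -
    have "2 * N \<le> \<zeta>$1" "\<zeta>$1 \<le> 12 / 5 * N" "0 \<le> \<zeta>$2" "\<zeta>$2 \<le> N / 2" "0 \<le> \<zeta>$3" "\<zeta>$3 \<le> N / 2"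
      "N / 4 \<le> \<eta>$1" "\<eta>$1 \<le> N / 2" "N / 4 \<le> \<eta>$2" "\<eta>$2 \<le> N / 2" "N / 4 \<le> \<eta>$3" "\<eta>$3 \<le> N / 2"
      using that unfolding mem_cbox_R3 by blast+
    then show ?thesis using N by (intro A; unfold vector_minus_component; linarith)
  qed
  have E: "\<eta> \<noteq> 0 \<and> (norm \<eta>)\<^sup>2 \<le> ?R" if "\<eta> \<in> ?E" for \<eta>
  proof -
    have e: "N / 4 \<le> \<eta>$1" "\<eta>$1 \<le> N / 2" "N / 4 \<le> \<eta>$2" "\<eta>$2 \<le> N / 2" "N / 4 \<le> \<eta>$3" "\<eta>$3 \<le> N / 2" using that unfolding mem_cbox_R3 by auto
    have "(\<eta>$1)\<^sup>2 \<le> (N / 2)\<^sup>2" "(\<eta>$2)\<^sup>2 \<le> (N / 2)\<^sup>2" "(\<eta>$3)\<^sup>2 \<le> (N / 2)\<^sup>2" using e N by (intro power_mono; linarith)+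
    moreover have "\<eta> \<noteq> 0" using e(1) N by auto
    moreover have "(N / 2)\<^sup>2 = N\<^sup>2 / 4" "0 \<le> N\<^sup>2" by (simp_all add: power_divide)
    ultimately show ?thesis unfolding norm_R3 by linarith
  qed
  have disp: "0 \<le> dispersion m \<xi> \<and> dispersion m \<xi> \<le> 5 * N" if "\<xi> \<in> ?A" for \<xi>
  proof -
    have "(norm \<xi>)\<^sup>2 \<le> (4 * N)\<^sup>2" using that by (intro power_mono) auto
    moreover have "(4 * N)\<^sup>2 = 16 * N\<^sup>2" "(5 * N)\<^sup>2 = 25 * N\<^sup>2" by (simp_all add: power_mult_distrib)
    ultimately have "(norm \<xi>)\<^sup>2 + m\<^sup>2 \<le> (5 * N)\<^sup>2" using m zero_le_power2[of N] by linarith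
    with real_le_lsqrt[OF _ this] N show ?thesis by (simp only: dispersion_def) auto
  qed
  have ph: "?t * \<bar>phase_mismatch m \<xi> \<zeta> \<eta>\<bar> \<le> 1" if "\<xi> \<in> ?A" "\<zeta> \<in> ?A" "\<zeta> - \<eta> \<in> ?A" "\<xi> - \<eta> \<in> ?A" for \<xi> \<zeta> \<eta>
  proof -
    have "\<bar>phase_mismatch m \<xi> \<zeta> \<eta>\<bar> \<le> 10 * N"
      using disp[OF that(1)] disp[OF that(2)] disp[OF that(3)] disp[OF that(4)]
      unfolding phase_mismatch_def by linarith
    then show ?thesis using N by (simp add: pos_divide_le_eq)
  qed
  have "?A = cball 0 (4 * N) - ball 0 N" by (auto simp: dist_norm)
  then have As: "?A \<in> sets borel" and bA: "bounded ?A"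
    by (auto intro!: bounded_subset[OF bounded_cball[of 0 "4 * N"]])
  have bs: "?B \<in> sets borel" "?E \<in> sets borel" "bounded ?E" by (auto simp: borel_closed)
  show ?thesis unfolding resonant_def
  proof (intro conjI ballI allI impI)
    show "?A \<in> sets borel" "?B \<in> sets borel" "?E \<in> sets borel" "bounded ?A" "bounded ?E" "?B \<subseteq> ?A" by fact+
    show "0 < N\<^sup>2" "0 \<le> ?t" using N by auto
  qed (use BE E ph in blast)+
qed

lemma no_C3_flow_Hs:
  assumes s: "s < 1 / 4" and T: "T > 0" and flow: "flow_map m T (Hs s) V \<Phi>"
  shows "\<not> C3_at (Hs s) (curves T (Hs s)) V \<Phi> 0"
proof
  assume C3: "C3_at (Hs s) (curves T (Hs s)) V \<Phi> 0"
  obtain M where M: "M \<ge> 0" and ineq: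
    "\<And>A B E R t N \<kappa> a. resonant m A B E R t \<Longrightarrow> t \<le> T \<Longrightarrow> measure lborel A \<le> a \<Longrightarrow> N > 0 \<Longrightarrow> \<kappa> \<ge> 1 \<Longrightarrow>
      (\<And>\<xi>. \<xi> \<in> A \<Longrightarrow> N \<le> 1 + (norm \<xi>)\<^sup>2 \<and> 1 + (norm \<xi>)\<^sup>2 \<le> \<kappa> * N) \<Longrightarrow>
      t * (measure lborel B)\<^sup>2 * measure lborel E / (4 * pi\<^sup>2 * R) \<le> M * a\<^sup>2 * (\<kappa> powr \<bar>s\<bar>)\<^sup>2 * N powr s"
    by (rule C3_flow_map_inequality[OF T seminormed_Hs order_refl refl flow C3]) blast
  \<comment> \<open>The time is fixed while \<open>K\<close> tends to infinity, so any
    \<open>T > 0\<close> is admissible.\<close>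
  define t where "t = min T (1 / 4)"
  have t: "0 < t" "t \<le> T" "t \<le> 1 / 4" using T by (auto simp: t_def)
  define c where "c = M * (7 powr \<bar>s\<bar>)\<^sup>2"
  \<comment> \<open>\<open>6144 = 16 * 384\<close>: the 16 is the square of the 4 in
    \<open>mA\<close>, and \<open>384 = 4 * 8 * 4 * 3\<close> collects \<open>mB\<close> squared,
    \<open>mE\<close>, the \<open>4 pi^2\<close> and the 3 of \<open>R\<close>.\<close>
  define Q where "Q = 6144 * pi\<^sup>2 * c / t"
  obtain K where K: "K \<ge> max 2 \<bar>m\<bar>" and big: "K powr (1 - 4 * s) > Q"
    using exists_powr_gt[of "1 - 4 * s" "max 2 \<bar>m\<bar>" Q] s by auto
  have K2: "K \<ge> 2" "K > 0" using K by auto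
  have "m\<^sup>2 \<le> K\<^sup>2" using K by (simp flip: abs_le_square_iff)
  then have mK: "m\<^sup>2 \<le> 2 * K\<^sup>2" using zero_le_power2[of K] by linarith
  let ?A = "cbox (vector [K\<^sup>2, - K, - K]) (vector [2 * K\<^sup>2, K, K]) :: R3 set"
  let ?B = "cbox (vector [3 / 2 * K\<^sup>2, 0, 0]) (vector [2 * K\<^sup>2, K, K]) :: R3 set"
  let ?E = "cbox (vector [K / 2, K / 2, K / 2]) (vector [K, K, K]) :: R3 set"
  have res: "resonant m ?A ?B ?E (3 * K\<^sup>2) t" by (rule resonant_parallel[OF K2(1) mK less_imp_le[OF t(1)] t(3)])
  have mA: "measure lborel ?A \<le> 4 * K ^ 4"
    using K2 by (subst measure_cbox_R3) (auto simp: power2_eq_square power4_eq_xxxx)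
  have mB: "measure lborel ?B = K ^ 4 / 2"
    using K2 by (subst measure_cbox_R3) (auto simp: power2_eq_square power4_eq_xxxx)
  have mE: "measure lborel ?E = K ^ 3 / 8"
    using K2 by (subst measure_cbox_R3) (auto simp: power3_eq_cube)
  \<comment> \<open>The factor 7 is \<open>1 + 4 + 2\<close>, from the summand 1, the first
    component and the two transverse ones. The reference size of \<open>1 + |\<xi>|^2\<close> is
    \<open>K ^ 4\<close>, which turns \<open>s\<close> into \<open>4 * s\<close> and produces the
    threshold \<open>1 / 4\<close>.\<close>
  have range: "K ^ 4 \<le> 1 + (norm \<xi>)\<^sup>2 \<and> 1 + (norm \<xi>)\<^sup>2 \<le> 7 * K ^ 4" if "\<xi> \<in> ?A" for \<xi>
  proof -
    have x: "K\<^sup>2 \<le> \<xi>$1" "\<xi>$1 \<le> 2 * K\<^sup>2" "\<bar>\<xi>$2\<bar> \<le> \<bar>K\<bar>" "\<bar>\<xi>$3\<bar> \<le> \<bar>K\<bar>" using that K2 by (auto simp: mem_cbox_R3)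
    have y: "(\<xi>$2)\<^sup>2 \<le> K\<^sup>2" "(\<xi>$3)\<^sup>2 \<le> K\<^sup>2" using x by (simp_all only: abs_le_square_iff)
    have "(K\<^sup>2)\<^sup>2 \<le> (\<xi>$1)\<^sup>2" by (rule power_mono[OF x(1)]) simp
    moreover have "(\<xi>$1)\<^sup>2 \<le> (2 * K\<^sup>2)\<^sup>2" by (rule power_mono[OF x(2) order_trans[OF zero_le_power2 x(1)]])
    moreover have "(K\<^sup>2)\<^sup>2 = K ^ 4" "(2 * K\<^sup>2)\<^sup>2 = 4 * K ^ 4" by (simp_all add: power_mult_distrib)
    moreover have "1 \<le> K ^ 4" "K\<^sup>2 \<le> K ^ 4" using K2 by (auto intro: one_le_power power_increasing)
    ultimately show ?thesis unfolding norm_R3 using y zero_le_power2[of "\<xi>$2"] zero_le_power2[of "\<xi>$3"] by linarith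
  qed
  have "t * (K ^ 4 / 2)\<^sup>2 * (K ^ 3 / 8) / (4 * pi\<^sup>2 * (3 * K\<^sup>2)) \<le> M * (4 * K ^ 4)\<^sup>2 * (7 powr \<bar>s\<bar>)\<^sup>2 * (K ^ 4) powr s"
    using ineq[OF res t(2) mA _ _ range] K2 unfolding mB mE by simp
  also have "(K ^ 4) powr s = K powr (4 * s)"
  proof -
    have "K ^ 4 = K powr 4" using K2 by simp
    then show ?thesis by (simp add: powr_powr)
  qed
  also have "M * (4 * K ^ 4)\<^sup>2 * (7 powr \<bar>s\<bar>)\<^sup>2 * K powr (4 * s) = 16 * c * K ^ 8 * K powr (4 * s)"
    by (simp add: c_def power_mult_distrib mult_ac)
  also have "t * (K ^ 4 / 2)\<^sup>2 * (K ^ 3 / 8) / (4 * pi\<^sup>2 * (3 * K\<^sup>2)) = (t / (384 * pi\<^sup>2) * K) * K ^ 8"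
    using K2 by (simp add: field_simps eval_nat_numeral)
  finally have "(t / (384 * pi\<^sup>2) * K) * K ^ 8 \<le> (16 * c * K powr (4 * s)) * K ^ 8" by (simp only: mult_ac)
  then have "t / (384 * pi\<^sup>2) * K \<le> 16 * c * K powr (4 * s)"
    by (rule mult_right_le_imp_le) (use K2 in simp)
  then have "K \<le> Q * K powr (4 * s)" using t(1) by (simp add: Q_def field_simps)
  also have "\<dots> < K powr (1 - 4 * s) * K powr (4 * s)" using big K2 by (intro mult_strict_right_mono) auto
  also have "\<dots> = K" using K2 by (simp flip: powr_add)
  finally show False by simp
qed

text \<open>Radial data occupy all directions, so the dispersion has no common linear part to cancel
  and the phase is controlled only for times of order \<open>1 / N\<close>. This loss offsets
  exactly the gain \<open>N\<close> from the transferred frequencies, and only the negative power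
  \<open>N powr (2 * s)\<close> decides.\<close>

lemma no_C3_flow_Hs_rad:
  assumes s: "s < 0" and T: "T > 0" and flow: "flow_map m T (Hs_rad s) V \<Phi>"
  shows "\<not> C3_at (Hs_rad s) (curves T (Hs_rad s)) V \<Phi> 0"
proof
  assume C3: "C3_at (Hs_rad s) (curves T (Hs_rad s)) V \<Phi> 0"
  have sub: "ncarrier (Hs_rad s) \<subseteq> ncarrier (Hs s)" and nrm: "nnorm (Hs_rad s) = nnorm (Hs s)"
    by (auto simp: Hs_rad_def)
  obtain M where M: "M \<ge> 0" and ineq:
    "\<And>A B E R t N \<kappa> a. resonant m A B E R t \<Longrightarrow> t \<le> T \<Longrightarrow> measure lborel A \<le> a \<Longrightarrow> N > 0 \<Longrightarrow> \<kappa> \<ge> 1 \<Longrightarrow>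
      (\<And>\<xi>. \<xi> \<in> A \<Longrightarrow> N \<le> 1 + (norm \<xi>)\<^sup>2 \<and> 1 + (norm \<xi>)\<^sup>2 \<le> \<kappa> * N) \<Longrightarrow>
      (spectral (indicator A) \<in> ncarrier (Hs s) \<Longrightarrow> spectral (indicator A) \<in> ncarrier (Hs_rad s)) \<Longrightarrow>
      t * (measure lborel B)\<^sup>2 * measure lborel E / (4 * pi\<^sup>2 * R) \<le> M * a\<^sup>2 * (\<kappa> powr \<bar>s\<bar>)\<^sup>2 * N powr s"
    by (rule C3_flow_map_inequality[OF T seminormed_Hs_rad sub nrm flow C3]) blast
  define c where "c = M * (17 powr \<bar>s\<bar>)\<^sup>2"
  \<comment> \<open>\<open>262144\<close> is the square of the 512 in \<open>mA\<close>, and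
    \<open>256000 = 10 * 100 * 64 * 4\<close> collects the time, \<open>mB\<close> squared,
    \<open>mE\<close> and the \<open>4 pi^2\<close>.\<close>
  define Q where "Q = 256000 * 262144 * pi\<^sup>2 * c"
  \<comment> \<open>The bound \<open>1 / (10 * T)\<close> places the shrinking time
    \<open>1 / (10 * N)\<close> inside \<open>[0, T]\<close>; the bound by the mass makes the shell
    resonant.\<close>
  obtain N where N: "N \<ge> max (max 1 \<bar>m\<bar>) (1 / (10 * T))" and big: "N powr (- 2 * s) > Q"
    using exists_powr_gt[of "- 2 * s" "max (max 1 \<bar>m\<bar>) (1 / (10 * T))" Q] s by auto
  have N1: "N \<ge> 1" "N > 0" using N by auto
  have mN: "m\<^sup>2 \<le> N\<^sup>2" using N by (simp flip: abs_le_square_iff)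
  have tT: "1 / (10 * N) \<le> T"
  proof -
    have "1 / (10 * T) \<le> N" using N by simp
    then show ?thesis using T N1 by (simp add: field_simps)
  qed
  let ?A = "{\<xi>. N \<le> norm \<xi> \<and> norm \<xi> \<le> 4 * N} :: R3 set"
  let ?B = "cbox (vector [2 * N, 0, 0]) (vector [12 / 5 * N, N / 2, N / 2]) :: R3 set"
  let ?E = "cbox (vector [N / 4, N / 4, N / 4]) (vector [N / 2, N / 2, N / 2]) :: R3 set"
  have res: "resonant m ?A ?B ?E (N\<^sup>2) (1 / (10 * N))" by (rule resonant_shell[OF N1(2) mN])
  \<comment> \<open>The circumscribed cube of side \<open>8 * N\<close> gives 512; a sharp volume of
    the shell would only change the constant.\<close>
  have mA: "measure lborel ?A \<le> 512 * N ^ 3"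
  proof -
    let ?C = "cbox (vector [- (4 * N), - (4 * N), - (4 * N)]) (vector [4 * N, 4 * N, 4 * N]) :: R3 set"
    have "?A \<subseteq> ?C"
    proof
      fix \<xi> assume "\<xi> \<in> ?A"
      then have "\<bar>\<xi>$i\<bar> \<le> 4 * N" for i using component_le_norm_cart[of \<xi> i] by simp
      from this[of 1] this[of 2] this[of 3] show "\<xi> \<in> ?C" by (auto simp: mem_cbox_R3 abs_le_iff)
    qed
    moreover have "?A \<in> sets lborel" using res by (simp add: resonant_def)
    ultimately have "measure lborel ?A \<le> measure lborel ?C" by (intro measure_mono_fmeasurable) auto
    also have "\<dots> = 512 * N ^ 3" using N1 by (subst measure_cbox_R3) (auto simp: power3_eq_cube)
    finally show ?thesis .
  qed
  have mB: "measure lborel ?B = N ^ 3 / 10"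
    using N1 by (subst measure_cbox_R3) (auto simp: power3_eq_cube)
  have mE: "measure lborel ?E = N ^ 3 / 64"
    using N1 by (subst measure_cbox_R3) (auto simp: power3_eq_cube)
  have range: "N\<^sup>2 \<le> 1 + (norm \<xi>)\<^sup>2 \<and> 1 + (norm \<xi>)\<^sup>2 \<le> 17 * N\<^sup>2" if "\<xi> \<in> ?A" for \<xi>
  proof -
    have "N\<^sup>2 \<le> (norm \<xi>)\<^sup>2" "(norm \<xi>)\<^sup>2 \<le> (4 * N)\<^sup>2" using that N1 by (intro power_mono; auto)+
    moreover have "(4 * N)\<^sup>2 = 16 * N\<^sup>2" "1 \<le> N\<^sup>2" using N1 by (simp_all add: power_mult_distrib)
    ultimately show ?thesis by linarith
  qed
  have rad: "spectral (indicator ?A) \<in> ncarrier (Hs_rad s)" if "spectral (indicator ?A) \<in> ncarrier (Hs s)"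
  proof -
    have "radial (spectral (indicator ?A))"
    proof (rule spectral_radial)
      show "integrable lborel (indicator ?A :: R3 \<Rightarrow> complex)"
      proof -
        have As: "?A \<in> sets borel" and bA: "bounded ?A" using res unfolding resonant_def by blast+
        obtain L where "\<And>\<xi>. cmod (indicator ?A \<xi>) \<le> L * decay \<xi>" using indicator_le_decay[OF bA] by blast
        then show ?thesis by (rule integrable_le_decay[OF borel_measurable_indicator[OF As]])
      qed
    qed (simp add: orthogonal_transformation_norm indicator_def)
    then show ?thesis using that by (simp add: Hs_rad_def)
  qed
  have "1 / (10 * N) * (N ^ 3 / 10)\<^sup>2 * (N ^ 3 / 64) / (4 * pi\<^sup>2 * N\<^sup>2) \<le> M * (512 * N ^ 3)\<^sup>2 * (17 powr \<bar>s\<bar>)\<^sup>2 * (N\<^sup>2) powr s"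
    using ineq[OF res tT mA _ _ range rad] N1 unfolding mB mE by simp
  also have "(N\<^sup>2) powr s = N powr (2 * s)"
  proof -
    have "N\<^sup>2 = N powr 2" using N1 by simp
    then show ?thesis by (simp add: powr_powr)
  qed
  also have "M * (512 * N ^ 3)\<^sup>2 * (17 powr \<bar>s\<bar>)\<^sup>2 * N powr (2 * s) = (262144 * c * N powr (2 * s)) * N ^ 6"
    by (simp add: c_def power_mult_distrib mult_ac)
  also have "1 / (10 * N) * (N ^ 3 / 10)\<^sup>2 * (N ^ 3 / 64) / (4 * pi\<^sup>2 * N\<^sup>2) = 1 / (256000 * pi\<^sup>2) * N ^ 6"
    using N1 by (simp add: field_simps eval_nat_numeral)
  finally have "1 / (256000 * pi\<^sup>2) \<le> 262144 * c * N powr (2 * s)"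
    by (rule mult_right_le_imp_le) (use N1 in simp)
  then have "1 \<le> Q * N powr (2 * s)" by (simp add: Q_def field_simps)
  also have "\<dots> < N powr (- 2 * s) * N powr (2 * s)" using big N1 by (intro mult_strict_right_mono) auto
  also have "\<dots> = 1" using N1 by (simp flip: powr_add)
  finally show False by simp
qed

theorem theorem1p2:
  fixes m :: real
  assumes "m \<ge> 0"
  shows "(\<forall>s T V \<Phi>. s < 1 / 4 \<and> T > 0 \<and> flow_map m T (Hs s) V \<Phi> \<longrightarrow>
            \<not> C3_at (Hs s) (curves T (Hs s)) V \<Phi> 0) \<and>
         (\<forall>s T V \<Phi>. s < 0 \<and> T > 0 \<and> flow_map m T (Hs_rad s) V \<Phi> \<longrightarrow>
            \<not> C3_at (Hs_rad s) (curves T (Hs_rad s)) V \<Phi> 0)"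
  by (intro conjI allI impI; elim conjE) (erule (2) no_C3_flow_Hs, erule (2) no_C3_flow_Hs_rad)

end
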